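(* Let $u\in W^{1,2}(\mathbb{B}^3;\mathbb{S}^2)$ and $\eta\in L^2\big(\mathbb{B}^3;\bigwedge^1(\mathbb{R}^3)^*\big)$ be such that $$d\eta=u^*\omega_{\mathbb{S}^2}\quad\text{in the sense of distributions on } \mathbb{B}^3.$$ Then there exist sequences $(u_k)_{k\in\mathbb{N}}\subset C^\infty(\mathbb{B}^3;\mathbb{S}^2)$ and $(\eta_k)_{k\in\mathbb{N}}\subset\Omega^1(\mathbb{B}^3)$ such that (i) $d\eta_k=u_k^*\omega_{\mathbb{S}^2}$ for every $k\in\mathbb{N}$; (ii) $(u_k,\eta_k)\to(u,\eta)$ strongly in $W^{1,2}(\mathbb{B}^3;\mathbb{S}^2)\times L^2\big(\mathbb{B}^3;\bigwedge^1(\mathbb{R}^3)^*\big)$ as $k\to\infty$.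
   Context: $\mathbb{B}^3$ is the unit ball of $\mathbb{R}^3$, and $\mathbb{S}^2\subset\mathbb{R}^3$ is the unit sphere. $W^{1,2}(\mathbb{B}^3;\mathbb{S}^2)$ denotes the set of maps $u\in W^{1,2}(\mathbb{B}^3;\mathbb{R}^3)$ with $|u|=1$ almost everywhere; strong convergence in it means convergence in the norm of $W^{1,2}(\mathbb{B}^3;\mathbb{R}^3)$. $L^2(\mathbb{B}^3;\bigwedge^1(\mathbb{R}^3)^* )$ is the space of $1$-forms on $\mathbb{B}^3$ with $L^2$ coefficients, and $\Omega^1(\mathbb{B}^3)$ is the space of smooth $1$-forms on $\mathbb{B}^3$. The volume form on $\mathbb{S}^2$ is $\omega_{\mathbb{S}^2}=x^1dx^2\wedge dx^3+x^2dx^3\wedge dx^1+x^3dx^1\wedge dx^2$ (restricted to $\mathbb{S}^2$). For $u=(u^1,u^2,u^3)\in W^{1,2}(\mathbb{B}^3;\mathbb{S}^2)$ its pullback is the $2$-form with $L^1$ coefficients $$u^*\omega_{\mathbb{S}^2}=u^1du^2\wedge du^3+u^2du^3\wedge du^1+u^3du^1\wedge du^2=\sum_{1\le j<\ell\le 3}u\cdot(\partial_ju\times\partial_\ell u)\,dx^j\wedge dx^\ell,$$ computed with weak derivatives. The identity $d\eta=u^*\omega_{\mathbb{S}^2}$ in the sense of distributions means that $\int_{\mathbb{B}^3}\eta\wedge d\varphi=\int_{\mathbb{B}^3}u^*\omega_{\mathbb{S}^2}\wedge\varphi$ for every smooth $1$-form $\varphi$ compactly supported in the interior of $\mathbb{B}^3$.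 *)

theory Defs
  imports "HOL-Analysis.Analysis"
begin

section \<open>Smooth maps\<close>

text \<open>\<open>Ck_on k U f\<close> is meant for open \<open>U\<close>. In finite dimension it says that \<open>f\<close> is of class
  \<open>C\<^sup>k\<close> on \<open>U\<close>: all iterated directional derivatives up to order \<open>k\<close> exist and are continuous.\<close>

fun Ck_on :: "nat \<Rightarrow> 'a::real_normed_vector set \<Rightarrow> ('a \<Rightarrow> 'b::real_normed_vector) \<Rightarrow> bool" where
  "Ck_on 0 U f \<longleftrightarrow> continuous_on U f"
| "Ck_on (Suc k) U f \<longleftrightarrow> (\<forall>x\<in>U. f differentiable (at x)) \<and>
     (\<forall>v. Ck_on k U (\<lambda>x. frechet_derivative f (at x) v))"

text \<open>For a set that is not open, such as the closed ball, smoothness (up to the boundary) means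
  being the restriction of a smooth map defined on an open neighbourhood.\<close>

definition smooth_on :: "'a::real_normed_vector set \<Rightarrow> ('a \<Rightarrow> 'b::real_normed_vector) \<Rightarrow> bool" where
  "smooth_on S f \<longleftrightarrow>
     (\<exists>U g. open U \<and> S \<subseteq> U \<and> (\<forall>k. Ck_on k U g) \<and> (\<forall>x\<in>S. f x = g x))"

definition test_function :: "'a::real_normed_vector set \<Rightarrow> ('a \<Rightarrow> 'b::real_normed_vector) \<Rightarrow> bool" where
  "test_function S \<phi> \<longleftrightarrow> smooth_on UNIV \<phi> \<and>
     compact (closure {x. \<phi> x \<noteq> 0}) \<and> closure {x. \<phi> x \<noteq> 0} \<subseteq> interior S"

text \<open>The derivative is taken within \<open>S\<close>, so that it only depends on the values on \<open>S\<close>. It is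
  uniquely determined at every point of \<open>S\<close> (boundary points included) when \<open>S\<close> is open or a
  closed ball of positive radius.\<close>

definition partial :: "(real^'n) set \<Rightarrow> 'n \<Rightarrow> (real^'n \<Rightarrow> 'b::real_normed_vector) \<Rightarrow> real^'n \<Rightarrow> 'b" where
  "partial S j f x = frechet_derivative f (at x within S) (axis j 1)"


section \<open>The spaces \<open>L\<^sup>2\<close> and \<open>W\<^sup>1\<^sup>,\<^sup>2\<close>\<close>

definition L2_on :: "'a::euclidean_space set \<Rightarrow> ('a \<Rightarrow> 'b::euclidean_space) \<Rightarrow> bool" where
  "L2_on S f \<longleftrightarrow> f \<in> borel_measurable (lebesgue_on S) \<and>
     integrable (lebesgue_on S) (\<lambda>x. (norm (f x))\<^sup>2)"

definition L2_norm_on :: "'a::euclidean_space set \<Rightarrow> ('a \<Rightarrow> 'b::euclidean_space) \<Rightarrow> real" where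
  "L2_norm_on S f = sqrt (LINT x|lebesgue_on S. (norm (f x))\<^sup>2)"

definition locally_integrable_on :: "('a::euclidean_space \<Rightarrow> 'b::euclidean_space) \<Rightarrow> 'a set \<Rightarrow> bool" where
  "locally_integrable_on f U \<longleftrightarrow> (\<forall>K. compact K \<and> K \<subseteq> U \<longrightarrow> f absolutely_integrable_on K)"

definition has_weak_partial ::
    "(real^'n) set \<Rightarrow> 'n \<Rightarrow> (real^'n \<Rightarrow> 'b::euclidean_space) \<Rightarrow> (real^'n \<Rightarrow> 'b) \<Rightarrow> bool" where
  "has_weak_partial S j f g \<longleftrightarrow>
     locally_integrable_on f (interior S) \<and> locally_integrable_on g (interior S) \<and>
     (\<forall>\<phi> :: real^'n \<Rightarrow> real. test_function S \<phi> \<longrightarrow>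
        (LINT x|lebesgue_on S. partial UNIV j \<phi> x *\<^sub>R f x) = - (LINT x|lebesgue_on S. \<phi> x *\<^sub>R g x))"

text \<open>A representative of the weak partial derivative, which is unique almost everywhere on the
  interior of \<open>S\<close> whenever it exists.\<close>

definition weak_partial ::
    "(real^'n) set \<Rightarrow> 'n \<Rightarrow> (real^'n \<Rightarrow> 'b::euclidean_space) \<Rightarrow> real^'n \<Rightarrow> 'b" where
  "weak_partial S j f = (SOME g. has_weak_partial S j f g)"

definition W12_on :: "(real^'n) set \<Rightarrow> (real^'n \<Rightarrow> 'b::euclidean_space) \<Rightarrow> bool" where
  "W12_on S f \<longleftrightarrow> L2_on S f \<and> (\<forall>j. \<exists>g. L2_on S g \<and> has_weak_partial S j f g)"

definition W12_norm_on :: "(real^'n) set \<Rightarrow> (real^'n \<Rightarrow> 'b::euclidean_space) \<Rightarrow> real" where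
  "W12_norm_on S f =
     sqrt ((L2_norm_on S f)\<^sup>2 + (\<Sum>j\<in>UNIV. (L2_norm_on S (weak_partial S j f))\<^sup>2))"

text \<open>Membership is part of convergence: the integrals defining the norms take the default value
  \<open>0\<close> on functions that are not integrable.\<close>

definition L2_converges :: "'a::euclidean_space set \<Rightarrow> (nat \<Rightarrow> 'a \<Rightarrow> 'b::euclidean_space) \<Rightarrow> ('a \<Rightarrow> 'b) \<Rightarrow> bool" where
  "L2_converges S fs f \<longleftrightarrow> (\<forall>k. L2_on S (fs k)) \<and> L2_on S f \<and>
     (\<lambda>k. L2_norm_on S (\<lambda>x. fs k x - f x)) \<longlonglongrightarrow> 0"

definition W12_converges :: "(real^'n) set \<Rightarrow> (nat \<Rightarrow> real^'n \<Rightarrow> 'b::euclidean_space) \<Rightarrow> (real^'n \<Rightarrow> 'b) \<Rightarrow> bool" where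
  "W12_converges S fs f \<longleftrightarrow> (\<forall>k. W12_on S (fs k)) \<and> W12_on S f \<and>
     (\<lambda>k. W12_norm_on S (\<lambda>x. fs k x - f x)) \<longlonglongrightarrow> 0"


section \<open>Differential forms in dimension three\<close>

abbreviation B3 :: "(real^3) set" where
  "B3 \<equiv> cball 0 1"

abbreviation S2 :: "(real^3) set" where
  "S2 \<equiv> sphere 0 1"

definition W12_S2 :: "(real^3 \<Rightarrow> real^3) \<Rightarrow> bool" where
  "W12_S2 u \<longleftrightarrow> W12_on B3 u \<and> (AE x in lebesgue_on B3. u x \<in> S2)"

text \<open>A 1-form \<open>\<Sum>\<^sub>i \<alpha>\<^sub>i dx\<^sup>i\<close> is given by its coefficient vector, a 2-form
  \<open>\<Sum>\<^sub>j\<^sub><\<^sub>l \<beta>\<^sub>j\<^sub>l dx\<^sup>j \<and> dx\<^sup>l\<close> by its antisymmetric coefficient matrix, and a 3-form by its coefficient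
  with respect to \<open>dx\<^sup>1 \<and> dx\<^sup>2 \<and> dx\<^sup>3\<close>.\<close>

type_synonym form1 = "real^3 \<Rightarrow> real^3"
type_synonym form2 = "real^3 \<Rightarrow> real^3^3"
type_synonym form3 = "real^3 \<Rightarrow> real"

definition ext_deriv :: "(real^3) set \<Rightarrow> form1 \<Rightarrow> form2" where
  "ext_deriv S \<alpha> x = (\<chi> j l. partial S j \<alpha> x $ l - partial S l \<alpha> x $ j)"

definition wedge12 :: "form1 \<Rightarrow> form2 \<Rightarrow> form3" where
  "wedge12 \<alpha> \<beta> x = \<alpha> x $ 1 * \<beta> x $ 2 $ 3 - \<alpha> x $ 2 * \<beta> x $ 1 $ 3 + \<alpha> x $ 3 * \<beta> x $ 1 $ 2"

definition wedge21 :: "form2 \<Rightarrow> form1 \<Rightarrow> form3" where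
  "wedge21 \<beta> \<alpha> x = \<beta> x $ 1 $ 2 * \<alpha> x $ 3 - \<beta> x $ 1 $ 3 * \<alpha> x $ 2 + \<beta> x $ 2 $ 3 * \<alpha> x $ 1"

text \<open>The pullback of the volume form of the sphere by \<open>u\<close>, where \<open>Du j\<close> stands for the (weak or
  classical) partial derivative of \<open>u\<close> in direction \<open>j\<close>.\<close>

definition pullback_vol :: "(real^3 \<Rightarrow> real^3) \<Rightarrow> (3 \<Rightarrow> real^3 \<Rightarrow> real^3) \<Rightarrow> form2" where
  "pullback_vol u Du x = (\<chi> j l. u x \<bullet> cross3 (Du j x) (Du l x))"

lemma pullback_vol_eq:
  "pullback_vol u Du x $ j $ l =
      u x $ 1 * (Du j x $ 2 * Du l x $ 3 - Du l x $ 2 * Du j x $ 3)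
    + u x $ 2 * (Du j x $ 3 * Du l x $ 1 - Du l x $ 3 * Du j x $ 1)
    + u x $ 3 * (Du j x $ 1 * Du l x $ 2 - Du l x $ 1 * Du j x $ 2)"
  by (simp add: pullback_vol_def cross3_simps)

definition weak_pullback_vol :: "(real^3 \<Rightarrow> real^3) \<Rightarrow> form2" where
  "weak_pullback_vol u = pullback_vol u (\<lambda>j. weak_partial B3 j u)"

definition smooth_pullback_vol :: "(real^3 \<Rightarrow> real^3) \<Rightarrow> form2" where
  "smooth_pullback_vol u = pullback_vol u (\<lambda>j. partial B3 j u)"

text \<open>\<open>d\<eta> = \<beta>\<close> in the sense of distributions; meant for \<open>\<eta>\<close> and \<open>\<beta>\<close> with integrable
  coefficients.\<close>

definition distributional_d :: "form1 \<Rightarrow> form2 \<Rightarrow> bool" where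
  "distributional_d \<eta> \<beta> \<longleftrightarrow>
     (\<forall>\<phi> :: form1. test_function B3 \<phi> \<longrightarrow>
        (LINT x|lebesgue_on B3. wedge12 \<eta> (ext_deriv UNIV \<phi>) x)
        = (LINT x|lebesgue_on B3. wedge21 \<beta> \<phi> x))"

end

theory Submission
  imports Defs
begin

text \<open>
  Regard $S^3$ as the unit quaternions and fix a unit imaginary quaternion \<open>c\<close>; the Hopf map is
  \<open>H(q) = q c q\<^sup>*\<close>. For every smooth \<open>G : B \<rightarrow> S\<^sup>3\<close> the map \<open>H \<circ> G\<close> and the form with coefficients
  \<open>-2 (\<partial>\<^sub>j G \<bullet> G c)\<close> satisfy the equation, so it suffices to write \<open>(u, \<eta>)\<close> in this way with a Sobolev map
  \<open>g : B \<rightarrow> S\<^sup>3\<close> and to approximate \<open>g\<close>.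

  The form \<open>A = (u \<times> du - \<eta> u) / 2\<close>, read as a form with imaginary quaternion values, is a connection
  for which \<open>u\<close> is parallel, and \<open>d\<eta> = u\<^sup>*\<omega>\<close> says precisely that it is flat. One gets \<open>g\<close> with
  \<open>dg = A g\<close> as a limit: mollification of \<open>(u, \<eta>)\<close> gives smooth connections whose curvature tends to \<open>0\<close>
  in \<open>L\<^sup>1\<close>, and parallel transport along the rays from a base point is parallel up to the integral of
  the curvature along the ray, which tends to \<open>0\<close> in \<open>L\<^sup>1\<close> for almost every base point.

  Smooth maps are dense in \<open>W\<^sup>1\<^sup>,\<^sup>2(B, S\<^sup>3)\<close>: mollify \<open>g\<close> and project radially to the sphere from a point
  near the origin. Since \<open>|y|\<^sup>-\<^sup>2\<close> is locally integrable on \<open>\<real>\<^sup>4\<close>, averaging over that point shows that for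
  a good choice the projection costs little energy.
\<close>

section \<open>Maps of class $C^k$\<close>

text \<open>Neither half of the pair can be regularised alone: mollifying \<open>u\<close> leaves
  the sphere, and projecting back destroys the relation with \<open>\<eta>\<close>. The Hopf map
  makes the relation an identity, and its lift takes values in a four-dimensional space, where
  almost every centre of projection is missed by the smooth image of a three-dimensional ball. The
  connection is forced. If u = g c g^{-1} and dg = A g, then du = 2 A x u, which fixes the part of A
  normal to u as u x du / 2. The component along u is free and is spent on \<eta>, with the
  coefficient -1/2 for which -2 <dg, g c> = \<eta>. For smooth sphere-valued u the curvature is then
  (pullback - d\<eta>) u / 2. The curvature is quadratic in the derivatives, so for the mollified
  connections it is small in L^1 only. This is why base points are averaged, why a fast subsequence
  makes the errors along almost all rays summable, and why it matters that transports have norm one: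
  their errors add up without exponential factors.\<close>

lemma Ck_on_cong:
  assumes "open U" "\<And>x. x \<in> U \<Longrightarrow> f x = g x" "Ck_on k U f"
  shows "Ck_on k U g"
  using assms(2,3)
proof (induction k arbitrary: f g)
  case 0
  then show ?case using continuous_on_cong by force
next
  case (Suc k)
  have D: "(g has_derivative frechet_derivative f (at x)) (at x)" if "x \<in> U" for x
    using that Suc.prems assms(1)
    by (intro has_derivative_transform_within_open[of f _ x UNIV U g]) (auto simp flip: frechet_derivative_works)
  show ?case
    unfolding Ck_on.simps
  proof (intro conjI ballI allI)
    show "g differentiable (at x)" if "x \<in> U" for x
      using D[OF that] by (auto simp: differentiable_def)
    show "Ck_on k U (\<lambda>x. frechet_derivative g (at x) v)" for v
      by (rule Suc.IH[of "\<lambda>x. frechet_derivative f (at x) v"])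
         (use Suc.prems frechet_derivative_at[OF D] in auto)
  qed
qed

text \<open>The inductive step of the closure properties: uniqueness of the derivative at points of
  an open set lets any convenient formula \<open>D\<close> replace
  \<open>frechet_derivative f\<close>.\<close>

lemma Ck_on_SucI':
  assumes "open U" "\<And>x. x \<in> U \<Longrightarrow> (f has_derivative D x) (at x)" "\<And>v. Ck_on k U (\<lambda>x. D x v)"
  shows "Ck_on (Suc k) U f"
proof -
  have "Ck_on k U (\<lambda>x. frechet_derivative f (at x) v)" for v
    by (rule Ck_on_cong[OF assms(1) _ assms(3)[of v]]) (simp add: frechet_derivative_at[OF assms(2)])
  then show ?thesis using assms(2) by (auto simp: differentiable_def)
qed

lemma Ck_on_has_derivative:
  "Ck_on (Suc k) U f \<Longrightarrow> x \<in> U \<Longrightarrow> (f has_derivative frechet_derivative f (at x)) (at x)"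
  by (simp flip: frechet_derivative_works)

lemma Ck_on_imp_continuous_on: "Ck_on k U f \<Longrightarrow> continuous_on U f"
  by (cases k) (auto simp: continuous_at_imp_continuous_on differentiable_imp_continuous_within)

lemma Ck_on_SucD: "Ck_on (Suc k) U f \<Longrightarrow> Ck_on k U f"
proof (induction k arbitrary: f)
  case 0
  then show ?case using Ck_on_imp_continuous_on by (metis Ck_on.simps(1))
next
  case (Suc k)
  then show ?case by (metis Ck_on.simps(2))
qed

lemma Ck_on_subset: "Ck_on k U f \<Longrightarrow> V \<subseteq> U \<Longrightarrow> Ck_on k V f"
  by (induction k arbitrary: f) (auto intro: continuous_on_subset)

lemma Ck_on_const: "open U \<Longrightarrow> Ck_on k U (\<lambda>x. c)"
proof (induction k arbitrary: c)
  case (Suc k)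
  show ?case by (rule Ck_on_SucI'[where D="\<lambda>x v. 0"]) (use Suc in auto)
qed auto

lemma Ck_on_add: "open U \<Longrightarrow> Ck_on k U f \<Longrightarrow> Ck_on k U g \<Longrightarrow> Ck_on k U (\<lambda>x. f x + g x)"
proof (induction k arbitrary: f g)
  case (Suc k)
  show ?case
    by (rule Ck_on_SucI'[where D="\<lambda>x v. frechet_derivative f (at x) v + frechet_derivative g (at x) v"])
       (use Suc in \<open>auto intro!: has_derivative_add simp flip: frechet_derivative_works\<close>)
qed (auto intro: continuous_on_add)

lemma Ck_on_bounded_linear:
  assumes "bounded_linear h" "open U" 
  shows "Ck_on k U f \<Longrightarrow> Ck_on k U (\<lambda>x. h (f x))"
proof (induction k arbitrary: f)
  case 0
  then show ?case using assms(1) by (simp add: bounded_linear.continuous_on)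
next
  case (Suc k)
  show ?case
    by (rule Ck_on_SucI'[where D="\<lambda>x v. h (frechet_derivative f (at x) v)"])
       (use Suc assms in \<open>auto intro!: bounded_linear.has_derivative[OF assms(1)] simp flip: frechet_derivative_works\<close>)
qed

lemma Ck_on_bounded_bilinear:
  assumes "bounded_bilinear h" "open U"
  shows "Ck_on k U f \<Longrightarrow> Ck_on k U g \<Longrightarrow> Ck_on k U (\<lambda>x. h (f x) (g x))"
proof (induction k arbitrary: f g)
  case 0
  then show ?case using assms(1) by (simp add: bounded_bilinear.continuous_on)
next
  case (Suc k)
  show ?case
  proof (rule Ck_on_SucI'[OF assms(2)])
    show "((\<lambda>x. h (f x) (g x)) has_derivative
        (\<lambda>v. h (f x) (frechet_derivative g (at x) v) + h (frechet_derivative f (at x) v) (g x))) (at x)"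
      if "x \<in> U" for x
      using Suc.prems that by (intro bounded_bilinear.FDERIV[OF assms(1)] Ck_on_has_derivative[of k U])
    show "Ck_on k U (\<lambda>x. h (f x) (frechet_derivative g (at x) v) + h (frechet_derivative f (at x) v) (g x))" for v
      using Suc.prems by (intro Ck_on_add[OF assms(2)] Suc.IH Ck_on_SucD[of k U f] Ck_on_SucD[of k U g]) auto
  qed
qed

lemma Ck_on_sum:
  assumes "open U" "\<And>i. i \<in> I \<Longrightarrow> Ck_on k U (f i)"
  shows "Ck_on k U (\<lambda>x. \<Sum>i\<in>I. f i x)"
  using assms(2) by (induction I rule: infinite_finite_induct) (auto intro: Ck_on_const Ck_on_add assms(1))

lemma Ck_on_id: "open U \<Longrightarrow> Ck_on k U (\<lambda>x. x)"
proof (cases k)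
  case (Suc m)
  assume "open U"
  then show ?thesis unfolding Suc
    by (intro Ck_on_SucI'[where D="\<lambda>x v. v"] Ck_on_const) auto
qed auto

lemma Ck_on_compose_real:
  fixes f :: "real \<Rightarrow> 'b::real_normed_vector" and g :: "'a::real_normed_vector \<Rightarrow> real"
  assumes "open U" "open V"  "g ` U \<subseteq> V"
  shows "Ck_on k V f \<Longrightarrow> Ck_on k U g \<Longrightarrow> Ck_on k U (\<lambda>x. f (g x))"
proof (induction k arbitrary: f)
  case 0
  then show ?case using continuous_on_compose2 assms(3) by auto
next
  case (Suc k)
  show ?case
  proof (rule Ck_on_SucI'[OF assms(1)])
    show "((\<lambda>x. f (g x)) has_derivative (\<lambda>v. frechet_derivative g (at x) v *\<^sub>R frechet_derivative f (at (g x)) 1)) (at x)"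
      if "x \<in> U" for x
    proof -
      have f: "(f has_derivative frechet_derivative f (at (g x))) (at (g x))"
        using Suc.prems that assms(3) by (intro Ck_on_has_derivative[of k V]) auto
      interpret bounded_linear "frechet_derivative f (at (g x))"
        using f by (rule has_derivative_bounded_linear)
      show ?thesis
        using has_derivative_compose[OF Ck_on_has_derivative[OF Suc.prems(2) that] f]
          scaleR[of "frechet_derivative g (at x) v" 1 for v] by simp
    qed
    show "Ck_on k U (\<lambda>x. frechet_derivative g (at x) v *\<^sub>R frechet_derivative f (at (g x)) 1)" for v
      using Suc.prems by (intro Ck_on_bounded_bilinear[OF bounded_bilinear_scaleR assms(1)] Suc.IH
          Ck_on_SucD[of k U g]) auto
  qed
qed

lemma Ck_on_powr: "Ck_on k {0<..} (\<lambda>t::real. t powr a)"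
proof (induction k arbitrary: a)
  case 0
  then show ?case by (auto intro!: continuous_intros)
next
  case (Suc k)
  show ?case
  proof (rule Ck_on_SucI')
    show "((\<lambda>t. t powr a) has_derivative (\<lambda>v. v * (a * t powr (a - 1)))) (at t)" if "t \<in> {0<..}" for t
      using that has_real_derivative_powr[of t a] by (simp add: has_field_derivative_def mult_commute_abs)
    show "Ck_on k {0<..} (\<lambda>t. v * (a * t powr (a - 1)))" for v
      by (intro Ck_on_bounded_linear[OF bounded_linear_mult_right] Suc.IH) auto
  qed auto
qed

text \<open>The norm is hidden in a real power: v / |v| = (v . v)^(-1/2) v, where v . v is bilinear
  in v and stays in the open half-line on which the power is smooth.\<close>

lemma Ck_on_normalize:
  fixes v :: "'a::real_normed_vector \<Rightarrow> 'b::euclidean_space"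
  assumes "open U" "Ck_on k U v" "\<And>x. x \<in> U \<Longrightarrow> v x \<noteq> 0"
  shows "Ck_on k U (\<lambda>x. v x /\<^sub>R norm (v x))"
proof (rule Ck_on_cong[OF assms(1)])
  show "Ck_on k U (\<lambda>x. (v x \<bullet> v x) powr (-1/2) *\<^sub>R v x)"
    by (intro Ck_on_bounded_bilinear[OF bounded_bilinear_scaleR assms(1) _ assms(2)]
        Ck_on_compose_real[OF assms(1) _ _ Ck_on_powr] 
        Ck_on_bounded_bilinear[OF bounded_bilinear_inner assms(1) assms(2,2)]) (use assms(3) in auto)
  show "(v x \<bullet> v x) powr (-1/2) *\<^sub>R v x = v x /\<^sub>R norm (v x)" if "x \<in> U" for x
    using assms(3)[OF that]
    by (simp add: powr_minus powr_half_sqrt norm_eq_sqrt_inner)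
qed

section \<open>A flat function on the line\<close>

definition expinv :: "nat \<Rightarrow> real \<Rightarrow> real" where
  "expinv m t = (if t > 0 then exp (- (1/t)) / t ^ m else 0)"

text \<open>The substitution s = 1/t turns the claim into s^m / exp s tending to 0 at
  infinity.\<close>

lemma expinv_lim: "(expinv m \<longlongrightarrow> 0) (at 0)"
proof -
  have "((\<lambda>x::real. x ^ m / exp x) \<longlongrightarrow> 0) at_top" by (rule tendsto_power_div_exp_0)
  then have *: "((\<lambda>t::real. (inverse t) ^ m / exp (inverse t)) \<longlongrightarrow> 0) (at_right 0)"
    by (rule filterlim_compose) (rule filterlim_inverse_at_top_right)
  have "(expinv m \<longlongrightarrow> 0) (at_right 0)"
    by (rule Lim_transform_eventually[OF *])
       (auto simp: expinv_def eventually_at_filter exp_minus field_simps)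
  moreover have "(expinv m \<longlongrightarrow> 0) (at_left 0)"
    by (rule Lim_transform_eventually[OF tendsto_const])
       (auto simp: expinv_def eventually_at_filter)
  ultimately show ?thesis by (simp add: filterlim_at_split)
qed

text \<open>The powers of t in the denominator close the family under differentiation, so that
  smoothness follows by induction; \<open>m = 0\<close> is the usual flat function.\<close>

lemma expinv_has_derivative:
  "(expinv m has_real_derivative (expinv (m + 2) t - m * expinv (m + 1) t)) (at t)"
proof -
  consider "t > 0" | "t < 0" | "t = 0" by linarith
  then show ?thesis
  proof cases
    case 1
    have "((\<lambda>t. exp (- inverse t) * inverse t ^ m) has_real_derivative
        exp (- inverse t) * inverse t ^ 2 * inverse t ^ m
        - exp (- inverse t) * (m * inverse t ^ (m - 1) * inverse t ^ 2)) (at t)"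
      using 1 by (auto intro!: derivative_eq_intros simp: power2_eq_square algebra_simps)
    also have "exp (- inverse t) * inverse t ^ 2 * inverse t ^ m
        - exp (- inverse t) * (m * inverse t ^ (m - 1) * inverse t ^ 2)
        = expinv (m + 2) t - m * expinv (m + 1) t"
      using 1 by (cases m) (simp_all add: expinv_def field_simps power2_eq_square)
    finally show ?thesis
      by (rule has_field_derivative_transform_within_open[where S="{0<..}"])
         (use 1 in \<open>auto simp: expinv_def field_simps\<close>)
  next
    case 2
    have "((\<lambda>t. 0) has_real_derivative 0) (at t)" by simp
    then have "(expinv m has_real_derivative 0) (at t)"
      by (rule has_field_derivative_transform_within_open[where S="{..<0}"]) (use 2 in \<open>auto simp: expinv_def\<close>)
    then show ?thesis using 2 by (simp add: expinv_def)
  next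
    case 3
    \<comment> \<open>For h > 0, dividing \<open>expinv m h\<close> by h gives
      \<open>expinv (Suc m) h\<close>; for h < 0 both sides vanish.\<close>
    have "((\<lambda>h. (expinv m (0 + h) - expinv m 0) / h) \<longlongrightarrow> 0) (at 0)"
      by (rule Lim_transform_eventually[OF expinv_lim[of "Suc m"]])
         (auto simp: expinv_def eventually_at_filter)
    then show ?thesis using 3 by (simp add: DERIV_def expinv_def)
  qed
qed

lemma Ck_on_expinv: "Ck_on k UNIV (expinv m)"
proof (induction k arbitrary: m)
  case 0
  then show ?case
    using DERIV_isCont[OF expinv_has_derivative] by (simp add: continuous_at_imp_continuous_on)
next
  case (Suc k)
  show ?case
  proof (rule Ck_on_SucI')
    show "(expinv m has_derivative (\<lambda>v. v * (expinv (m + 2) t + (- real m) * expinv (m + 1) t))) (at t)" for t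
      using expinv_has_derivative[of m t] by (simp add: has_field_derivative_def mult_commute_abs)
    show "Ck_on k UNIV (\<lambda>t. v * (expinv (m + 2) t + (- real m) * expinv (m + 1) t))" for v
      by (intro Ck_on_bounded_linear[OF bounded_linear_mult_right] Ck_on_add Suc.IH) auto
  qed auto
qed

section \<open>Mollification\<close>

text \<open>The support has radius 1/2 for the sake of boundary points: if |x| <= 1 and |z| < 1/2,
  then (1 - e) x + e z has norm below 1 - e/2, so an average there still sees only a compact part of
  the open unit ball.\<close>

definition bump :: "'a::euclidean_space \<Rightarrow> real" where
  "bump z = expinv 0 (1 - 4 * (z \<bullet> z))"

definition rho :: "'a::euclidean_space \<Rightarrow> real" where
  "rho z = bump z / integral\<^sup>L lborel (bump :: 'a \<Rightarrow> real)"

lemma Ck_on_bump: "Ck_on k UNIV (bump :: 'a::euclidean_space \<Rightarrow> real)"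
proof -
  have "Ck_on k UNIV (\<lambda>z::'a. 1 + (-4) * (z \<bullet> z))"
    by (intro Ck_on_add Ck_on_const Ck_on_bounded_linear[OF bounded_linear_mult_right]
        Ck_on_bounded_bilinear[OF bounded_bilinear_inner] Ck_on_id) auto
  from Ck_on_compose_real[OF _ open_UNIV _ Ck_on_expinv[of k 0] this] show ?thesis
    by (simp add: bump_def[abs_def])
qed

lemma Ck_on_rho: "Ck_on k UNIV (rho :: 'a::euclidean_space \<Rightarrow> real)"
  using Ck_on_bounded_linear[OF bounded_linear_divide open_UNIV Ck_on_bump] by (simp add: rho_def[abs_def])

lemma continuous_on_rho: "continuous_on S (rho :: 'a::euclidean_space \<Rightarrow> real)"
  using Ck_on_rho[of 0] continuous_on_subset by auto

lemma bump_nonneg: "0 \<le> bump z"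
  by (simp add: bump_def expinv_def)

lemma bump_pos_iff: "0 < bump z \<longleftrightarrow> norm z < 1/2"
proof -
  have "norm z < 1/2 \<longleftrightarrow> (norm z)\<^sup>2 < (1/2)\<^sup>2" by (auto simp: power_mono_iff abs_square_less_1 simp flip: not_le)
  then show ?thesis
    by (simp add: bump_def expinv_def power2_norm_eq_inner power_divide field_simps)
qed

lemma bump_eq_0: "norm z \<ge> 1/2 \<Longrightarrow> bump z = 0"
  using bump_pos_iff[of z] bump_nonneg[of z] by force

lemma continuous_on_bump: "continuous_on S (bump :: 'a::euclidean_space \<Rightarrow> real)"
  using Ck_on_bump[of 0] continuous_on_subset by auto

lemma integrable_compact_support:
  fixes f :: "'a::euclidean_space \<Rightarrow> 'b::euclidean_space"
  assumes "continuous_on UNIV f" "\<And>z. norm z > R \<Longrightarrow> f z = 0"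
  shows "integrable lborel f"
proof -
  have "integrable lborel (\<lambda>x. indicator (cball 0 R) x *\<^sub>R f x)"
    by (intro borel_integrable_compact continuous_on_subset[OF assms(1)]) auto
  also have "(\<lambda>x. indicator (cball 0 R) x *\<^sub>R f x) = f"
    using assms(2) by (fastforce simp: indicator_def)
  finally show ?thesis .
qed

lemma integrable_bump: "integrable lborel (bump :: 'a::euclidean_space \<Rightarrow> real)"
  by (rule integrable_compact_support[OF continuous_on_bump, of "1/2"]) (simp add: bump_eq_0)

lemma integral_bump_pos: "0 < integral\<^sup>L lborel (bump :: 'a::euclidean_space \<Rightarrow> real)"
proof -
  have "integral\<^sup>L lborel (bump :: 'a \<Rightarrow> real) \<noteq> 0"
  proof
    assume "integral\<^sup>L lborel (bump :: 'a \<Rightarrow> real) = 0"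
    then have "AE x::'a in lborel. bump x = 0"
      using integral_nonneg_eq_0_iff_AE[OF integrable_bump] bump_nonneg by auto
    then have "AE x::'a in lborel. x \<notin> ball 0 (1/2)"
      by eventually_elim (metis bump_pos_iff dist_0_norm less_irrefl mem_ball)
    then have "emeasure lborel (ball (0::'a) (1/2)) = 0"
      by (subst (asm) AE_iff_measurable[where N="ball 0 (1/2)"]) auto
    then have "measure lborel (ball (0::'a) (1/2)) = 0" by (simp add: measure_def)
    with content_ball_pos[of "1/2" "0::'a"] show False by simp
  qed
  moreover have "integral\<^sup>L lborel (bump :: 'a \<Rightarrow> real) \<ge> 0"
    by (rule integral_nonneg_AE) (simp add: bump_nonneg)
  ultimately show ?thesis by linarith
qed

lemma rho_nonneg: "0 \<le> rho z"
  by (simp add: rho_def bump_nonneg integral_bump_pos[THEN less_imp_le])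

lemma rho_eq_0: "norm z \<ge> 1/2 \<Longrightarrow> rho z = 0"
  by (simp add: rho_def bump_eq_0)

lemma borel_measurable_rho[measurable]: "rho \<in> borel_measurable borel"
  by (rule borel_measurable_continuous_onI) (rule continuous_on_rho)

lemma integrable_rho: "integrable lborel (rho :: 'a::euclidean_space \<Rightarrow> real)"
  by (simp add: rho_def[abs_def] integrable_bump)

lemma integral_rho: "integral\<^sup>L lborel (rho :: 'a::euclidean_space \<Rightarrow> real) = 1"
  using integral_bump_pos[where 'a='a] by (simp add: rho_def[abs_def])

section \<open>Smooth kernels with compact support\<close>

definition test_kernel :: "real \<Rightarrow> ('a::euclidean_space \<Rightarrow> 'b::euclidean_space) \<Rightarrow> bool" where
  "test_kernel R k \<longleftrightarrow> (\<forall>m. Ck_on m UNIV k) \<and> (\<forall>z. norm z > R \<longrightarrow> k z = 0)"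

lemma test_kernel_rho: "test_kernel (1/2) rho"
  by (auto simp: test_kernel_def Ck_on_rho rho_eq_0)

lemma test_kernel_mult: "test_kernel R (k :: 'a::euclidean_space \<Rightarrow> real) \<Longrightarrow> test_kernel R (\<lambda>z. c * k z)"
  using Ck_on_bounded_linear[OF bounded_linear_mult_right open_UNIV] by (auto simp: test_kernel_def)

lemma test_kernel_continuous: "test_kernel R k \<Longrightarrow> continuous_on S k"
  unfolding test_kernel_def by (metis Ck_on.simps(1) continuous_on_subset subset_UNIV)

lemma test_kernel_measurable: "test_kernel R k \<Longrightarrow> k \<in> borel_measurable borel"
  by (rule borel_measurable_continuous_onI) (rule test_kernel_continuous)

lemma test_kernel_has_derivative:
  "test_kernel R k \<Longrightarrow> (k has_derivative frechet_derivative k (at z)) (at z)"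
  unfolding test_kernel_def by (metis Ck_on_has_derivative UNIV_I)

lemma test_kernel_derivative:
  assumes "test_kernel R k" shows "test_kernel R (\<lambda>z. frechet_derivative k (at z) v)"
proof -
  have "frechet_derivative k (at z) v = 0" if "norm z > R" for z
  proof -
    have "open {z::'a. norm z > R}" by (intro open_Collect_less continuous_intros)
    then have "(k has_derivative (\<lambda>v. 0)) (at z)"
      using assms that
      by (intro has_derivative_transform_within_open[of "\<lambda>x. 0" _ z UNIV "{z. norm z > R}" k]) (auto simp: test_kernel_def)
    then show ?thesis using frechet_derivative_at by metis
  qed
  moreover have "Ck_on m UNIV (\<lambda>z. frechet_derivative k (at z) v)" for m
    using assms Ck_on.simps(2) unfolding test_kernel_def by metis
  ultimately show ?thesis by (auto simp: test_kernel_def)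
qed

lemma test_kernel_bounded:
  assumes "test_kernel R k" obtains K where "K > 0" "\<And>z. norm (k z) \<le> K"
proof -
  have "compact (k ` cball 0 R)"
    by (intro compact_continuous_image test_kernel_continuous[OF assms]) auto
  then obtain K where K: "K > 0" "\<And>y. y \<in> k ` cball 0 R \<Longrightarrow> norm y \<le> K"
    using compact_imp_bounded bounded_pos by metis
  have "norm (k z) \<le> K" for z
    using K assms by (cases "norm z \<le> R") (auto simp: test_kernel_def)
  with K show ?thesis using that by blast
qed

lemma linear_norm_bound_Basis:
  assumes "linear L" "\<And>b. b \<in> Basis \<Longrightarrow> norm (L b) \<le> K b"
  shows "norm (L v) \<le> (\<Sum>b\<in>Basis. K b) * norm v"
proof -
  have "L v = (\<Sum>b\<in>Basis. (v \<bullet> b) *\<^sub>R L b)"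
    by (subst euclidean_representation[of v, symmetric]) (simp only: linear_sum[OF assms(1)] linear_scale[OF assms(1)])
  also have "norm \<dots> \<le> (\<Sum>b\<in>Basis. K b * norm v)"
    by (intro order_trans[OF norm_sum] sum_mono)
       (auto simp: mult.commute[of "K _"] Basis_le_norm intro!: mult_mono assms(2))
  finally show ?thesis by (simp add: sum_distrib_right)
qed

lemma test_kernel_derivative_bounded:
  fixes k :: "'a::euclidean_space \<Rightarrow> 'b::euclidean_space"
  assumes "test_kernel R k" obtains K where "K > 0" "\<And>z v. norm (frechet_derivative k (at z) v) \<le> K * norm v"
proof -
  have "\<exists>K. \<forall>z. norm (frechet_derivative k (at z) b) \<le> K" for b
    using test_kernel_bounded[OF test_kernel_derivative[OF assms]] by metis
  then obtain K where K: "\<And>b z. norm (frechet_derivative k (at z) b) \<le> K b" by metis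
  have K0: "K b \<ge> 0" for b using order_trans[OF norm_ge_zero K] .
  define L where "L = 1 + (\<Sum>b\<in>Basis. K b)"
  have "norm (frechet_derivative k (at z) v) \<le> L * norm v" for z v
    using linear_norm_bound_Basis[OF has_derivative_linear[OF test_kernel_has_derivative[OF assms, of z]] K, of v]
    by (simp add: L_def distrib_right add_increasing)
  moreover have "L > 0" unfolding L_def using sum_nonneg[of Basis K] K0 by (simp add: add_pos_nonneg)
  ultimately show ?thesis using that by blast
qed

lemma integrable_bounded_scaleR:
  fixes f :: "'a \<Rightarrow> 'b::euclidean_space"
  assumes "integrable M f" "k \<in> borel_measurable M" "\<And>y. \<bar>k y\<bar> \<le> K"
  shows "integrable M (\<lambda>y. k y *\<^sub>R f y)"
proof (rule Bochner_Integration.integrable_bound)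
  show "integrable M (\<lambda>y. K * norm (f y))" using assms(1) by auto
  show "(\<lambda>y. k y *\<^sub>R f y) \<in> borel_measurable M" using assms by measurable
  have "\<bar>k y\<bar> * norm (f y) \<le> \<bar>K\<bar> * norm (f y)" for y
    by (intro mult_right_mono) (use assms(3)[of y] in auto)
  then show "AE y in M. norm (k y *\<^sub>R f y) \<le> norm (K * norm (f y))"
    by (auto simp: abs_mult)
qed

text \<open>Differentiation under the integral sign, for the affine arguments to which mollification
  leads. The kernel is globally Lipschitz, so a constant multiple of |f| dominates the difference
  quotients.\<close>

lemma kernel_integral_has_derivative:
  fixes k :: "'a::euclidean_space \<Rightarrow> real" and f :: "'a \<Rightarrow> 'b::euclidean_space"
  assumes k: "test_kernel R k" and f: "integrable lborel f"
  shows "((\<lambda>x. LINT y|lborel. k (c *\<^sub>R x + d *\<^sub>R y) *\<^sub>R f y) has_derivative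
    (\<lambda>v. LINT y|lborel. frechet_derivative k (at (c *\<^sub>R x + d *\<^sub>R y)) (c *\<^sub>R v) *\<^sub>R f y)) (at x)"
proof -
  obtain K where K: "K > 0" "\<And>z. \<bar>k z\<bar> \<le> K" using test_kernel_bounded[OF k] by (metis real_norm_def)
  obtain L where L: "L > 0" "\<And>z v. \<bar>frechet_derivative k (at z) v\<bar> \<le> L * norm v"
    using test_kernel_derivative_bounded[OF k] by (metis real_norm_def)
  have bl: "bounded_linear (frechet_derivative k (at z))" for z
    using test_kernel_has_derivative[OF k] has_derivative_bounded_linear by blast
  have Lip: "\<bar>k z - k w\<bar> \<le> L * norm (z - w)" for z w
  proof -
    have "norm (k z - k w) \<le> L * norm (z - w)"
      by (rule differentiable_bound[of UNIV k "\<lambda>x. frechet_derivative k (at x)"])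
         (auto intro!: test_kernel_has_derivative[OF k] onorm_bound L simp: L(1)[THEN less_imp_le])
    then show ?thesis by simp
  qed
  have [measurable]: "k \<in> borel_measurable borel" "(\<lambda>z. frechet_derivative k (at z) v) \<in> borel_measurable borel" for v
    using test_kernel_measurable k test_kernel_derivative by blast+
  have i1: "integrable lborel (\<lambda>y. k (c *\<^sub>R x + d *\<^sub>R y) *\<^sub>R f y)" for x
    by (rule integrable_bounded_scaleR[OF f _ K(2)]) measurable
  have i2: "integrable lborel (\<lambda>y. frechet_derivative k (at (c *\<^sub>R x + d *\<^sub>R y)) v *\<^sub>R f y)" for x v
    by (rule integrable_bounded_scaleR[OF f _ L(2)]) measurable
  have "bounded_linear (\<lambda>v. LINT y|lborel. frechet_derivative k (at (c *\<^sub>R x + d *\<^sub>R y)) (c *\<^sub>R v) *\<^sub>R f y)"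
  proof (rule bounded_linear_intro[where K="\<bar>c\<bar> * L * (LINT y|lborel. norm (f y))"])
    show "(LINT y|lborel. frechet_derivative k (at (c *\<^sub>R x + d *\<^sub>R y)) (c *\<^sub>R (v + w)) *\<^sub>R f y)
      = (LINT y|lborel. frechet_derivative k (at (c *\<^sub>R x + d *\<^sub>R y)) (c *\<^sub>R v) *\<^sub>R f y)
      + (LINT y|lborel. frechet_derivative k (at (c *\<^sub>R x + d *\<^sub>R y)) (c *\<^sub>R w) *\<^sub>R f y)" for v w
      by (subst Bochner_Integration.integral_add[symmetric, OF i2 i2])
         (simp add: scaleR_add_right linear_add[OF bounded_linear.linear[OF bl]] scaleR_add_left)
    show "(LINT y|lborel. frechet_derivative k (at (c *\<^sub>R x + d *\<^sub>R y)) (c *\<^sub>R (r *\<^sub>R v)) *\<^sub>R f y)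
      = r *\<^sub>R (LINT y|lborel. frechet_derivative k (at (c *\<^sub>R x + d *\<^sub>R y)) (c *\<^sub>R v) *\<^sub>R f y)" for r v
      by (subst integral_scaleR_right[symmetric])
         (simp add: linear_scale[OF bounded_linear.linear[OF bl]] mult_ac)
    show "norm (LINT y|lborel. frechet_derivative k (at (c *\<^sub>R x + d *\<^sub>R y)) (c *\<^sub>R v) *\<^sub>R f y)
      \<le> norm v * (\<bar>c\<bar> * L * (LINT y|lborel. norm (f y)))" for v
    proof -
      have "norm (LINT y|lborel. frechet_derivative k (at (c *\<^sub>R x + d *\<^sub>R y)) (c *\<^sub>R v) *\<^sub>R f y)
        \<le> (LINT y|lborel. norm v * (\<bar>c\<bar> * L) * norm (f y))"
      proof (rule order_trans[OF integral_norm_bound integral_mono])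
        show "norm (frechet_derivative k (at (c *\<^sub>R x + d *\<^sub>R y)) (c *\<^sub>R v) *\<^sub>R f y) \<le> norm v * (\<bar>c\<bar> * L) * norm (f y)" for y
          using mult_right_mono[OF L(2)[of "c *\<^sub>R x + d *\<^sub>R y" "c *\<^sub>R v"], of "norm (f y)"] by (simp add: mult_ac)
      qed (use f integrable_norm[OF i2] in auto)
      then show ?thesis by (simp add: mult_ac)
    qed
  qed
  moreover have "((\<lambda>y. (1 / norm (y - x)) *\<^sub>R ((LINT z|lborel. k (c *\<^sub>R y + d *\<^sub>R z) *\<^sub>R f z)
     - ((LINT z|lborel. k (c *\<^sub>R x + d *\<^sub>R z) *\<^sub>R f z)
        + (LINT z|lborel. frechet_derivative k (at (c *\<^sub>R x + d *\<^sub>R z)) (c *\<^sub>R (y - x)) *\<^sub>R f z)))) \<longlongrightarrow> 0) (at x)"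
    (is "(?Q \<longlongrightarrow> 0) _")
    unfolding tendsto_at_iff_sequentially
  proof (intro allI impI)
    fix X :: "nat \<Rightarrow> 'a" assume X: "\<forall>i. X i \<in> UNIV - {x}" "X \<longlonglongrightarrow> x"
    \<comment> \<open>\<open>q i\<close> is the error of the first-order expansion of the kernel at
      x divided by the length of the increment. It is at most 2 |c| L and tends to 0
      pointwise.\<close>
    define q where "q i z = ((1 / norm (X i - x)) * (k (c *\<^sub>R X i + d *\<^sub>R z) - k (c *\<^sub>R x + d *\<^sub>R z)
      - frechet_derivative k (at (c *\<^sub>R x + d *\<^sub>R z)) (c *\<^sub>R (X i - x))))" for i z
    have "?Q (X i) = (LINT z|lborel. q i z *\<^sub>R f z)" for i
    proof -
      have "(LINT z|lborel. q i z *\<^sub>R f z) = (LINT z|lborel. (1 / norm (X i - x)) *\<^sub>R (k (c *\<^sub>R X i + d *\<^sub>R z) *\<^sub>R f z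
         - k (c *\<^sub>R x + d *\<^sub>R z) *\<^sub>R f z - frechet_derivative k (at (c *\<^sub>R x + d *\<^sub>R z)) (c *\<^sub>R (X i - x)) *\<^sub>R f z))"
        by (simp only: q_def scaleR_scaleR[symmetric] scaleR_diff_left)
      also have "\<dots> = (1 / norm (X i - x)) *\<^sub>R ((LINT z|lborel. k (c *\<^sub>R X i + d *\<^sub>R z) *\<^sub>R f z)
         - (LINT z|lborel. k (c *\<^sub>R x + d *\<^sub>R z) *\<^sub>R f z)
         - (LINT z|lborel. frechet_derivative k (at (c *\<^sub>R x + d *\<^sub>R z)) (c *\<^sub>R (X i - x)) *\<^sub>R f z))"
        by (simp only: integral_scaleR_right Bochner_Integration.integral_diff[OF i1 i1]
            Bochner_Integration.integral_diff[OF Bochner_Integration.integrable_diff[OF i1 i1] i2])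
      finally show ?thesis by (simp only: diff_diff_eq)
    qed
    moreover have "(\<lambda>i. LINT z|lborel. q i z *\<^sub>R f z) \<longlonglongrightarrow> (LINT z|(lborel::'a measure). (0::'b))"
    proof (rule integral_dominated_convergence[where w="\<lambda>z. (2 * \<bar>c\<bar> * L) * norm (f z)"])
      show "AE z in lborel. (\<lambda>i. q i z *\<^sub>R f z) \<longlonglongrightarrow> 0"
      proof (rule AE_I2)
        fix z
        have "((\<lambda>y. k (c *\<^sub>R y + d *\<^sub>R z)) has_derivative (\<lambda>v. frechet_derivative k (at (c *\<^sub>R x + d *\<^sub>R z)) (c *\<^sub>R v))) (at x)"
          by (rule has_derivative_compose[OF _ test_kernel_has_derivative[OF k]])
             (auto intro!: derivative_eq_intros)
        then have "((\<lambda>y. (1 / norm (y - x)) *\<^sub>R (k (c *\<^sub>R y + d *\<^sub>R z) - (k (c *\<^sub>R x + d *\<^sub>R z) + frechet_derivative k (at (c *\<^sub>R x + d *\<^sub>R z)) (c *\<^sub>R (y - x))))) \<longlongrightarrow> 0) (at x)"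
          by (simp add: has_derivative_within)
        then have "(\<lambda>i. q i z) \<longlonglongrightarrow> 0"
          unfolding tendsto_at_iff_sequentially using X by (auto simp: q_def o_def diff_diff_eq)
        then show "(\<lambda>i. q i z *\<^sub>R f z) \<longlonglongrightarrow> 0"
          using tendsto_scaleR[OF _ tendsto_const[of "f z"]] by fastforce
      qed
      show "AE z in lborel. norm (q i z *\<^sub>R f z) \<le> (2 * \<bar>c\<bar> * L) * norm (f z)" for i
      proof (rule AE_I2)
        fix z
        have n: "norm (X i - x) > 0" using X by auto
        have "\<bar>k (c *\<^sub>R X i + d *\<^sub>R z) - k (c *\<^sub>R x + d *\<^sub>R z)\<bar> \<le> L * (\<bar>c\<bar> * norm (X i - x))"
          using Lip[of "c *\<^sub>R X i + d *\<^sub>R z" "c *\<^sub>R x + d *\<^sub>R z"] by (simp flip: scaleR_diff_right)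
        moreover have "\<bar>frechet_derivative k (at (c *\<^sub>R x + d *\<^sub>R z)) (c *\<^sub>R (X i - x))\<bar> \<le> L * (\<bar>c\<bar> * norm (X i - x))"
          using L(2)[of "c *\<^sub>R x + d *\<^sub>R z" "c *\<^sub>R (X i - x)"] by simp
        ultimately have "\<bar>k (c *\<^sub>R X i + d *\<^sub>R z) - k (c *\<^sub>R x + d *\<^sub>R z) - frechet_derivative k (at (c *\<^sub>R x + d *\<^sub>R z)) (c *\<^sub>R (X i - x))\<bar> \<le> 2 * \<bar>c\<bar> * L * norm (X i - x)"
          by (simp add: mult_ac)
        then have "\<bar>q i z\<bar> \<le> 2 * \<bar>c\<bar> * L"
          using n by (simp add: q_def abs_mult divide_simps)
        then show "norm (q i z *\<^sub>R f z) \<le> (2 * \<bar>c\<bar> * L) * norm (f z)"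
          by (simp add: mult_right_mono)
      qed
    qed (use f in \<open>auto simp: q_def\<close>)
    ultimately show "(?Q \<circ> X) \<longlonglongrightarrow> 0" by (simp add: o_def)
  qed
  ultimately show ?thesis by (simp add: has_derivative_within)
qed

text \<open>The induction generalises over \<open>k\<close>: a directional derivative of the
  integral is an integral of the same shape, with a directional derivative of \<open>k\<close> as
  its kernel.\<close>

lemma Ck_on_kernel_integral:
  fixes k :: "'a::euclidean_space \<Rightarrow> real" and f :: "'a \<Rightarrow> 'b::euclidean_space"
  assumes "test_kernel R k" "integrable lborel f"
  shows "Ck_on m UNIV (\<lambda>x. LINT y|lborel. k (c *\<^sub>R x + d *\<^sub>R y) *\<^sub>R f y)"
  using assms(1)
proof (induction m arbitrary: k)
  case 0
  show ?case
    using has_derivative_continuous[OF kernel_integral_has_derivative[OF 0 assms(2)]]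
    by (simp add: continuous_at_imp_continuous_on)
next
  case (Suc m)
  show ?case
    by (rule Ck_on_SucI'[OF open_UNIV kernel_integral_has_derivative[OF Suc.prems assms(2)]])
       (rule Suc.IH[OF test_kernel_derivative[OF Suc.prems]])
qed

lemma lborel_integral_affine:
  fixes h :: "'a::euclidean_space \<Rightarrow> 'b::euclidean_space"
  assumes [measurable]: "h \<in> borel_measurable borel" and "c > 0"
  shows "(LINT y|lborel. h y) = c ^ DIM('a) *\<^sub>R (LINT z|lborel. h (t + c *\<^sub>R z))"
  using assms(2)
  by (subst lborel_affine[of c t]) (simp_all add: integral_density integral_distr)

lemma lborel_nn_integral_affine:
  fixes h :: "'a::euclidean_space \<Rightarrow> ennreal"
  assumes [measurable]: "h \<in> borel_measurable borel" and "c > 0"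
  shows "(\<integral>\<^sup>+y. h y \<partial>lborel) = ennreal (c ^ DIM('a)) * (\<integral>\<^sup>+z. h (t + c *\<^sub>R z) \<partial>lborel)"
  using assms(2)
  by (subst lborel_affine[of c t])
     (simp_all add: nn_integral_density nn_integral_distr nn_integral_cmult ennreal_power)

section \<open>Averages near a contracted point\<close>

definition rho_measure :: "'a::euclidean_space measure" where
  "rho_measure = density lborel (\<lambda>z. ennreal (rho z))"

lemma sets_rho_measure[measurable_cong, simp]: "sets rho_measure = sets borel"
  by (simp add: rho_measure_def)

lemma space_rho_measure[simp]: "space rho_measure = UNIV"
  by (simp add: rho_measure_def)

lemma nn_integral_rho_1: "(\<integral>\<^sup>+z. ennreal (rho (z::'a::euclidean_space)) \<partial>lborel) = 1"
  by (subst nn_integral_eq_integral) (auto simp: integrable_rho rho_nonneg integral_rho)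

lemma emeasure_rho_measure: "emeasure (rho_measure :: 'a::euclidean_space measure) UNIV = 1"
  by (simp add: rho_measure_def emeasure_density nn_integral_rho_1)

lemma finite_measure_rho: "finite_measure (rho_measure :: 'a::euclidean_space measure)"
  by (rule finite_measureI) (simp add: emeasure_rho_measure)

text \<open>Averaging near the contracted point \<open>(1 - e) x\<close> only uses values inside the unit ball, so that weak
  derivatives are mollified correctly up to the boundary.\<close>

definition mol :: "real \<Rightarrow> ('a::euclidean_space \<Rightarrow> 'b::euclidean_space) \<Rightarrow> 'a \<Rightarrow> 'b" where
  "mol e f x = (LINT z|rho_measure. f ((1 - e) *\<^sub>R x + e *\<^sub>R z))"

lemma mol_eq_integral_rho:
  assumes [measurable]: "f \<in> borel_measurable borel"
  shows "mol e f x = (LINT z|lborel. rho z *\<^sub>R f ((1 - e) *\<^sub>R x + e *\<^sub>R z))"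
  unfolding mol_def rho_measure_def by (subst integral_density) (auto simp: rho_nonneg)

text \<open>The substitution y = (1 - e) x + e z moves x from the merely measurable \<open>f\<close>
  into the smooth kernel; its Jacobian accounts for the prefactor.\<close>

lemma mol_eq_kernel:
  fixes f :: "'a::euclidean_space \<Rightarrow> 'b::euclidean_space"
  assumes [measurable]: "f \<in> borel_measurable borel" and "e > 0"
  shows "mol e f x = (LINT y|lborel. ((1/e) ^ DIM('a) * rho ((- ((1 - e)/e)) *\<^sub>R x + (1/e) *\<^sub>R y)) *\<^sub>R f y)"
proof -
  have eq: "(- ((1 - e) / e)) *\<^sub>R x + (1 / e) *\<^sub>R ((1 - e) *\<^sub>R x + e *\<^sub>R z) = z" for z
    using \<open>e > 0\<close> by (simp add: scaleR_add_right)
  show ?thesis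
    unfolding mol_eq_integral_rho[OF assms(1)]
    using lborel_integral_affine[where c=e and t="(1 - e) *\<^sub>R x" and
        h="\<lambda>y. ((1/e) ^ DIM('a) * rho ((- ((1 - e)/e)) *\<^sub>R x + (1/e) *\<^sub>R y)) *\<^sub>R f y"] \<open>e > 0\<close>
    by (simp only: eq) (simp add: power_divide flip: integral_scaleR_right)
qed

lemma mol_fun_eq:
  fixes f :: "'a::euclidean_space \<Rightarrow> 'b::euclidean_space"
  assumes f: "integrable lborel f" and e: "e > 0"
  shows "mol e f = (\<lambda>x. LINT y|lborel. ((1/e) ^ DIM('a) * rho ((- ((1 - e)/e)) *\<^sub>R x + (1/e) *\<^sub>R y)) *\<^sub>R f y)"
  using mol_eq_kernel[OF _ e, of f] f by (intro ext) auto

lemma Ck_on_mol: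
  fixes f :: "'a::euclidean_space \<Rightarrow> 'b::euclidean_space"
  assumes f: "integrable lborel f" and e: "e > 0"
  shows "Ck_on m UNIV (mol e f)"
  unfolding mol_fun_eq[OF assms] by (rule Ck_on_kernel_integral[OF test_kernel_mult[OF test_kernel_rho] f])

text \<open>Weak directional derivative on the open unit ball, in a form suited to Borel functions.
  The integrals may run over the whole space because test functions vanish outside the ball.\<close>

definition weak_dir :: "'a::euclidean_space \<Rightarrow> ('a \<Rightarrow> 'b::euclidean_space) \<Rightarrow> ('a \<Rightarrow> 'b) \<Rightarrow> bool" where
  "weak_dir v f g \<longleftrightarrow> (\<forall>\<phi>. test_function (cball 0 1) \<phi> \<longrightarrow>
    (LINT y|lborel. frechet_derivative \<phi> (at y) v *\<^sub>R f y) = - (LINT y|lborel. \<phi> y *\<^sub>R g y))"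

definition mol_kernel :: "real \<Rightarrow> 'a::euclidean_space \<Rightarrow> 'a \<Rightarrow> real" where
  "mol_kernel e x y = (1/e) ^ DIM('a) * rho ((- ((1 - e)/e)) *\<^sub>R x + (1/e) *\<^sub>R y)"

lemma Ck_on_affine_arg:
  fixes k :: "'a::euclidean_space \<Rightarrow> 'b::euclidean_space"
  shows "Ck_on m UNIV k \<Longrightarrow> Ck_on m UNIV (\<lambda>y. k (a + d *\<^sub>R y))"
proof (induction m arbitrary: k)
  case 0
  then show ?case by (auto intro!: continuous_intros continuous_on_compose2[of UNIV k])
next
  case (Suc m)
  show ?case
  proof (rule Ck_on_SucI'[OF open_UNIV])
    show "((\<lambda>y. k (a + d *\<^sub>R y)) has_derivative (\<lambda>v. d *\<^sub>R frechet_derivative k (at (a + d *\<^sub>R y)) v)) (at y)" for y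
    proof -
      have "(k has_derivative frechet_derivative k (at (a + d *\<^sub>R y))) (at (a + d *\<^sub>R y))"
        using Suc.prems by (intro Ck_on_has_derivative[of m UNIV]) auto
      note D = this
      have "((\<lambda>y. a + d *\<^sub>R y) has_derivative (\<lambda>v. d *\<^sub>R v)) (at y)" by (auto intro!: derivative_eq_intros)
      from has_derivative_compose[OF this D] linear_scale[OF has_derivative_linear[OF D]]
      show ?thesis by simp
    qed
    show "Ck_on m UNIV (\<lambda>y. d *\<^sub>R frechet_derivative k (at (a + d *\<^sub>R y)) v)" for v
      by (rule Ck_on_bounded_linear[OF bounded_linear_scaleR_right open_UNIV])
         (use Suc.prems in \<open>auto intro: Suc.IH[where k="\<lambda>x. frechet_derivative k (at x) v"]\<close>)
  qed
qed

lemma smooth_on_UNIV_iff: "smooth_on UNIV f \<longleftrightarrow> (\<forall>m. Ck_on m UNIV f)"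
proof
  assume "smooth_on UNIV f"
  then obtain U g where "UNIV \<subseteq> U" "\<forall>m. Ck_on m U g" "\<forall>x\<in>UNIV. f x = g x" by (auto simp: smooth_on_def)
  moreover from this have "f = g" "U = UNIV" by auto
  ultimately show "\<forall>m. Ck_on m UNIV f" by simp
next
  assume "\<forall>m. Ck_on m UNIV f"
  then show "smooth_on UNIV f" unfolding smooth_on_def by (intro exI[of _ UNIV] exI[of _ f]) auto
qed

text \<open>As a function of y the kernel lives on the ball of radius e/2 about (1 - e) x, and the
  hypothesis places that ball strictly inside radius \<open>r\<close>. A general \<open>r\<close>
  allows localisation to smaller balls.\<close>

lemma test_function_mol_kernel:
  assumes e: "0 < e" "e \<le> 1" and x: "norm ((1 - e) *\<^sub>R x) + e/2 < r"
  shows "test_function (cball 0 r) (mol_kernel e x)" "\<And>y. norm y \<ge> r \<Longrightarrow> mol_kernel e x y = 0"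
proof -
  have 0: "mol_kernel e x y = 0" if "dist ((1 - e) *\<^sub>R x) y \<ge> e/2" for y
  proof -
    have "e *\<^sub>R ((- ((1 - e)/e)) *\<^sub>R x + (1/e) *\<^sub>R y) = - ((1 - e) *\<^sub>R x - y)"
      using e by (simp add: scaleR_right_diff_distrib)
    then have "dist ((1 - e) *\<^sub>R x) y = norm (e *\<^sub>R ((- ((1 - e)/e)) *\<^sub>R x + (1/e) *\<^sub>R y))"
      by (simp only: dist_norm norm_minus_cancel)
    then have "norm ((- ((1 - e)/e)) *\<^sub>R x + (1/e) *\<^sub>R y) \<ge> 1/2" using that e by simp
    then show ?thesis by (simp add: mol_kernel_def rho_eq_0)
  qed
  have sub: "cball ((1 - e) *\<^sub>R x) (e/2) \<subseteq> ball 0 r"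
  proof
    fix y assume "y \<in> cball ((1 - e) *\<^sub>R x) (e/2)"
    then show "y \<in> ball 0 r"
      using x norm_triangle_ineq4[of "(1 - e) *\<^sub>R x" "(1 - e) *\<^sub>R x - y"] by (simp add: dist_norm)
  qed
  show "mol_kernel e x y = 0" if "norm y \<ge> r" for y
  proof (rule 0, rule ccontr)
    assume "\<not> e/2 \<le> dist ((1 - e) *\<^sub>R x) y"
    then have "y \<in> cball ((1 - e) *\<^sub>R x) (e/2)" by (simp add: mem_cball)
    with sub have "y \<in> ball 0 r" by blast
    with that show False by simp
  qed
  have cl: "closure {y. mol_kernel e x y \<noteq> 0} \<subseteq> cball ((1 - e) *\<^sub>R x) (e/2)"
    by (rule closure_minimal) (use 0 in force)+
  have "Ck_on m UNIV (mol_kernel e x)" for m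
    unfolding mol_kernel_def[abs_def]
    by (intro Ck_on_bounded_linear[OF bounded_linear_mult_right open_UNIV] Ck_on_affine_arg Ck_on_rho)
  moreover have "compact (closure {y. mol_kernel e x y \<noteq> 0})"
    using cl by (meson bounded_cball bounded_subset closed_closure compact_eq_bounded_closed)
  ultimately show "test_function (cball 0 r) (mol_kernel e x)"
    using cl sub by (auto simp: test_function_def smooth_on_UNIV_iff)
qed

text \<open>The kernel depends on y - (1 - e) x only, so a derivative in x is -(1 - e) times a
  derivative in y. In this form it can be moved to the weak derivative of \<open>f\<close>.\<close>

lemma mol_has_derivative:
  fixes f :: "'a::euclidean_space \<Rightarrow> 'b::euclidean_space"
  assumes f: "integrable lborel f" and e: "e > 0"
  shows "(mol e f has_derivative
     (\<lambda>v. - (1 - e) *\<^sub>R (LINT y|lborel. frechet_derivative (mol_kernel e x) (at y) v *\<^sub>R f y))) (at x)"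
proof -
  let ?c = "- ((1 - e)/e)" and ?C = "(1/e) ^ DIM('a)"
  let ?D = "frechet_derivative (\<lambda>z::'a. ?C * rho z)"
  have tk: "test_kernel (1/2) (\<lambda>z::'a. ?C * rho z)" by (rule test_kernel_mult[OF test_kernel_rho])
  have lin: "linear (?D (at z))" for z
    using test_kernel_has_derivative[OF tk] has_derivative_linear by blast
  have "(mol_kernel e x has_derivative (\<lambda>v. ?D (at (?c *\<^sub>R x + (1/e) *\<^sub>R y)) ((1/e) *\<^sub>R v))) (at y)" for y
    unfolding mol_kernel_def[abs_def]
    by (rule has_derivative_compose[OF _ test_kernel_has_derivative[OF tk]]) (auto intro!: derivative_eq_intros)
  note * = frechet_derivative_at[OF this, THEN fun_cong, symmetric]
  have eq: "?D (at (?c *\<^sub>R x + (1/e) *\<^sub>R y)) (?c *\<^sub>R v) = - (1 - e) * frechet_derivative (mol_kernel e x) (at y) v" for y v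
  proof -
    have "?c = - (1 - e) * (1/e)" using e by (simp add: field_simps)
    with * show ?thesis by (simp only: linear_scale[OF lin] real_scaleR_def mult.assoc)
  qed
  have "(mol e f has_derivative
    (\<lambda>v. LINT y|lborel. ?D (at (?c *\<^sub>R x + (1/e) *\<^sub>R y)) (?c *\<^sub>R v) *\<^sub>R f y)) (at x)"
    using kernel_integral_has_derivative[OF tk f, of ?c "1/e" x] unfolding mol_fun_eq[OF f e] .
  then show ?thesis by (simp only: eq) (simp flip: scaleR_scaleR)
qed

lemma mol_eq_mol_kernel:
  fixes f :: "'a::euclidean_space \<Rightarrow> 'b::euclidean_space"
  assumes "f \<in> borel_measurable borel" "e > 0"
  shows "mol e f x = (LINT y|lborel. mol_kernel e x y *\<^sub>R f y)"
  using mol_eq_kernel[OF assms] by (simp add: mol_kernel_def)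

text \<open>Even for x on the sphere the kernel is supported within radius 1 - e/2 and is an
  admissible test function. The factor 1 - e is the price of the contraction and tends to 1.\<close>

lemma mol_weak_dir:
  fixes f :: "'a::euclidean_space \<Rightarrow> 'b::euclidean_space"
  assumes "integrable lborel f" "g \<in> borel_measurable borel" "weak_dir v f g" "0 < e" "e \<le> 1" "norm x \<le> 1"
  shows "frechet_derivative (mol e f) (at x) v = (1 - e) *\<^sub>R mol e g x"
proof -
  have "(1 - e) * norm x \<le> (1 - e) * 1" using assms by (intro mult_left_mono) auto
  then have "test_function (cball 0 1) (mol_kernel e x)"
    using assms by (intro test_function_mol_kernel(1)) auto
  then have "(LINT y|lborel. frechet_derivative (mol_kernel e x) (at y) v *\<^sub>R f y) = - mol e g x"
    using assms(2-4) by (simp add: weak_dir_def mol_eq_mol_kernel)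
  then show ?thesis
    by (simp add: frechet_derivative_at[OF mol_has_derivative[OF assms(1,4), of x], symmetric] flip: scaleR_minus_left)
qed

text \<open>Jensen's inequality for the probability measure \<open>rho_measure\<close>; for p = 2 it
  is Cauchy-Schwarz against the constant 1.\<close>

lemma nn_mol_power_le:
  fixes f :: "'a::euclidean_space \<Rightarrow> 'b::euclidean_space"
  assumes [measurable]: "f \<in> borel_measurable borel" and p: "p = 1 \<or> p = 2"
  shows "ennreal (norm (mol e f x) ^ p) \<le> (\<integral>\<^sup>+z. ennreal (norm (f ((1 - e) *\<^sub>R x + e *\<^sub>R z)) ^ p) \<partial>rho_measure)"
proof -
  let ?h = "\<lambda>z. f ((1 - e) *\<^sub>R x + e *\<^sub>R z)"
  have 1: "ennreal (norm (mol e f x)) \<le> (\<integral>\<^sup>+z. ennreal (norm (?h z)) \<partial>rho_measure)"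
  \<comment> \<open>If the average does not exist, \<open>mol\<close> has the default value 0 and
    the bound is trivial.\<close>
  proof (cases "integrable rho_measure ?h")
    case True then show ?thesis unfolding mol_def by (rule integral_norm_bound_ennreal)
  qed (simp add: mol_def not_integrable_integral_eq)
  show ?thesis
  proof (cases "p = 1")
    case True then show ?thesis using 1 by simp
  next
    case False
    then have p2: "p = 2" using p by simp
    have "ennreal (norm (mol e f x) ^ 2) = ennreal (norm (mol e f x)) ^ 2" by (simp add: ennreal_power)
    also have "\<dots> \<le> (\<integral>\<^sup>+z. ennreal (norm (?h z)) \<partial>rho_measure) ^ 2" by (rule power_mono[OF 1]) simp
    also have "\<dots> = (\<integral>\<^sup>+z. ennreal (norm (?h z)) * 1 \<partial>rho_measure) ^ 2" by simp
    also have "\<dots> \<le> (\<integral>\<^sup>+z. ennreal (norm (?h z)) ^ 2 \<partial>rho_measure) * (\<integral>\<^sup>+z. 1 ^ 2 \<partial>(rho_measure::'a measure))"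
      by (rule Cauchy_Schwarz_nn_integral) measurable
    also have "\<dots> = (\<integral>\<^sup>+z. ennreal (norm (?h z) ^ 2) \<partial>rho_measure)"
      by (simp add: emeasure_rho_measure ennreal_power)
    finally show ?thesis by (simp add: p2)
  qed
qed

text \<open>Fubini, then for fixed z the change of variables x -> (1 - e) x + e z. Its Jacobian (1 -
  e)^n is at least 2^(-n), whence the constant.\<close>

lemma nn_mol_Lp_le:
  fixes f :: "'a::euclidean_space \<Rightarrow> 'b::euclidean_space"
  assumes [measurable]: "f \<in> borel_measurable borel" and p: "p = 1 \<or> p = 2" and e: "0 < e" "e \<le> 1/2"
  shows "(\<integral>\<^sup>+x. ennreal (norm (mol e f x) ^ p) \<partial>lborel) \<le> 2 ^ DIM('a) * (\<integral>\<^sup>+x. ennreal (norm (f x) ^ p) \<partial>lborel)"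
proof -
  interpret R: finite_measure "rho_measure :: 'a measure" by (rule finite_measure_rho)
  interpret P: pair_sigma_finite "lborel :: 'a measure" "rho_measure :: 'a measure" ..
  let ?I = "\<integral>\<^sup>+x. ennreal (norm (f x) ^ p) \<partial>lborel"
  have "(\<integral>\<^sup>+x. ennreal (norm (mol e f x) ^ p) \<partial>lborel)
    \<le> (\<integral>\<^sup>+x. (\<integral>\<^sup>+z. ennreal (norm (f ((1 - e) *\<^sub>R x + e *\<^sub>R z)) ^ p) \<partial>rho_measure) \<partial>lborel)"
    by (intro nn_integral_mono nn_mol_power_le p) simp
  also have "\<dots> = (\<integral>\<^sup>+z. (\<integral>\<^sup>+x. ennreal (norm (f ((1 - e) *\<^sub>R x + e *\<^sub>R z)) ^ p) \<partial>lborel) \<partial>rho_measure)"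
    by (rule P.Fubini'[symmetric]) measurable
  also have "\<dots> \<le> (\<integral>\<^sup>+z. 2 ^ DIM('a) * ?I \<partial>(rho_measure::'a measure))"
  proof (rule nn_integral_mono)
    fix z :: 'a
    let ?J = "\<integral>\<^sup>+x. ennreal (norm (f ((1 - e) *\<^sub>R x + e *\<^sub>R z)) ^ p) \<partial>lborel"
    have "?I = ennreal ((1 - e) ^ DIM('a)) * ?J"
      by (subst lborel_nn_integral_affine[where c="1 - e" and t="e *\<^sub>R z"]) (use e in \<open>auto simp: add.commute\<close>)
    then have "ennreal (2 ^ DIM('a)) * ?I = ennreal (2 ^ DIM('a) * (1 - e) ^ DIM('a)) * ?J"
      using e by (simp add: ennreal_mult mult.assoc)
    moreover have "1 \<le> 2 ^ DIM('a) * (1 - e) ^ DIM('a)"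
      unfolding power_mult_distrib[symmetric] by (rule one_le_power) (use e in auto)
    then have "1 \<le> ennreal (2 ^ DIM('a) * (1 - e) ^ DIM('a))" by (simp add: ennreal_leI flip: ennreal_1)
    then have "1 * ?J \<le> ennreal (2 ^ DIM('a) * (1 - e) ^ DIM('a)) * ?J" by (rule mult_right_mono) simp
    ultimately show "?J \<le> 2 ^ DIM('a) * ?I" by (simp flip: ennreal_power)
  qed
  also have "\<dots> = 2 ^ DIM('a) * ?I" by (simp add: emeasure_rho_measure)
  finally show ?thesis .
qed

section \<open>$L^p$ functions on the unit ball\<close>

text \<open>Borel instead of Lebesgue sets, so that product measures and compositions are available.
  The spaces over \<open>lebesgue_on\<close> are reached at the end through equality almost
  everywhere.\<close>

abbreviation uball :: "'a::euclidean_space measure" where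
  "uball \<equiv> restrict_space lborel (cball 0 1)"

lemma space_uball[simp]: "space uball = cball 0 1"
  by (simp add: space_restrict_space)

lemma emeasure_uball_finite: "emeasure uball (cball (0::'a::euclidean_space) 1) < \<infinity>"
  using emeasure_lborel_cball_finite[of 0 1] by (simp add: emeasure_restrict_space)

lemma finite_measure_uball: "finite_measure (uball :: 'a::euclidean_space measure)"
  by (rule finite_measureI) (use emeasure_uball_finite[where 'a='a] in auto)

lemma measurable_uball[measurable (raw)]: "f \<in> measurable borel M \<Longrightarrow> f \<in> measurable uball M"
  by (rule measurable_restrict_space1) simp

lemma nn_integral_uball_le: "(\<integral>\<^sup>+x. f x \<partial>uball) \<le> (\<integral>\<^sup>+x. f x \<partial>lborel)"
  by (subst nn_integral_restrict_space) (auto intro!: nn_integral_mono simp: indicator_def)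

lemma AE_uball_iff: "(AE x in uball. P x) \<longleftrightarrow> (AE x in lborel. norm (x::'a::euclidean_space) \<le> 1 \<longrightarrow> P x)"
  by (subst AE_restrict_space_iff) auto

text \<open>Representatives are Borel on the whole space and 0 outside the closed ball: integrals
  over the ball and over the space then agree, and mollification needs no cut-off.\<close>

definition Lp_ball :: "nat \<Rightarrow> ('a::euclidean_space \<Rightarrow> 'b::euclidean_space) \<Rightarrow> bool" where
  "Lp_ball p f \<longleftrightarrow> f \<in> borel_measurable borel \<and> (\<forall>x. norm x > 1 \<longrightarrow> f x = 0) \<and>
     integrable lborel (\<lambda>x. norm (f x) ^ p)"

lemma Lp_ball_integrable:
  fixes f :: "'a::euclidean_space \<Rightarrow> 'b::euclidean_space"
  assumes "Lp_ball p f" "p \<noteq> 0"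
  shows "integrable lborel f"
proof (rule Bochner_Integration.integrable_bound)
  show "integrable lborel (\<lambda>x::'a. indicator (cball 0 1) x + norm (f x) ^ p)"
    using assms emeasure_lborel_cball_finite[of "0::'a" 1]
    by (intro Bochner_Integration.integrable_add integrable_real_indicator) (auto simp: Lp_ball_def)
  show "f \<in> borel_measurable lborel" using assms by (simp add: Lp_ball_def)
  have "norm (f x) \<le> indicator (cball 0 1) x + norm (f x) ^ p" for x
  proof (cases "norm x \<le> 1")
    case True
    have "norm (f x) \<le> 1 + norm (f x) ^ p"
      using self_le_power[of "norm (f x)" p] assms(2) by (cases "norm (f x) \<le> 1") (auto simp: add_increasing2)
    then show ?thesis using True by simp
  next
    case False
    then show ?thesis using assms by (auto simp: Lp_ball_def)
  qed
  then show "AE x in lborel. norm (f x) \<le> norm (indicator (cball 0 1) x + norm (f x) ^ p)"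
    by (intro AE_I2) (metis abs_ge_self order_trans real_norm_def)
qed

section \<open>Convergence of mollifications in L^p\<close>

definition clamp_norm :: "real \<Rightarrow> 'b::real_normed_vector \<Rightarrow> 'b" where
  "clamp_norm N v = v /\<^sub>R max 1 (norm v / N)"

lemma clamp_norm_le: "N > 0 \<Longrightarrow> norm (clamp_norm N v) \<le> N" "N > 0 \<Longrightarrow> norm (clamp_norm N v) \<le> norm v"
  by (auto simp: clamp_norm_def max_def divide_simps mult_left_le)

lemma clamp_norm_eq: "N > 0 \<Longrightarrow> norm v \<le> N \<Longrightarrow> clamp_norm N v = v"
  by (auto simp: clamp_norm_def max_def divide_simps)

lemma continuous_on_clamp_norm: "continuous_on S (clamp_norm N)"
  unfolding clamp_norm_def[abs_def] by (cases "N = 0") (auto intro!: continuous_intros)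

lemma ennreal_2_power: "(2::ennreal) ^ p = ennreal (2 ^ p)"
  by (simp flip: ennreal_power)

lemma norm_power_add_le:
  fixes a b :: "'b::real_normed_vector"
  shows "norm (a + b) ^ p \<le> 2 ^ p * (norm a ^ p + norm b ^ p)"
proof -
  have "norm (a + b) ^ p \<le> (2 * max (norm a) (norm b)) ^ p"
    using norm_triangle_ineq[of a b] by (intro power_mono) auto
  also have "\<dots> \<le> 2 ^ p * (norm a ^ p + norm b ^ p)"
    by (auto simp: power_mult_distrib max_def)
  finally show ?thesis .
qed

lemma norm_power_diff_le:
  fixes a b :: "'b::real_normed_vector"
  shows "norm (a - b) ^ p \<le> 2 ^ p * (norm a ^ p + norm b ^ p)"
  using norm_power_add_le[of a "- b" p] by simp

lemma nn_norm_power_diff_le: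
  fixes f g h :: "'a \<Rightarrow> 'b::euclidean_space"
  assumes [measurable]: "f \<in> borel_measurable M" "g \<in> borel_measurable M" "h \<in> borel_measurable M"
  shows "(\<integral>\<^sup>+x. ennreal (norm (f x - h x) ^ p) \<partial>M) \<le>
    2 ^ p * ((\<integral>\<^sup>+x. ennreal (norm (f x - g x) ^ p) \<partial>M) + (\<integral>\<^sup>+x. ennreal (norm (g x - h x) ^ p) \<partial>M))"
proof -
  have "(\<integral>\<^sup>+x. ennreal (norm (f x - h x) ^ p) \<partial>M) \<le>
    (\<integral>\<^sup>+x. 2 ^ p * (ennreal (norm (f x - g x) ^ p) + ennreal (norm (g x - h x) ^ p)) \<partial>M)"
  proof (rule nn_integral_mono)
    fix x
    have "ennreal (norm (f x - h x) ^ p) \<le> ennreal (2 ^ p * (norm (f x - g x) ^ p + norm (g x - h x) ^ p))"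
      using norm_power_add_le[of "f x - g x" "g x - h x" p] by (simp add: ennreal_leI)
    then show "ennreal (norm (f x - h x) ^ p) \<le> 2 ^ p * (ennreal (norm (f x - g x) ^ p) + ennreal (norm (g x - h x) ^ p))"
      by (simp add: ennreal_mult ennreal_2_power)
  qed
  also have "\<dots> = 2 ^ p * ((\<integral>\<^sup>+x. ennreal (norm (f x - g x) ^ p) \<partial>M) + (\<integral>\<^sup>+x. ennreal (norm (g x - h x) ^ p) \<partial>M))"
    by (simp add: nn_integral_cmult nn_integral_add)
  finally show ?thesis .
qed

lemma Lp_ball_clamp_approx:
  fixes f :: "'a::euclidean_space \<Rightarrow> 'b::euclidean_space"
  assumes f: "Lp_ball p f" "p \<noteq> 0" and "\<delta> > (0::ennreal)"
  obtains N where "N > 0" "(\<integral>\<^sup>+x. ennreal (norm (clamp_norm N (f x) - f x) ^ p) \<partial>lborel) < \<delta>"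
proof -
  have [measurable]: "f \<in> borel_measurable borel" using f by (simp add: Lp_ball_def)
  have [measurable]: "clamp_norm N \<in> borel_measurable borel" for N
    by (rule borel_measurable_continuous_onI) (rule continuous_on_clamp_norm)
  have fin: "(\<integral>\<^sup>+x. ennreal (norm (f x) ^ p) \<partial>lborel) < \<infinity>"
    using f by (auto simp: Lp_ball_def integrable_iff_bounded)
  have "(\<lambda>n. \<integral>\<^sup>+x. ennreal (norm (clamp_norm (Suc n) (f x) - f x) ^ p) \<partial>lborel) \<longlonglongrightarrow> (\<integral>\<^sup>+x. 0 \<partial>(lborel::'a measure))"
  proof (rule nn_integral_dominated_convergence[where w="\<lambda>x. 2 ^ p * 2 * ennreal (norm (f x) ^ p)"])
    show "AE x in lborel. ennreal (norm (clamp_norm (Suc n) (f x) - f x) ^ p) \<le> 2 ^ p * 2 * ennreal (norm (f x) ^ p)" for n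
    proof (rule AE_I2)
      fix x
      have "norm (clamp_norm (Suc n) (f x) - f x) ^ p \<le> 2 ^ p * (norm (f x) ^ p + norm (f x) ^ p)"
        by (rule order_trans[OF norm_power_diff_le]) (auto intro!: power_mono clamp_norm_le)
      then have "ennreal (norm (clamp_norm (Suc n) (f x) - f x) ^ p) \<le> ennreal (2 ^ p * 2 * norm (f x) ^ p)"
        by (intro ennreal_leI) simp
      then show "ennreal (norm (clamp_norm (Suc n) (f x) - f x) ^ p) \<le> 2 ^ p * 2 * ennreal (norm (f x) ^ p)"
        by (simp add: ennreal_mult ennreal_2_power)
    qed
    show "(\<integral>\<^sup>+x. 2 ^ p * 2 * ennreal (norm (f x) ^ p) \<partial>lborel) < \<infinity>"
      using fin by (subst nn_integral_cmult) (auto simp: ennreal_mult_less_top power_less_top_ennreal)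
    show "AE x in lborel. (\<lambda>n. ennreal (norm (clamp_norm (Suc n) (f x) - f x) ^ p)) \<longlonglongrightarrow> 0"
    proof (rule AE_I2)
      fix x
      obtain n0 where n0: "norm (f x) \<le> real n0" using real_arch_simple by blast
      have "\<forall>\<^sub>F n in sequentially. ennreal (norm (clamp_norm (Suc n) (f x) - f x) ^ p) = 0"
        using eventually_ge_at_top[of n0]
        by eventually_elim (use n0 f(2) in \<open>auto simp: clamp_norm_eq\<close>)
      then show "(\<lambda>n. ennreal (norm (clamp_norm (Suc n) (f x) - f x) ^ p)) \<longlonglongrightarrow> 0"
        by (rule tendsto_eventually)
    qed
  qed auto
  then have "\<forall>\<^sub>F n in sequentially. (\<integral>\<^sup>+x. ennreal (norm (clamp_norm (Suc n) (f x) - f x) ^ p) \<partial>lborel) < \<delta>"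
    using assms(3) by (auto simp: order_tendsto_iff)
  then obtain n where "(\<integral>\<^sup>+x. ennreal (norm (clamp_norm (Suc n) (f x) - f x) ^ p) \<partial>lborel) < \<delta>"
    by (auto simp: eventually_sequentially)
  then show ?thesis using that[of "real (Suc n)"] by simp
qed

text \<open>\<open>measurable_on\<close> supplies continuous functions converging almost everywhere.
  Clamping their values at \<open>N\<close> and cutting them off between radius 1 and radius 2 makes
  them dominated without changing the limit.\<close>

lemma continuous_approx_bounded:
  fixes f :: "'a::euclidean_space \<Rightarrow> 'b::euclidean_space"
  assumes [measurable]: "f \<in> borel_measurable borel" and f0: "\<And>x. norm x > 1 \<Longrightarrow> f x = 0"
    and N: "N > 0" "\<And>x. norm (f x) \<le> N" and "p \<noteq> 0" "\<delta> > (0::ennreal)"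
  obtains g where "continuous_on UNIV g" "\<And>x. norm (g x) \<le> N"
    "(\<integral>\<^sup>+x. ennreal (norm (f x - g x) ^ p) \<partial>lborel) < \<delta>"
proof -
  have "f \<in> borel_measurable (lebesgue_on UNIV)"
    by (simp add: lebesgue_on_UNIV_eq measurable_completion)
  then have "f measurable_on UNIV" by (subst measurable_on_iff_borel_measurable) auto
  then obtain Z G where Z: "negligible Z" and G: "\<And>n. continuous_on UNIV (G n)"
    "\<And>x. x \<notin> Z \<Longrightarrow> (\<lambda>n. G n x) \<longlonglongrightarrow> f x"
    unfolding measurable_on_def by auto
  define \<psi> :: "'a \<Rightarrow> real" where "\<psi> x = min 1 (max 0 (2 - norm x))" for x
  define H where "H n x = \<psi> x *\<^sub>R clamp_norm N (G n x)" for n x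
  have c: "continuous_on UNIV (H n)" for n
    unfolding H_def \<psi>_def
    by (intro continuous_intros continuous_on_compose2[OF continuous_on_clamp_norm G(1)]) auto
  have [measurable]: "H n \<in> borel_measurable borel" for n by (rule borel_measurable_continuous_onI[OF c])
  have \<psi>: "0 \<le> \<psi> x" "\<psi> x \<le> 1" "norm x > 2 \<Longrightarrow> \<psi> x = 0" "norm x \<le> 1 \<Longrightarrow> \<psi> x = 1" for x
    by (auto simp: \<psi>_def)
  have HN: "norm (H n x) \<le> N" for n x
  proof -
    have "norm (H n x) \<le> 1 * N" unfolding H_def norm_scaleR
      by (intro mult_mono clamp_norm_le N) (use \<psi> in auto)
    then show ?thesis by simp
  qed
  have "(\<lambda>n. \<integral>\<^sup>+x. ennreal (norm (f x - H n x) ^ p) \<partial>lborel) \<longlonglongrightarrow> (\<integral>\<^sup>+x. 0 \<partial>(lborel::'a measure))"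
  proof (rule nn_integral_dominated_convergence[where w="\<lambda>x. ennreal ((2 * N) ^ p) * indicator (cball 0 2) x"])
    show "AE x in lborel. ennreal (norm (f x - H n x) ^ p) \<le> ennreal ((2 * N) ^ p) * indicator (cball 0 2) x" for n
    proof (rule AE_I2)
      fix x
      show "ennreal (norm (f x - H n x) ^ p) \<le> ennreal ((2 * N) ^ p) * indicator (cball 0 2) x"
      proof (cases "norm x \<le> 2")
        case True
        have "norm (f x - H n x) \<le> 2 * N"
          using norm_triangle_ineq4[of "f x" "H n x"] N(2)[of x] HN[of n x] by linarith
        then have "norm (f x - H n x) ^ p \<le> (2 * N) ^ p" by (intro power_mono) auto
        then show ?thesis using True by (simp add: ennreal_leI)
      next
        case False
        then show ?thesis using f0[of x] \<psi>(3)[of x] \<open>p \<noteq> 0\<close> by (simp add: H_def)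
      qed
    qed
    show "(\<integral>\<^sup>+x. ennreal ((2 * N) ^ p) * indicator (cball 0 2) x \<partial>(lborel::'a measure)) < \<infinity>"
      using emeasure_lborel_cball_finite[of "0::'a" 2]
      by (subst nn_integral_cmult_indicator) (auto simp: ennreal_mult_less_top)
    have "AE x in lebesgue. x \<notin> Z"
      using Z by (auto simp: negligible_iff_null_sets intro: AE_not_in)
    then have "AE x in lborel. x \<notin> Z" by (simp add: AE_completion_iff)
    then show "AE x in lborel. (\<lambda>n. ennreal (norm (f x - H n x) ^ p)) \<longlonglongrightarrow> 0"
    proof eventually_elim
      case (elim x)
      have "(\<lambda>n. clamp_norm N (G n x)) \<longlonglongrightarrow> clamp_norm N (f x)"
        using continuous_on_clamp_norm[of UNIV N] G(2)[OF elim]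
        by (metis UNIV_I continuous_on_eq_continuous_at isCont_tendsto_compose open_UNIV)
      then have "(\<lambda>n. H n x) \<longlonglongrightarrow> \<psi> x *\<^sub>R f x"
        unfolding H_def using N by (auto intro!: tendsto_intros simp: clamp_norm_eq)
      moreover have "\<psi> x *\<^sub>R f x = f x" using \<psi>(4)[of x] f0[of x] by (cases "norm x \<le> 1") auto
      ultimately have "(\<lambda>n. norm (f x - H n x) ^ p) \<longlonglongrightarrow> norm (f x - f x) ^ p" by (intro tendsto_intros) simp
      from tendsto_ennrealI[OF this] show ?case using \<open>p \<noteq> 0\<close> by (simp add: power_0_left)
    qed
  qed (auto intro!: borel_measurable_times_ennreal borel_measurable_indicator)
  then have "\<forall>\<^sub>F n in sequentially. (\<integral>\<^sup>+x. ennreal (norm (f x - H n x) ^ p) \<partial>lborel) < \<delta>"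
    using assms(6) by (auto simp: order_tendsto_iff)
  then obtain n where "(\<integral>\<^sup>+x. ennreal (norm (f x - H n x) ^ p) \<partial>lborel) < \<delta>"
    by (auto simp: eventually_sequentially)
  then show ?thesis using that[of "H n"] c HN by blast
qed

lemma mol_measurable[measurable]:
  fixes f :: "'a::euclidean_space \<Rightarrow> 'b::euclidean_space"
  assumes [measurable]: "f \<in> borel_measurable borel"
  shows "mol e f \<in> borel_measurable borel"
proof -
  interpret R: finite_measure "rho_measure :: 'a measure" by (rule finite_measure_rho)
  show ?thesis unfolding mol_def[abs_def] by measurable
qed

lemma integrable_rho_measure:
  fixes f :: "'a::euclidean_space \<Rightarrow> 'b::euclidean_space"
  assumes f: "integrable lborel f" and e: "e > 0"
  shows "integrable rho_measure (\<lambda>z. f ((1 - e) *\<^sub>R x + e *\<^sub>R z))"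
proof -
  have [measurable]: "f \<in> borel_measurable borel" using f by auto
  have "(\<integral>\<^sup>+y. ennreal (norm (f y)) \<partial>lborel) < \<infinity>" using f by (simp add: integrable_iff_bounded)
  then have "ennreal (e ^ DIM('a)) * (\<integral>\<^sup>+z. ennreal (norm (f ((1 - e) *\<^sub>R x + e *\<^sub>R z))) \<partial>lborel) < \<infinity>"
    by (subst (asm) lborel_nn_integral_affine[where c=e and t="(1 - e) *\<^sub>R x"]) (use e in auto)
  then have *: "integrable lborel (\<lambda>z. f ((1 - e) *\<^sub>R x + e *\<^sub>R z))"
    using e by (auto simp: integrable_iff_bounded ennreal_mult_less_top)
  obtain K where K: "\<And>z::'a. \<bar>rho z\<bar> \<le> K" using test_kernel_bounded[OF test_kernel_rho] by (metis real_norm_def)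
  then show ?thesis
    unfolding rho_measure_def
    by (subst integrable_density) (auto simp: rho_nonneg intro!: integrable_bounded_scaleR[OF * _ K])
qed

lemma mol_diff:
  fixes f g :: "'a::euclidean_space \<Rightarrow> 'b::euclidean_space"
  assumes "\<And>x. integrable rho_measure (\<lambda>z. f ((1 - e) *\<^sub>R x + e *\<^sub>R z))"
    and "\<And>x. integrable rho_measure (\<lambda>z. g ((1 - e) *\<^sub>R x + e *\<^sub>R z))"
  shows "mol e (\<lambda>x. f x - g x) x = mol e f x - mol e g x"
  unfolding mol_def by (intro Bochner_Integration.integral_diff assms)

lemma integrable_rho_measure_bounded:
  fixes g :: "'a::euclidean_space \<Rightarrow> 'b::euclidean_space"
  assumes [measurable]: "g \<in> borel_measurable borel" and "\<And>x. norm (g x) \<le> N"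
  shows "integrable rho_measure (\<lambda>z. g ((1 - e) *\<^sub>R x + e *\<^sub>R z))"
proof -
  interpret R: finite_measure "rho_measure :: 'a measure" by (rule finite_measure_rho)
  show ?thesis by (rule R.integrable_const_bound[where B=N]) (use assms in auto)
qed

lemma norm_mol_le:
  fixes g :: "'a::euclidean_space \<Rightarrow> 'b::euclidean_space"
  assumes [measurable]: "g \<in> borel_measurable borel" and N: "\<And>x. norm (g x) \<le> N"
  shows "norm (mol e g x) \<le> N"
proof -
  have "N \<ge> 0" using N[of 0] norm_ge_zero order_trans by blast
  have "ennreal (norm (mol e g x)) \<le> (\<integral>\<^sup>+z. ennreal (norm (g ((1 - e) *\<^sub>R x + e *\<^sub>R z))) \<partial>rho_measure)"
    using nn_mol_power_le[of g 1] by simp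
  also have "\<dots> \<le> (\<integral>\<^sup>+z. ennreal N \<partial>(rho_measure::'a measure))"
    by (intro nn_integral_mono ennreal_leI N)
  also have "\<dots> = ennreal N" by (simp add: emeasure_rho_measure)
  finally show ?thesis using \<open>N \<ge> 0\<close> by simp
qed

lemma mol_continuous_tendsto:
  fixes g :: "'a::euclidean_space \<Rightarrow> 'b::euclidean_space"
  assumes g: "continuous_on UNIV g" "\<And>x. norm (g x) \<le> N" and e: "e \<longlonglongrightarrow> (0::real)"
  shows "(\<lambda>k. mol (e k) g x) \<longlonglongrightarrow> g x"
proof -
  interpret R: finite_measure "rho_measure :: 'a measure" by (rule finite_measure_rho)
  have [measurable]: "g \<in> borel_measurable borel" by (rule borel_measurable_continuous_onI[OF g(1)])
  have "(\<lambda>k. mol (e k) g x) \<longlonglongrightarrow> (LINT z|(rho_measure::'a measure). g x)"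
    unfolding mol_def
  proof (rule integral_dominated_convergence[where w="\<lambda>_. N"])
    show "AE z in rho_measure. (\<lambda>k. g ((1 - e k) *\<^sub>R x + e k *\<^sub>R z)) \<longlonglongrightarrow> g x"
    proof (rule AE_I2)
      fix z :: 'a
      have "(\<lambda>k. (1 - e k) *\<^sub>R x + e k *\<^sub>R z) \<longlonglongrightarrow> (1 - 0) *\<^sub>R x + 0 *\<^sub>R z"
        by (intro tendsto_intros e)
      then have "(\<lambda>k. (1 - e k) *\<^sub>R x + e k *\<^sub>R z) \<longlonglongrightarrow> x" by simp
      then show "(\<lambda>k. g ((1 - e k) *\<^sub>R x + e k *\<^sub>R z)) \<longlonglongrightarrow> g x"
        using g(1) by (metis UNIV_I continuous_on_eq_continuous_at isCont_tendsto_compose open_UNIV)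
    qed
  qed (use g(2) in auto)
  then show ?thesis by (simp add: measure_def emeasure_rho_measure)
qed

text \<open>\<open>f\<close> is replaced by a bounded continuous \<open>g\<close> close to it in
  L^p. The mollified difference is controlled uniformly in the radius, and for \<open>g\<close>
  itself dominated convergence applies.\<close>

lemma mol_Lp_tendsto:
  fixes f :: "'a::euclidean_space \<Rightarrow> 'b::euclidean_space"
  assumes f: "Lp_ball p f" and p: "p = 1 \<or> p = 2"
    and e: "e \<longlonglongrightarrow> 0" "\<And>k. 0 < e k" "\<And>k. e k \<le> 1/2"
  shows "(\<lambda>k. \<integral>\<^sup>+x. ennreal (norm (mol (e k) f x - f x) ^ p) \<partial>uball) \<longlonglongrightarrow> 0"
proof (rule order_tendstoI)
  have [measurable]: "f \<in> borel_measurable borel" using f by (simp add: Lp_ball_def)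
  have p0: "p \<noteq> 0" using p by auto
  fix c :: ennreal assume "c > 0"
  \<comment> \<open>\<open>c\<close> may be infinite, so the actual target is a finite
    \<open>c0\<close> below it. \<open>C\<close> collects a factor 2^p for each triangle inequality
    between p-th powers and 2^n for mollification; \<delta> is chosen so that C \<delta> =
    c0.\<close>
  obtain c0 where c0: "0 < c0" "c0 < c" using dense[OF \<open>c > 0\<close>] by blast
  define C :: ennreal where "C = 2 ^ p * (2 ^ DIM('a) * (2 ^ p * 2) + 2 ^ p * (1 + 2 ^ p * 2))"
  have C: "C = ennreal (2 ^ p * (2 ^ DIM('a) * (2 ^ p * 2) + 2 ^ p * (1 + 2 ^ p * 2)))" (is "_ = ennreal ?C")
    by (simp add: C_def ennreal_mult ennreal_plus flip: ennreal_power ennreal_1 ennreal_numeral)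
  have Cpos: "?C > 0" by (intro mult_pos_pos add_pos_pos) auto
  define \<delta> where "\<delta> = ennreal (enn2real c0 / ?C)"
  have "c0 \<noteq> top" using c0 by auto
  then have "enn2real c0 > 0" using c0 by (simp add: enn2real_positive_iff less_top)
  then have \<delta>: "\<delta> > 0" using Cpos by (simp add: \<delta>_def)
  have "C * \<delta> = ennreal (enn2real c0)"
    unfolding C \<delta>_def using Cpos by (subst ennreal_mult[symmetric]) auto
  then have C\<delta>: "C * \<delta> < c" using c0 \<open>c0 \<noteq> top\<close> by (simp add: less_top)
  obtain N where N: "N > 0" "(\<integral>\<^sup>+x. ennreal (norm (clamp_norm N (f x) - f x) ^ p) \<partial>lborel) < \<delta>"
    using Lp_ball_clamp_approx[OF f p0 \<delta>] by blast
  have [measurable]: "clamp_norm N \<in> borel_measurable borel"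
    by (rule borel_measurable_continuous_onI) (rule continuous_on_clamp_norm)
  obtain g where g: "continuous_on UNIV g" "\<And>x. norm (g x) \<le> N"
    "(\<integral>\<^sup>+x. ennreal (norm (clamp_norm N (f x) - g x) ^ p) \<partial>lborel) < \<delta>"
  proof (rule continuous_approx_bounded[of "\<lambda>x. clamp_norm N (f x)" N p \<delta>])
    show "clamp_norm N (f x) = 0" if "norm x > 1" for x
      using that f by (simp add: Lp_ball_def clamp_norm_def)
  qed (use N p0 \<delta> clamp_norm_le in auto)
  have [measurable]: "g \<in> borel_measurable borel" by (rule borel_measurable_continuous_onI[OF g(1)])
  define J where "J = (\<integral>\<^sup>+x. ennreal (norm (f x - g x) ^ p) \<partial>lborel)"
  have J: "J \<le> 2 ^ p * (\<delta> + \<delta>)"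
    unfolding J_def
    by (rule order_trans[OF nn_norm_power_diff_le[where g="\<lambda>x. clamp_norm N (f x)"]])
       (use N(2) g(3) in \<open>auto intro!: mult_left_mono add_mono simp: norm_minus_commute\<close>)
  have "(\<lambda>k. \<integral>\<^sup>+x. ennreal (norm (mol (e k) g x - g x) ^ p) \<partial>uball) \<longlonglongrightarrow> (\<integral>\<^sup>+x. 0 \<partial>(uball::'a measure))"
  proof (rule nn_integral_dominated_convergence[where w="\<lambda>x. ennreal ((2 * N) ^ p)"])
    show "AE x in uball. ennreal (norm (mol (e k) g x - g x) ^ p) \<le> ennreal ((2 * N) ^ p)" for k
    proof (rule AE_I2)
      fix x
      have "norm (mol (e k) g x - g x) \<le> 2 * N"
        using norm_triangle_ineq4[of "mol (e k) g x" "g x"] g(2)[of x] norm_mol_le[of g N "e k" x, OF _ g(2)]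
        by simp
      then show "ennreal (norm (mol (e k) g x - g x) ^ p) \<le> ennreal ((2 * N) ^ p)"
        by (intro ennreal_leI power_mono) auto
    qed
    show "(\<integral>\<^sup>+x. ennreal ((2 * N) ^ p) \<partial>(uball::'a measure)) < \<infinity>"
      using emeasure_uball_finite[where 'a='a] by (simp add: ennreal_mult_less_top)
    show "AE x in uball. (\<lambda>k. ennreal (norm (mol (e k) g x - g x) ^ p)) \<longlonglongrightarrow> 0"
    proof (rule AE_I2)
      fix x
      have "(\<lambda>k. norm (mol (e k) g x - g x) ^ p) \<longlonglongrightarrow> norm (g x - g x) ^ p"
        by (intro tendsto_intros mol_continuous_tendsto[OF g(1,2) e(1)])
      from tendsto_ennrealI[OF this] show "(\<lambda>k. ennreal (norm (mol (e k) g x - g x) ^ p)) \<longlonglongrightarrow> 0"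
        using p0 by (simp add: power_0_left)
    qed
  qed auto
  then have "\<forall>\<^sub>F k in sequentially. (\<integral>\<^sup>+x. ennreal (norm (mol (e k) g x - g x) ^ p) \<partial>uball) < \<delta>"
    using \<delta> by (auto simp: order_tendsto_iff)
  then show "\<forall>\<^sub>F k in sequentially. (\<integral>\<^sup>+x. ennreal (norm (mol (e k) f x - f x) ^ p) \<partial>uball) < c"
  proof eventually_elim
    case (elim k)
    have md: "mol (e k) f x - mol (e k) g x = mol (e k) (\<lambda>x. f x - g x) x" for x
      by (intro mol_diff[symmetric] integrable_rho_measure Lp_ball_integrable[OF f p0] e
          integrable_rho_measure_bounded[where N=N] g) measurable
    have "(\<integral>\<^sup>+x. ennreal (norm (mol (e k) f x - mol (e k) g x) ^ p) \<partial>uball)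
       \<le> (\<integral>\<^sup>+x. ennreal (norm (mol (e k) (\<lambda>x. f x - g x) x) ^ p) \<partial>lborel)"
      unfolding md by (rule nn_integral_uball_le)
    also have "\<dots> \<le> 2 ^ DIM('a) * J"
      unfolding J_def by (rule nn_mol_Lp_le) (use p e in auto)
    finally have 1: "(\<integral>\<^sup>+x. ennreal (norm (mol (e k) f x - mol (e k) g x) ^ p) \<partial>uball) \<le> 2 ^ DIM('a) * J" .
    have 2: "(\<integral>\<^sup>+x. ennreal (norm (g x - f x) ^ p) \<partial>uball) \<le> J"
      unfolding J_def by (rule order_trans[OF nn_integral_uball_le]) (simp add: norm_minus_commute)
    have 3: "(\<integral>\<^sup>+x. ennreal (norm (mol (e k) g x - f x) ^ p) \<partial>uball) \<le> 2 ^ p * (\<delta> + J)"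
      by (rule order_trans[OF nn_norm_power_diff_le[where g=g]])
         (use elim 2 in \<open>auto intro!: mult_left_mono add_mono\<close>)
    have "(\<integral>\<^sup>+x. ennreal (norm (mol (e k) f x - f x) ^ p) \<partial>uball) \<le> 2 ^ p * (2 ^ DIM('a) * J + 2 ^ p * (\<delta> + J))"
      by (rule order_trans[OF nn_norm_power_diff_le[where g="mol (e k) g"]])
         (use 1 3 in \<open>auto intro!: mult_left_mono add_mono\<close>)
    also have "\<dots> \<le> 2 ^ p * (2 ^ DIM('a) * (2 ^ p * (\<delta> + \<delta>)) + 2 ^ p * (\<delta> + 2 ^ p * (\<delta> + \<delta>)))"
      by (intro mult_left_mono add_mono J order_refl) auto
    also have "\<dots> = C * \<delta>"
      unfolding C_def by (simp add: algebra_simps mult_2_right mult_2)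
    also note C\<delta>
    finally show ?case .
  qed
qed simp

lemma fast_subsequence:
  fixes a :: "nat \<Rightarrow> ennreal"
  assumes "a \<longlonglongrightarrow> 0"
  obtains r where "strict_mono r" "\<And>k. a (r k) \<le> ennreal ((1/2) ^ k)"
proof -
  have ev: "\<exists>n>m. a n \<le> ennreal ((1/2) ^ k)" for k m
  proof -
    have "\<forall>\<^sub>F n in sequentially. a n < ennreal ((1/2) ^ k)"
      using assms by (simp add: order_tendsto_iff)
    then obtain N where "\<And>n. n \<ge> N \<Longrightarrow> a n < ennreal ((1/2) ^ k)" by (auto simp: eventually_sequentially)
    then show ?thesis by (intro exI[of _ "Suc (max N m)"]) (auto intro: less_imp_le)
  qed
  obtain r where "\<And>k. a (r k) \<le> ennreal ((1/2) ^ k) \<and> r k < r (Suc k)"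
    using dependent_nat_choice[of "\<lambda>k x. a x \<le> ennreal ((1/2) ^ k)" "\<lambda>k x y. x < y"] ev by blast
  then show ?thesis using that[of r] by (simp add: strict_mono_Suc_iff)
qed

lemma le_suminf_ennreal: "f n \<le> (\<Sum>i. f (i::nat) :: ennreal)"
  using sum_le_suminf[of f "{n}"] by simp

text \<open>The converse of dominated convergence. Along a subsequence whose p-th power errors are
  at most 2^(-k), the sum of all |f_k - f|^p is integrable; its terms therefore tend to 0 almost
  everywhere, and the sum itself provides the majorant.\<close>

lemma dominated_subsequence:
  fixes fs :: "nat \<Rightarrow> 'a \<Rightarrow> 'b::euclidean_space"
  assumes [measurable]: "\<And>k. fs k \<in> borel_measurable M" "f \<in> borel_measurable M"
    and f: "integrable M (\<lambda>x. norm (f x) ^ p)" and p: "p \<noteq> 0"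
    and lim: "(\<lambda>k. \<integral>\<^sup>+x. ennreal (norm (fs k x - f x) ^ p) \<partial>M) \<longlonglongrightarrow> 0"
  obtains r \<Phi> where "strict_mono r" "integrable M \<Phi>" "\<And>x. \<Phi> x \<ge> 0"
    "AE x in M. (\<lambda>k. fs (r k) x) \<longlonglongrightarrow> f x"
    "AE x in M. \<forall>k. norm (fs (r k) x) ^ p \<le> \<Phi> x"
proof -
  obtain r where r: "strict_mono r" "\<And>k. (\<integral>\<^sup>+x. ennreal (norm (fs (r k) x - f x) ^ p) \<partial>M) \<le> ennreal ((1/2) ^ k)"
    using fast_subsequence[OF lim] by blast
  define S where "S x = (\<Sum>k. ennreal (norm (fs (r k) x - f x) ^ p))" for x
  have [measurable]: "S \<in> borel_measurable M" unfolding S_def by measurable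
  have "(\<integral>\<^sup>+x. S x \<partial>M) = (\<Sum>k. \<integral>\<^sup>+x. ennreal (norm (fs (r k) x - f x) ^ p) \<partial>M)"
    unfolding S_def by (rule nn_integral_suminf) measurable
  also have "\<dots> \<le> (\<Sum>k. ennreal ((1/2) ^ k))" by (intro suminf_le r) auto
  also have "\<dots> = ennreal 2" by (rule suminf_ennreal_eq) (use power_half_series[THEN sums_mult, of 2] in \<open>auto simp: sums_Suc_iff\<close>)
  finally have Sfin: "(\<integral>\<^sup>+x. S x \<partial>M) < \<infinity>" by (simp add: le_less_trans)
  then have AES: "AE x in M. S x \<noteq> \<infinity>" by (intro nn_integral_noteq_infinite) auto
  define \<Phi> where "\<Phi> x = 2 ^ p * (norm (f x) ^ p + enn2real (S x))" for x
  have iS: "integrable M (\<lambda>x. enn2real (S x))"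
  proof (rule integrableI_bounded)
    have "(\<integral>\<^sup>+x. ennreal (norm (enn2real (S x))) \<partial>M) \<le> (\<integral>\<^sup>+x. S x \<partial>M)"
      by (intro nn_integral_mono) (auto simp: ennreal_enn2real_if)
    then show "(\<integral>\<^sup>+x. ennreal (norm (enn2real (S x))) \<partial>M) < \<infinity>" using Sfin by simp
  qed measurable
  show ?thesis
  proof (rule that[OF r(1)])
    show "integrable M \<Phi>" unfolding \<Phi>_def using f iS by auto
    show "\<Phi> x \<ge> 0" for x by (simp add: \<Phi>_def)
    show "AE x in M. (\<lambda>k. fs (r k) x) \<longlonglongrightarrow> f x"
      using AES
    proof eventually_elim
      case (elim x)
      then have "summable (\<lambda>k. norm (fs (r k) x - f x) ^ p)"
        by (intro summable_suminf_not_top) (auto simp: S_def)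
      then have "(\<lambda>k. norm (fs (r k) x - f x) ^ p) \<longlonglongrightarrow> 0" by (rule summable_LIMSEQ_zero)
      then have "(\<lambda>k. root p (norm (fs (r k) x - f x) ^ p)) \<longlonglongrightarrow> root p 0" by (rule tendsto_real_root)
      then have "(\<lambda>k. norm (fs (r k) x - f x)) \<longlonglongrightarrow> 0" using p by (simp add: real_root_power_cancel)
      then show ?case by (simp add: tendsto_norm_zero_iff LIM_zero_iff)
    qed
    show "AE x in M. \<forall>k. norm (fs (r k) x) ^ p \<le> \<Phi> x"
      using AES
    proof eventually_elim
      case (elim x)
      show ?case
      proof
        fix k
        have "ennreal (norm (fs (r k) x - f x) ^ p) \<le> S x"
          unfolding S_def by (rule le_suminf_ennreal)
        also have "S x = ennreal (enn2real (S x))" using elim by (simp add: less_top)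
        finally have "norm (fs (r k) x - f x) ^ p \<le> enn2real (S x)" by simp
        then have "2 ^ p * (norm (f x) ^ p + norm (fs (r k) x - f x) ^ p) \<le> \<Phi> x"
          unfolding \<Phi>_def by (intro mult_left_mono) auto
        then show "norm (fs (r k) x) ^ p \<le> \<Phi> x"
          using norm_power_add_le[of "f x" "fs (r k) x - f x" p] by simp
      qed
    qed
  qed
qed

lemma integrable_uball:
  fixes f :: "'a::euclidean_space \<Rightarrow> 'b::euclidean_space"
  assumes "integrable lborel f"
  shows "integrable uball f"
proof -
  have "integrable lborel (\<lambda>x. indicator (cball 0 1) x *\<^sub>R f x)"
    by (rule integrable_mult_indicator[OF _ assms]) simp
  then show ?thesis by (subst integrable_restrict_space) auto
qed

text \<open>Almost everywhere f(x) is the limit of mollifications along a subsequence, and for |x| <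
  r the kernel at x is eventually a test function on the ball of radius \<open>r\<close>, so these
  mollifications vanish.\<close>

lemma fundamental_lemma:
  fixes f :: "'a::euclidean_space \<Rightarrow> 'b::euclidean_space"
  assumes f: "Lp_ball 1 f" and r: "r \<le> 1"
    and test: "\<And>\<phi>. test_function (cball 0 r) \<phi> \<Longrightarrow> (LINT y|lborel. \<phi> y *\<^sub>R f y) = 0"
  shows "AE x in lborel. norm x < r \<longrightarrow> f x = 0"
proof -
  define e where "e k = 1 / (real k + 2)" for k :: nat
  have e: "e \<longlonglongrightarrow> 0" "0 < e k" "e k \<le> 1/2" for k
    using LIMSEQ_ignore_initial_segment[OF lim_1_over_n[where 'a=real], of 2]
    unfolding e_def[abs_def] by (auto simp: divide_simps add.commute)
  have [measurable]: "f \<in> borel_measurable borel" using f by (simp add: Lp_ball_def)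
  obtain q \<Phi> where q: "strict_mono q" "AE x in uball. (\<lambda>k. mol (e (q k)) f x) \<longlonglongrightarrow> f x"
  proof (rule dominated_subsequence[of "\<lambda>k. mol (e k) f" uball f 1])
    show "integrable uball (\<lambda>x. norm (f x) ^ 1)"
      using f by (intro integrable_uball) (simp add: Lp_ball_def)
    show "(\<lambda>k. \<integral>\<^sup>+x. ennreal (norm (mol (e k) f x - f x) ^ 1) \<partial>uball) \<longlonglongrightarrow> 0"
      by (rule mol_Lp_tendsto[OF f _ e]) simp
  qed auto
  have "(\<lambda>k. e (q k)) \<longlonglongrightarrow> 0" using LIMSEQ_subseq_LIMSEQ[OF e(1) q(1)] by (simp add: o_def)
  have "AE x in lborel. norm x \<le> 1 \<longrightarrow> (\<lambda>k. mol (e (q k)) f x) \<longlonglongrightarrow> f x"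
    using q(2) by (simp add: AE_uball_iff)
  then show ?thesis
  proof eventually_elim
    case (elim x)
    show ?case
    proof
      assume x: "norm x < r"
      have "(\<lambda>k. norm ((1 - e (q k)) *\<^sub>R x) + e (q k) / 2) \<longlonglongrightarrow> norm ((1 - 0) *\<^sub>R x) + 0 / 2"
        using \<open>(\<lambda>k. e (q k)) \<longlonglongrightarrow> 0\<close> by (intro tendsto_intros) auto
      then have "\<forall>\<^sub>F k in sequentially. norm ((1 - e (q k)) *\<^sub>R x) + e (q k) / 2 < r"
        using x by (simp add: order_tendsto_iff)
      then have "\<forall>\<^sub>F k in sequentially. mol (e (q k)) f x = 0"
      proof eventually_elim
        case (elim k)
        have "e (q k) \<le> 1" using e(3)[of "q k"] by simp
        from test[OF test_function_mol_kernel(1)[OF e(2) this elim]] show ?case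
          by (simp add: mol_eq_mol_kernel e)
      qed
      then have "(\<lambda>k. mol (e (q k)) f x) \<longlonglongrightarrow> 0" by (rule tendsto_eventually)
      moreover have "(\<lambda>k. mol (e (q k)) f x) \<longlonglongrightarrow> f x" using elim x r by simp
      ultimately show "f x = 0" using LIMSEQ_unique by blast
    qed
  qed
qed

text \<open>At fixed t the point p + t (x - p) has Jacobian t^n in x and (1 - t)^n in p. Changing
  variables in x for t >= 1/2 and in p for t < 1/2 bounds the integral over p, x and t by 2^n |B|
  times the integral of \<open>f\<close>. For a single fixed p the factor t^(-n) would not be
  integrable at 0, which is why p is averaged.\<close>

lemma AE_finite_ray_integrals:
  fixes f :: "'a::euclidean_space \<Rightarrow> ennreal"
  assumes [measurable]: "f \<in> borel_measurable borel" and fin: "(\<integral>\<^sup>+x. f x \<partial>lborel) < \<infinity>"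
  shows "AE p in uball. (\<integral>\<^sup>+x. (\<integral>\<^sup>+t. f (p + t *\<^sub>R (x - p)) \<partial>restrict_space lborel {0..1}) \<partial>uball) < \<infinity>"
proof -
  let ?T = "restrict_space lborel {0..1::real}"
  interpret U: finite_measure "uball :: 'a measure" by (rule finite_measure_uball)
  interpret T: finite_measure ?T
    by (rule finite_measureI) (simp add: emeasure_restrict_space space_restrict_space)
  interpret P: pair_sigma_finite ?T "uball :: 'a measure" ..
  have [measurable]: "(\<lambda>t. t) \<in> borel_measurable ?T" by (rule measurable_restrict_space1) simp
  have [measurable]: "(\<lambda>t. t) \<in> borel_measurable (uball::'a measure)" by (rule measurable_restrict_space1) simp
  have eq: "p + t *\<^sub>R (x - p) = (1 - t) *\<^sub>R p + t *\<^sub>R x" for p x :: 'a and t by (simp add: algebra_simps)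
  let ?F = "\<integral>\<^sup>+x. f x \<partial>lborel"
  have half: "(\<integral>\<^sup>+x. f (b + s *\<^sub>R x) \<partial>uball) \<le> 2 ^ DIM('a) * ?F" if s: "s \<ge> 1/2" for b s
  proof -
    let ?J = "\<integral>\<^sup>+x. f (b + s *\<^sub>R x) \<partial>lborel"
    have "?F = ennreal (s ^ DIM('a)) * ?J"
      by (rule lborel_nn_integral_affine) (use s in auto)
    then have "ennreal (2 ^ DIM('a)) * ?F = ennreal (2 ^ DIM('a) * s ^ DIM('a)) * ?J"
      using s by (simp add: ennreal_mult mult.assoc)
    moreover have "1 \<le> 2 ^ DIM('a) * s ^ DIM('a)"
      unfolding power_mult_distrib[symmetric] by (rule one_le_power) (use s in auto)
    then have "1 \<le> ennreal (2 ^ DIM('a) * s ^ DIM('a))" by (simp add: ennreal_leI flip: ennreal_1)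
    then have "1 * ?J \<le> ennreal (2 ^ DIM('a) * s ^ DIM('a)) * ?J" by (rule mult_right_mono) simp
    ultimately have "?J \<le> 2 ^ DIM('a) * ?F" by (simp add: ennreal_2_power)
    then show ?thesis by (rule order_trans[OF nn_integral_uball_le])
  qed
  let ?c = "emeasure (uball::'a measure) (cball 0 1)"
  have fixt: "(\<integral>\<^sup>+p. (\<integral>\<^sup>+x. f (p + t *\<^sub>R (x - p)) \<partial>uball) \<partial>uball) \<le> (2 ^ DIM('a) * ?F) * ?c" for t
  proof (cases "t \<ge> 1/2")
    case True
    have "(\<integral>\<^sup>+p. (\<integral>\<^sup>+x. f (p + t *\<^sub>R (x - p)) \<partial>uball) \<partial>uball) \<le> (\<integral>\<^sup>+p. 2 ^ DIM('a) * ?F \<partial>(uball::'a measure))"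
      unfolding eq by (intro nn_integral_mono half True)
    then show ?thesis by simp
  next
    case False
    interpret Q: pair_sigma_finite "uball :: 'a measure" "uball :: 'a measure" ..
    have "(\<integral>\<^sup>+p. (\<integral>\<^sup>+x. f (p + t *\<^sub>R (x - p)) \<partial>uball) \<partial>uball) = (\<integral>\<^sup>+x. (\<integral>\<^sup>+p. f (t *\<^sub>R x + (1 - t) *\<^sub>R p) \<partial>uball) \<partial>uball)"
      unfolding eq by (subst Q.Fubini') (auto simp: add.commute)
    also have "\<dots> \<le> (\<integral>\<^sup>+p. 2 ^ DIM('a) * ?F \<partial>(uball::'a measure))"
      using False by (intro nn_integral_mono half) auto
    finally show ?thesis by simp
  qed
  interpret PT: pair_sigma_finite "uball :: 'a measure" ?T ..
  have "(\<integral>\<^sup>+p. (\<integral>\<^sup>+x. (\<integral>\<^sup>+t. f (p + t *\<^sub>R (x - p)) \<partial>?T) \<partial>uball) \<partial>uball)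
    = (\<integral>\<^sup>+p. (\<integral>\<^sup>+t. (\<integral>\<^sup>+x. f (p + t *\<^sub>R (x - p)) \<partial>uball) \<partial>?T) \<partial>uball)"
    by (intro nn_integral_cong P.Fubini') measurable
  also have "\<dots> = (\<integral>\<^sup>+t. (\<integral>\<^sup>+p. (\<integral>\<^sup>+x. f (p + t *\<^sub>R (x - p)) \<partial>uball) \<partial>uball) \<partial>?T)"
    by (rule P.Fubini') measurable
  also have "\<dots> \<le> (\<integral>\<^sup>+t. (2 ^ DIM('a) * ?F) * ?c \<partial>?T)"
    by (intro nn_integral_mono fixt)
  also have "\<dots> < \<infinity>"
    using fin emeasure_uball_finite[where 'a='a]
    by (simp add: ennreal_mult_less_top emeasure_restrict_space space_restrict_space ennreal_2_power)
  finally have "AE p in (uball::'a measure). (\<integral>\<^sup>+x. (\<integral>\<^sup>+t. f (p + t *\<^sub>R (x - p)) \<partial>?T) \<partial>uball) \<noteq> \<infinity>"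
    by (intro nn_integral_noteq_infinite) auto
  then show ?thesis by (simp add: less_top)
qed

text \<open>Dyadic comparison: for |b| < 1, |b|^(-2) is at most the sum of 4^(n+1) over those n for
  which b lies in the ball of radius 2^(-n). The n-th ball contributes 4^(n+1) V 2^(-n d), which is
  at most 4 V 2^(-n) once d >= 3. Where |y - a| >= 1 the integrand is at most 1, hence the extra
  V.\<close>

lemma singular_integral_bounded:
  assumes "3 \<le> DIM('a::euclidean_space)"
  obtains C :: real where "C \<ge> 0" "\<And>y::'a. (\<integral>\<^sup>+a. ennreal (1 / (norm (y - a))\<^sup>2) * indicator (cball 0 1) a \<partial>lborel) \<le> ennreal C"
proof -
  define V where "V = unit_ball_vol (real DIM('a))"
  have V: "V \<ge> 0" by (simp add: V_def unit_ball_vol_nonneg)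
  have em: "emeasure lborel (cball (0::'a) r) = ennreal (V * r ^ DIM('a))" if "r \<ge> 0" for r
    unfolding V_def using emeasure_cball[OF that, of 0] by simp
  let ?s = "\<lambda>n b. ennreal (4 ^ Suc n) * indicator (cball (0::'a) ((1/2) ^ n)) b"
  have [measurable]: "cball (c::'a) r \<in> sets borel" for c r by simp
  have [measurable]: "(\<lambda>b. \<Sum>n. ?s n b) \<in> borel_measurable borel"
    by (intro borel_measurable_suminf_order borel_measurable_times_ennreal borel_measurable_indicator) auto
  have [measurable]: "(\<lambda>b. \<Sum>n. ?s n (b - y)) \<in> borel_measurable borel" for y
    by (rule measurable_compose[of "\<lambda>b. b - y" borel borel "\<lambda>b. \<Sum>n. ?s n b"]) measurable
  have [measurable]: "indicator (cball (c::'a) r) \<in> borel_measurable borel" for c r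
    by (intro borel_measurable_indicator) auto
  have pt: "ennreal (1 / (norm b)\<^sup>2) \<le> (\<Sum>n. ?s n b)" if b: "b \<noteq> 0" "norm b < 1" for b :: 'a
  proof -
    have "\<exists>n. (1/2) ^ n < norm b" using b by (intro real_arch_pow_inv) auto
    \<comment> \<open>\<open>m\<close> indexes the first dyadic radius below |b|. It is positive
      because |b| < 1, and the single term of index m - 1 already dominates.\<close>
    define m where "m = (LEAST n. (1/2) ^ n < norm b)"
    have m: "(1/2) ^ m < norm b" unfolding m_def by (rule LeastI_ex) fact
    then obtain n where n: "m = Suc n" using b by (cases m) auto
    have le: "norm b \<le> (1/2) ^ n"
      using not_less_Least[of n "\<lambda>n. (1/2) ^ n < norm b"] n by (simp add: m_def not_less)
    have "((1/2) ^ Suc n)\<^sup>2 \<le> (norm b)\<^sup>2" using m n by (intro power_mono) auto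
    then have "1 / (norm b)\<^sup>2 \<le> 1 / ((1/2) ^ Suc n)\<^sup>2" using b by (intro divide_left_mono) auto
    also have "\<dots> = 4 ^ Suc n" by (simp add: power_divide power2_eq_square flip: power_mult_distrib)
    finally have "ennreal (1 / (norm b)\<^sup>2) \<le> ?s n b" using le by (simp add: ennreal_leI)
    also have "\<dots> \<le> (\<Sum>n. ?s n b)"
      by (rule le_suminf_ennreal)
    finally show ?thesis .
  qed
  have "(\<integral>\<^sup>+b. (\<Sum>n. ?s n b) \<partial>lborel) = (\<Sum>n. \<integral>\<^sup>+b. ?s n b \<partial>lborel)"
    by (rule nn_integral_suminf) (auto intro!: borel_measurable_times_ennreal borel_measurable_indicator)
  also have "\<dots> = (\<Sum>n. ennreal (4 ^ Suc n * (V * ((1/2) ^ n) ^ DIM('a))))"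
    using V by (intro suminf_cong) (simp add: nn_integral_cmult_indicator em ennreal_mult)
  also have "\<dots> \<le> (\<Sum>n. ennreal (4 * V * (1/2) ^ n))"
  proof (intro suminf_le ennreal_leI)
    fix n
    have "((1/2::real) ^ n) ^ DIM('a) \<le> ((1/2) ^ n) ^ 3"
      using assms by (intro power_decreasing) (auto simp: power_le_one)
    then have "4 ^ Suc n * (V * ((1/2) ^ n) ^ DIM('a)) \<le> 4 ^ Suc n * (V * ((1/2) ^ n) ^ 3)"
      using V by (intro mult_left_mono) auto
    also have "\<dots> = 4 * V * (4 * (1/2) ^ 3) ^ n"
      by (simp only: power_mult_distrib power_mult[symmetric] mult.commute[of n 3]) (simp add: mult_ac power_mult)
    finally show "4 ^ Suc n * (V * ((1/2) ^ n) ^ DIM('a)) \<le> 4 * V * (1/2) ^ n" by (simp add: power3_eq_cube)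
  qed auto
  also have "\<dots> = ennreal (4 * V * 2)"
    by (rule suminf_ennreal_eq) (use V sums_mult[OF geometric_sums[of "1/2::real"], of "4 * V"] in auto)
  finally have fin: "(\<integral>\<^sup>+b. (\<Sum>n. ?s n b) \<partial>lborel) \<le> ennreal (4 * V * 2)" .
  show ?thesis
  proof (rule that[of "4 * V * 2 + V"])
    show "4 * V * 2 + V \<ge> 0" using V by simp
    fix y :: 'a
    have "(\<integral>\<^sup>+a. ennreal (1 / (norm (y - a))\<^sup>2) * indicator (cball 0 1) a \<partial>lborel)
      \<le> (\<integral>\<^sup>+a. (\<Sum>n. ?s n (a - y)) + indicator (cball 0 1) a \<partial>lborel)"
    proof (rule nn_integral_mono)
      fix a :: 'a
      \<comment> \<open>At a = y the integrand is 1/0 = 0.\<close>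
      consider "a = y" | "a \<noteq> y" "norm (a - y) < 1" | "norm (a - y) \<ge> 1" by linarith
      then show "ennreal (1 / (norm (y - a))\<^sup>2) * indicator (cball 0 1) a \<le> (\<Sum>n. ?s n (a - y)) + indicator (cball 0 1) a"
      proof cases
        case 2
        then have "ennreal (1 / (norm (y - a))\<^sup>2) \<le> (\<Sum>n. ?s n (a - y))" using pt[of "a - y"] by (simp add: norm_minus_commute)
        then have "ennreal (1 / (norm (y - a))\<^sup>2) * indicator (cball 0 1) a \<le> (\<Sum>n. ?s n (a - y))"
          by (auto simp: indicator_def)
        then show ?thesis by (rule add_increasing2[rotated]) simp
      next
        case 3
        then have "1 / (norm (y - a))\<^sup>2 \<le> 1" by (simp add: norm_minus_commute divide_simps)
        then have "ennreal (1 / (norm (y - a))\<^sup>2) \<le> 1" by (simp add: ennreal_leI flip: ennreal_1)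
        then have "ennreal (1 / (norm (y - a))\<^sup>2) * indicator (cball 0 1) a \<le> indicator (cball 0 1) a"
          by (auto simp: indicator_def)
        then show ?thesis by (rule add_increasing[rotated]) simp
      qed simp
    qed
    also have "\<dots> = (\<integral>\<^sup>+a. (\<Sum>n. ?s n (a - y)) \<partial>lborel) + ennreal V"
      by (subst nn_integral_add) (auto simp: em)
    also have "(\<integral>\<^sup>+a. (\<Sum>n. ?s n (a - y)) \<partial>lborel) = (\<integral>\<^sup>+b. (\<Sum>n. ?s n b) \<partial>lborel)"
      by (subst lborel_nn_integral_affine[where c=1 and t=y]) auto
    also have "\<dots> + ennreal V \<le> ennreal (4 * V * 2) + ennreal V"
      by (rule add_right_mono[OF fin])
    also have "\<dots> = ennreal (4 * V * 2 + V)" using V by (intro ennreal_plus[symmetric]) auto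
    finally show "(\<integral>\<^sup>+a. ennreal (1 / (norm (y - a))\<^sup>2) * indicator (cball 0 1) a \<partial>lborel) \<le> ennreal (4 * V * 2 + V)" by simp
  qed
qed

text \<open>By translation invariance every difference quotient has integral 0. Only the steps
  v/(n+1) and a bounded pointwise limit enter, not differentiability of \<open>F\<close>; this suits
  products with parallel transports, for which no more than that is proved.\<close>

lemma integral_directional_derivative_zero:
  fixes F :: "'a::euclidean_space \<Rightarrow> 'b::euclidean_space"
  assumes F: "continuous_on UNIV F" "\<And>x. norm x > R \<Longrightarrow> F x = 0" and v: "norm v \<le> 1"
    and K: "\<And>n x. norm (real (Suc n) *\<^sub>R (F (x + v /\<^sub>R real (Suc n)) - F x)) \<le> K"
    and lim: "\<And>x. (\<lambda>n. real (Suc n) *\<^sub>R (F (x + v /\<^sub>R real (Suc n)) - F x)) \<longlonglongrightarrow> F' x"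
  shows "integrable lborel F'" "(LINT x|lborel. F' x) = 0"
proof -
  have [measurable]: "F \<in> borel_measurable borel" by (rule borel_measurable_continuous_onI[OF F(1)])
  have iF: "integrable lborel F" by (rule integrable_compact_support[OF F])
  have "K \<ge> 0" using K[of 0 0] norm_ge_zero order_trans by blast
  \<comment> \<open>The steps have length at most 1, so all quotients vanish beyond radius R +
    1.\<close>
  define w where "w x = K * indicator (cball 0 (R + 1)) (x::'a)" for x
  have iw: "integrable lborel w"
    unfolding w_def using emeasure_lborel_cball_finite[of "0::'a" "R + 1"] by auto
  have b: "norm (real (Suc n) *\<^sub>R (F (x + v /\<^sub>R real (Suc n)) - F x)) \<le> w x" for n x
  proof (cases "norm x \<le> R + 1")
    case True
    then show ?thesis using K by (simp add: w_def)
  next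
    case False
    have "norm (v /\<^sub>R real (Suc n)) \<le> 1" using v by (simp add: divide_simps)
    then have "norm (x + v /\<^sub>R real (Suc n)) > R"
      using False norm_triangle_ineq4[of "x + v /\<^sub>R real (Suc n)" "v /\<^sub>R real (Suc n)"] by simp
    then show ?thesis using False F(2) by (simp add: w_def)
  qed
  have [measurable]: "F' \<in> borel_measurable borel"
    by (rule borel_measurable_LIMSEQ_metric[OF _ lim]) measurable
  show "integrable lborel F'"
    by (rule integrable_dominated_convergence[OF _ _ iw AE_I2[OF lim] AE_I2[OF b]]) auto
  have "(\<lambda>n. LINT x|lborel. real (Suc n) *\<^sub>R (F (x + v /\<^sub>R real (Suc n)) - F x)) \<longlonglongrightarrow> (LINT x|lborel. F' x)"
    by (rule integral_dominated_convergence[OF _ _ iw AE_I2[OF lim] AE_I2[OF b]]) auto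
  moreover have "(LINT x|lborel. real (Suc n) *\<^sub>R (F (x + v /\<^sub>R real (Suc n)) - F x)) = 0" for n
  proof -
    have "integrable lborel (\<lambda>x. F (x + v /\<^sub>R real (Suc n)))"
    proof (rule integrable_compact_support[of _ "R + norm (v /\<^sub>R real (Suc n))"])
      show "continuous_on UNIV (\<lambda>x. F (x + v /\<^sub>R real (Suc n)))"
        by (rule continuous_on_compose2[OF F(1)]) (auto intro!: continuous_intros)
      show "F (x + v /\<^sub>R real (Suc n)) = 0" if "norm x > R + norm (v /\<^sub>R real (Suc n))" for x
        using that norm_triangle_ineq4[of "x + v /\<^sub>R real (Suc n)" "v /\<^sub>R real (Suc n)"] by (intro F(2)) simp
    qed
    moreover have "(LINT x|lborel. F (x + v /\<^sub>R real (Suc n))) = (LINT x|lborel. F x)"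
      using lborel_integral_affine[of F 1 "v /\<^sub>R real (Suc n)"] by (simp add: add.commute)
    ultimately show ?thesis
      using iF by (simp only: integral_scaleR_right Bochner_Integration.integral_diff) simp
  qed
  ultimately have "(\<lambda>n::nat. 0::'b) \<longlonglongrightarrow> (LINT x|lborel. F' x)" by (simp only:)
  then show "(LINT x|lborel. F' x) = 0" using LIMSEQ_unique[OF _ tendsto_const] by metis
qed

section \<open>Quaternions and the Hopf map\<close>

text \<open>Real part and imaginary part. The product type already carries the Euclidean norm, inner
  product and Lebesgue measure of the four-dimensional space.\<close>

type_synonym quat = "real \<times> (real^3)"

definition qmul :: "quat \<Rightarrow> quat \<Rightarrow> quat" (infixl \<open>\<odot>\<close> 70) where
  "p \<odot> q = (fst p * fst q - snd p \<bullet> snd q, fst p *\<^sub>R snd q + fst q *\<^sub>R snd p + cross3 (snd p) (snd q))"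

definition qcnj :: "quat \<Rightarrow> quat" where
  "qcnj q = (fst q, - snd q)"

definition im :: "real^3 \<Rightarrow> quat" where
  "im a = (0, a)"

definition qone :: quat where
  "qone = (1, 0)"

lemmas quat_simps = qmul_def qcnj_def im_def qone_def prod_eq_iff vec_eq_iff forall_3 inner_vec_def sum_3 cross3_def

lemma qmul_assoc: "p \<odot> q \<odot> r = p \<odot> (q \<odot> r)"
  by (simp add: quat_simps algebra_simps)

lemma qcnj_qmul: "qcnj (p \<odot> q) = qcnj q \<odot> qcnj p"
  by (simp add: quat_simps algebra_simps)

lemma qmul_qone [simp]: "qone \<odot> q = q" "q \<odot> qone = q"
  by (simp_all add: quat_simps)

lemma qcnj_qone: "qcnj qone = qone"
  by (simp add: quat_simps)

lemma qcnj_im: "qcnj (im a) = - im a"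
  by (simp add: quat_simps)

lemma im_linear: "im (a + b) = im a + im b" "im (a - b) = im a - im b" "im (r *\<^sub>R a) = r *\<^sub>R im a" "im (- a) = - im a"
  by (simp_all add: im_def)

lemma norm_im [simp]: "norm (im a) = norm a"
  by (simp add: im_def norm_Pair)

lemma norm_qcnj [simp]: "norm (qcnj a) = norm a"
  by (simp add: qcnj_def norm_prod_def)

lemma norm_quat_sq: "(norm (q::quat))\<^sup>2 = (fst q)\<^sup>2 + snd q \<bullet> snd q"
  by (simp add: norm_prod_def power2_norm_eq_inner)

text \<open>Euler's four-square identity, checked in coordinates.\<close>

lemma norm_qmul: "norm (p \<odot> q) = norm p * norm q"
proof -
  have "(norm (p \<odot> q))\<^sup>2 = (norm p)\<^sup>2 * (norm q)\<^sup>2"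
    unfolding norm_quat_sq by (simp add: quat_simps power2_eq_square algebra_simps)
  also have "\<dots> = (norm p * norm q)\<^sup>2" by (simp add: power_mult_distrib)
  finally show ?thesis by (simp add: power2_eq_iff_nonneg)
qed

lemma qcnj_qmul_self: "qcnj q \<odot> q = (norm q)\<^sup>2 *\<^sub>R qone" "q \<odot> qcnj q = (norm q)\<^sup>2 *\<^sub>R qone"
  unfolding norm_quat_sq by (simp_all add: quat_simps power2_eq_square algebra_simps)

lemma bounded_bilinear_qmul: "bounded_bilinear (\<odot>)"
proof
  show "\<exists>K. \<forall>a b. norm (a \<odot> b) \<le> norm a * norm b * K"
    by (intro exI[of _ 1]) (simp add: norm_qmul)
qed (simp_all add: quat_simps algebra_simps)

interpretation qmul: bounded_bilinear "(\<odot>)"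
  by (rule bounded_bilinear_qmul)

lemma bounded_linear_qcnj: "bounded_linear qcnj"
  by (rule bounded_linear_intro[where K=1]) (simp_all add: qcnj_def norm_prod_def prod_eq_iff)

lemma bounded_linear_im: "bounded_linear im"
  by (rule bounded_linear_intro[where K=1]) (auto simp: im_def)

text \<open>The source of the factors 2 below: the bracket of imaginary quaternions is twice the
  cross product.\<close>

lemma im_commutator: "im a \<odot> im b - im b \<odot> im a = im (2 *\<^sub>R cross3 a b)"
  by (simp add: quat_simps algebra_simps)

text \<open>Left multiplication by an imaginary quaternion is skew. This keeps transports at norm 1
  and makes A g tangent to the three-sphere.\<close>

lemma inner_im_qmul: "(im a \<odot> q) \<bullet> q = 0"
  by (simp add: quat_simps inner_prod_def algebra_simps)

lemma continuous_on_qmul[continuous_intros]: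
  "continuous_on S f \<Longrightarrow> continuous_on S g \<Longrightarrow> continuous_on S (\<lambda>x. f x \<odot> g x)"
  by (rule qmul.continuous_on)

lemma continuous_on_qcnj[continuous_intros]: "continuous_on S f \<Longrightarrow> continuous_on S (\<lambda>x. qcnj (f x))"
  by (rule bounded_linear.continuous_on[OF bounded_linear_qcnj])

lemma continuous_on_im[continuous_intros]: "continuous_on S f \<Longrightarrow> continuous_on S (\<lambda>x. im (f x))"
  by (rule bounded_linear.continuous_on[OF bounded_linear_im])

lemma tendsto_qmul[tendsto_intros]: "(f \<longlongrightarrow> a) F \<Longrightarrow> (g \<longlongrightarrow> b) F \<Longrightarrow> ((\<lambda>x. f x \<odot> g x) \<longlongrightarrow> a \<odot> b) F"
  by (rule qmul.tendsto)

lemma tendsto_qcnj[tendsto_intros]: "(f \<longlongrightarrow> a) F \<Longrightarrow> ((\<lambda>x. qcnj (f x)) \<longlongrightarrow> qcnj a) F"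
  by (rule bounded_linear.tendsto[OF bounded_linear_qcnj])

lemma tendsto_im[tendsto_intros]: "(f \<longlongrightarrow> a) F \<Longrightarrow> ((\<lambda>x. im (f x)) \<longlongrightarrow> im a) F"
  by (rule bounded_linear.tendsto[OF bounded_linear_im])

text \<open>The weight \<open>exp (2 K t)\<close> makes the Picard operator a contraction on the whole interval.\<close>

lemma linear_ode_exists:
  fixes h :: "'c::real_normed_vector \<Rightarrow> 'b::euclidean_space \<Rightarrow> 'b" and a :: "real \<Rightarrow> 'c"
  assumes h: "bounded_bilinear h" and a: "continuous_on {0..1} a"
  obtains \<psi> where "\<psi> 0 = x0"
    "\<And>t. t \<in> {0..1} \<Longrightarrow> (\<psi> has_vector_derivative h (a t) (\<psi> t)) (at t within {0..1})"
proof -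
  interpret h: bounded_bilinear h by (rule h)
  obtain K0 where K0: "K0 > 0" "\<And>x y. norm (h x y) \<le> norm x * norm y * K0" using h.pos_bounded by blast
  have "bounded (a ` {0..1})" by (intro compact_imp_bounded compact_continuous_image a) auto
  then obtain Ka where Ka: "Ka > 0" "\<And>t. t \<in> {0..1} \<Longrightarrow> norm (a t) \<le> Ka" by (auto simp: bounded_pos)
  define K where "K = Ka * K0"
  have K: "K > 0" using K0 Ka by (simp add: K_def)
  have hK: "norm (h (a t) y) \<le> K * norm y" if "t \<in> {0..1}" for t y
  proof -
    have "norm (h (a t) y) \<le> norm (a t) * (norm y * K0)" using K0(2)[of "a t" y] by (simp add: mult_ac)
    also have "\<dots> \<le> Ka * (norm y * K0)" using that Ka K0 by (intro mult_right_mono) auto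
    finally show ?thesis by (simp add: K_def mult_ac)
  qed
  \<comment> \<open>Clamping time to [0,1] turns functions on the interval into bounded continuous
    functions on the line, a complete space for the fixed point theorem.\<close>
  define c :: "real \<Rightarrow> real" where "c t = max 0 (min 1 t)" for t
  have c: "c t \<in> {0..1}" "t \<in> {0..1} \<Longrightarrow> c t = t" for t by (auto simp: c_def)
  \<comment> \<open>The unknown \<phi> stands for exp(-2 K t) times the solution; therefore
    \<open>f\<close> multiplies by exp(2 K s) and \<open>T\<close> divides by it again.\<close>
  define f where "f \<phi> s = exp (2 * K * s) *\<^sub>R h (a s) (apply_bcontfun \<phi> s)" for \<phi> :: "real \<Rightarrow>\<^sub>C 'b" and s
  have fc: "continuous_on {0..1} (f \<phi>)" for \<phi>
    unfolding f_def by (intro continuous_intros h.continuous_on a) auto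
  have fi: "f \<phi> integrable_on {0..t}" if "t \<in> {0..1}" for \<phi> t
    using that by (intro integrable_continuous_real continuous_on_subset[OF fc]) auto
  define T where "T \<phi> t = exp (- 2 * K * c t) *\<^sub>R (x0 + integral {0..c t} (f \<phi>))" for \<phi> t
  have "continuous_on UNIV (T \<phi>)" for \<phi>
  proof -
    have "continuous_on {0..1} (\<lambda>t. integral {0..t} (f \<phi>))"
      by (intro indefinite_integral_continuous_1 integrable_continuous_real fc)
    then have "continuous_on UNIV (\<lambda>t. integral {0..c t} (f \<phi>))"
      by (rule continuous_on_compose2) (use c in \<open>auto simp: c_def[abs_def] intro!: continuous_intros\<close>)
    moreover have "continuous_on UNIV c" unfolding c_def[abs_def] by (intro continuous_intros)
    ultimately show ?thesis unfolding T_def[abs_def] by (intro continuous_intros)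
  qed
  note Tc = this
  have "bounded (range (T \<phi>))" for \<phi>
  proof -
    have "T \<phi> t = T \<phi> (c t)" for t using c by (simp add: T_def)
    then have "range (T \<phi>) \<subseteq> T \<phi> ` {0..1}" using c by (metis image_subsetI imageI)
    moreover have "bounded (T \<phi> ` {0..1})"
      by (intro compact_imp_bounded compact_continuous_image continuous_on_subset[OF Tc]) auto
    ultimately show ?thesis by (rule bounded_subset[rotated])
  qed
  then have TB: "T \<phi> \<in> bcontfun" for \<phi> using Tc by (simp add: bcontfun_def)
  have "dist (Bcontfun (T \<phi>)) (Bcontfun (T \<phi>')) \<le> 1/2 * dist \<phi> \<phi>'" for \<phi> \<phi>'
  proof (rule dist_bound)
    fix t
    let ?d = "dist \<phi> \<phi>'" and ?u = "c t"
    have u: "?u \<in> {0..1}" "0 \<le> ?u" using c[of t] by auto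
    \<comment> \<open>Integrating K exp(2 K s) up to u gives at most exp(2 K u) / 2: the 1/2 is the
      contraction constant.\<close>
    have hi: "((\<lambda>s. (K * ?d) * exp (2 * K * s)) has_integral
        (exp (2 * K * ?u) * ?d / 2 - exp (2 * K * 0) * ?d / 2)) {0..?u}"
      by (rule fundamental_theorem_of_calculus)
         (use u K in \<open>auto intro!: derivative_eq_intros simp flip: has_real_derivative_iff_has_vector_derivative\<close>)
    have "norm (integral {0..?u} (f \<phi>) - integral {0..?u} (f \<phi>')) = norm (integral {0..?u} (\<lambda>s. f \<phi> s - f \<phi>' s))"
      by (subst integral_diff) (use fi u in auto)
    also have "\<dots> \<le> integral {0..?u} (\<lambda>s. (K * ?d) * exp (2 * K * s))"
    proof (rule integral_norm_bound_integral)
      show "(\<lambda>s. f \<phi> s - f \<phi>' s) integrable_on {0..?u}" using fi u by (intro integrable_diff) auto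
      show "(\<lambda>s. (K * ?d) * exp (2 * K * s)) integrable_on {0..?u}" using hi by blast
      fix s assume s: "s \<in> {0..?u}"
      then have s1: "s \<in> {0..1}" using u by auto
      have "norm (f \<phi> s - f \<phi>' s) = exp (2 * K * s) * norm (h (a s) (apply_bcontfun \<phi> s - apply_bcontfun \<phi>' s))"
        by (simp add: f_def h.diff_right flip: scaleR_diff_right)
      also have "\<dots> \<le> exp (2 * K * s) * (K * norm (apply_bcontfun \<phi> s - apply_bcontfun \<phi>' s))"
        by (intro mult_left_mono hK s1) auto
      also have "\<dots> \<le> exp (2 * K * s) * (K * ?d)"
        using K dist_bounded[of \<phi> s \<phi>'] by (intro mult_left_mono) (auto simp: dist_norm)
      finally show "norm (f \<phi> s - f \<phi>' s) \<le> (K * ?d) * exp (2 * K * s)" by (simp add: mult_ac)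
    qed
    also have "\<dots> \<le> exp (2 * K * ?u) * ?d / 2" unfolding integral_unique[OF hi] by simp
    finally have le: "norm (integral {0..?u} (f \<phi>) - integral {0..?u} (f \<phi>')) \<le> exp (2 * K * ?u) * ?d / 2" .
    have "dist (T \<phi> t) (T \<phi>' t) = exp (- 2 * K * ?u) * norm (integral {0..?u} (f \<phi>) - integral {0..?u} (f \<phi>'))"
      by (simp add: T_def dist_norm flip: scaleR_diff_right)
    also have "\<dots> \<le> exp (- 2 * K * ?u) * (exp (2 * K * ?u) * ?d / 2)" by (intro mult_left_mono le) auto
    also have "\<dots> = ?d / 2" by (simp add: exp_minus)
    finally show "dist (apply_bcontfun (Bcontfun (T \<phi>)) t) (apply_bcontfun (Bcontfun (T \<phi>')) t) \<le> 1/2 * ?d"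
      by (simp add: Bcontfun_inverse TB)
  qed
  then have "\<exists>!\<phi>. Bcontfun (T \<phi>) = \<phi>" by (intro banach_fix_type[of "1/2"]) auto
  then obtain \<phi> where "Bcontfun (T \<phi>) = \<phi>" by blast
  then have \<phi>: "apply_bcontfun \<phi> t = T \<phi> t" for t using TB[of \<phi>] by (metis Bcontfun_inverse)
  define \<psi> where "\<psi> t = x0 + integral {0..t} (f \<phi>)" for t
  have f\<psi>: "f \<phi> t = h (a t) (\<psi> t)" if "t \<in> {0..1}" for t
  proof -
    have "f \<phi> t = exp (2 * K * t) *\<^sub>R h (a t) (exp (- (2 * K * t)) *\<^sub>R \<psi> t)"
      using that c(2)[OF that] by (simp add: f_def \<phi> T_def \<psi>_def)
    then show ?thesis by (simp add: h.scaleR_right exp_minus)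
  qed
  show ?thesis
  proof (rule that[of \<psi>])
    show "\<psi> 0 = x0" by (simp add: \<psi>_def)
    fix t :: real assume t: "t \<in> {0..1}"
    have "((\<lambda>u. integral {0..u} (f \<phi>)) has_vector_derivative f \<phi> t) (at t within {0..1})"
      by (rule integral_has_vector_derivative[OF fc t])
    then show "(\<psi> has_vector_derivative h (a t) (\<psi> t)) (at t within {0..1})"
      unfolding f\<psi>[OF t] \<psi>_def[abs_def] by (intro has_vector_derivative_add[where f'=0, simplified]) auto
  qed
qed

section \<open>Unit quaternions transported along a path\<close>

definition qsol :: "(real \<Rightarrow> real^3) \<Rightarrow> (real \<Rightarrow> quat) \<Rightarrow> bool" where
  "qsol a \<psi> \<longleftrightarrow> \<psi> 0 = qone \<and>
    (\<forall>t\<in>{0..1}. (\<psi> has_vector_derivative im (a t) \<odot> \<psi> t) (at t within {0..1}))"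

lemma qsol_exists: "continuous_on {0..1} a \<Longrightarrow> \<exists>\<psi>. qsol a \<psi>"
  unfolding qsol_def
  by (rule linear_ode_exists[OF bounded_bilinear_qmul, of "\<lambda>t. im (a t)" qone])
     (auto intro: continuous_on_im)

lemma qsol_continuous: "qsol a \<psi> \<Longrightarrow> continuous_on {0..1} \<psi>"
  unfolding qsol_def by (meson continuous_on_eq_continuous_within has_vector_derivative_continuous)

lemma qsol_norm:
  assumes "qsol a \<psi>" "t \<in> {0..1}" shows "norm (\<psi> t) = 1"
proof -
  have "((\<lambda>t. \<psi> t \<bullet> \<psi> t) has_vector_derivative 0) (at t within {0..1})" if "t \<in> {0..1}" for t
  proof -
    have "(\<psi> has_derivative (\<lambda>h. h *\<^sub>R (im (a t) \<odot> \<psi> t))) (at t within {0..1})"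
      using assms(1) that by (auto simp: qsol_def has_vector_derivative_def)
    from has_derivative_inner[OF this this] show ?thesis
      by (simp add: has_vector_derivative_def inner_im_qmul inner_commute[of "\<psi> t"])
  qed
  then obtain c where c: "\<And>t. t \<in> {0..1} \<Longrightarrow> \<psi> t \<bullet> \<psi> t = c"
    using has_vector_derivative_zero_constant[of "{0..1}" "\<lambda>t. \<psi> t \<bullet> \<psi> t"] by auto
  have "\<psi> t \<bullet> \<psi> t = \<psi> 0 \<bullet> \<psi> 0" using c[of t] c[of 0] assms(2) by simp
  also have "\<dots> = 1" using assms(1) by (simp add: qsol_def qone_def inner_prod_def)
  finally show ?thesis by (simp add: norm_eq_sqrt_inner)
qed

text \<open>Variation of constants: the integrand is the derivative of
  \<open>qcnj (\<psi> s) \<odot> W s \<odot> \<phi> s\<close>, since the conjugate of a solution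
  solves the equation with -a acting from the right. With W = 1 it compares two connections, with W
  = s A(v) it differentiates a transport in its end point, and with W = u it measures how far u is
  from parallel.\<close>

lemma qsol_ftc:
  assumes \<psi>: "qsol a \<psi>" and \<phi>: "qsol b \<phi>"
    and W: "\<And>s. s \<in> {0..1} \<Longrightarrow> (W has_vector_derivative W' s) (at s within {0..1})" and t: "t \<in> {0..1}"
  shows "((\<lambda>s. qcnj (\<psi> s) \<odot> (W' s - im (a s) \<odot> W s + W s \<odot> im (b s)) \<odot> \<phi> s) has_integral
    (qcnj (\<psi> t) \<odot> W t \<odot> \<phi> t - W 0)) {0..t}"
proof -
  have "((\<lambda>s. qcnj (\<psi> s) \<odot> W s \<odot> \<phi> s) has_vector_derivative
      qcnj (\<psi> s) \<odot> (W' s - im (a s) \<odot> W s + W s \<odot> im (b s)) \<odot> \<phi> s) (at s within {0..t})" if s: "s \<in> {0..t}" for s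
  proof -
    have s1: "s \<in> {0..1}" and sub: "{0..t} \<subseteq> {0..1}" using s t by auto
    have d\<psi>: "((\<lambda>s. qcnj (\<psi> s)) has_vector_derivative qcnj (im (a s) \<odot> \<psi> s)) (at s within {0..1})"
      using \<psi> s1 by (intro bounded_linear.has_vector_derivative[OF bounded_linear_qcnj]) (auto simp: qsol_def)
    have d\<phi>: "(\<phi> has_vector_derivative im (b s) \<odot> \<phi> s) (at s within {0..1})"
      using \<phi> s1 by (auto simp: qsol_def)
    note qmul.has_vector_derivative[OF qmul.has_vector_derivative[OF d\<psi> W[OF s1]] d\<phi>]
    moreover have "qcnj (\<psi> s) \<odot> W s \<odot> (im (b s) \<odot> \<phi> s) + (qcnj (\<psi> s) \<odot> W' s + qcnj (im (a s) \<odot> \<psi> s) \<odot> W s) \<odot> \<phi> s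
      = qcnj (\<psi> s) \<odot> (W' s - im (a s) \<odot> W s + W s \<odot> im (b s)) \<odot> \<phi> s"
      by (simp add: qmul_assoc qcnj_qmul qcnj_im qmul.add_left qmul.add_right qmul.diff_left qmul.diff_right
          qmul.minus_left qmul.minus_right)
    ultimately show ?thesis by (auto intro: has_vector_derivative_within_subset[OF _ sub])
  qed
  from fundamental_theorem_of_calculus[OF _ this] t show ?thesis
    using \<psi> \<phi> by (simp add: qsol_def qcnj_qone)
qed

text \<open>The case W = 1. Since both solutions have norm 1, the error is the plain integral of |b
  - a| without an exponential factor, so that L^1 control of connections is enough.\<close>

lemma qsol_diff_le:
  assumes \<psi>: "qsol a \<psi>" and \<phi>: "qsol b \<phi>" and t: "t \<in> {0..1}"
    and ab: "continuous_on {0..1} a" "continuous_on {0..1} b"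
  shows "norm (\<phi> t - \<psi> t) \<le> integral {0..t} (\<lambda>s. norm (b s - a s))"
    and "((\<lambda>s. qcnj (\<psi> s) \<odot> im (b s - a s) \<odot> \<phi> s) has_integral (qcnj (\<psi> t) \<odot> (\<phi> t - \<psi> t))) {0..t}"
proof -
  have n: "qcnj (\<psi> t) \<odot> \<psi> t = qone" by (simp add: qcnj_qmul_self qsol_norm[OF \<psi> t])
  have "((\<lambda>s. qcnj (\<psi> s) \<odot> (0 - im (a s) \<odot> qone + qone \<odot> im (b s)) \<odot> \<phi> s) has_integral
    (qcnj (\<psi> t) \<odot> qone \<odot> \<phi> t - qone)) {0..t}"
    by (rule qsol_ftc[OF \<psi> \<phi> _ t]) auto
  then show hi: "((\<lambda>s. qcnj (\<psi> s) \<odot> im (b s - a s) \<odot> \<phi> s) has_integral (qcnj (\<psi> t) \<odot> (\<phi> t - \<psi> t))) {0..t}"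
    by (simp add: im_linear qmul.diff_right n)
  have sub: "{0..t} \<subseteq> {0..1}" using t by auto
  have "norm (\<phi> t - \<psi> t) = norm (qcnj (\<psi> t) \<odot> (\<phi> t - \<psi> t))"
    by (simp add: norm_qmul qsol_norm[OF \<psi> t])
  also have "\<dots> = norm (integral {0..t} (\<lambda>s. qcnj (\<psi> s) \<odot> im (b s - a s) \<odot> \<phi> s))"
    using hi by (simp add: integral_unique)
  also have "\<dots> \<le> integral {0..t} (\<lambda>s. norm (b s - a s))"
  proof (rule integral_norm_bound_integral)
    show "(\<lambda>s. qcnj (\<psi> s) \<odot> im (b s - a s) \<odot> \<phi> s) integrable_on {0..t}" using hi by blast
    show "(\<lambda>s. norm (b s - a s)) integrable_on {0..t}"
      by (intro integrable_continuous_real continuous_intros continuous_on_subset[OF ab(1) sub] continuous_on_subset[OF ab(2) sub])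
    show "norm (qcnj (\<psi> s) \<odot> im (b s - a s) \<odot> \<phi> s) \<le> norm (b s - a s)" if "s \<in> {0..t}" for s
      using that sub by (simp add: norm_qmul qsol_norm[OF \<psi>] qsol_norm[OF \<phi>] subset_iff)
  qed
  finally show "norm (\<phi> t - \<psi> t) \<le> integral {0..t} (\<lambda>s. norm (b s - a s))" .
qed

lemma norm_cross3_le: "norm (cross3 x y) \<le> norm x * norm y"
proof (rule power2_le_imp_le)
  show "(norm (cross3 x y))\<^sup>2 \<le> (norm x * norm y)\<^sup>2"
    using norm_cross_dot[of x y] zero_le_power2[of "x \<bullet> y"] by linarith
qed auto

lemma bounded_bilinear_cross3: "bounded_bilinear cross3"
proof
  show "\<exists>K. \<forall>a b. norm (cross3 a b) \<le> norm a * norm b * K"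
    using norm_cross3_le by (intro exI[of _ 1]) simp
qed (simp_all add: cross_add_left cross_add_right cross_mult_left cross_mult_right)

lemma tendsto_cross3[tendsto_intros]:
  "(f \<longlongrightarrow> a) F \<Longrightarrow> (g \<longlongrightarrow> b) F \<Longrightarrow> ((\<lambda>x. cross3 (f x) (g x)) \<longlongrightarrow> cross3 a b) F"
  by (rule bounded_bilinear.tendsto[OF bounded_bilinear_cross3])

lemma cross3_measurable[measurable (raw)]:
  "f \<in> borel_measurable M \<Longrightarrow> g \<in> borel_measurable M \<Longrightarrow> (\<lambda>x. cross3 (f x) (g x)) \<in> borel_measurable M"
  by (rule borel_measurable_continuous_Pair[where H="cross3"]) (auto intro!: continuous_on_cross continuous_intros)

text \<open>For unit u and d normal to it, (u x d) x u = d, while the term along u disappears in the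
  cross product. Thus du = 2 A x u, whatever \<eta> is.\<close>

lemma cross_recovers_tangent:
  assumes "norm u = 1" "u \<bullet> d = 0"
  shows "2 *\<^sub>R cross3 ((1/2) *\<^sub>R (cross3 u d - r *\<^sub>R u)) u = d"
proof -
  have uu: "u \<bullet> u = 1" using assms(1) by (simp add: norm_eq_1)
  have "2 *\<^sub>R cross3 ((1/2) *\<^sub>R (cross3 u d - r *\<^sub>R u)) u = cross3 (cross3 u d - r *\<^sub>R u) u"
    by (simp only: cross_mult_left scaleR_scaleR) simp
  also have "\<dots> = cross3 (cross3 u d) u"
    by (simp add: bounded_bilinear.diff_left[OF bounded_bilinear_cross3] cross_mult_left)
  also have "\<dots> = d"
    using uu assms(2) by (simp add: cross_skew[of "cross3 u d"] Lagrange)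
  finally show ?thesis .
qed

section \<open>The Hopf map and its differential\<close>

definition Hopf :: "real^3 \<Rightarrow> quat \<Rightarrow> real^3" where
  "Hopf c q = snd (q \<odot> im c \<odot> qcnj q)"

definition DHopf :: "real^3 \<Rightarrow> quat \<Rightarrow> quat \<Rightarrow> real^3" where
  "DHopf c q p = snd (p \<odot> im c \<odot> qcnj q + q \<odot> im c \<odot> qcnj p)"

lemma im_Hopf: "im (Hopf c q) = q \<odot> im c \<odot> qcnj q"
  by (simp add: Hopf_def quat_simps algebra_simps)

text \<open>The real part of the right-hand side is 0, so taking \<open>snd\<close> in the
  definition loses nothing; the same holds for \<open>Hopf\<close>.\<close>

lemma im_DHopf: "im (DHopf c q p) = p \<odot> im c \<odot> qcnj q + q \<odot> im c \<odot> qcnj p"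
  by (simp add: DHopf_def quat_simps algebra_simps)

lemma norm_Hopf: "norm (Hopf c q) = norm c * (norm q)\<^sup>2"
  using arg_cong[OF im_Hopf[of c q], of norm] by (simp add: norm_qmul power2_eq_square mult_ac)

lemma qmul_im_eq_Hopf_qmul: "norm q = 1 \<Longrightarrow> q \<odot> im c = im (Hopf c q) \<odot> q"
  by (simp add: im_Hopf qmul_assoc qcnj_qmul_self)

lemma inner_qmul_right: "(p \<odot> q) \<bullet> (r \<odot> q) = (p \<bullet> r) * (norm q)\<^sup>2"
  unfolding norm_quat_sq by (simp add: quat_simps inner_prod_def power2_eq_square algebra_simps)

text \<open>The real part of \<open>p \<odot> qcnj q\<close> is the inner product of p and q, so for
  tangent p this quotient is imaginary.\<close>

lemma tangent_eq_im_qmul: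
  assumes "norm q = 1" "p \<bullet> q = 0"
  obtains a where "p = im a \<odot> q"
proof -
  have "p \<odot> qcnj q = im (snd (p \<odot> qcnj q))"
    using assms(2) by (simp add: qmul_def qcnj_def im_def inner_prod_def)
  then have "p = im (snd (p \<odot> qcnj q)) \<odot> q"
    using assms(1) by (metis qcnj_qmul_self(1) qmul_assoc qmul_qone(2) power_one scaleR_one)
  then show ?thesis by (rule that)
qed

text \<open>Left multiplication of q acts on its image by conjugation, hence infinitesimally by the
  commutator with \<open>im a\<close>, which is twice a cross product.\<close>

lemma DHopf_im_qmul: "norm q = 1 \<Longrightarrow> DHopf c q (im a \<odot> q) = 2 *\<^sub>R cross3 a (Hopf c q)"
proof -
  assume q: "norm q = 1"
  have "im (DHopf c q (im a \<odot> q)) = im a \<odot> im (Hopf c q) - im (Hopf c q) \<odot> im a"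
    by (simp add: im_DHopf im_Hopf qcnj_qmul qcnj_im qmul_assoc qmul.minus_right)
  then show ?thesis unfolding im_commutator by (simp add: im_def)
qed

lemma inner_im_qmul_Hopf: "norm q = 1 \<Longrightarrow> (im a \<odot> q) \<bullet> (q \<odot> im c) = a \<bullet> Hopf c q"
  by (simp add: qmul_im_eq_Hopf_qmul inner_qmul_right) (simp add: im_def inner_prod_def)

text \<open>The pointwise content of the equation for smooth lifts. With p = a q and p' = b q the
  left side is 4 u . ((a x u) x (b x u)), and (a x u) x (b x u) = (a . (b x u)) u. On the right, q c
  = u q reduces the inner product to the same triple product.\<close>

lemma Hopf_volume_identity:
  assumes q: "norm q = 1" and c: "norm c = 1" and p: "p \<bullet> q = 0" "p' \<bullet> q = 0"
  shows "Hopf c q \<bullet> cross3 (DHopf c q p) (DHopf c q p') = 4 * (p \<bullet> (p' \<odot> im c))"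
proof -
  obtain a where a: "p = im a \<odot> q" using tangent_eq_im_qmul[OF q p(1)] .
  obtain b where b: "p' = im b \<odot> q" using tangent_eq_im_qmul[OF q p(2)] .
  let ?u = "Hopf c q"
  have u: "?u \<bullet> ?u = 1" using norm_Hopf[of c q] q c by (simp add: norm_eq_sqrt_inner)
  have "p' \<odot> im c = im b \<odot> im ?u \<odot> q" by (simp add: b qmul_assoc qmul_im_eq_Hopf_qmul[OF q])
  then have "p \<bullet> (p' \<odot> im c) = im a \<bullet> (im b \<odot> im ?u)" by (simp add: a inner_qmul_right q)
  also have "\<dots> = a \<bullet> cross3 b ?u" by (simp add: quat_simps inner_prod_def)
  finally have r: "p \<bullet> (p' \<odot> im c) = a \<bullet> cross3 b ?u" .
  have "cross3 (cross3 a ?u) (cross3 b ?u) = (a \<bullet> cross3 b ?u) *\<^sub>R ?u"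
    by (simp add: vec_eq_iff forall_3 cross3_def inner_vec_def sum_3 algebra_simps)
  then have "?u \<bullet> cross3 (cross3 a ?u) (cross3 b ?u) = a \<bullet> cross3 b ?u" using u by simp
  then show ?thesis
    unfolding r by (simp add: a b DHopf_im_qmul[OF q] cross_mult_left cross_mult_right)
qed

section \<open>Parallel transport along rays\<close>

definition ray :: "real^3 \<Rightarrow> real^3 \<Rightarrow> real \<Rightarrow> real^3" where
  "ray p x s = p + s *\<^sub>R (x - p)"

text \<open>Transport along the segment from \<open>p\<close> to \<open>x\<close>, started at 1. A
  solution is chosen, and later arguments use only that it is one. Its value at time 1, as a
  function of the end point, is the candidate for a solution of dg = A g.\<close>

definition transport :: "(real^3 \<Rightarrow> real^3 \<Rightarrow> real^3) \<Rightarrow> real^3 \<Rightarrow> real^3 \<Rightarrow> real \<Rightarrow> quat" where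
  "transport A p x = (SOME \<psi>. qsol (\<lambda>s. A (ray p x s) (x - p)) \<psi>)"

abbreviation gauge where "gauge A p x \<equiv> transport A p x 1"

text \<open>The integrability condition of dg = A g: equality of the mixed derivatives of g demands
  D_v A_w - D_w A_v = [A_v, A_w], and the bracket is twice the cross product. In
  \<open>DA y v w\<close> the direction of differentiation comes before the argument of the
  form.\<close>

definition curvature :: "(real^3 \<Rightarrow> real^3 \<Rightarrow> real^3) \<Rightarrow> (real^3 \<Rightarrow> real^3 \<Rightarrow> real^3 \<Rightarrow> real^3) \<Rightarrow>
    real^3 \<Rightarrow> real^3 \<Rightarrow> real^3 \<Rightarrow> real^3" where
  "curvature A DA y v w = DA y v w - DA y w v - 2 *\<^sub>R cross3 (A y v) (A y w)"

lemma continuous_on_ray[continuous_intros]: "continuous_on S (ray p x)"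
  unfolding ray_def[abs_def] by (intro continuous_intros)

lemma ray_has_vector_derivative: "(ray p x has_vector_derivative (x - p)) (at s within S)"
  unfolding ray_def[abs_def] by (auto intro!: derivative_eq_intros simp: has_vector_derivative_def)

lemma has_vector_derivative_quotient_LIMSEQ:
  assumes "(f has_vector_derivative f') (at 0)"
  shows "(\<lambda>n. real (Suc n) *\<^sub>R (f (inverse (real (Suc n))) - f 0)) \<longlonglongrightarrow> f'"
proof -
  have "((\<lambda>h. norm (f (0 + h) - f 0 - h *\<^sub>R f') / norm h) \<longlongrightarrow> 0) (at 0)"
    using assms by (simp add: has_vector_derivative_def has_derivative_at)
  moreover have "filterlim (\<lambda>n. inverse (real (Suc n))) (at 0) sequentially"
    by (rule filterlim_atI) (use LIMSEQ_inverse_real_of_nat in auto)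
  ultimately have "(\<lambda>n. norm (f (inverse (real (Suc n))) - f 0 - inverse (real (Suc n)) *\<^sub>R f') / norm (inverse (real (Suc n)))) \<longlonglongrightarrow> 0"
    by (auto dest: filterlim_compose)
  moreover have "norm (f (inverse (real (Suc n))) - f 0 - inverse (real (Suc n)) *\<^sub>R f') / norm (inverse (real (Suc n)))
    = norm (real (Suc n) *\<^sub>R (f (inverse (real (Suc n))) - f 0) - f')" for n
  proof -
    have "real (Suc n) *\<^sub>R (f (inverse (real (Suc n))) - f 0) - f'
      = real (Suc n) *\<^sub>R (f (inverse (real (Suc n))) - f 0 - inverse (real (Suc n)) *\<^sub>R f')"
      by (simp add: scaleR_diff_right del: of_nat_Suc)
    then show ?thesis by (simp add: divide_inverse mult.commute del: of_nat_Suc)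
  qed
  ultimately show ?thesis by (simp only:) (rule LIM_zero_cancel, rule tendsto_norm_zero_cancel)
qed

lemma has_vector_derivative_ray:
  assumes "(f has_derivative f') (at (ray p x s))"
  shows "((\<lambda>s. f (ray p x s)) has_vector_derivative f' (x - p)) (at s within S)"
proof -
  have "(f has_derivative f') (at (ray p x s) within ray p x ` S)" using assms by (rule has_derivative_at_withinI)
  from has_derivative_in_compose[OF ray_has_vector_derivative[unfolded has_vector_derivative_def] this]
  show ?thesis using linear_scale[OF has_derivative_linear[OF assms]] by (simp add: has_vector_derivative_def)
qed

text \<open>\<open>A y v\<close> is the value at \<open>v\<close> of a connection form, with values in the imaginary quaternions, and
  \<open>DA y w v\<close> is its derivative in direction \<open>w\<close>.\<close>

locale connection =
  fixes A :: "real^3 \<Rightarrow> real^3 \<Rightarrow> real^3" and DA :: "real^3 \<Rightarrow> real^3 \<Rightarrow> real^3 \<Rightarrow> real^3" and K :: real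
  assumes lin: "linear (A y)"
    and bound: "norm (A y v) \<le> K * norm v"
    and der: "((\<lambda>y. A y v) has_derivative (\<lambda>w. DA y w v)) (at y)"
    and dbound: "norm (DA y w v) \<le> K * norm w * norm v"
    and dcont: "continuous_on UNIV (\<lambda>y. DA y w v)"
begin

lemma K_nonneg: "K \<ge> 0"
  using order_trans[OF norm_ge_zero bound[of 0 "axis 1 1"]] by simp

lemma A_lipschitz: "norm (A y v - A y' v) \<le> K * norm v * norm (y - y')"
  by (rule differentiable_bound[of UNIV "\<lambda>y. A y v" "\<lambda>y w. DA y w v"])
     (use der dbound in \<open>auto intro!: onorm_bound mult_nonneg_nonneg K_nonneg simp: mult_ac\<close>)

lemma A_continuous: "continuous_on S (\<lambda>y. A y v)"
  using has_derivative_continuous[OF der] by (auto intro: continuous_at_imp_continuous_on)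

lemma A_ray_continuous: "continuous_on {0..1} (\<lambda>s. A (ray p x s) v)"
  by (rule continuous_on_compose2[OF A_continuous continuous_on_ray]) auto

lemma DA_ray_continuous: "continuous_on {0..1} (\<lambda>s. DA (ray p x s) w v)"
  by (rule continuous_on_compose2[OF dcont continuous_on_ray]) auto

lemma qsol_transport: "qsol (\<lambda>s. A (ray p x s) (x - p)) (transport A p x)"
  unfolding transport_def by (rule someI_ex[OF qsol_exists[OF A_ray_continuous]])

lemma transport_norm: "t \<in> {0..1} \<Longrightarrow> norm (transport A p x t) = 1"
  by (rule qsol_norm[OF qsol_transport])

lemma transport_continuous: "continuous_on {0..1} (transport A p x)"
  by (rule qsol_continuous[OF qsol_transport])

lemma transport_direction_lipschitz:
  assumes "s \<in> {0..1}"
  shows "norm (A (ray p y s) (y - p) - A (ray p x s) (x - p)) \<le> K * (norm (y - p) + 1) * norm (y - x)"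
proof -
  have "norm (A (ray p y s) (y - p) - A (ray p x s) (y - p)) \<le> K * norm (y - p) * norm (ray p y s - ray p x s)"
    by (rule A_lipschitz)
  also have "ray p y s - ray p x s = s *\<^sub>R (y - x)" by (simp add: ray_def algebra_simps)
  also have "K * norm (y - p) * norm (s *\<^sub>R (y - x)) \<le> K * norm (y - p) * norm (y - x)"
    using assms K_nonneg by (intro mult_left_mono) (auto intro: mult_left_le_one_le)
  finally have 1: "norm (A (ray p y s) (y - p) - A (ray p x s) (y - p)) \<le> K * norm (y - p) * norm (y - x)" .
  have "A (ray p x s) (y - p) - A (ray p x s) (x - p) = A (ray p x s) (y - x)"
    by (simp flip: linear_diff[OF lin])
  then have 2: "norm (A (ray p x s) (y - p) - A (ray p x s) (x - p)) \<le> K * norm (y - x)"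
    using bound by metis
  have "norm (A (ray p y s) (y - p) - A (ray p x s) (x - p)) \<le> K * norm (y - p) * norm (y - x) + K * norm (y - x)"
    using norm_triangle_mono[OF 1 2] by simp
  then show ?thesis by (simp add: algebra_simps)
qed

lemma transport_lipschitz:
  assumes t: "t \<in> {0..1}"
  shows "norm (transport A p y t - transport A p x t) \<le> K * (norm (y - p) + 1) * norm (y - x)"
proof -
  let ?a = "\<lambda>x s. A (ray p x s) (x - p)" and ?M = "K * (norm (y - p) + 1) * norm (y - x)"
  have "norm (transport A p y t - transport A p x t) \<le> integral {0..t} (\<lambda>s. norm (?a y s - ?a x s))"
    by (rule qsol_diff_le(1)[OF qsol_transport qsol_transport t A_ray_continuous A_ray_continuous])
  also have "\<dots> \<le> integral {0..t} (\<lambda>s. ?M)"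
  proof (rule integral_le)
    show "(\<lambda>s. norm (?a y s - ?a x s)) integrable_on {0..t}"
      using t by (intro integrable_continuous_real continuous_intros continuous_on_subset[OF A_ray_continuous]) auto
  qed (use t transport_direction_lipschitz in auto)
  also have "\<dots> = t * ?M" using t by simp
  also have "\<dots> \<le> 1 * ?M" using t K_nonneg by (intro mult_right_mono) auto
  finally have "norm (transport A p y t - transport A p x t) \<le> 1 * ?M" .
  then show ?thesis by simp
qed

text \<open>What separates the derivative of the gauge from A g: the curvature collected along the
  ray and carried to its end. The factor \<open>s\<close> is the displacement of the point at time s
  when the end point moves by \<open>v\<close>.\<close>

definition gauge_defect :: "real^3 \<Rightarrow> real^3 \<Rightarrow> real^3 \<Rightarrow> quat" where
  "gauge_defect p x v = gauge A p x \<odot> integral {0..1} (\<lambda>s. qcnj (transport A p x s) \<odot>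
     im (s *\<^sub>R curvature A DA (ray p x s) v (x - p)) \<odot> transport A p x s)"

lemma curvature_ray_continuous: "continuous_on {0..1} (\<lambda>s. curvature A DA (ray p x s) v w)"
  unfolding curvature_def
  by (intro continuous_intros DA_ray_continuous continuous_on_cross A_ray_continuous)

lemma gauge_defect_le: "norm (gauge_defect p x v) \<le> integral {0..1} (\<lambda>s. norm (curvature A DA (ray p x s) v (x - p)))"
proof -
  have "norm (gauge_defect p x v) = norm (integral {0..1} (\<lambda>s. qcnj (transport A p x s) \<odot>
     im (s *\<^sub>R curvature A DA (ray p x s) v (x - p)) \<odot> transport A p x s))"
    by (simp add: gauge_defect_def norm_qmul transport_norm)
  also have "\<dots> \<le> integral {0..1} (\<lambda>s. norm (curvature A DA (ray p x s) v (x - p)))"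
  proof (rule integral_norm_bound_integral)
    show "(\<lambda>s. qcnj (transport A p x s) \<odot> im (s *\<^sub>R curvature A DA (ray p x s) v (x - p)) \<odot> transport A p x s) integrable_on {0..1}"
      by (intro integrable_continuous_real continuous_intros transport_continuous curvature_ray_continuous)
    show "(\<lambda>s. norm (curvature A DA (ray p x s) v (x - p))) integrable_on {0..1}"
      by (intro integrable_continuous_real continuous_intros curvature_ray_continuous)
    show "norm (qcnj (transport A p x s) \<odot> im (s *\<^sub>R curvature A DA (ray p x s) v (x - p)) \<odot> transport A p x s)
        \<le> norm (curvature A DA (ray p x s) v (x - p))" if "s \<in> {0..1}" for s
      using that by (simp add: norm_qmul transport_norm mult_left_le_one_le)
  qed
  finally show ?thesis .
qed

text \<open>Comparing the transports to two nearby end points and passing to the limit gives a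
  conjugated integral of the variation of the connection along the ray. Subtracting the exact
  derivative of s A(v) leaves s times the curvature, that is, the defect. A limit along the steps
  1/(n+1) is all that the weak equation will ask for.\<close>

lemma gauge_difference_quotient:
  shows "(\<lambda>n. real (Suc n) *\<^sub>R (gauge A p (x + v /\<^sub>R real (Suc n)) - gauge A p x))
    \<longlonglongrightarrow> im (A x v) \<odot> gauge A p x + gauge_defect p x v"
proof -
  let ?T = "transport A p" and ?a = "\<lambda>x s. A (ray p x s) (x - p)"
  let ?x = "\<lambda>n. x + v /\<^sub>R real (Suc n)"
  define q where "q n s = real (Suc n) *\<^sub>R (?a (?x n) s - ?a x s)" for n s
  \<comment> \<open>\<open>d\<close> is the limit of \<open>q\<close>: the point at time s moves by
    s v, and the direction x - p moves by v.\<close>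
  define d where "d s = s *\<^sub>R DA (ray p x s) v (x - p) + A (ray p x s) v" for s
  have hi: "((\<lambda>s. qcnj (?T x s) \<odot> im (q n s) \<odot> ?T (?x n) s) has_integral
     (qcnj (?T x 1) \<odot> (real (Suc n) *\<^sub>R (?T (?x n) 1 - ?T x 1)))) {0..1}" for n
  proof -
    have "((\<lambda>s. qcnj (?T x s) \<odot> im (?a (?x n) s - ?a x s) \<odot> ?T (?x n) s) has_integral
       (qcnj (?T x 1) \<odot> (?T (?x n) 1 - ?T x 1))) {0..1}"
      by (rule qsol_diff_le(2)[OF qsol_transport qsol_transport _ A_ray_continuous A_ray_continuous]) auto
    from has_integral_cmul[OF this, of "real (Suc n)"] show ?thesis
      by (simp only: q_def im_linear(3) qmul.scaleR_left qmul.scaleR_right)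
  qed
  have xlim: "?x \<longlonglongrightarrow> x"
    using tendsto_add[OF tendsto_const tendsto_scaleR[OF LIMSEQ_inverse_real_of_nat tendsto_const], of x v] by simp
  have qlim: "(\<lambda>n. q n s) \<longlonglongrightarrow> d s" if s: "s \<in> {0..1}" for s
  proof -
    let ?D = "\<lambda>w. DA (ray p x s) (s *\<^sub>R w) (x - p)"
    have "((\<lambda>z. A (ray p z s) (x - p)) has_derivative ?D) (at x)"
      by (rule has_derivative_compose[OF _ der]) (auto simp: ray_def intro!: derivative_eq_intros)
    then have "((\<lambda>h. A (ray p (x + h *\<^sub>R v) s) (x - p)) has_derivative (\<lambda>h. ?D (h *\<^sub>R v))) (at 0)"
      by (intro has_derivative_compose[where g="\<lambda>z. A (ray p z s) (x - p)" and f="\<lambda>h. x + h *\<^sub>R v"])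
         (auto intro!: derivative_eq_intros)
    moreover have "?D (h *\<^sub>R v) = h *\<^sub>R (s *\<^sub>R DA (ray p x s) v (x - p))" for h
      using linear_scale[OF has_derivative_linear[OF der]] by (simp add: mult_ac)
    ultimately have "((\<lambda>h. A (ray p (x + h *\<^sub>R v) s) (x - p)) has_vector_derivative s *\<^sub>R DA (ray p x s) v (x - p)) (at 0)"
      by (simp add: has_vector_derivative_def)
    from has_vector_derivative_quotient_LIMSEQ[OF this]
    have 1: "(\<lambda>n. real (Suc n) *\<^sub>R (A (ray p (?x n) s) (x - p) - A (ray p x s) (x - p))) \<longlonglongrightarrow> s *\<^sub>R DA (ray p x s) v (x - p)"
      by simp
    have "(\<lambda>n. ray p (?x n) s) \<longlonglongrightarrow> ray p x s" unfolding ray_def by (intro tendsto_intros xlim)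
    from isCont_tendsto_compose[OF has_derivative_continuous[OF der] this]
    have 2: "(\<lambda>n. A (ray p (?x n) s) v) \<longlonglongrightarrow> A (ray p x s) v" .
    have "q n s = real (Suc n) *\<^sub>R (A (ray p (?x n) s) (x - p) - A (ray p x s) (x - p)) + A (ray p (?x n) s) v" for n
    proof -
      have "A (ray p (?x n) s) (?x n - p) = A (ray p (?x n) s) (x - p) + A (ray p (?x n) s) v /\<^sub>R real (Suc n)"
        by (simp add: linear_add[OF lin, symmetric] linear_scale[OF lin, symmetric] algebra_simps)
      then show ?thesis by (simp add: q_def scaleR_diff_right scaleR_add_right)
    qed
    then show ?thesis unfolding d_def using tendsto_add[OF 1 2] by (simp only:)
  qed
  have Tlim: "(\<lambda>n. ?T (?x n) s) \<longlonglongrightarrow> ?T x s" if s: "s \<in> {0..1}" for s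
  proof (rule LIM_zero_cancel, rule tendsto_norm_zero_cancel, rule tendsto_sandwich[OF _ _ tendsto_const])
    show "\<forall>\<^sub>F n in sequentially. norm (?T (?x n) s - ?T x s) \<le> K * (norm (?x n - p) + 1) * norm (?x n - x)"
      by (intro always_eventually allI transport_lipschitz[OF s])
    have "(\<lambda>n. K * (norm (?x n - p) + 1) * norm (?x n - x)) \<longlonglongrightarrow> K * (norm (x - p) + 1) * norm (x - x)"
      by (intro tendsto_intros xlim)
    then show "(\<lambda>n. K * (norm (?x n - p) + 1) * norm (?x n - x)) \<longlonglongrightarrow> 0" by simp
  qed auto
  \<comment> \<open>A majorant uniform in n, because v/(n+1) is never longer than v.\<close>
  define M where "M = K * (norm (x - p) + norm v + 1) * norm v"
  have "(\<lambda>n. integral {0..1} (\<lambda>s. qcnj (?T x s) \<odot> im (q n s) \<odot> ?T (?x n) s))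
    \<longlonglongrightarrow> integral {0..1} (\<lambda>s. qcnj (?T x s) \<odot> im (d s) \<odot> ?T x s)"
  proof (rule dominated_convergence(2)[where h="\<lambda>_. M"])
    show "(\<lambda>s. qcnj (?T x s) \<odot> im (q n s) \<odot> ?T (?x n) s) integrable_on {0..1}" for n using hi by blast
    show "(\<lambda>n. qcnj (?T x s) \<odot> im (q n s) \<odot> ?T (?x n) s) \<longlonglongrightarrow> qcnj (?T x s) \<odot> im (d s) \<odot> ?T x s" if "s \<in> {0..1}" for s
      by (intro tendsto_intros qlim Tlim that)
    show "norm (qcnj (?T x s) \<odot> im (q n s) \<odot> ?T (?x n) s) \<le> M" if s: "s \<in> {0..1}" for n s
    proof -
      have "norm (q n s) \<le> real (Suc n) * (K * (norm (?x n - p) + 1) * norm (?x n - x))"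
        unfolding q_def norm_scaleR using transport_direction_lipschitz[OF s, of p "?x n" x]
        by (simp del: of_nat_Suc add: mult_left_mono)
      also have "\<dots> = K * (norm (?x n - p) + 1) * norm v" by (simp del: of_nat_Suc)
      also have "norm (?x n - p) \<le> norm (x - p) + norm v"
      proof -
        have "norm (v /\<^sub>R real (Suc n)) \<le> norm v" by (simp add: divide_simps algebra_simps)
        then show ?thesis using norm_triangle_ineq[of "x - p" "v /\<^sub>R real (Suc n)"] by (simp add: algebra_simps)
      qed
      then have "K * (norm (?x n - p) + 1) * norm v \<le> M"
        unfolding M_def using K_nonneg by (intro mult_right_mono mult_left_mono) auto
      finally show ?thesis using s by (simp add: norm_qmul transport_norm)
    qed
  qed auto
  then have "(\<lambda>n. qcnj (?T x 1) \<odot> (real (Suc n) *\<^sub>R (?T (?x n) 1 - ?T x 1)))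
    \<longlonglongrightarrow> integral {0..1} (\<lambda>s. qcnj (?T x s) \<odot> im (d s) \<odot> ?T x s)"
    unfolding integral_unique[OF hi] .
  from tendsto_qmul[OF tendsto_const[of "?T x 1"] this]
  have "(\<lambda>n. ?T x 1 \<odot> (qcnj (?T x 1) \<odot> (real (Suc n) *\<^sub>R (?T (?x n) 1 - ?T x 1))))
    \<longlonglongrightarrow> ?T x 1 \<odot> integral {0..1} (\<lambda>s. qcnj (?T x s) \<odot> im (d s) \<odot> ?T x s)" .
  then have lim: "(\<lambda>n. real (Suc n) *\<^sub>R (?T (?x n) 1 - ?T x 1))
    \<longlonglongrightarrow> ?T x 1 \<odot> integral {0..1} (\<lambda>s. qcnj (?T x s) \<odot> im (d s) \<odot> ?T x s)"
    by (simp add: qcnj_qmul_self transport_norm del: of_nat_Suc flip: qmul_assoc)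
  let ?F = "\<lambda>s. curvature A DA (ray p x s) v (x - p)"
  \<comment> \<open>The s-derivative of s A(v) along the ray. It differs from \<open>d\<close> only
    in which argument of \<open>DA\<close> is the direction of differentiation; the difference is
    the curvature up to the bracket.\<close>
  let ?w = "\<lambda>s. A (ray p x s) v + s *\<^sub>R DA (ray p x s) (x - p) v"
  have dw: "((\<lambda>s. im (s *\<^sub>R A (ray p x s) v)) has_vector_derivative im (?w s)) (at s within {0..1})" if "s \<in> {0..1}" for s
  proof -
    have "((\<lambda>s. A (ray p x s) v) has_vector_derivative DA (ray p x s) (x - p) v) (at s within {0..1})"
      by (rule has_vector_derivative_ray[OF der])
    from has_vector_derivative_scaleR[OF DERIV_ident this]
    show ?thesis by (intro bounded_linear.has_vector_derivative[OF bounded_linear_im]) (simp add: add.commute)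
  qed
  have "((\<lambda>s. qcnj (?T x s) \<odot> (im (?w s) - im (?a x s) \<odot> im (s *\<^sub>R A (ray p x s) v) + im (s *\<^sub>R A (ray p x s) v) \<odot> im (?a x s)) \<odot> ?T x s)
    has_integral (qcnj (?T x 1) \<odot> im (1 *\<^sub>R A (ray p x 1) v) \<odot> ?T x 1 - im (0 *\<^sub>R A (ray p x 0) v))) {0..1}"
    by (rule qsol_ftc[OF qsol_transport qsol_transport dw]) auto
  then have hi2: "((\<lambda>s. qcnj (?T x s) \<odot> im (d s - s *\<^sub>R ?F s) \<odot> ?T x s) has_integral (qcnj (?T x 1) \<odot> im (A x v) \<odot> ?T x 1)) {0..1}"
  proof (rule has_integral_eq_rhs[OF has_integral_eq, rotated])
    show "qcnj (?T x 1) \<odot> im (A x v) \<odot> ?T x 1 = qcnj (?T x 1) \<odot> im (1 *\<^sub>R A (ray p x 1) v) \<odot> ?T x 1 - im (0 *\<^sub>R A (ray p x 0) v)"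
      by (simp add: ray_def im_linear im_def zero_prod_def[symmetric])
    fix s
    have "im (?w s) - im (?a x s) \<odot> im (s *\<^sub>R A (ray p x s) v) + im (s *\<^sub>R A (ray p x s) v) \<odot> im (?a x s)
      = im (?w s) - (im (?a x s) \<odot> im (s *\<^sub>R A (ray p x s) v) - im (s *\<^sub>R A (ray p x s) v) \<odot> im (?a x s))" by simp
    also have "\<dots> = im (?w s - 2 *\<^sub>R cross3 (?a x s) (s *\<^sub>R A (ray p x s) v))"
      by (simp only: im_commutator im_linear(2))
    also have "?w s - 2 *\<^sub>R cross3 (?a x s) (s *\<^sub>R A (ray p x s) v) = d s - s *\<^sub>R ?F s"
      unfolding d_def curvature_def cross_mult_right cross_skew[of "?a x s"] by (simp add: algebra_simps)
    finally show "qcnj (?T x s) \<odot> (im (?w s) - im (?a x s) \<odot> im (s *\<^sub>R A (ray p x s) v) + im (s *\<^sub>R A (ray p x s) v) \<odot> im (?a x s)) \<odot> ?T x s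
      = qcnj (?T x s) \<odot> im (d s - s *\<^sub>R ?F s) \<odot> ?T x s" by simp
  qed
  have i3: "(\<lambda>s. qcnj (?T x s) \<odot> im (s *\<^sub>R ?F s) \<odot> ?T x s) integrable_on {0..1}"
    by (intro integrable_continuous_real continuous_intros transport_continuous curvature_ray_continuous)
  have "((\<lambda>s. qcnj (?T x s) \<odot> im (d s) \<odot> ?T x s) has_integral
    (qcnj (?T x 1) \<odot> im (A x v) \<odot> ?T x 1 + integral {0..1} (\<lambda>s. qcnj (?T x s) \<odot> im (s *\<^sub>R ?F s) \<odot> ?T x s))) {0..1}"
    using has_integral_add[OF hi2 integrable_integral[OF i3]]
    by (simp only: qmul.add_left[symmetric] qmul.add_right[symmetric] im_linear(1)[symmetric] diff_add_cancel)
  then have "?T x 1 \<odot> integral {0..1} (\<lambda>s. qcnj (?T x s) \<odot> im (d s) \<odot> ?T x s)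
    = im (A x v) \<odot> ?T x 1 + gauge_defect p x v"
    unfolding gauge_defect_def
    by (simp add: integral_unique qmul.add_right qcnj_qmul_self transport_norm flip: qmul_assoc)
  with lim show ?thesis by (simp only:)
qed

text \<open>Carried back to the base point, u changes along the ray by its covariant derivative du -
  2 A x u. If this is small, u(x) is nearly the rotation of u(p) by the gauge.\<close>

lemma gauge_conjugation:
  assumes u: "\<And>y. (u has_derivative Du y) (at y)" and c: "\<And>w. continuous_on UNIV (\<lambda>y. Du y w)"
  shows "norm (qcnj (gauge A p x) \<odot> im (u x) \<odot> gauge A p x - im (u p))
    \<le> integral {0..1} (\<lambda>s. norm (Du (ray p x s) (x - p) - 2 *\<^sub>R cross3 (A (ray p x s) (x - p)) (u (ray p x s))))"
proof -
  let ?T = "transport A p x" and ?a = "\<lambda>s. A (ray p x s) (x - p)"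
  let ?E = "\<lambda>s. Du (ray p x s) (x - p) - 2 *\<^sub>R cross3 (?a s) (u (ray p x s))"
  have uc: "continuous_on UNIV u"
    using has_derivative_continuous[OF u] by (auto intro: continuous_at_imp_continuous_on)
  have Ec: "continuous_on {0..1} ?E"
    by (intro continuous_intros continuous_on_cross A_ray_continuous continuous_on_compose2[OF c continuous_on_ray]
      continuous_on_compose2[OF uc continuous_on_ray]) auto
  have dw: "((\<lambda>s. im (u (ray p x s))) has_vector_derivative im (Du (ray p x s) (x - p))) (at s within {0..1})" for s
    by (intro bounded_linear.has_vector_derivative[OF bounded_linear_im] has_vector_derivative_ray[OF u])
  have "((\<lambda>s. qcnj (?T s) \<odot> (im (Du (ray p x s) (x - p)) - im (?a s) \<odot> im (u (ray p x s)) + im (u (ray p x s)) \<odot> im (?a s)) \<odot> ?T s)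
    has_integral (qcnj (?T 1) \<odot> im (u (ray p x 1)) \<odot> ?T 1 - im (u (ray p x 0)))) {0..1}"
    by (rule qsol_ftc[OF qsol_transport qsol_transport dw]) auto
  moreover have "im (Du (ray p x s) (x - p)) - im (?a s) \<odot> im (u (ray p x s)) + im (u (ray p x s)) \<odot> im (?a s) = im (?E s)" for s
    unfolding im_linear(2) im_commutator[symmetric] by simp
  ultimately have hi: "((\<lambda>s. qcnj (?T s) \<odot> im (?E s) \<odot> ?T s) has_integral (qcnj (?T 1) \<odot> im (u x) \<odot> ?T 1 - im (u p))) {0..1}"
    by (simp add: ray_def)
  have "norm (qcnj (?T 1) \<odot> im (u x) \<odot> ?T 1 - im (u p)) = norm (integral {0..1} (\<lambda>s. qcnj (?T s) \<odot> im (?E s) \<odot> ?T s))"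
    using hi by (simp only: integral_unique)
  also have "\<dots> \<le> integral {0..1} (\<lambda>s. norm (?E s))"
  proof (rule integral_norm_bound_integral)
    show "(\<lambda>s. qcnj (?T s) \<odot> im (?E s) \<odot> ?T s) integrable_on {0..1}" using hi by blast
    show "(\<lambda>s. norm (?E s)) integrable_on {0..1}" by (intro integrable_continuous_real continuous_intros Ec)
    show "norm (qcnj (?T s) \<odot> im (?E s) \<odot> ?T s) \<le> norm (?E s)" if "s \<in> {0..1}" for s
      using that by (simp add: norm_qmul transport_norm)
  qed
  finally show ?thesis .
qed

end

lemma gauge_compare:
  assumes "connection A DA K" "connection A' DA' K'"
  shows "norm (gauge A' p x - gauge A p x) \<le> integral {0..1} (\<lambda>s. norm (A' (ray p x s) (x - p) - A (ray p x s) (x - p)))"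
  by (rule qsol_diff_le(1)[OF connection.qsol_transport[OF assms(1)] connection.qsol_transport[OF assms(2)] _
        connection.A_ray_continuous[OF assms(1)] connection.A_ray_continuous[OF assms(2)]]) auto

section \<open>Symmetry of second derivatives\<close>

lemma second_difference_mvt:
  fixes F :: "'a::euclidean_space \<Rightarrow> real"
  assumes F: "Ck_on 2 U F" and h: "h > 0"
    and box: "\<And>s t. s \<in> {0..h} \<Longrightarrow> t \<in> {0..h} \<Longrightarrow> x + s *\<^sub>R v + t *\<^sub>R w \<in> U"
  obtains s t where "s \<in> {0..h}" "t \<in> {0..h}"
    "F (x + h *\<^sub>R v + h *\<^sub>R w) - F (x + h *\<^sub>R v) - F (x + h *\<^sub>R w) + F x
     = h\<^sup>2 * frechet_derivative (\<lambda>y. frechet_derivative F (at y) v) (at (x + s *\<^sub>R v + t *\<^sub>R w)) w"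
proof -
  let ?D = "\<lambda>y. frechet_derivative F (at y) v"
  have F2: "Ck_on (Suc (Suc 0)) U F" using F by (simp add: numeral_2_eq_2)
  have dF: "(F has_derivative frechet_derivative F (at y)) (at y)" if "y \<in> U" for y
    using Ck_on_has_derivative[OF F2 that] .
  have dD: "(?D has_derivative frechet_derivative ?D (at y)) (at y)" if "y \<in> U" for y
    using F2 that by (intro Ck_on_has_derivative[of 0 U]) auto
  have line: "((\<lambda>r. G (a + r *\<^sub>R e)) has_real_derivative frechet_derivative G (at (a + r *\<^sub>R e)) e) (at r)"
    if "(G has_derivative frechet_derivative G (at (a + r *\<^sub>R e))) (at (a + r *\<^sub>R e))" for G :: "'a \<Rightarrow> real" and a e r
  proof -
    have "((\<lambda>r. a + r *\<^sub>R e) has_derivative (\<lambda>r. r *\<^sub>R e)) (at r)" by (auto intro!: derivative_eq_intros)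
    from has_derivative_compose[OF this that] linear_scale[OF has_derivative_linear[OF that]]
    show ?thesis by (simp add: has_field_derivative_def mult_commute_abs)
  qed
  have "\<exists>s. 0 < s \<and> s < h \<and> (F (x + h *\<^sub>R w + h *\<^sub>R v) - F (x + h *\<^sub>R v)) - (F (x + h *\<^sub>R w + 0 *\<^sub>R v) - F (x + 0 *\<^sub>R v))
      = (h - 0) * (?D (x + h *\<^sub>R w + s *\<^sub>R v) - ?D (x + s *\<^sub>R v))"
  proof (rule MVT2[OF h])
    fix r assume "0 \<le> r" "r \<le> h"
    then have "x + h *\<^sub>R w + r *\<^sub>R v \<in> U" "x + r *\<^sub>R v \<in> U"
      using box[of r h] box[of r 0] h by (auto simp: add_ac)
    then show "((\<lambda>r. F (x + h *\<^sub>R w + r *\<^sub>R v) - F (x + r *\<^sub>R v)) has_real_derivative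
      ?D (x + h *\<^sub>R w + r *\<^sub>R v) - ?D (x + r *\<^sub>R v)) (at r)"
      by (intro DERIV_diff line dF)
  qed
  then obtain s where s: "0 < s" "s < h" and eq1: "(F (x + h *\<^sub>R w + h *\<^sub>R v) - F (x + h *\<^sub>R v)) - (F (x + h *\<^sub>R w) - F x)
      = h * (?D (x + h *\<^sub>R w + s *\<^sub>R v) - ?D (x + s *\<^sub>R v))"
    by auto
  have "\<exists>t. 0 < t \<and> t < h \<and> ?D (x + s *\<^sub>R v + h *\<^sub>R w) - ?D (x + s *\<^sub>R v + 0 *\<^sub>R w)
      = (h - 0) * frechet_derivative ?D (at (x + s *\<^sub>R v + t *\<^sub>R w)) w"
    by (rule MVT2[OF h]) (use box s in \<open>auto intro!: line dD\<close>)
  then obtain t where t: "0 < t" "t < h" and eq2: "?D (x + s *\<^sub>R v + h *\<^sub>R w) - ?D (x + s *\<^sub>R v)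
      = h * frechet_derivative ?D (at (x + s *\<^sub>R v + t *\<^sub>R w)) w" by auto
  show ?thesis
    by (rule that[of s t]) (use s t eq1 eq2 in \<open>auto simp: power2_eq_square add_ac algebra_simps\<close>)
qed

text \<open>The second difference does not depend on the order of v and w. The mean value theorem
  equates it with h^2 times either mixed derivative at a point near x, and continuity at x forces
  the two to agree.\<close>

lemma symmetric_derivative_real:
  fixes F :: "'a::euclidean_space \<Rightarrow> real"
  assumes U: "open U" "x \<in> U" and F: "Ck_on 2 U F"
  shows "frechet_derivative (\<lambda>y. frechet_derivative F (at y) v) (at x) w
       = frechet_derivative (\<lambda>y. frechet_derivative F (at y) w) (at x) v"
proof (rule ccontr)
  let ?A = "\<lambda>v w y. frechet_derivative (\<lambda>y. frechet_derivative F (at y) v) (at y) w"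
  assume neq: "\<not> ?thesis"
  define e where "e = \<bar>?A v w x - ?A w v x\<bar> / 2"
  have e: "e > 0" using neq by (simp add: e_def)
  have cont: "isCont (?A v w) x" for v w
    using F U by (simp add: numeral_2_eq_2 continuous_on_eq_continuous_at)
  obtain d1 where d1: "d1 > 0" "\<And>y. dist y x < d1 \<Longrightarrow> \<bar>?A v w y - ?A v w x\<bar> < e"
    using cont[of v w] e unfolding continuous_at_eps_delta by (auto simp: dist_real_def)
  obtain d2 where d2: "d2 > 0" "\<And>y. dist y x < d2 \<Longrightarrow> \<bar>?A w v y - ?A w v x\<bar> < e"
    using cont[of w v] e unfolding continuous_at_eps_delta by (auto simp: dist_real_def)
  obtain d3 where d3: "d3 > 0" "ball x d3 \<subseteq> U" using U open_contains_ball by blast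
  define d where "d = min d1 (min d2 d3)"
  \<comment> \<open>Chosen so that the whole parallelogram with sides h v and h w stays within
    distance d of x.\<close>
  define h where "h = d / (2 * (norm v + norm w + 1))"
  have d: "d > 0" "d \<le> d1" "d \<le> d2" "d \<le> d3" using d1 d2 d3 by (auto simp: d_def)
  have N: "norm v + norm w + 1 > 0" by (simp add: add_nonneg_pos)
  have h: "h > 0" using d N by (simp add: h_def)
  have near: "dist (x + s *\<^sub>R v + t *\<^sub>R w) x < d" if "s \<in> {0..h}" "t \<in> {0..h}" for s t
  proof -
    have "norm (s *\<^sub>R v + t *\<^sub>R w) \<le> s * norm v + t * norm w"
      using that norm_triangle_ineq[of "s *\<^sub>R v" "t *\<^sub>R w"] by simp
    also have "\<dots> \<le> h * norm v + h * norm w" using that by (intro add_mono mult_right_mono) auto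
    also have "\<dots> < h * (2 * (norm v + norm w + 1))" using h N
      by (simp add: algebra_simps add_pos_nonneg add_nonneg_pos mult_nonneg_nonneg)
    also have "\<dots> = d" using N by (simp add: h_def)
    finally show ?thesis by (simp add: dist_norm add.assoc)
  qed
  have "x + s *\<^sub>R v + t *\<^sub>R w \<in> U" if "s \<in> {0..h}" "t \<in> {0..h}" for s t
    using near[OF that] d d3 by (auto simp: dist_commute subset_iff)
  then obtain s t where 1: "s \<in> {0..h}" "t \<in> {0..h}"
    "F (x + h *\<^sub>R v + h *\<^sub>R w) - F (x + h *\<^sub>R v) - F (x + h *\<^sub>R w) + F x = h\<^sup>2 * ?A v w (x + s *\<^sub>R v + t *\<^sub>R w)"
    using second_difference_mvt[OF F h] by metis
  have "x + s *\<^sub>R w + t *\<^sub>R v \<in> U" if "s \<in> {0..h}" "t \<in> {0..h}" for s t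
    using near[OF that(2,1)] d d3 by (auto simp: dist_commute subset_iff add_ac)
  then obtain s' t' where 2: "s' \<in> {0..h}" "t' \<in> {0..h}"
    "F (x + h *\<^sub>R w + h *\<^sub>R v) - F (x + h *\<^sub>R w) - F (x + h *\<^sub>R v) + F x = h\<^sup>2 * ?A w v (x + s' *\<^sub>R w + t' *\<^sub>R v)"
    using second_difference_mvt[OF F h] by metis
  have "h\<^sup>2 * ?A v w (x + s *\<^sub>R v + t *\<^sub>R w) = h\<^sup>2 * ?A w v (x + s' *\<^sub>R w + t' *\<^sub>R v)"
  proof -
    have "x + h *\<^sub>R w + h *\<^sub>R v = x + h *\<^sub>R v + h *\<^sub>R w" by (simp add: add_ac)
    with 1(3) 2(3) show ?thesis by (simp only:)
  qed
  then have "?A v w (x + s *\<^sub>R v + t *\<^sub>R w) = ?A w v (x + t' *\<^sub>R v + s' *\<^sub>R w)"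
    using h by (simp add: add_ac)
  moreover have "\<bar>?A v w (x + s *\<^sub>R v + t *\<^sub>R w) - ?A v w x\<bar> < e" using near[OF 1(1,2)] d by (intro d1) auto
  moreover have "\<bar>?A w v (x + t' *\<^sub>R v + s' *\<^sub>R w) - ?A w v x\<bar> < e" using near[OF 2(2,1)] d by (intro d2) auto
  moreover have False if "a = b" "\<bar>a - X\<bar> < \<bar>X - Y\<bar> / 2" "\<bar>b - Y\<bar> < \<bar>X - Y\<bar> / 2" for a b X Y :: real
    using that abs_triangle_ineq[of "X - a" "a - Y"] by (simp add: abs_minus_commute)
  ultimately show False unfolding e_def by blast
qed

lemma symmetric_derivative:
  fixes F :: "'a::euclidean_space \<Rightarrow> 'b::euclidean_space"
  assumes U: "open U" "x \<in> U" and F: "Ck_on 2 U F"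
  shows "frechet_derivative (\<lambda>y. frechet_derivative F (at y) v) (at x) w
       = frechet_derivative (\<lambda>y. frechet_derivative F (at y) w) (at x) v"
proof (rule euclidean_eqI)
  fix b :: 'b assume "b \<in> Basis"
  have F2: "Ck_on (Suc (Suc 0)) U F" using F by (simp add: numeral_2_eq_2)
  have bl: "bounded_linear (\<lambda>z. z \<bullet> b)" by (rule bounded_linear_inner_left)
  have 1: "frechet_derivative (\<lambda>y. F y \<bullet> b) (at y) v = frechet_derivative F (at y) v \<bullet> b" if "y \<in> U" for y v
    using frechet_derivative_at[OF bounded_linear.has_derivative[OF bl Ck_on_has_derivative[OF F2 that]]] by metis
  have 2: "frechet_derivative (\<lambda>y. frechet_derivative (\<lambda>y. F y \<bullet> b) (at y) v) (at x) w
    = frechet_derivative (\<lambda>y. frechet_derivative F (at y) v) (at x) w \<bullet> b" for v w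
  proof -
    have "Ck_on (Suc 0) U (\<lambda>y. frechet_derivative F (at y) v)" using F2 by auto
    from bounded_linear.has_derivative[OF bl Ck_on_has_derivative[OF this U(2)]]
    have "((\<lambda>y. frechet_derivative (\<lambda>y. F y \<bullet> b) (at y) v) has_derivative
      (\<lambda>w. frechet_derivative (\<lambda>y. frechet_derivative F (at y) v) (at x) w \<bullet> b)) (at x)"
      by (rule has_derivative_transform_within_open[OF _ U]) (simp add: 1)
    from frechet_derivative_at[OF this] show ?thesis by metis
  qed
  show "frechet_derivative (\<lambda>y. frechet_derivative F (at y) v) (at x) w \<bullet> b
       = frechet_derivative (\<lambda>y. frechet_derivative F (at y) w) (at x) v \<bullet> b"
    unfolding 2[symmetric]
    by (rule symmetric_derivative_real[OF U Ck_on_bounded_linear[OF bl U(1) F]])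
qed

text \<open>Compact support turns smoothness into the global bounds that \<open>connection\<close>
  asks for; a basis suffices by linearity in \<open>v\<close>.\<close>

lemma connectionI:
  assumes lin: "\<And>y. linear (A y)" and A: "\<And>v. test_kernel R (\<lambda>y. A y v)"
  shows "\<exists>K. connection A (\<lambda>y w v. frechet_derivative (\<lambda>y. A y v) (at y) w) K"
proof -
  let ?DA = "\<lambda>y w v. frechet_derivative (\<lambda>y. A y v) (at y) w"
  have der: "((\<lambda>y. A y v) has_derivative (\<lambda>w. ?DA y w v)) (at y)" for y v
    by (rule test_kernel_has_derivative[OF A])
  have "\<exists>K. \<forall>y. norm (A y b) \<le> K" for b
    using test_kernel_bounded[OF A[of b]] by metis
  then obtain K where K: "\<And>b y. norm (A y b) \<le> K b" by metis
  have "\<exists>L. \<forall>y w. norm (?DA y w b) \<le> L * norm w" for b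
    using test_kernel_derivative_bounded[OF A[of b]] by metis
  then obtain L where L: "\<And>b y w. norm (?DA y w b) \<le> L b * norm w" by metis
  have linD: "linear (?DA y w)" for y w
  proof (rule linearI)
    show "?DA y w (v + v') = ?DA y w v + ?DA y w v'" for v v'
      using frechet_derivative_at[OF has_derivative_add[OF der[of v y] der[of v' y]]]
      by (simp add: linear_add[OF lin] fun_eq_iff)
    show "?DA y w (r *\<^sub>R v) = r *\<^sub>R ?DA y w v" for r v
      using frechet_derivative_at[OF has_derivative_scaleR_right[OF der[of v y], of r]]
      by (simp add: linear_scale[OF lin] fun_eq_iff)
  qed
  define M where "M = max (\<Sum>b\<in>Basis. K b) (\<Sum>b\<in>Basis. L b)"
  have "connection A ?DA M"
  proof
    show "norm (A y v) \<le> M * norm v" for y v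
      by (rule order_trans[OF linear_norm_bound_Basis[OF lin K]]) (auto simp: M_def intro: mult_right_mono)
    show "norm (?DA y w v) \<le> M * norm w * norm v" for y w v
    proof -
      have "norm (?DA y w v) \<le> (\<Sum>b\<in>Basis. L b * norm w) * norm v" by (rule linear_norm_bound_Basis[OF linD L])
      also have "\<dots> = (\<Sum>b\<in>Basis. L b) * (norm w * norm v)" by (simp add: sum_distrib_right mult.assoc)
      also have "\<dots> \<le> M * (norm w * norm v)" by (intro mult_right_mono) (auto simp: M_def)
      finally show ?thesis by (simp add: mult.assoc)
    qed
    show "continuous_on UNIV (\<lambda>y. ?DA y w v)" for w v
      by (rule test_kernel_continuous[OF test_kernel_derivative[OF A]])
  qed (use lin der in \<open>auto simp: linear_add linear_scale\<close>)
  then show ?thesis by blast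
qed

text \<open>At a boundary point only directions y - x with y in the ball are visible. They determine
  the derivative, since any small v is (v - x) - (0 - x), a difference of two of them.\<close>

lemma frechet_derivative_within_cball:
  fixes f :: "'a::euclidean_space \<Rightarrow> 'b::real_normed_vector"
  assumes f: "(f has_derivative f') (at x)" and x: "norm x \<le> 1"
  shows "frechet_derivative f (at x within cball 0 1) = f'"
proof -
  let ?B = "cball 0 1 :: 'a set"
  define g where "g = frechet_derivative f (at x within ?B)"
  have fB: "(f has_derivative f') (at x within ?B)" using f by (rule has_derivative_at_withinI)
  then have gB: "(f has_derivative g) (at x within ?B)"
    unfolding g_def by (subst frechet_derivative_works[symmetric]) (auto simp: differentiable_def)
  have lf: "linear f'" and lg: "linear g" using fB gB has_derivative_linear by blast+
  have eq: "f' (y - x) = g (y - x)" if y: "norm y \<le> 1" for y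
  proof -
    let ?c = "\<lambda>t. x + t *\<^sub>R (y - x)"
    have sub: "?c ` {0..1} \<subseteq> ?B"
    proof safe
      fix t :: real assume t: "t \<in> {0..1}"
      have "?c t = (1 - t) *\<^sub>R x + t *\<^sub>R y" by (simp add: algebra_simps)
      then show "?c t \<in> ?B" using convex_cball[of "0::'a" 1] t x y by (auto simp: convex_alt)
    qed
    have "(?c has_derivative (\<lambda>t. t *\<^sub>R (y - x))) (at 0 within {0..1})" by (auto intro!: derivative_eq_intros)
    then have comp: "((\<lambda>t. f (?c t)) has_derivative (\<lambda>t. h (t *\<^sub>R (y - x)))) (at 0 within {0..1})"
      if "(f has_derivative h) (at x within ?B)" for h
      by (rule has_derivative_in_compose) (use has_derivative_subset[OF that sub] in simp)
    have "((\<lambda>t. f (?c t)) has_vector_derivative f' (y - x)) (at 0 within cbox 0 (1::real))"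
      using comp[OF fB] by (simp add: has_vector_derivative_def linear_scale[OF lf])
    moreover have "((\<lambda>t. f (?c t)) has_vector_derivative g (y - x)) (at 0 within cbox 0 (1::real))"
      using comp[OF gB] by (simp add: has_vector_derivative_def linear_scale[OF lg])
    ultimately show ?thesis
      by (intro vector_derivative_unique_within_closed_interval[of 0 1 0]) auto
  qed
  have "f' v = g v" for v
  proof -
    obtain s :: real where s: "s > 0" "norm (s *\<^sub>R v) \<le> 1"
      by (rule that[of "1 / (norm v + 1)"]) (auto simp: divide_simps add_nonneg_pos)
    have "f' (s *\<^sub>R v) = f' (s *\<^sub>R v - x) - f' (0 - x)" by (simp flip: linear_diff[OF lf])
    also have "\<dots> = g (s *\<^sub>R v - x) - g (0 - x)" using eq[OF s(2)] eq[of 0] by simp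
    also have "\<dots> = g (s *\<^sub>R v)" by (simp flip: linear_diff[OF lg])
    finally show ?thesis using s by (simp add: linear_scale[OF lf] linear_scale[OF lg])
  qed
  then show ?thesis by (simp add: g_def fun_eq_iff)
qed

lemma integral_test_kernel_derivative:
  fixes F :: "'a::euclidean_space \<Rightarrow> 'b::euclidean_space"
  assumes F: "test_kernel R F" and v: "norm v \<le> 1"
  shows "(LINT x|lborel. frechet_derivative F (at x) v) = 0"
proof -
  obtain K where K: "K > 0" "\<And>z v. norm (frechet_derivative F (at z) v) \<le> K * norm v"
    using test_kernel_derivative_bounded[OF F] by metis
  note D = test_kernel_has_derivative[OF F]
  show ?thesis
  proof (rule integral_directional_derivative_zero(2)[of F R v K])
    show "F x = 0" if "norm x > R" for x using F that by (simp add: test_kernel_def)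
    show "norm (real (Suc n) *\<^sub>R (F (x + v /\<^sub>R real (Suc n)) - F x)) \<le> K" for n x
    proof -
      have "norm (F (x + v /\<^sub>R real (Suc n)) - F x) \<le> K * norm (x + v /\<^sub>R real (Suc n) - x)"
        by (rule differentiable_bound[of UNIV F "\<lambda>x. frechet_derivative F (at x)"])
           (use D K in \<open>auto intro!: onorm_bound\<close>)
      then have "real (Suc n) * norm (F (x + v /\<^sub>R real (Suc n)) - F x) \<le> K * norm v"
        by (simp add: divide_simps mult.commute del: of_nat_Suc)
      also have "\<dots> \<le> K" using K v by (simp add: mult_left_le)
      finally show ?thesis by (simp del: of_nat_Suc)
    qed
    show "(\<lambda>n. real (Suc n) *\<^sub>R (F (x + v /\<^sub>R real (Suc n)) - F x)) \<longlonglongrightarrow> frechet_derivative F (at x) v" for x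
    proof -
      have "((\<lambda>h. x + h *\<^sub>R v) has_derivative (\<lambda>h. h *\<^sub>R v)) (at 0)" by (auto intro!: derivative_eq_intros)
      from has_derivative_compose[OF this, of F "frechet_derivative F (at x)"] D[of x] linear_scale[OF has_derivative_linear[OF D[of x]]]
      have "((\<lambda>h. F (x + h *\<^sub>R v)) has_vector_derivative frechet_derivative F (at x) v) (at 0)"
        by (simp add: has_vector_derivative_def)
      from has_vector_derivative_quotient_LIMSEQ[OF this] show ?thesis by simp
    qed
  qed (use v test_kernel_continuous[OF F] in auto)
qed

lemma linear_norm_bound_axis:
  fixes L :: "real^3 \<Rightarrow> 'b::real_normed_vector"
  assumes L: "linear L"
  shows "norm (L w) \<le> (\<Sum>j\<in>UNIV. norm (L (axis j 1))) * norm w"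
proof -
  have "L w = L (\<Sum>j\<in>UNIV. w $ j *\<^sub>R axis j 1)"
    using basis_expansion[of w] by (simp add: scalar_mult_eq_scaleR)
  also have "\<dots> = (\<Sum>j\<in>UNIV. w $ j *\<^sub>R L (axis j 1))"
    by (simp add: linear_sum[OF L] linear_scale[OF L])
  also have "norm \<dots> \<le> (\<Sum>j\<in>UNIV. norm (L (axis j 1)) * norm w)"
    by (intro order_trans[OF norm_sum] sum_mono)
       (auto simp: mult.commute[of "norm (L _)"] component_le_norm_cart intro!: mult_right_mono)
  finally show ?thesis by (simp add: sum_distrib_right)
qed

abbreviation unit_interval_measure :: "real measure" where
  "unit_interval_measure \<equiv> restrict_space lborel {0..1}"

text \<open>A bridge from the Henstock-Kurzweil integrals of the ray estimates to measure theory;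
  extending \<open>h\<close> by 0 makes it Borel on the line.\<close>

lemma integral_unit_interval_le_nn_integral:
  fixes h :: "real \<Rightarrow> real"
  assumes h: "continuous_on {0..1} h" "\<And>t. t \<in> {0..1} \<Longrightarrow> 0 \<le> h t"
    and G: "\<And>t. t \<in> {0..1} \<Longrightarrow> ennreal (h t) \<le> G t"
  shows "ennreal (integral {0..1} h) \<le> (\<integral>\<^sup>+t. G t \<partial>unit_interval_measure)"
proof -
  define h' where "h' t = (if t \<in> {0..1} then h t else 0)" for t
  have hi: "(h' has_integral integral {0..1} h) {0..1}"
    by (rule has_integral_eq[OF _ integrable_integral[OF integrable_continuous_real[OF h(1)]]]) (simp add: h'_def)
  have "(\<lambda>t. indicator {0..1} t *\<^sub>R h t) \<in> borel_measurable borel"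
    by (rule borel_measurable_continuous_on_indicator[OF _ h(1)]) simp
  also have "(\<lambda>t. indicator {0..1} t *\<^sub>R h t) = h'" by (auto simp: h'_def indicator_def)
  finally have "(\<integral>\<^sup>+t. indicator {0..1} t * h' t \<partial>lborel) = ennreal (integral {0..1} h)"
    using nn_integral_has_integral_lebesgue[OF _ hi] h(2) by (simp add: h'_def)
  then have "ennreal (integral {0..1} h) = (\<integral>\<^sup>+t. indicator {0..1} t * h' t \<partial>lborel)" by simp
  also have "\<dots> \<le> (\<integral>\<^sup>+t. G t * indicator {0..1} t \<partial>lborel)"
    by (intro nn_integral_mono) (auto simp: indicator_def h'_def G)
  also have "\<dots> = (\<integral>\<^sup>+t. G t \<partial>unit_interval_measure)"
    by (subst nn_integral_restrict_space) auto
  finally show ?thesis .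
qed

lemma AE_uball_ex:
  assumes "AE p in (uball :: 'a::euclidean_space measure). P p"
  obtains p where "norm p \<le> 1" "P p"
proof -
  have "emeasure lborel (ball (0::'a) 1) \<noteq> 0"
  proof
    assume "emeasure lborel (ball (0::'a) 1) = 0"
    then have "measure lborel (ball (0::'a) 1) = 0" by (simp add: measure_def)
    with content_ball_pos[of 1 "0::'a"] show False by simp
  qed
  moreover have "ball (0::'a) 1 \<subseteq> cball 0 1" by auto
  ultimately have pos: "emeasure (uball::'a measure) (space uball) \<noteq> 0"
    using emeasure_mono[of "ball (0::'a) 1" "cball 0 1" lborel] by (auto simp: emeasure_restrict_space)
  have all: "{x \<in> space (uball :: 'a measure). \<not> False} = space uball"
    by (simp only: not_False_eq_True simp_thms Collect_mem_eq)
  have F: "\<not> (AE p in (uball :: 'a measure). False)"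
    unfolding AE_iff_measurable[OF sets.top all] by (rule pos)
  have "\<exists>p. norm p \<le> 1 \<and> P p"
  proof (rule ccontr)
    assume neg: "\<not> ?thesis"
    have "AE p in (uball :: 'a measure). False"
      by (rule AE_mp[OF assms]) (use neg in \<open>auto intro!: AE_I2\<close>)
    with F show False by blast
  qed
  then show ?thesis using that by blast
qed

lemma test_function_test_kernel:
  assumes "test_function (cball 0 1) \<phi>"
  shows "test_kernel 1 \<phi>" "norm x \<ge> 1 \<Longrightarrow> \<phi> x = 0"
proof -
  have sub: "closure {x. \<phi> x \<noteq> 0} \<subseteq> ball 0 1" and sm: "smooth_on UNIV \<phi>"
    using assms unfolding test_function_def interior_cball by blast+
  show 0: "\<phi> x = 0" if "norm x \<ge> 1" for x
  proof (rule ccontr)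
    assume "\<phi> x \<noteq> 0"
    then have "x \<in> closure {x. \<phi> x \<noteq> 0}" by (intro closure_subset[THEN subsetD]) simp
    with sub have "x \<in> ball 0 1" by (rule subsetD)
    then show False using that by simp
  qed
  show "test_kernel 1 \<phi>" using sm 0 by (auto simp: test_kernel_def smooth_on_UNIV_iff)
qed

lemma integral_lborel_eq_uball:
  fixes h :: "'a::euclidean_space \<Rightarrow> 'b::euclidean_space"
  assumes "\<And>x. norm x > 1 \<Longrightarrow> h x = 0"
  shows "(LINT x|lborel. h x) = (LINT x|uball. h x)" "integrable lborel h \<longleftrightarrow> integrable uball h"
proof -
  have "(\<lambda>x. indicator (cball 0 1) x *\<^sub>R h x) = h" using assms by (fastforce simp: indicator_def)
  then show "(LINT x|lborel. h x) = (LINT x|uball. h x)" "integrable lborel h \<longleftrightarrow> integrable uball h"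
    by (simp_all add: integral_restrict_space integrable_restrict_space)
qed

text \<open>\<open>S k\<close> gathers the three errors of the k-th approximation: the distance of
  the connection from its limit \<open>a\<close>, its curvature, and the failure of
  \<open>U k\<close> to be parallel. Its integrals decay geometrically, so the sum over k is
  integrable; that sum provides the majorants, both pointwise and along rays. The bounds
  \<open>K k\<close> need not be uniform in k.\<close>

locale gauge_sequence =
  fixes A :: "nat \<Rightarrow> real^3 \<Rightarrow> real^3 \<Rightarrow> real^3" and DA :: "nat \<Rightarrow> real^3 \<Rightarrow> real^3 \<Rightarrow> real^3 \<Rightarrow> real^3"
    and K :: "nat \<Rightarrow> real" and U :: "nat \<Rightarrow> real^3 \<Rightarrow> real^3" and DU :: "nat \<Rightarrow> real^3 \<Rightarrow> real^3 \<Rightarrow> real^3"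
    and a :: "3 \<Rightarrow> real^3 \<Rightarrow> real^3" and u :: "real^3 \<Rightarrow> real^3" and S :: "nat \<Rightarrow> real^3 \<Rightarrow> real"
  defines "S k y \<equiv> (\<Sum>j\<in>UNIV. norm (A k y (axis j 1) - a j y))
      + (\<Sum>i\<in>UNIV. \<Sum>j\<in>UNIV. norm (curvature (A k) (DA k) y (axis i 1) (axis j 1)))
      + (\<Sum>j\<in>UNIV. norm (DU k y (axis j 1) - 2 *\<^sub>R cross3 (A k y (axis j 1)) (U k y)))"
  assumes conn: "connection (A k) (DA k) (K k)"
    and U: "(U k has_derivative DU k y) (at y)" "continuous_on UNIV (\<lambda>y. DU k y w)"
    and a[measurable]: "a j \<in> borel_measurable borel" and a_int: "integrable uball (a j)"
    and u: "AE x in uball. norm (u x) = 1" "AE x in uball. (\<lambda>k. U k x) \<longlonglongrightarrow> u x"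
    and S_int: "(\<integral>\<^sup>+y. ennreal (S k y) \<partial>uball) \<le> ennreal ((1/2) ^ k)"
begin

lemma S_nonneg: "0 \<le> S k y"
  unfolding S_def by (intro add_nonneg_nonneg sum_nonneg) auto

lemma DA_linear: "linear (DA k y v)"
proof -
  interpret c: connection "A k" "DA k" "K k" by (rule conn)
  show ?thesis
  proof (rule linearI)
    show "DA k y v (w + w') = DA k y v w + DA k y v w'" for w w'
      using has_derivative_unique[OF has_derivative_add[OF c.der[of w y] c.der[of w' y]], of "\<lambda>v. DA k y v (w + w')"]
        c.der[of "w + w'" y] by (simp add: linear_add[OF c.lin] fun_eq_iff)
    show "DA k y v (r *\<^sub>R w) = r *\<^sub>R DA k y v w" for r w
      using has_derivative_unique[OF has_derivative_scaleR_right[OF c.der[of w y], of r], of "\<lambda>v. DA k y v (r *\<^sub>R w)"]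
        c.der[of "r *\<^sub>R w" y] by (simp add: linear_scale[OF c.lin] fun_eq_iff)
  qed
qed

lemma curvature_linear: "linear (curvature (A k) (DA k) y v)"
proof -
  interpret c: connection "A k" "DA k" "K k" by (rule conn)
  have lw: "linear (\<lambda>w. DA k y w v)" by (rule has_derivative_linear[OF c.der])
  show ?thesis
    unfolding curvature_def
    by (intro linearI)
       (simp_all add: linear_add[OF DA_linear] linear_scale[OF DA_linear] linear_add[OF c.lin] linear_scale[OF c.lin]
         linear_add[OF lw] linear_scale[OF lw] cross_add_right cross_mult_right algebra_simps)
qed

lemma defect_linear: "linear (\<lambda>w. DU k y w - 2 *\<^sub>R cross3 (A k y w) (U k y))"
proof -
  interpret c: connection "A k" "DA k" "K k" by (rule conn)
  show ?thesis
    by (intro linearI)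
       (simp_all add: linear_add[OF has_derivative_linear[OF U(1)]] linear_scale[OF has_derivative_linear[OF U(1)]]
         linear_add[OF c.lin] linear_scale[OF c.lin] cross_add_left cross_mult_left algebra_simps)
qed

text \<open>The length 2 is that of \<open>x - p\<close> for two points of the unit ball, the vector
  along which forms are evaluated on a ray. The first argument of the curvature stays a coordinate
  direction.\<close>

lemma bounds:
  assumes w: "norm w \<le> 2"
  shows "norm (A k y w - A l y w) \<le> 2 * (S k y + S l y)"
    and "norm (curvature (A k) (DA k) y (axis i 1) w) \<le> 2 * S k y"
    and "norm (DU k y w - 2 *\<^sub>R cross3 (A k y w) (U k y)) \<le> 2 * S k y"
    and "norm (A k y (axis j 1) - a j y) \<le> S k y"
proof -
  let ?s1 = "\<lambda>k. \<Sum>j\<in>UNIV. norm (A k y (axis j 1) - a j y)"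
  let ?s2 = "\<lambda>k. \<Sum>i\<in>UNIV. \<Sum>j\<in>UNIV. norm (curvature (A k) (DA k) y (axis i 1) (axis j 1))"
  let ?s3 = "\<lambda>k. \<Sum>j\<in>UNIV. norm (DU k y (axis j 1) - 2 *\<^sub>R cross3 (A k y (axis j 1)) (U k y))"
  have nn: "?s1 k \<ge> 0" "?s2 k \<ge> 0" "?s3 k \<ge> 0" for k by (intro sum_nonneg norm_ge_zero)+
  have le: "?s1 k \<le> S k y" "?s2 k \<le> S k y" "?s3 k \<le> S k y" for k
    using nn[of k] unfolding S_def by linarith+
  have gen: "norm (L w) \<le> 2 * M" if "linear L" "(\<Sum>j\<in>UNIV. norm (L (axis j 1))) \<le> M" for L :: "real^3 \<Rightarrow> real^3" and M
  proof -
    have s: "0 \<le> (\<Sum>j\<in>UNIV. norm (L (axis j 1)))" by (intro sum_nonneg) auto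
    have "norm (L w) \<le> (\<Sum>j\<in>UNIV. norm (L (axis j 1))) * norm w" by (rule linear_norm_bound_axis[OF that(1)])
    also have "\<dots> \<le> M * 2" using w s that(2) by (intro mult_mono) auto
    finally show ?thesis by simp
  qed
  interpret c: connection "A k" "DA k" "K k" by (rule conn)
  interpret cl: connection "A l" "DA l" "K l" by (rule conn)
  show "norm (A k y w - A l y w) \<le> 2 * (S k y + S l y)"
  proof (rule gen)
    show "linear (\<lambda>w. A k y w - A l y w)" by (rule linear_compose_sub[OF c.lin cl.lin])
    have "(\<Sum>j\<in>UNIV. norm (A k y (axis j 1) - A l y (axis j 1))) \<le> ?s1 k + ?s1 l"
      unfolding sum.distrib[symmetric]
    proof (rule sum_mono)
      fix j :: 3
      show "norm (A k y (axis j 1) - A l y (axis j 1)) \<le> norm (A k y (axis j 1) - a j y) + norm (A l y (axis j 1) - a j y)"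
        using norm_triangle_ineq4[of "A k y (axis j 1) - a j y" "A l y (axis j 1) - a j y"] by simp
    qed
    then show "(\<Sum>j\<in>UNIV. norm (A k y (axis j 1) - A l y (axis j 1))) \<le> S k y + S l y" using le[of k] le[of l] by linarith
  qed
  show "norm (curvature (A k) (DA k) y (axis i 1) w) \<le> 2 * S k y"
  proof (rule gen[OF curvature_linear])
    have "(\<Sum>j\<in>UNIV. norm (curvature (A k) (DA k) y (axis i 1) (axis j 1))) \<le> ?s2 k"
      by (rule member_le_sum) (auto intro: sum_nonneg)
    then show "(\<Sum>j\<in>UNIV. norm (curvature (A k) (DA k) y (axis i 1) (axis j 1))) \<le> S k y" using le[of k] by linarith
  qed
  show "norm (DU k y w - 2 *\<^sub>R cross3 (A k y w) (U k y)) \<le> 2 * S k y"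
    by (rule gen[OF defect_linear le(3)])
  have "norm (A k y (axis j 1) - a j y) \<le> ?s1 k" by (rule member_le_sum) auto
  then show "norm (A k y (axis j 1) - a j y) \<le> S k y" using le[of k] by linarith
qed

lemma measurable_pieces[measurable]:
  "(\<lambda>y. A k y v) \<in> borel_measurable borel" "(\<lambda>y. DA k y w v) \<in> borel_measurable borel"
  "U k \<in> borel_measurable borel" "(\<lambda>y. DU k y w) \<in> borel_measurable borel"
proof -
  interpret c: connection "A k" "DA k" "K k" by (rule conn)
  show "(\<lambda>y. A k y v) \<in> borel_measurable borel" "(\<lambda>y. DA k y w v) \<in> borel_measurable borel"
    by (rule borel_measurable_continuous_onI, rule c.A_continuous c.dcont)+
  have "continuous_on UNIV (U k)"
    using has_derivative_continuous[OF U(1)] by (auto intro: continuous_at_imp_continuous_on)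
  then show "U k \<in> borel_measurable borel" by (rule borel_measurable_continuous_onI)
  show "(\<lambda>y. DU k y w) \<in> borel_measurable borel" by (rule borel_measurable_continuous_onI[OF U(2)])
qed

lemma S_measurable[measurable]: "S k \<in> borel_measurable borel"
  unfolding S_def[abs_def] curvature_def by measurable

definition Stot :: "real^3 \<Rightarrow> ennreal" where
  "Stot y = (\<Sum>k. ennreal (S k y))"

lemma Stot_measurable[measurable]: "Stot \<in> borel_measurable borel"
  unfolding Stot_def[abs_def] by measurable

lemma Stot_finite: "(\<integral>\<^sup>+y. Stot y \<partial>uball) < \<infinity>"
proof -
  have "(\<integral>\<^sup>+y. Stot y \<partial>uball) = (\<Sum>k. \<integral>\<^sup>+y. ennreal (S k y) \<partial>uball)"
    unfolding Stot_def by (rule nn_integral_suminf) measurable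
  also have "\<dots> \<le> (\<Sum>k. ennreal ((1/2) ^ k))" by (intro suminf_le S_int) auto
  also have "\<dots> = ennreal 2" by (rule suminf_ennreal_eq) (use geometric_sums[of "1/2::real"] in auto)
  finally show ?thesis by (simp add: le_less_trans)
qed

text \<open>\<open>Stot\<close> is known to be integrable on the ball only, hence the indicator. It
  equals 1 along every segment between points of the ball.\<close>

definition ray_total :: "real^3 \<Rightarrow> real^3 \<Rightarrow> ennreal" where
  "ray_total p x = (\<integral>\<^sup>+t. Stot (ray p x t) * indicator (cball 0 1) (ray p x t) \<partial>unit_interval_measure)"

text \<open>Each requirement holds for almost every p, so one point meets them all. Convergence at
  the point itself matters because u(p) will be the constant of the Hopf map.\<close>

lemma good_base_point:
  obtains p where "norm p \<le> 1" "norm (u p) = 1" "(\<lambda>k. U k p) \<longlonglongrightarrow> u p"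
    "(\<integral>\<^sup>+x. ray_total p x \<partial>uball) < \<infinity>"
proof -
  have "(\<integral>\<^sup>+x. Stot x * indicator (cball 0 1) x \<partial>lborel) < \<infinity>"
    using Stot_finite by (subst (asm) nn_integral_restrict_space) auto
  moreover have "(\<lambda>x. Stot x * indicator (cball 0 1) x) \<in> borel_measurable borel"
    by (intro borel_measurable_times_ennreal borel_measurable_indicator) auto
  ultimately have "AE p in uball. (\<integral>\<^sup>+x. ray_total p x \<partial>uball) < \<infinity>"
    using AE_finite_ray_integrals[of "\<lambda>x. Stot x * indicator (cball 0 1) x"] by (simp add: ray_total_def ray_def)
  then have "AE p in uball. norm (u p) = 1 \<and> (\<lambda>k. U k p) \<longlonglongrightarrow> u p \<and> (\<integral>\<^sup>+x. ray_total p x \<partial>uball) < \<infinity>"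
    using u by eventually_elim auto
  then obtain p where "norm p \<le> 1"
    and p: "norm (u p) = 1 \<and> (\<lambda>k. U k p) \<longlonglongrightarrow> u p \<and> (\<integral>\<^sup>+x. ray_total p x \<partial>uball) < \<infinity>"
    by (rule AE_uball_ex)
  then show ?thesis by (intro that[OF _ p[THEN conjunct1] p[THEN conjunct2, THEN conjunct1] p[THEN conjunct2, THEN conjunct2]])
qed

end

section \<open>Integrating almost flat connections\<close>

lemma ray_measurable[measurable]: "ray p x \<in> borel_measurable borel"
  by (rule borel_measurable_continuous_onI) (rule continuous_on_ray)

lemma ray_norm_le: "norm p \<le> 1 \<Longrightarrow> norm x \<le> 1 \<Longrightarrow> t \<in> {0..1} \<Longrightarrow> norm (ray p x t) \<le> 1"
proof -
  assume "norm p \<le> 1" "norm x \<le> 1" "t \<in> {0..1}"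
  moreover have "ray p x t = (1 - t) *\<^sub>R p + t *\<^sub>R x" by (simp add: ray_def algebra_simps)
  ultimately show ?thesis using convex_cball[of "0::real^3" 1] by (auto simp: convex_alt)
qed

lemma summable_enn2real:
  fixes f :: "nat \<Rightarrow> ennreal"
  assumes "(\<Sum>k. f k) \<noteq> \<infinity>"
  shows "f k = ennreal (enn2real (f k))" "summable (\<lambda>k. enn2real (f k))" "enn2real (f k) \<le> enn2real (\<Sum>k. f k)"
proof -
  have le: "f k \<le> (\<Sum>k. f k)" for k by (rule le_suminf_ennreal)
  then have fin: "f k \<noteq> \<infinity>" for k using assms by (metis top.extremum_unique infinity_ennreal_def)
  then show eq: "f k = ennreal (enn2real (f k))" for k by (simp add: less_top)
  show "summable (\<lambda>k. enn2real (f k))"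
    using assms by (intro summable_suminf_not_top) (auto simp: eq[symmetric])
  show "enn2real (f k) \<le> enn2real (\<Sum>k. f k)"
    using le assms by (intro enn2real_mono) (auto simp: less_top)
qed

context gauge_sequence
begin

definition ray_mass :: "real^3 \<Rightarrow> nat \<Rightarrow> real^3 \<Rightarrow> ennreal" where
  "ray_mass p k x = (\<integral>\<^sup>+t. ennreal (S k (ray p x t)) \<partial>unit_interval_measure)"

lemma S_ray_measurable[measurable]: "(\<lambda>t. ennreal (S k (ray p x t))) \<in> borel_measurable unit_interval_measure"
  by (rule measurable_restrict_space1) measurable

lemma suminf_ray_mass:
  assumes "norm p \<le> 1" "norm x \<le> 1"
  shows "(\<Sum>k. ray_mass p k x) = ray_total p x"
proof -
  have "ray_total p x = (\<integral>\<^sup>+t. Stot (ray p x t) \<partial>unit_interval_measure)"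
    unfolding ray_total_def
    by (intro nn_integral_cong) (use ray_norm_le[OF assms] in \<open>auto simp: space_restrict_space\<close>)
  also have "\<dots> = (\<Sum>k. ray_mass p k x)"
    unfolding ray_mass_def Stot_def by (rule nn_integral_suminf) measurable
  finally show ?thesis by simp
qed

lemma ray_mass_bound:
  assumes "continuous_on {0..1} h" "\<And>t. t \<in> {0..1} \<Longrightarrow> 0 \<le> h t"
    "\<And>t. t \<in> {0..1} \<Longrightarrow> h t \<le> 2 * (S k (ray p x t) + S l (ray p x t))"
  shows "ennreal (integral {0..1} h) \<le> 2 * (ray_mass p k x + ray_mass p l x)"
proof -
  have "ennreal (integral {0..1} h) \<le> (\<integral>\<^sup>+t. 2 * (ennreal (S k (ray p x t)) + ennreal (S l (ray p x t))) \<partial>unit_interval_measure)"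
  proof (rule integral_unit_interval_le_nn_integral[OF assms(1,2)])
    fix t :: real assume "t \<in> {0..1}"
    then have "ennreal (h t) \<le> ennreal (2 * (S k (ray p x t) + S l (ray p x t)))"
      by (intro ennreal_leI assms(3))
    also have "\<dots> = 2 * (ennreal (S k (ray p x t)) + ennreal (S l (ray p x t)))"
      using S_nonneg by (simp add: ennreal_mult ennreal_plus)
    finally show "ennreal (h t) \<le> 2 * (ennreal (S k (ray p x t)) + ennreal (S l (ray p x t)))" .
  qed
  also have "\<dots> = 2 * (ray_mass p k x + ray_mass p l x)"
    unfolding ray_mass_def
    by (simp only: nn_integral_cmult[OF borel_measurable_add[OF S_ray_measurable S_ray_measurable]]
        nn_integral_add[OF S_ray_measurable S_ray_measurable])
  finally show ?thesis .
qed

text \<open>Every error at x is controlled by \<open>\<tau> k\<close>, the mass of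
  \<open>S k\<close> on the segment from p to x. These masses sum to \<open>ray_total p x\<close>;
  where the sum is finite they tend to 0 and never exceed it.\<close>

lemma gauge_estimates:
  assumes p: "norm p \<le> 1" and x: "norm x \<le> 1" and fin: "ray_total p x \<noteq> \<infinity>"
  defines "\<tau> \<equiv> \<lambda>k. enn2real (ray_mass p k x)"
  shows "norm (gauge (A k) p x - gauge (A l) p x) \<le> 2 * (\<tau> k + \<tau> l)"
    and "norm (qcnj (gauge (A k) p x) \<odot> im (U k x) \<odot> gauge (A k) p x - im (U k p)) \<le> 4 * \<tau> k"
    and "norm (connection.gauge_defect (A k) (DA k) p x (axis j 1)) \<le> 4 * \<tau> k"
    and "\<tau> \<longlonglongrightarrow> 0" and "\<tau> k \<le> enn2real (ray_total p x)"
proof -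
  have suminf: "(\<Sum>k. ray_mass p k x) \<noteq> \<infinity>" using fin suminf_ray_mass[OF p x] by simp
  note \<tau> = summable_enn2real[OF suminf]
  have \<tau>0: "\<tau> k \<ge> 0" for k by (simp add: \<tau>_def)
  interpret c: connection "A k" "DA k" "K k" for k by (rule conn)
  have w: "norm (x - p) \<le> 2" using norm_triangle_ineq4[of x p] p x by simp
  have conv: "integral {0..1} h \<le> 2 * (\<tau> k + \<tau> l)"
    if "continuous_on {0..1} h" "\<And>t. t \<in> {0..1} \<Longrightarrow> 0 \<le> h t"
      "\<And>t. t \<in> {0..1} \<Longrightarrow> h t \<le> 2 * (S k (ray p x t) + S l (ray p x t))" for h k l
  proof -
    have "ennreal (integral {0..1} h) \<le> 2 * (ray_mass p k x + ray_mass p l x)"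
      using that by (rule ray_mass_bound)
    also have "\<dots> = 2 * (ennreal (\<tau> k) + ennreal (\<tau> l))" using \<tau>(1) by (simp add: \<tau>_def)
    also have "\<dots> = ennreal (2 * (\<tau> k + \<tau> l))" using \<tau>0 by (simp add: ennreal_mult ennreal_plus)
    finally show ?thesis using \<tau>0 by (subst (asm) ennreal_le_iff) auto
  qed
  \<comment> \<open>The case l = k of the preceding bound, hence 4 in place of 2.\<close>
  have conv1: "integral {0..1} h \<le> 4 * \<tau> k"
    if "continuous_on {0..1} h" "\<And>t. t \<in> {0..1} \<Longrightarrow> 0 \<le> h t"
      "\<And>t. t \<in> {0..1} \<Longrightarrow> h t \<le> 2 * S k (ray p x t)" for h k
  proof -
    have "integral {0..1} h \<le> 2 * (\<tau> k + \<tau> k)"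
      using that(1,2)
    proof (rule conv)
      show "h t \<le> 2 * (S k (ray p x t) + S k (ray p x t))" if "t \<in> {0..1}" for t
        by (rule order_trans[OF \<open>\<And>t. t \<in> {0..1} \<Longrightarrow> h t \<le> 2 * S k (ray p x t)\<close>[OF that]])
           (simp add: S_nonneg)
    qed
    then show ?thesis by simp
  qed
  show "norm (gauge (A k) p x - gauge (A l) p x) \<le> 2 * (\<tau> k + \<tau> l)"
  proof (rule order_trans[OF gauge_compare[OF conn conn]], rule conv)
    show "continuous_on {0..1} (\<lambda>s. norm (A k (ray p x s) (x - p) - A l (ray p x s) (x - p)))"
      by (intro continuous_intros c.A_ray_continuous)
  qed (rule norm_ge_zero, rule bounds(1)[OF w])
  have Uc: "continuous_on UNIV (U k)"
    using has_derivative_continuous[OF U(1)] by (auto intro: continuous_at_imp_continuous_on)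
  show "norm (qcnj (gauge (A k) p x) \<odot> im (U k x) \<odot> gauge (A k) p x - im (U k p)) \<le> 4 * \<tau> k"
  proof (rule order_trans[OF c.gauge_conjugation[OF U]], rule conv1)
    show "continuous_on {0..1} (\<lambda>s. norm (DU k (ray p x s) (x - p) - 2 *\<^sub>R cross3 (A k (ray p x s) (x - p)) (U k (ray p x s))))"
      by (intro continuous_intros continuous_on_cross c.A_ray_continuous continuous_on_compose2[OF U(2) continuous_on_ray]
        continuous_on_compose2[OF Uc continuous_on_ray]) auto
  qed (auto intro!: bounds(3) w)
  show "norm (connection.gauge_defect (A k) (DA k) p x (axis j 1)) \<le> 4 * \<tau> k"
  proof (rule order_trans[OF c.gauge_defect_le], rule conv1)
    show "continuous_on {0..1} (\<lambda>s. norm (curvature (A k) (DA k) (ray p x s) (axis j 1) (x - p)))"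
      by (intro continuous_intros c.curvature_ray_continuous)
  qed (auto intro!: bounds(2) w)
  show "\<tau> \<longlonglongrightarrow> 0" using summable_LIMSEQ_zero[OF \<tau>(2)] by (simp add: \<tau>_def[abs_def])
  show "\<tau> k \<le> enn2real (ray_total p x)" using \<tau>(3) suminf_ray_mass[OF p x] by (simp add: \<tau>_def)
qed

lemma gauge_continuous: "continuous_on UNIV (gauge (A k) p)"
proof -
  interpret c: connection "A k" "DA k" "K k" by (rule conn)
  have "isCont (gauge (A k) p) x" for x
    unfolding isCont_def
  proof (rule LIM_zero_cancel, rule tendsto_norm_zero_cancel, rule tendsto_sandwich[OF _ _ tendsto_const])
    show "\<forall>\<^sub>F y in at x. norm (gauge (A k) p y - gauge (A k) p x) \<le> K k * (norm (y - p) + 1) * norm (y - x)"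
      by (intro always_eventually allI c.transport_lipschitz) simp
    have "((\<lambda>y. K k * (norm (y - p) + 1) * norm (y - x)) \<longlongrightarrow> K k * (norm (x - p) + 1) * norm (x - x)) (at x)"
      by (intro tendsto_intros)
    then show "((\<lambda>y. K k * (norm (y - p) + 1) * norm (y - x)) \<longlongrightarrow> 0) (at x)" by simp
  qed auto
  then show ?thesis by (simp add: continuous_at_imp_continuous_on)
qed

lemma gauge_measurable[measurable]: "gauge (A k) p \<in> borel_measurable borel"
  by (rule borel_measurable_continuous_onI[OF gauge_continuous])

text \<open>The defect is a pointwise limit of difference quotients of a continuous function, minus
  the continuous term A g.\<close>

lemma gauge_defect_measurable[measurable]:
  "(\<lambda>x. connection.gauge_defect (A k) (DA k) p x v) \<in> borel_measurable borel"
proof -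
  interpret c: connection "A k" "DA k" "K k" by (rule conn)
  have [measurable]: "(\<lambda>x. gauge (A k) p (x + w)) \<in> borel_measurable borel" for w
    by (rule measurable_compose[OF _ gauge_measurable]) measurable
  have "(\<lambda>x. im (A k x v) \<odot> gauge (A k) p x + c.gauge_defect p x v) \<in> borel_measurable borel"
    by (rule borel_measurable_LIMSEQ_metric[OF _ c.gauge_difference_quotient]) measurable
  moreover have "(\<lambda>x. im (A k x v) \<odot> gauge (A k) p x) \<in> borel_measurable borel"
    by (intro borel_measurable_continuous_onI continuous_intros gauge_continuous c.A_continuous)
  ultimately have "(\<lambda>x. (im (A k x v) \<odot> gauge (A k) p x + c.gauge_defect p x v) - im (A k x v) \<odot> gauge (A k) p x) \<in> borel_measurable borel"
    by (rule borel_measurable_diff)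
  then show ?thesis by simp
qed

text \<open>The k-th gauge solves dg = A g + defect weakly. What is known of it, a Lipschitz bound
  on bounded sets and convergent difference quotients, is what the vanishing of the integral of the
  limit of quotients of \<phi> g requires.\<close>

lemma gauge_weak:
  assumes \<phi>: "test_function (cball 0 1) \<phi>" and v: "norm v \<le> 1"
  shows "(LINT x|lborel. frechet_derivative \<phi> (at x) v *\<^sub>R gauge (A k) p x
    + \<phi> x *\<^sub>R (im (A k x v) \<odot> gauge (A k) p x + connection.gauge_defect (A k) (DA k) p x v)) = 0"
proof -
  interpret c: connection "A k" "DA k" "K k" by (rule conn)
  let ?g = "gauge (A k) p" and ?x = "\<lambda>n x. x + v /\<^sub>R real (Suc n)"
  note tk = test_function_test_kernel[OF \<phi>]
  obtain M where M: "M > 0" "\<And>x. norm (\<phi> x) \<le> M" using test_kernel_bounded[OF tk(1)] by metis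
  obtain L where L: "L > 0" "\<And>x v. norm (frechet_derivative \<phi> (at x) v) \<le> L * norm v"
    using test_kernel_derivative_bounded[OF tk(1)] by metis
  have gn: "norm (?g x) = 1" for x by (rule c.transport_norm) simp
  have Lip: "norm (real (Suc n) * (\<phi> (?x n x) - \<phi> x)) \<le> L" for n x
  proof -
    have "norm (\<phi> (?x n x) - \<phi> x) \<le> L * norm (?x n x - x)"
      by (rule differentiable_bound[of UNIV \<phi> "\<lambda>x. frechet_derivative \<phi> (at x)"])
         (use test_kernel_has_derivative[OF tk(1)] L in \<open>auto intro!: onorm_bound\<close>)
    then have "real (Suc n) * norm (\<phi> (?x n x) - \<phi> x) \<le> L * norm v"
      by (simp add: divide_simps mult.commute del: of_nat_Suc)
    also have "\<dots> \<le> L" using L v by (simp add: mult_left_le)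
    finally show ?thesis by (simp del: of_nat_Suc add: abs_mult)
  qed
  have lim\<phi>: "(\<lambda>n. real (Suc n) * (\<phi> (?x n x) - \<phi> x)) \<longlonglongrightarrow> frechet_derivative \<phi> (at x) v" for x
  proof -
    note D = test_kernel_has_derivative[OF tk(1), of x]
    have "((\<lambda>h. x + h *\<^sub>R v) has_derivative (\<lambda>h. h *\<^sub>R v)) (at 0)" by (auto intro!: derivative_eq_intros)
    from has_derivative_compose[OF this, of \<phi> "frechet_derivative \<phi> (at x)"] D linear_scale[OF has_derivative_linear[OF D]]
    have "((\<lambda>h. \<phi> (x + h *\<^sub>R v)) has_vector_derivative frechet_derivative \<phi> (at x) v) (at 0)"
      by (simp add: has_vector_derivative_def)
    from has_vector_derivative_quotient_LIMSEQ[OF this] show ?thesis by simp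
  qed
  have split: "real (Suc n) *\<^sub>R (\<phi> (?x n x) *\<^sub>R ?g (?x n x) - \<phi> x *\<^sub>R ?g x)
    = (real (Suc n) * (\<phi> (?x n x) - \<phi> x)) *\<^sub>R ?g (?x n x) + \<phi> x *\<^sub>R (real (Suc n) *\<^sub>R (?g (?x n x) - ?g x))" for n x
    by (simp add: scaleR_diff_right scaleR_diff_left right_diff_distrib mult.commute del: of_nat_Suc)
  show ?thesis
  \<comment> \<open>For |x| <= 1 the factor |x + v/(n+1) - p| + 1 in the Lipschitz bound is at most
    |p| + 3; for larger |x| the factor \<phi> x vanishes. The bound may depend on k, since k is
    fixed here.\<close>
  proof (rule integral_directional_derivative_zero(2)[of "\<lambda>x. \<phi> x *\<^sub>R ?g x" 1 v "L + M * (K k * (norm p + 3))"])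
    show "continuous_on UNIV (\<lambda>x. \<phi> x *\<^sub>R ?g x)"
      by (intro continuous_intros test_kernel_continuous[OF tk(1)] gauge_continuous)
    show "norm v \<le> 1" by fact
    show "\<phi> x *\<^sub>R ?g x = 0" if "norm x > 1" for x using tk(2)[of x] that by simp
    fix x n
    show "norm (real (Suc n) *\<^sub>R (\<phi> (?x n x) *\<^sub>R ?g (?x n x) - \<phi> x *\<^sub>R ?g x)) \<le> L + M * (K k * (norm p + 3))"
      unfolding split
    proof (rule norm_triangle_mono)
      show "norm ((real (Suc n) * (\<phi> (?x n x) - \<phi> x)) *\<^sub>R ?g (?x n x)) \<le> L"
        using Lip[of n x] gn by (simp del: of_nat_Suc)
      show "norm (\<phi> x *\<^sub>R (real (Suc n) *\<^sub>R (?g (?x n x) - ?g x))) \<le> M * (K k * (norm p + 3))"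
      proof (cases "norm x \<le> 1")
        case True
        have "norm (v /\<^sub>R real (Suc n)) \<le> norm v" by (simp add: divide_simps algebra_simps)
        then have "norm (?x n x - p) \<le> norm p + 2"
          using True v norm_triangle_ineq4[of "?x n x" p] norm_triangle_ineq[of x "v /\<^sub>R real (Suc n)"] by linarith
        then have "K k * (norm (?x n x - p) + 1) * norm (?x n x - x) \<le> K k * (norm p + 3) * norm (?x n x - x)"
          using c.K_nonneg by (intro mult_right_mono mult_left_mono) auto
        with c.transport_lipschitz[of 1 p "?x n x" x]
        have "norm (?g (?x n x) - ?g x) \<le> K k * (norm p + 3) * norm (?x n x - x)" by simp
        then have "real (Suc n) * norm (?g (?x n x) - ?g x) \<le> K k * (norm p + 3) * norm v"
          by (simp add: divide_simps mult.commute del: of_nat_Suc)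
        also have "\<dots> \<le> K k * (norm p + 3)" using v c.K_nonneg by (simp add: mult_left_le)
        finally have "norm (real (Suc n) *\<^sub>R (?g (?x n x) - ?g x)) \<le> K k * (norm p + 3)" by (simp del: of_nat_Suc)
        then show ?thesis unfolding norm_scaleR[of "\<phi> x"] using M(2)[of x] by (intro mult_mono) auto
      next
        case False
        then show ?thesis using tk(2)[of x] M c.K_nonneg by simp
      qed
    qed
  next
    fix x
    have xl: "(\<lambda>n. ?x n x) \<longlonglongrightarrow> x"
      using tendsto_add[OF tendsto_const tendsto_scaleR[OF LIMSEQ_inverse_real_of_nat tendsto_const], of x v] by simp
    have "isCont ?g x" using gauge_continuous by (simp add: continuous_on_eq_continuous_at)
    from isCont_tendsto_compose[OF this xl] have "(\<lambda>n. ?g (?x n x)) \<longlonglongrightarrow> ?g x" .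
    then show "(\<lambda>n. real (Suc n) *\<^sub>R (\<phi> (?x n x) *\<^sub>R ?g (?x n x) - \<phi> x *\<^sub>R ?g x)) \<longlonglongrightarrow>
      frechet_derivative \<phi> (at x) v *\<^sub>R ?g x + \<phi> x *\<^sub>R (im (A k x v) \<odot> ?g x + c.gauge_defect p x v)"
      unfolding split
      by (intro tendsto_add tendsto_scaleR lim\<phi> c.gauge_difference_quotient tendsto_const)
  qed
qed

end

section \<open>Passage to the limit in the gauges\<close>

context gauge_sequence
begin

definition lift :: "real^3 \<Rightarrow> real^3 \<Rightarrow> quat" where
  "lift p x = (if norm x \<le> 1 then lim (\<lambda>k. gauge (A k) p x) else 0)"

lemma lift_measurable[measurable]: "lift p \<in> borel_measurable borel"
proof -
  have "(\<lambda>x. lim (\<lambda>k. gauge (A k) p x)) \<in> borel_measurable borel"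
    by (rule borel_measurable_lim_metric) measurable
  then show ?thesis unfolding lift_def[abs_def] by measurable
qed

text \<open>Two gauges differ at x by at most a multiple of their masses on the segment, so they
  form a Cauchy sequence. In the limit the conjugation estimate becomes an equality, which unit norm
  allows to be solved for u(x).\<close>

lemma lift_properties:
  assumes p: "norm p \<le> 1" "norm (u p) = 1" "(\<lambda>k. U k p) \<longlonglongrightarrow> u p"
    and x: "norm x \<le> 1" "(\<lambda>k. U k x) \<longlonglongrightarrow> u x" and fin: "ray_total p x \<noteq> \<infinity>"
  shows "(\<lambda>k. gauge (A k) p x) \<longlonglongrightarrow> lift p x" "norm (lift p x) = 1"
    "im (u x) = lift p x \<odot> im (u p) \<odot> qcnj (lift p x)"
proof -
  let ?g = "\<lambda>k. gauge (A k) p x"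
  define \<tau> where "\<tau> k = enn2real (ray_mass p k x)" for k
  note est = gauge_estimates[OF p(1) x(1) fin, folded \<tau>_def]
  have \<tau>0: "\<tau> \<longlonglongrightarrow> 0" using est(4) unfolding \<tau>_def by simp
  have "Cauchy ?g"
  proof (rule metric_CauchyI)
    fix e :: real assume e: "e > 0"
    have "\<forall>\<^sub>F k in sequentially. \<tau> k < e / 4" using order_tendstoD(2)[OF \<tau>0, of "e / 4"] e by simp
    then obtain N where N: "\<And>k. k \<ge> N \<Longrightarrow> \<tau> k < e / 4" by (auto simp: eventually_sequentially)
    show "\<exists>M. \<forall>m\<ge>M. \<forall>n\<ge>M. dist (?g m) (?g n) < e"
    proof (intro exI[of _ N] allI impI)
      fix m n assume "m \<ge> N" "n \<ge> N"
      then show "dist (?g m) (?g n) < e"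
        using est(1)[of m n] N[of m] N[of n] by (simp add: dist_norm)
    qed
  qed
  then have "convergent ?g" by (rule Cauchy_convergent)
  then show lim: "?g \<longlonglongrightarrow> lift p x" using x by (simp add: lift_def convergent_LIMSEQ_iff)
  interpret c: connection "A k" "DA k" "K k" for k by (rule conn)
  have "norm (?g k) = 1" for k by (rule c.transport_norm) simp
  with tendsto_norm[OF lim] show n1: "norm (lift p x) = 1" by (simp add: LIMSEQ_const_iff)
  have "(\<lambda>k. qcnj (?g k) \<odot> im (U k x) \<odot> ?g k - im (U k p)) \<longlonglongrightarrow> 0"
  proof (rule tendsto_norm_zero_cancel, rule tendsto_sandwich[OF _ _ tendsto_const])
    show "\<forall>\<^sub>F k in sequentially. norm (qcnj (?g k) \<odot> im (U k x) \<odot> ?g k - im (U k p)) \<le> 4 * \<tau> k"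
      using est(2) by (intro always_eventually allI)
    show "(\<lambda>k. 4 * \<tau> k) \<longlonglongrightarrow> 0" using tendsto_mult_right_zero[OF \<tau>0, of 4] by simp
  qed auto
  moreover have "(\<lambda>k. qcnj (?g k) \<odot> im (U k x) \<odot> ?g k - im (U k p))
    \<longlonglongrightarrow> qcnj (lift p x) \<odot> im (u x) \<odot> lift p x - im (u p)"
    by (intro tendsto_intros lim x p)
  ultimately have "qcnj (lift p x) \<odot> im (u x) \<odot> lift p x - im (u p) = 0"
    using LIMSEQ_unique by blast
  then have "im (u p) = qcnj (lift p x) \<odot> im (u x) \<odot> lift p x" by simp
  then have "lift p x \<odot> im (u p) \<odot> qcnj (lift p x)
    = (lift p x \<odot> qcnj (lift p x)) \<odot> im (u x) \<odot> (lift p x \<odot> qcnj (lift p x))"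
    by (simp add: qmul_assoc)
  then show "im (u x) = lift p x \<odot> im (u p) \<odot> qcnj (lift p x)" by (simp add: qcnj_qmul_self n1)
qed

text \<open>Dominated convergence in the weak equation of the gauges. The connections converge
  almost everywhere with majorant |a| + \<open>Stot\<close>, the defects tend to 0 with majorant 4
  \<open>ray_total\<close>, and the base point was chosen to make the latter integrable.\<close>

lemma lift_exists:
  obtains g c where "norm c = 1" "g \<in> borel_measurable borel" "\<And>x. norm x > 1 \<Longrightarrow> g x = 0"
    "AE x in uball. norm (g x) = 1 \<and> u x = Hopf c (g x)"
    "\<And>j. weak_dir (axis j 1) g (\<lambda>x. im (a j x) \<odot> g x)"
proof -
  obtain p where p: "norm p \<le> 1" "norm (u p) = 1" "(\<lambda>k. U k p) \<longlonglongrightarrow> u p"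
    and fin: "(\<integral>\<^sup>+x. ray_total p x \<partial>uball) < \<infinity>"
    using good_base_point by blast
  interpret c: connection "A k" "DA k" "K k" for k by (rule conn)
  have rt: "ray_total p x = (\<Sum>k. ray_mass p k x)" if "norm x \<le> 1" for x
    using suminf_ray_mass[OF p(1) that] by simp
  have [measurable]: "(\<lambda>(x, t). ennreal (S k (ray p x t))) \<in> borel_measurable (uball \<Otimes>\<^sub>M unit_interval_measure)" for k
  proof -
    have [measurable]: "(\<lambda>t. t) \<in> borel_measurable unit_interval_measure" by (rule measurable_restrict_space1) simp
    have [measurable]: "(\<lambda>t. t) \<in> borel_measurable (uball :: (real^3) measure)" by (rule measurable_restrict_space1) simp
    show ?thesis unfolding ray_def by measurable
  qed
  interpret T: finite_measure unit_interval_measure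
    by (rule finite_measureI) (simp add: emeasure_restrict_space space_restrict_space)
  have mass_meas: "ray_mass p k \<in> borel_measurable uball" for k
    unfolding ray_mass_def[abs_def] by (rule T.borel_measurable_nn_integral) measurable
  have "(\<lambda>x. \<Sum>k. ray_mass p k x) \<in> borel_measurable uball"
    using mass_meas by (rule borel_measurable_suminf_order)
  then have T_meas[measurable]: "ray_total p \<in> borel_measurable uball"
    by (rule measurable_cong[THEN iffD1, rotated]) (simp add: rt)
  have AE_T: "AE x in uball. ray_total p x \<noteq> \<infinity>"
    by (rule nn_integral_noteq_infinite) (use fin in auto)
  have T_int: "integrable uball (\<lambda>x. enn2real (ray_total p x))"
  proof (rule integrableI_bounded)
    have "(\<integral>\<^sup>+x. ennreal (norm (enn2real (ray_total p x))) \<partial>uball) \<le> (\<integral>\<^sup>+x. ray_total p x \<partial>uball)"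
      by (intro nn_integral_mono) (auto simp: ennreal_enn2real_if)
    then show "(\<integral>\<^sup>+x. ennreal (norm (enn2real (ray_total p x))) \<partial>uball) < \<infinity>" using fin by simp
  qed measurable
  have AE_S: "AE x in uball. Stot x \<noteq> \<infinity>"
    by (rule nn_integral_noteq_infinite) (use Stot_finite in auto)
  have S_int': "integrable uball (\<lambda>x. enn2real (Stot x))"
  proof (rule integrableI_bounded)
    have "(\<integral>\<^sup>+x. ennreal (norm (enn2real (Stot x))) \<partial>uball) \<le> (\<integral>\<^sup>+x. Stot x \<partial>uball)"
      by (intro nn_integral_mono) (auto simp: ennreal_enn2real_if)
    then show "(\<integral>\<^sup>+x. ennreal (norm (enn2real (Stot x))) \<partial>uball) < \<infinity>" using Stot_finite by simp
  qed measurable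
  have AE_x: "AE x in uball. norm x \<le> 1" by (rule AE_I2) simp
  have AE_lift: "AE x in uball. (\<lambda>k. gauge (A k) p x) \<longlonglongrightarrow> lift p x \<and> norm (lift p x) = 1 \<and> u x = Hopf (u p) (lift p x)"
    using AE_T u(2) AE_x
  proof eventually_elim
    case (elim x)
    note L = lift_properties[OF p elim(3,2,1)]
    have "im (u x) = im (Hopf (u p) (lift p x))" using L(3) by (simp add: im_Hopf)
    then show ?case using L(1,2) by (simp add: im_def)
  qed
  have weak: "weak_dir (axis j 1) (lift p) (\<lambda>x. im (a j x) \<odot> lift p x)" for j
    unfolding weak_dir_def
  proof (intro allI impI)
    fix \<phi> :: "real^3 \<Rightarrow> real" assume \<phi>: "test_function (cball 0 1) \<phi>"
    note tk = test_function_test_kernel[OF \<phi>]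
    obtain M where M: "M > 0" "\<And>x. norm (\<phi> x) \<le> M" using test_kernel_bounded[OF tk(1)] by metis
    obtain L where L: "L > 0" "\<And>x v. norm (frechet_derivative \<phi> (at x) v) \<le> L * norm v"
      using test_kernel_derivative_bounded[OF tk(1)] by metis
    let ?e = "axis j 1 :: real^3" and ?d = "\<lambda>k x. c.gauge_defect k p x (axis j 1)" and ?g = "\<lambda>k x. gauge (A k) p x"
    let ?D = "\<lambda>x. frechet_derivative \<phi> (at x) ?e"
    have [measurable]: "\<phi> \<in> borel_measurable borel" "?D \<in> borel_measurable borel"
      using test_kernel_measurable[OF tk(1)] test_kernel_measurable[OF test_kernel_derivative[OF tk(1)]] by auto
    have [measurable]: "im \<in> borel_measurable borel"
      by (intro borel_measurable_continuous_onI continuous_intros)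
    have qm[measurable]: "(\<lambda>x. f x \<odot> h x) \<in> borel_measurable N"
      if "f \<in> borel_measurable N" "h \<in> borel_measurable N" for f h and N :: "(real^3) measure"
      using that by (rule borel_measurable_continuous_Pair) (intro continuous_intros)
    have [measurable]: "(\<lambda>x. im (a j x)) \<in> borel_measurable borel" by (rule measurable_compose[OF a]) measurable
    have [measurable]: "(\<lambda>x. im (A k x ?e)) \<in> borel_measurable borel" for k
      by (rule measurable_compose[OF measurable_pieces(1)]) measurable
    let ?f = "\<lambda>k x. ?D x *\<^sub>R ?g k x + \<phi> x *\<^sub>R (im (A k x ?e) \<odot> ?g k x + ?d k x)"
    let ?fl = "\<lambda>x. ?D x *\<^sub>R lift p x + \<phi> x *\<^sub>R (im (a j x) \<odot> lift p x)"
    have D0: "?D x = 0" if "norm x > 1" for x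
      using test_kernel_derivative[OF tk(1), of ?e] that by (simp add: test_kernel_def)
    have \<phi>0: "\<phi> x = 0" if "norm x > 1" for x using tk(2)[of x] that by simp
    have zero: "(LINT x|uball. ?f k x) = 0" for k
      using gauge_weak[OF \<phi>, of ?e k p] by (subst integral_lborel_eq_uball(1)[symmetric]) (auto simp: D0 \<phi>0)
    \<comment> \<open>\<open>L\<close> is for the derivative of \<phi>, the next two terms for the
      connection, the last one for the defect.\<close>
    define w where "w x = L + M * (norm (a j x) + enn2real (Stot x) + 4 * enn2real (ray_total p x))" for x
    have "(\<lambda>k. LINT x|uball. ?f k x) \<longlonglongrightarrow> (LINT x|uball. ?fl x)"
    proof (rule integral_dominated_convergence[where w=w])
      show "?fl \<in> borel_measurable uball" by measurable
      show "?f k \<in> borel_measurable uball" for k by measurable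
      have "integrable uball (\<lambda>x::real^3. L)" using finite_measure.integrable_const[OF finite_measure_uball] .
      then show "integrable uball w" unfolding w_def using a_int[of j] S_int' T_int
        by (intro Bochner_Integration.integrable_add integrable_mult_right integrable_norm)
      show "AE x in uball. norm (?f k x) \<le> w x" for k
        using AE_T AE_S AE_x
      proof eventually_elim
        case (elim x)
        have n: "norm (?g k x) = 1" by (rule c.transport_norm) simp
        have "(\<Sum>k. ennreal (S k x)) \<noteq> \<infinity>" using elim by (simp add: Stot_def)
        then have "enn2real (ennreal (S k x)) \<le> enn2real (Stot x)" unfolding Stot_def by (rule summable_enn2real(3))
        then have "S k x \<le> enn2real (Stot x)" by (simp add: S_nonneg)
        then have A: "norm (A k x ?e) \<le> norm (a j x) + enn2real (Stot x)"
          using bounds(4)[of 0 k x j] norm_triangle_sub[of "A k x ?e" "a j x"] by simp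
        have d: "norm (?d k x) \<le> 4 * enn2real (ray_total p x)"
          using gauge_estimates(3,5)[OF p(1) elim(3,1), of k] by (meson mult_left_mono order_trans zero_le_numeral)
        have "norm (im (A k x ?e) \<odot> ?g k x + ?d k x) \<le> norm (a j x) + enn2real (Stot x) + 4 * enn2real (ray_total p x)"
          by (rule norm_triangle_mono) (use A d n in \<open>auto simp: norm_qmul\<close>)
        then have 2: "norm (\<phi> x *\<^sub>R (im (A k x ?e) \<odot> ?g k x + ?d k x)) \<le> M * (norm (a j x) + enn2real (Stot x) + 4 * enn2real (ray_total p x))"
          unfolding norm_scaleR using M(2)[of x] M(1) by (intro mult_mono) auto
        have 1: "norm (?D x *\<^sub>R ?g k x) \<le> L" using L(2)[of x ?e] n by simp
        show ?case unfolding w_def by (rule norm_triangle_mono[OF 1 2])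
      qed
      show "AE x in uball. (\<lambda>k. ?f k x) \<longlonglongrightarrow> ?fl x"
        using AE_T AE_S AE_x AE_lift
      proof eventually_elim
        case (elim x)
        have "(\<Sum>k. ennreal (S k x)) \<noteq> \<infinity>" using elim by (simp add: Stot_def)
        from summable_LIMSEQ_zero[OF summable_enn2real(2)[OF this]]
        have S0: "(\<lambda>k. S k x) \<longlonglongrightarrow> 0" by (simp add: S_nonneg)
        have Alim: "(\<lambda>k. A k x ?e) \<longlonglongrightarrow> a j x"
        proof (rule LIM_zero_cancel, rule tendsto_norm_zero_cancel, rule tendsto_sandwich[OF _ _ tendsto_const S0])
          show "\<forall>\<^sub>F k in sequentially. norm (A k x ?e - a j x) \<le> S k x"
            using bounds(4)[of 0] by (intro always_eventually allI) simp
        qed auto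
        have dlim: "(\<lambda>k. ?d k x) \<longlonglongrightarrow> 0"
        proof (rule tendsto_norm_zero_cancel, rule tendsto_sandwich[OF _ _ tendsto_const])
          show "\<forall>\<^sub>F k in sequentially. norm (?d k x) \<le> 4 * enn2real (ray_mass p k x)"
            using gauge_estimates(3)[OF p(1) elim(3,1)] by (intro always_eventually allI)
          show "(\<lambda>k. 4 * enn2real (ray_mass p k x)) \<longlonglongrightarrow> 0"
            using tendsto_mult_right_zero[OF gauge_estimates(4)[OF p(1) elim(3,1)], of 4] by simp
        qed auto
        have "(\<lambda>k. ?f k x) \<longlonglongrightarrow> ?D x *\<^sub>R lift p x + \<phi> x *\<^sub>R (im (a j x) \<odot> lift p x + 0)"
          by (intro tendsto_intros Alim dlim) (use elim in auto)
        then show ?case by simp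
      qed
    qed
    then have "(LINT x|uball. ?fl x) = 0" unfolding zero by (simp add: LIMSEQ_const_iff)
    moreover have ng: "AE x in uball. norm (lift p x) \<le> 1" using AE_lift by eventually_elim simp
    have i1: "integrable uball (\<lambda>x. ?D x *\<^sub>R lift p x)"
    proof (rule finite_measure.integrable_const_bound[OF finite_measure_uball, where B=L])
      show "AE x in uball. norm (?D x *\<^sub>R lift p x) \<le> L"
        using ng
      proof eventually_elim
        case (elim x)
        have "norm (?D x) * norm (lift p x) \<le> L * 1" using L(2)[of x ?e] L(1) elim by (intro mult_mono) auto
        then show ?case by simp
      qed
    qed measurable
    have i2: "integrable uball (\<lambda>x. \<phi> x *\<^sub>R (im (a j x) \<odot> lift p x))"
    proof (rule Bochner_Integration.integrable_bound)
      show "integrable uball (\<lambda>x. M * norm (a j x))" using a_int by auto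
      show "AE x in uball. norm (\<phi> x *\<^sub>R (im (a j x) \<odot> lift p x)) \<le> norm (M * norm (a j x))"
        using ng
      proof eventually_elim
        case (elim x)
        have "norm (\<phi> x) * (norm (a j x) * norm (lift p x)) \<le> M * (norm (a j x) * 1)"
          using M(2)[of x] M(1) elim by (intro mult_mono) auto
        then show ?case using M(1) by (simp add: norm_qmul abs_mult)
      qed
    qed measurable
    ultimately have "(LINT x|uball. ?D x *\<^sub>R lift p x) + (LINT x|uball. \<phi> x *\<^sub>R (im (a j x) \<odot> lift p x)) = 0"
      by (simp add: Bochner_Integration.integral_add[OF i1 i2])
    then have "(LINT x|lborel. ?D x *\<^sub>R lift p x) + (LINT x|lborel. \<phi> x *\<^sub>R (im (a j x) \<odot> lift p x)) = 0"
      by (subst (1 2) integral_lborel_eq_uball(1)) (auto simp: D0 \<phi>0)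
    then show "(LINT x|lborel. ?D x *\<^sub>R lift p x) = - (LINT x|lborel. \<phi> x *\<^sub>R (im (a j x) \<odot> lift p x))"
      by (simp add: eq_neg_iff_add_eq_0)
  qed
  show ?thesis
    by (rule that[of "u p" "lift p"]) (use p weak AE_lift in \<open>auto simp: lift_def\<close>)
qed

end

section \<open>The lift to the three-sphere\<close>

lemma mol_bounded_linear:
  fixes f :: "'a::euclidean_space \<Rightarrow> 'b::euclidean_space" and h :: "'b \<Rightarrow> 'c::euclidean_space"
  assumes "bounded_linear h" "integrable lborel f" "e > 0"
  shows "mol e (\<lambda>x. h (f x)) x = h (mol e f x)"
  unfolding mol_def by (rule integral_bounded_linear[OF assms(1) integrable_rho_measure[OF assms(2,3)]])

text \<open>If |x| > 3, e <= 1/2 and |z| < 1/2, then (1 - e) x + e z has norm above 3/2 - 1/4 > 1,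
  where \<open>f\<close> vanishes; hence the radius 3.\<close>

lemma test_kernel_mol:
  fixes f :: "'a::euclidean_space \<Rightarrow> 'b::euclidean_space"
  assumes f: "integrable lborel f" "\<And>x. norm x > 1 \<Longrightarrow> f x = 0" and e: "0 < e" "e \<le> 1/2"
  shows "test_kernel 3 (mol e f)"
proof -
  have [measurable]: "f \<in> borel_measurable borel" using f(1) by auto
  have "mol e f x = 0" if x: "norm x > 3" for x
  proof -
    have "rho z *\<^sub>R f ((1 - e) *\<^sub>R x + e *\<^sub>R z) = 0" for z
    proof (cases "norm z \<ge> 1/2")
      case False
      have "(1/2) * 3 \<le> (1 - e) * norm x" using e x by (intro mult_mono) auto
      moreover have "e * norm z \<le> (1/2) * (1/2)" using e False by (intro mult_mono) auto
      ultimately have "norm ((1 - e) *\<^sub>R x + e *\<^sub>R z) > 1"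
        using norm_triangle_ineq4[of "(1 - e) *\<^sub>R x + e *\<^sub>R z" "e *\<^sub>R z"] e by simp
      then show ?thesis using f(2) by simp
    qed (simp add: rho_eq_0)
    then have "(\<lambda>z. rho z *\<^sub>R f ((1 - e) *\<^sub>R x + e *\<^sub>R z)) = (\<lambda>z. 0)" by (rule ext)
    then show ?thesis by (simp only: mol_eq_integral_rho[OF \<open>f \<in> borel_measurable borel\<close>] Bochner_Integration.integral_zero)
  qed
  then show ?thesis using Ck_on_mol[OF f(1) e(1)] by (auto simp: test_kernel_def)
qed

text \<open>One sequence of radii has to serve an L^2 datum and an L^1 datum. The L^1 slot is meant
  for the pullback, which is mollified as a whole: this differs from the product of the mollified
  factors, and the two agree only in the limit.\<close>

lemma mol_sequence:
  fixes f :: "'a::euclidean_space \<Rightarrow> 'b::euclidean_space" and h :: "'a \<Rightarrow> 'c::euclidean_space"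
  assumes f: "Lp_ball 2 f" and h: "Lp_ball 1 h"
  obtains \<epsilon> \<Phi> where "\<epsilon> \<longlonglongrightarrow> 0" "\<And>k. 0 < \<epsilon> k" "\<And>k. \<epsilon> k \<le> 1/2" "integrable uball \<Phi>"
    "AE x in uball. (\<lambda>k. mol (\<epsilon> k) f x) \<longlonglongrightarrow> f x \<and> (\<forall>k. (norm (mol (\<epsilon> k) f x))\<^sup>2 \<le> \<Phi> x)
      \<and> (\<lambda>k. mol (\<epsilon> k) h x) \<longlonglongrightarrow> h x \<and> (\<forall>k. norm (mol (\<epsilon> k) h x) \<le> \<Phi> x) \<and> (norm (f x))\<^sup>2 \<le> \<Phi> x"
proof -
  define e where "e k = 1 / (real k + 2)" for k :: nat
  have e: "e \<longlonglongrightarrow> 0" "0 < e k" "e k \<le> 1/2" for k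
    using LIMSEQ_ignore_initial_segment[OF lim_1_over_n[where 'a=real], of 2]
    unfolding e_def[abs_def] by (auto simp: divide_simps add.commute)
  have [measurable]: "f \<in> borel_measurable borel" "h \<in> borel_measurable borel"
    using f h by (auto simp: Lp_ball_def)
  obtain q \<Phi> where q: "strict_mono q" "integrable uball \<Phi>" "\<And>x. \<Phi> x \<ge> 0"
    "AE x in uball. (\<lambda>k. mol (e (q k)) f x) \<longlonglongrightarrow> f x"
    "AE x in uball. \<forall>k. norm (mol (e (q k)) f x) ^ 2 \<le> \<Phi> x"
  proof (rule dominated_subsequence[of "\<lambda>k. mol (e k) f" uball f 2])
    show "integrable uball (\<lambda>x. norm (f x) ^ 2)" using f by (intro integrable_uball) (simp add: Lp_ball_def)
    show "(\<lambda>k. \<integral>\<^sup>+x. ennreal (norm (mol (e k) f x - f x) ^ 2) \<partial>uball) \<longlonglongrightarrow> 0"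
      by (rule mol_Lp_tendsto[OF f _ e]) simp
  qed auto
  have eq: "(\<lambda>k. e (q k)) \<longlonglongrightarrow> 0" using LIMSEQ_subseq_LIMSEQ[OF e(1) q(1)] by (simp add: o_def)
  obtain r \<Psi> where r: "strict_mono r" "integrable uball \<Psi>" "\<And>x. \<Psi> x \<ge> 0"
    "AE x in uball. (\<lambda>k. mol (e (q (r k))) h x) \<longlonglongrightarrow> h x"
    "AE x in uball. \<forall>k. norm (mol (e (q (r k))) h x) ^ 1 \<le> \<Psi> x"
  proof (rule dominated_subsequence[of "\<lambda>k. mol (e (q k)) h" uball h 1])
    show "integrable uball (\<lambda>x. norm (h x) ^ 1)" using h by (intro integrable_uball) (simp add: Lp_ball_def)
    show "(\<lambda>k. \<integral>\<^sup>+x. ennreal (norm (mol (e (q k)) h x - h x) ^ 1) \<partial>uball) \<longlonglongrightarrow> 0"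
      by (rule mol_Lp_tendsto[OF h _ eq]) (use e in auto)
  qed auto
  show ?thesis
  proof (rule that[of "\<lambda>k. e (q (r k))" "\<lambda>x. \<Phi> x + \<Psi> x"])
    show "(\<lambda>k. e (q (r k))) \<longlonglongrightarrow> 0" using LIMSEQ_subseq_LIMSEQ[OF eq r(1)] by (simp add: o_def)
    show "integrable uball (\<lambda>x. \<Phi> x + \<Psi> x)" using q(2) r(2) by simp
    show "AE x in uball. (\<lambda>k. mol (e (q (r k))) f x) \<longlonglongrightarrow> f x \<and> (\<forall>k. (norm (mol (e (q (r k))) f x))\<^sup>2 \<le> \<Phi> x + \<Psi> x)
      \<and> (\<lambda>k. mol (e (q (r k))) h x) \<longlonglongrightarrow> h x \<and> (\<forall>k. norm (mol (e (q (r k))) h x) \<le> \<Phi> x + \<Psi> x) \<and> (norm (f x))\<^sup>2 \<le> \<Phi> x + \<Psi> x"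
      using q(4,5) r(4,5)
    proof eventually_elim
      case (elim x)
      have l: "(\<lambda>k. mol (e (q (r k))) f x) \<longlonglongrightarrow> f x"
        using LIMSEQ_subseq_LIMSEQ[OF elim(1) r(1)] by (simp add: o_def)
      have b: "\<forall>k. (norm (mol (e (q (r k))) f x))\<^sup>2 \<le> \<Phi> x + \<Psi> x"
        using elim(2) r(3)[of x] by (auto intro: add_increasing2)
      have "(norm (f x))\<^sup>2 \<le> \<Phi> x + \<Psi> x"
        by (rule LIMSEQ_le_const2[OF tendsto_power[OF tendsto_norm[OF l]]]) (use b in auto)
      then show ?case using l b elim(3,4) q(3)[of x] by (auto intro: add_increasing)
    qed
  qed (use e in auto)
qed

text \<open>The curvature at a point: \<open>u\<close> is the value of the map, \<open>a\<close> and
  \<open>b\<close> its derivatives in two directions, \<open>s\<close> and \<open>t\<close> the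
  values of \<eta> on them, and \<open>z\<close> the value of d\<eta>. Being polynomial, it passes
  to pointwise limits.\<close>

definition curv_poly :: "real^3 \<Rightarrow> real^3 \<Rightarrow> real^3 \<Rightarrow> real \<Rightarrow> real \<Rightarrow> real \<Rightarrow> real^3" where
  "curv_poly u a b s t z = cross3 a b - (1/2) *\<^sub>R (z *\<^sub>R u + t *\<^sub>R a - s *\<^sub>R b)
     - 2 *\<^sub>R cross3 ((1/2) *\<^sub>R (cross3 u a - s *\<^sub>R u)) ((1/2) *\<^sub>R (cross3 u b - t *\<^sub>R u))"

text \<open>Tangency makes a x b parallel to u, and Lagrange's identity gives (u x a - s u) x (u x b
  - t u) = z u - t a + s b. The terms in a and b cancel those coming from the derivative of \<eta>
  u, and the multiples of u add up to 0 for exactly this z.\<close>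

lemma curv_poly_zero:
  assumes u: "norm u = 1" and a: "u \<bullet> a = 0" and b: "u \<bullet> b = 0"
  shows "curv_poly u a b s t (u \<bullet> cross3 a b) = 0"
proof -
  have uu: "u \<bullet> u = 1" using u by (simp add: norm_eq_1)
  have ab: "cross3 a b = (u \<bullet> cross3 a b) *\<^sub>R u"
  proof -
    have "cross3 u (cross3 a b) = 0" using a b by (simp add: Lagrange)
    moreover have "cross3 (cross3 u (cross3 a b)) u = cross3 a b - (u \<bullet> cross3 a b) *\<^sub>R u"
      using uu by (simp add: cross_skew[of "cross3 u (cross3 a b)"] Lagrange[of u u "cross3 a b"])
    ultimately show ?thesis by simp
  qed
  have 1: "cross3 (cross3 u a) u = a" using uu a by (subst cross_skew[of "cross3 u a"]) (simp add: Lagrange)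
  have 2: "cross3 u (cross3 u b) = - b" using uu b by (simp add: Lagrange)
  have 3: "cross3 (cross3 u a) (cross3 u b) = (u \<bullet> cross3 a b) *\<^sub>R u"
  proof -
    have "cross3 (cross3 u a) (cross3 u b) = (cross3 u a \<bullet> b) *\<^sub>R u - (cross3 u a \<bullet> u) *\<^sub>R b" by (rule Lagrange)
    also have "cross3 u a \<bullet> b = u \<bullet> cross3 a b" by (simp add: cross3_simps)
    finally show ?thesis by (simp add: dot_cross_self)
  qed
  have "cross3 (cross3 u a - s *\<^sub>R u) (cross3 u b - t *\<^sub>R u) = (u \<bullet> cross3 a b) *\<^sub>R u - t *\<^sub>R a + s *\<^sub>R b"
  proof -
    have "cross3 (cross3 u a - s *\<^sub>R u) (cross3 u b - t *\<^sub>R u)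
      = cross3 (cross3 u a) (cross3 u b) - t *\<^sub>R cross3 (cross3 u a) u - s *\<^sub>R cross3 u (cross3 u b) + (s * t) *\<^sub>R cross3 u u"
      using bounded_bilinear.diff_left[OF bounded_bilinear_cross3] bounded_bilinear.diff_right[OF bounded_bilinear_cross3]
      by (simp add: cross_mult_left cross_mult_right)
    then show ?thesis unfolding 1 2 3 by simp
  qed
  then have "2 *\<^sub>R cross3 ((1/2) *\<^sub>R (cross3 u a - s *\<^sub>R u)) ((1/2) *\<^sub>R (cross3 u b - t *\<^sub>R u))
    = (1/2) *\<^sub>R ((u \<bullet> cross3 a b) *\<^sub>R u - t *\<^sub>R a + s *\<^sub>R b)"
    by (simp only: cross_mult_left cross_mult_right scaleR_scaleR) simp
  then have "curv_poly u a b s t (u \<bullet> cross3 a b) = cross3 a b - (1/2) *\<^sub>R ((u \<bullet> cross3 a b) *\<^sub>R u + t *\<^sub>R a - s *\<^sub>R b)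
    - (1/2) *\<^sub>R ((u \<bullet> cross3 a b) *\<^sub>R u - t *\<^sub>R a + s *\<^sub>R b)"
    unfolding curv_poly_def by simp
  also have "\<dots> = cross3 a b - (u \<bullet> cross3 a b) *\<^sub>R u"
    by (simp add: vec_eq_iff algebra_simps)
  finally show ?thesis using ab by simp
qed

text \<open>Growth of second order in the data keeps the curvature dominated in L^1 for data in L^2.
  The three terms give 1 + 3/2 + 2, rounded up to 5.\<close>

lemma curv_poly_bound:
  assumes u: "norm u \<le> 1" and m: "norm a \<le> m" "norm b \<le> m" "\<bar>s\<bar> \<le> m" "\<bar>t\<bar> \<le> m" "\<bar>z\<bar> \<le> m\<^sup>2"
  shows "norm (curv_poly u a b s t z) \<le> 5 * m\<^sup>2"
proof -
  have m0: "m \<ge> 0" using m(1) norm_ge_zero order_trans by blast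
  have c: "norm (cross3 x y) \<le> p * q" if "norm x \<le> p" "norm y \<le> q" for x y p q
    by (rule order_trans[OF norm_cross3_le mult_mono]) (use that in \<open>auto intro: order_trans[OF norm_ge_zero]\<close>)
  have 1: "norm (cross3 a b) \<le> m * m" by (rule c) (use m in auto)
  have z: "norm (z *\<^sub>R u) \<le> m\<^sup>2 * 1" unfolding norm_scaleR using m u by (intro mult_mono) auto
  have ta: "norm (t *\<^sub>R a) \<le> m * m" unfolding norm_scaleR using m m0 by (intro mult_mono) auto
  have sb: "norm (s *\<^sub>R b) \<le> m * m" unfolding norm_scaleR using m m0 by (intro mult_mono) auto
  have h: "norm ((1/2) *\<^sub>R (cross3 u x - r *\<^sub>R u)) \<le> m" if "norm x \<le> m" "\<bar>r\<bar> \<le> m" for x r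
  proof -
    have "norm (cross3 u x) \<le> 1 * m" by (rule c) (use u that in auto)
    moreover have "norm (r *\<^sub>R u) \<le> m * 1" unfolding norm_scaleR using u that m0 by (intro mult_mono) auto
    ultimately show ?thesis using norm_triangle_ineq4[of "cross3 u x" "r *\<^sub>R u"] by simp
  qed
  have 3: "norm (cross3 ((1/2) *\<^sub>R (cross3 u a - s *\<^sub>R u)) ((1/2) *\<^sub>R (cross3 u b - t *\<^sub>R u))) \<le> m * m"
    by (rule c) (use h m in auto)
  have 2: "norm (z *\<^sub>R u + t *\<^sub>R a - s *\<^sub>R b) \<le> 3 * (m * m)"
    using norm_triangle_ineq4[of "z *\<^sub>R u + t *\<^sub>R a" "s *\<^sub>R b"] norm_triangle_ineq[of "z *\<^sub>R u" "t *\<^sub>R a"] z ta sb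
    by (simp add: power2_eq_square)
  have "norm (curv_poly u a b s t z) \<le> norm (cross3 a b) + norm ((1/2) *\<^sub>R (z *\<^sub>R u + t *\<^sub>R a - s *\<^sub>R b))
    + norm (2 *\<^sub>R cross3 ((1/2) *\<^sub>R (cross3 u a - s *\<^sub>R u)) ((1/2) *\<^sub>R (cross3 u b - t *\<^sub>R u)))"
    unfolding curv_poly_def
    by (rule order_trans[OF norm_triangle_ineq4 add_right_mono[OF norm_triangle_ineq4]])
  also have "\<dots> \<le> m * m + (1/2) * (3 * (m * m)) + 2 * (m * m)"
    using 1 2 3 by (intro add_mono) auto
  also have "\<dots> \<le> 5 * m\<^sup>2" using zero_le_square[of m] by (simp add: power2_eq_square)
  finally show ?thesis .
qed

text \<open>The connection form \<open>A = (u \<times> du - \<eta> u) / 2\<close> is chosen so that \<open>du = 2 A \<times> u\<close> and so that its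
  curvature vanishes exactly when \<open>d\<eta>\<close> is the pullback of the volume form.\<close>

definition sphere_connection ::
    "(real^3 \<Rightarrow> real^3) \<Rightarrow> (real^3 \<Rightarrow> real^3) \<Rightarrow> real^3 \<Rightarrow> real^3 \<Rightarrow> real^3" where
  "sphere_connection u \<eta> y v = (1/2) *\<^sub>R (cross3 (u y) (frechet_derivative u (at y) v) - (\<eta> y \<bullet> v) *\<^sub>R u y)"

lemma sphere_connection:
  assumes u: "test_kernel 3 u" and \<eta>: "test_kernel 3 \<eta>"
  shows "\<exists>K. connection (sphere_connection u \<eta>) (\<lambda>y w v. frechet_derivative (\<lambda>y. sphere_connection u \<eta> y v) (at y) w) K"
proof (rule connectionI[where R=3])
  show "linear (sphere_connection u \<eta> y)" for y
    using has_derivative_linear[OF test_kernel_has_derivative[OF u, of y]]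
    by (intro linearI) (simp_all add: sphere_connection_def linear_add linear_scale cross_add_right cross_mult_right
        inner_add_right algebra_simps)
  fix v
  have Du: "test_kernel 3 (\<lambda>y. frechet_derivative u (at y) v)" by (rule test_kernel_derivative[OF u])
  have "Ck_on m UNIV (\<lambda>y. (1/2) *\<^sub>R (cross3 (u y) (frechet_derivative u (at y) v) + (-1) *\<^sub>R ((\<eta> y \<bullet> v) *\<^sub>R u y)))" for m
    using u \<eta> Du
    by (intro Ck_on_bounded_linear[OF bounded_linear_scaleR_right] Ck_on_add
        Ck_on_bounded_bilinear[OF bounded_bilinear_cross3] Ck_on_bounded_bilinear[OF bounded_bilinear_scaleR]
        Ck_on_bounded_linear[OF bounded_linear_inner_left]) (auto simp: test_kernel_def)
  moreover have "sphere_connection u \<eta> y v = 0" if "norm y > 3" for y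
    using that u by (simp add: sphere_connection_def test_kernel_def)
  ultimately show "test_kernel 3 (\<lambda>y. sphere_connection u \<eta> y v)"
    by (simp add: test_kernel_def sphere_connection_def)
qed

text \<open>Second derivatives of u enter only as u x (D_v D_w u - D_w D_v u) and cancel by
  symmetry. First derivatives of u and the antisymmetrised derivative of \<eta> remain, which are
  the quantities that mollification controls.\<close>

lemma sphere_connection_curvature:
  assumes u: "test_kernel 3 u" and \<eta>: "test_kernel 3 \<eta>"
  shows "curvature (sphere_connection u \<eta>) (\<lambda>y w v. frechet_derivative (\<lambda>y. sphere_connection u \<eta> y v) (at y) w) y v w
    = curv_poly (u y) (frechet_derivative u (at y) v) (frechet_derivative u (at y) w) (\<eta> y \<bullet> v) (\<eta> y \<bullet> w)
        (frechet_derivative \<eta> (at y) v \<bullet> w - frechet_derivative \<eta> (at y) w \<bullet> v)"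
proof -
  let ?u = "u y" and ?Du = "frechet_derivative u (at y)" and ?D\<eta> = "frechet_derivative \<eta> (at y)"
  let ?DDu = "\<lambda>v. frechet_derivative (\<lambda>y. frechet_derivative u (at y) v) (at y)"
  have "((\<lambda>y. sphere_connection u \<eta> y v) has_derivative (\<lambda>w. (1/2) *\<^sub>R
      ((cross3 ?u (?DDu v w) + cross3 (?Du w) (?Du v)) - ((\<eta> y \<bullet> v) *\<^sub>R ?Du w + (?D\<eta> w \<bullet> v) *\<^sub>R ?u)))) (at y)" for v
  proof -
    note Du = test_kernel_has_derivative[OF u, of y]
    note c = bounded_bilinear.FDERIV[OF bounded_bilinear_cross3 Du
        test_kernel_has_derivative[OF test_kernel_derivative[OF u, of v], of y]]
    note s = has_derivative_scaleR[OF has_derivative_inner_left[OF test_kernel_has_derivative[OF \<eta>, of y], of v] Du]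
    show ?thesis
      unfolding sphere_connection_def by (rule has_derivative_scaleR_right[OF has_derivative_diff[OF c s]])
  qed
  note D = frechet_derivative_at[OF this, THEN fun_cong, symmetric]
  have "Ck_on 2 UNIV u" using u by (simp add: test_kernel_def)
  then have sym: "?DDu v w = ?DDu w v" by (intro symmetric_derivative[of UNIV]) auto
  have skew: "cross3 (?Du v) (?Du w) = - cross3 (?Du w) (?Du v)" by (rule cross_skew)
  show ?thesis
    unfolding curvature_def D
    unfolding curv_poly_def sphere_connection_def sym
    by (simp add: skew vec_eq_iff algebra_simps)
qed

lemma AE_lborel_norm_neq_1: "AE x in lborel. norm (x::'a::euclidean_space) \<noteq> 1"
proof -
  have "negligible (sphere (0::'a) 1)" by (rule negligible_sphere)
  then have "sphere (0::'a) 1 \<in> null_sets lebesgue" by (simp add: negligible_iff_null_sets)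
  then have "AE x in lebesgue. x \<notin> sphere (0::'a) 1" by (rule AE_not_in)
  then have "AE x in lborel. x \<notin> sphere (0::'a) 1" by (simp add: AE_completion_iff)
  then show ?thesis by eventually_elim simp
qed

lemma AE_uball_open:
  assumes "AE x in lborel. norm (x::'a::euclidean_space) < 1 \<longrightarrow> P x"
  shows "AE x in uball. P x"
  unfolding AE_uball_iff using assms AE_lborel_norm_neq_1 by eventually_elim auto

lemma Lp_ball_bounded_by:
  fixes f :: "'a::euclidean_space \<Rightarrow> 'b::euclidean_space"
  assumes "f \<in> borel_measurable borel" "\<And>x. norm x > 1 \<Longrightarrow> f x = 0"
    "\<And>x. norm (f x) ^ p \<le> G x" "integrable lborel G"
  shows "Lp_ball p f"
  unfolding Lp_ball_def
proof (intro conjI allI impI)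
  show "integrable lborel (\<lambda>x. norm (f x) ^ p)"
    by (rule Bochner_Integration.integrable_bound[OF assms(4)])
       (use assms in \<open>auto intro!: AE_I2 intro: order_trans[OF assms(3) abs_ge_self]\<close>)
qed (use assms in auto)

lemma vec_lambda_measurable:
  fixes f :: "'n::finite \<Rightarrow> 'a \<Rightarrow> 'b::euclidean_space"
  assumes "\<And>i. f i \<in> borel_measurable M"
  shows "(\<lambda>x. \<chi> i. f i x) \<in> borel_measurable M"
proof -
  show ?thesis
    unfolding borel_measurable_euclidean_space[of "\<lambda>x. \<chi> i. f i x"]
    using assms by (auto simp: Basis_vec_def inner_axis)
qed

lemma norm_Pair_sq: "(norm (a, b))\<^sup>2 = (norm a)\<^sup>2 + (norm b)\<^sup>2"
  by (simp add: norm_Pair)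

lemma norm_vec_sq: "(norm (v::'b::euclidean_space^'n::finite))\<^sup>2 = (\<Sum>i\<in>UNIV. (norm (v $ i))\<^sup>2)"
  by (simp add: norm_vec_def L2_set_def sum_nonneg)

text \<open>Borel representatives of the data, extended by 0. The bound |u| <= 1 holds at every
  point so that estimates need no exceptional set, whereas |u| = 1 is an almost everywhere
  statement. The equation for d\<eta> is tested one component at a time with scalar
  functions.\<close>

locale sphere_data =
  fixes u \<eta> :: "real^3 \<Rightarrow> real^3" and D :: "3 \<Rightarrow> real^3 \<Rightarrow> real^3" and \<omega> :: "3 \<Rightarrow> 3 \<Rightarrow> real^3 \<Rightarrow> real"
  defines "\<omega> i l y \<equiv> u y \<bullet> cross3 (D i y) (D l y)"
  assumes u: "Lp_ball 2 u" and u_le: "norm (u x) \<le> 1" and u_sphere: "AE x in uball. norm (u x) = 1"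
    and \<eta>: "Lp_ball 2 \<eta>" and D: "Lp_ball 2 (D j)" and Du: "weak_dir (axis j 1) u (D j)"
    and d\<eta>: "test_function (cball 0 1) \<phi> \<Longrightarrow>
      (LINT y|lborel. frechet_derivative \<phi> (at y) (axis i 1) * \<eta> y $ l - frechet_derivative \<phi> (at y) (axis l 1) * \<eta> y $ i)
        = - (LINT y|lborel. \<phi> y * \<omega> i l y)"
begin

lemma measurable_data[measurable]: "u \<in> borel_measurable borel" "\<eta> \<in> borel_measurable borel" "D j \<in> borel_measurable borel"
  using u \<eta> D by (auto simp: Lp_ball_def)

lemma zero_outside: "norm x > 1 \<Longrightarrow> u x = 0" "norm x > 1 \<Longrightarrow> \<eta> x = 0" "norm x > 1 \<Longrightarrow> D j x = 0"
  using u \<eta> D by (auto simp: Lp_ball_def)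

lemma integrable_data: "integrable lborel u" "integrable lborel \<eta>" "integrable lborel (D j)"
  using u \<eta> D by (auto intro: Lp_ball_integrable[where p=2])

lemma \<omega>_measurable[measurable]: "\<omega> i l \<in> borel_measurable borel"
  unfolding \<omega>_def[abs_def] by measurable

lemma \<omega>_le: "\<bar>\<omega> i l y\<bar> \<le> (norm (D i y))\<^sup>2 + (norm (D l y))\<^sup>2"
proof -
  have "\<bar>\<omega> i l y\<bar> \<le> norm (u y) * norm (cross3 (D i y) (D l y))" unfolding \<omega>_def by (rule Cauchy_Schwarz_ineq2)
  also have "\<dots> \<le> 1 * (norm (D i y) * norm (D l y))" by (intro mult_mono u_le norm_cross3_le) auto
  also have "\<dots> \<le> (norm (D i y))\<^sup>2 + (norm (D l y))\<^sup>2"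
    using sum_squares_bound[of "norm (D i y)" "norm (D l y)"] mult_nonneg_nonneg[OF norm_ge_zero norm_ge_zero, of "D i y" "D l y"] by linarith
  finally show ?thesis .
qed

text \<open>All square-integrable data in one vector, so that a single subsequence and a single
  majorant serve every component; \<open>\<Omega>\<close> does the same for the components of the
  pullback.\<close>

definition pack :: "real^3 \<Rightarrow> ((real^3) \<times> (real^3)) \<times> (real^3^3)" where
  "pack x = ((u x, \<eta> x), \<chi> j. D j x)"

definition \<Omega> :: "real^3 \<Rightarrow> real^3^3" where
  "\<Omega> x = (\<chi> i l. \<omega> i l x)"

lemma pack_Lp: "Lp_ball 2 pack"
proof (rule Lp_ball_bounded_by[where G="\<lambda>x. (norm (u x))\<^sup>2 + (norm (\<eta> x))\<^sup>2 + (\<Sum>j\<in>UNIV. (norm (D j x))\<^sup>2)"])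
  show "pack \<in> borel_measurable borel"
    unfolding pack_def[abs_def] by (intro borel_measurable_Pair vec_lambda_measurable) measurable
  show "pack x = 0" if "norm x > 1" for x
    using zero_outside that by (simp add: pack_def zero_prod_def vec_eq_iff)
  show "(norm (pack x))\<^sup>2 \<le> (norm (u x))\<^sup>2 + (norm (\<eta> x))\<^sup>2 + (\<Sum>j\<in>UNIV. (norm (D j x))\<^sup>2)" for x
    by (simp only: pack_def norm_Pair_sq norm_vec_sq[of "\<chi> j. D j x"] vec_lambda_beta order_refl)
  show "integrable lborel (\<lambda>x. (norm (u x))\<^sup>2 + (norm (\<eta> x))\<^sup>2 + (\<Sum>j\<in>UNIV. (norm (D j x))\<^sup>2))"
    using u \<eta> D by (intro Bochner_Integration.integrable_add Bochner_Integration.integrable_sum) (auto simp: Lp_ball_def)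
qed

lemma \<Omega>_Lp: "Lp_ball 1 \<Omega>"
proof (rule Lp_ball_bounded_by[where G="\<lambda>x. \<Sum>i\<in>UNIV. \<Sum>l\<in>UNIV. (norm (D i x))\<^sup>2 + (norm (D l x))\<^sup>2"])
  show "\<Omega> \<in> borel_measurable borel"
    unfolding \<Omega>_def[abs_def] by (intro vec_lambda_measurable) measurable
  show "\<Omega> x = 0" if "norm x > 1" for x
    by (simp add: \<Omega>_def \<omega>_def vec_eq_iff[where 'a="real^3"] vec_eq_iff[where 'a=real] zero_outside(1)[OF that])
  show "norm (\<Omega> x) ^ 1 \<le> (\<Sum>i\<in>UNIV. \<Sum>l\<in>UNIV. (norm (D i x))\<^sup>2 + (norm (D l x))\<^sup>2)" for x
  proof -
    have "norm (\<Omega> x) \<le> (\<Sum>i\<in>UNIV. norm (\<Omega> x $ i))" by (simp add: norm_vec_def L2_set_le_sum)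
    also have "\<dots> \<le> (\<Sum>i\<in>UNIV. \<Sum>l\<in>UNIV. norm (\<Omega> x $ i $ l))"
      by (intro sum_mono) (simp only: norm_vec_def[of "_ $ _"], rule L2_set_le_sum, simp)
    also have "\<dots> \<le> (\<Sum>i\<in>UNIV. \<Sum>l\<in>UNIV. (norm (D i x))\<^sup>2 + (norm (D l x))\<^sup>2)"
      by (intro sum_mono) (simp add: \<Omega>_def \<omega>_le)
    finally show ?thesis by simp
  qed
  show "integrable lborel (\<lambda>x. \<Sum>i\<in>UNIV. \<Sum>l\<in>UNIV. (norm (D i x))\<^sup>2 + (norm (D l x))\<^sup>2)"
    using D by (intro Bochner_Integration.integrable_add Bochner_Integration.integrable_sum) (auto simp: Lp_ball_def)
qed

end

locale sphere_seq = sphere_data +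
  fixes \<epsilon> :: "nat \<Rightarrow> real" and \<Phi> :: "real^3 \<Rightarrow> real"
  assumes \<epsilon>: "\<epsilon> \<longlonglongrightarrow> 0" "0 < \<epsilon> k" "\<epsilon> k \<le> 1/2" and \<Phi>: "integrable uball \<Phi>"
    and pack_lim: "AE x in uball. (\<lambda>k. mol (\<epsilon> k) pack x) \<longlonglongrightarrow> pack x \<and> (\<forall>k. (norm (mol (\<epsilon> k) pack x))\<^sup>2 \<le> \<Phi> x)
      \<and> (\<lambda>k. mol (\<epsilon> k) \<Omega> x) \<longlonglongrightarrow> \<Omega> x \<and> (\<forall>k. norm (mol (\<epsilon> k) \<Omega> x) \<le> \<Phi> x) \<and> (norm (pack x))\<^sup>2 \<le> \<Phi> x"
begin

abbreviation "uk k \<equiv> mol (\<epsilon> k) u"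
abbreviation "\<eta>k k \<equiv> mol (\<epsilon> k) \<eta>"

definition a :: "3 \<Rightarrow> real^3 \<Rightarrow> real^3" where
  "a j y = (1/2) *\<^sub>R (cross3 (u y) (D j y) - \<eta> y $ j *\<^sub>R u y)"


lemma comps:
  "mol (\<epsilon> k) u x = fst (fst (mol (\<epsilon> k) pack x))"
  "mol (\<epsilon> k) \<eta> x = snd (fst (mol (\<epsilon> k) pack x))"
  "mol (\<epsilon> k) (D j) x = snd (mol (\<epsilon> k) pack x) $ j"
  "mol (\<epsilon> k) (\<omega> i l) x = mol (\<epsilon> k) \<Omega> x $ i $ l"
proof -
  have i: "integrable lborel pack" "integrable lborel \<Omega>" using Lp_ball_integrable[OF pack_Lp] Lp_ball_integrable[OF \<Omega>_Lp] by auto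
  have "mol (\<epsilon> k) (\<lambda>x. fst (fst (pack x))) x = fst (fst (mol (\<epsilon> k) pack x))"
    by (rule mol_bounded_linear[OF _ i(1) \<epsilon>(2)]) (intro bounded_linear_fst_comp bounded_linear_fst)
  then show "mol (\<epsilon> k) u x = fst (fst (mol (\<epsilon> k) pack x))" by (simp add: pack_def)
  have "mol (\<epsilon> k) (\<lambda>x. snd (fst (pack x))) x = snd (fst (mol (\<epsilon> k) pack x))"
    by (rule mol_bounded_linear[OF _ i(1) \<epsilon>(2)]) (intro bounded_linear_snd_comp bounded_linear_fst)
  then show "mol (\<epsilon> k) \<eta> x = snd (fst (mol (\<epsilon> k) pack x))" by (simp add: pack_def)
  have "mol (\<epsilon> k) (\<lambda>x. snd (pack x) $ j) x = snd (mol (\<epsilon> k) pack x) $ j"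
    by (rule mol_bounded_linear[OF _ i(1) \<epsilon>(2)])
       (intro bounded_linear_compose[OF bounded_linear_vec_nth bounded_linear_snd])
  then show "mol (\<epsilon> k) (D j) x = snd (mol (\<epsilon> k) pack x) $ j" by (simp add: pack_def)
  have "mol (\<epsilon> k) (\<lambda>x. \<Omega> x $ i $ l) x = mol (\<epsilon> k) \<Omega> x $ i $ l"
    by (rule mol_bounded_linear[OF _ i(2) \<epsilon>(2)])
       (intro bounded_linear_compose[OF bounded_linear_vec_nth bounded_linear_vec_nth])
  then show "mol (\<epsilon> k) (\<omega> i l) x = mol (\<epsilon> k) \<Omega> x $ i $ l" by (simp add: \<Omega>_def)
qed

lemma norm_comps:
  "norm (fst (fst v)) \<le> norm v" "norm (snd (fst v)) \<le> norm v" "norm (snd v $ j) \<le> norm v"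
  for v :: "((real^3) \<times> (real^3)) \<times> (real^3^3)"
proof -
  have f: "norm (fst w) \<le> norm w" "norm (snd w) \<le> norm w" for w :: "'x::real_normed_vector \<times> 'y::real_normed_vector"
    by (cases w; simp add: norm_fst_le norm_snd_le)+
  show "norm (fst (fst v)) \<le> norm v" "norm (snd (fst v)) \<le> norm v"
    by (rule order_trans[OF f(1) f(1)], rule order_trans[OF f(2) f(1)])
  show "norm (snd v $ j) \<le> norm v"
    by (rule order_trans[OF Finite_Cartesian_Product.norm_nth_le f(2)])
qed

definition good :: "real^3 \<Rightarrow> bool" where
  "good x \<longleftrightarrow> norm x \<le> 1 \<and> (\<lambda>k. uk k x) \<longlonglongrightarrow> u x \<and> (\<lambda>k. \<eta>k k x) \<longlonglongrightarrow> \<eta> x \<and> (\<forall>j. (\<lambda>k. mol (\<epsilon> k) (D j) x) \<longlonglongrightarrow> D j x)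
    \<and> (\<forall>i l. (\<lambda>k. mol (\<epsilon> k) (\<omega> i l) x) \<longlonglongrightarrow> \<omega> i l x)
    \<and> norm (u x) = 1 \<and> \<Phi> x \<ge> 0 \<and> (\<forall>k. norm (\<eta>k k x) \<le> sqrt (\<Phi> x)) \<and> (\<forall>k j. norm (mol (\<epsilon> k) (D j) x) \<le> sqrt (\<Phi> x))
    \<and> (\<forall>k i l. \<bar>mol (\<epsilon> k) (\<omega> i l) x\<bar> \<le> \<Phi> x) \<and> norm (\<eta> x) \<le> sqrt (\<Phi> x) \<and> (\<forall>j. norm (D j x) \<le> sqrt (\<Phi> x))"

lemma AE_good: "AE x in uball. good x"
proof -
  have "AE x in uball. norm x \<le> 1" by (rule AE_I2) simp
  with pack_lim u_sphere show ?thesis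
  proof eventually_elim
    case (elim x)
    then have l: "(\<lambda>k. mol (\<epsilon> k) pack x) \<longlonglongrightarrow> pack x" and b: "\<And>k. (norm (mol (\<epsilon> k) pack x))\<^sup>2 \<le> \<Phi> x"
      and l': "(\<lambda>k. mol (\<epsilon> k) \<Omega> x) \<longlonglongrightarrow> \<Omega> x" and b': "\<And>k. norm (mol (\<epsilon> k) \<Omega> x) \<le> \<Phi> x" and p: "(norm (pack x))\<^sup>2 \<le> \<Phi> x"
      by blast+
    have \<Phi>0: "\<Phi> x \<ge> 0" using p zero_le_power2 order_trans by blast
    have s: "norm v \<le> sqrt (\<Phi> x)" if "(norm v)\<^sup>2 \<le> \<Phi> x" for v :: "((real^3) \<times> (real^3)) \<times> (real^3^3)"
      using real_le_rsqrt[OF that] .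
    have \<Omega>: "\<bar>mol (\<epsilon> k) \<Omega> x $ i $ l\<bar> \<le> \<Phi> x" for k i l
      using b'[of k] component_le_norm_cart[of "mol (\<epsilon> k) \<Omega> x $ i" l] Finite_Cartesian_Product.norm_nth_le[of "mol (\<epsilon> k) \<Omega> x" i] by linarith
    have e: "u x = fst (fst (pack x))" "\<eta> x = snd (fst (pack x))" "D j x = snd (pack x) $ j" "\<omega> i l x = \<Omega> x $ i $ l" for i j l
      by (auto simp: pack_def \<Omega>_def)
    show ?case
      unfolding good_def comps
    proof (intro conjI allI)
      show "norm x \<le> 1" "norm (u x) = 1" using elim by auto
      show "(\<lambda>k. fst (fst (mol (\<epsilon> k) pack x))) \<longlonglongrightarrow> u x" unfolding e by (intro tendsto_fst l)
      show "(\<lambda>k. snd (fst (mol (\<epsilon> k) pack x))) \<longlonglongrightarrow> \<eta> x" unfolding e by (intro tendsto_fst tendsto_snd l)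
      show "(\<lambda>k. snd (mol (\<epsilon> k) pack x) $ j) \<longlonglongrightarrow> D j x" for j unfolding e by (intro tendsto_snd tendsto_vec_nth l)
      show "(\<lambda>k. mol (\<epsilon> k) \<Omega> x $ i $ l) \<longlonglongrightarrow> \<omega> i l x" for i l unfolding e by (intro tendsto_vec_nth l')
      show "norm (\<eta> x) \<le> sqrt (\<Phi> x)" "norm (D j x) \<le> sqrt (\<Phi> x)" for j
        unfolding e by (rule order_trans[OF norm_comps(2) s[OF p]], rule order_trans[OF norm_comps(3) s[OF p]])
      show "norm (snd (fst (mol (\<epsilon> k) pack x))) \<le> sqrt (\<Phi> x)" for k by (rule order_trans[OF norm_comps(2) s[OF b]])
      show "norm (snd (mol (\<epsilon> k) pack x) $ j) \<le> sqrt (\<Phi> x)" for k j by (rule order_trans[OF norm_comps(3) s[OF b]])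
    qed (rule \<Phi>0 \<Omega>)+
  qed
qed

lemma kernels: "test_kernel 3 (uk k)" "test_kernel 3 (\<eta>k k)"
  using test_kernel_mol[OF integrable_data(1) zero_outside(1) \<epsilon>(2,3)]
    test_kernel_mol[OF integrable_data(2) zero_outside(2) \<epsilon>(2,3)] by auto

lemma \<epsilon>1: "\<epsilon> k \<le> 1"
  using \<epsilon>(3)[of k] by simp

lemma uk_derivative:
  "norm x \<le> 1 \<Longrightarrow> frechet_derivative (uk k) (at x) (axis j 1) = (1 - \<epsilon> k) *\<^sub>R mol (\<epsilon> k) (D j) x"
  by (rule mol_weak_dir[OF integrable_data(1) measurable_data(3) Du \<epsilon>(2) \<epsilon>1])

text \<open>\<eta> need not have weak derivatives; only this antisymmetric combination is
  controlled, by using the mollifying kernel at x as test function in the equation. The factor 1 -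
  \<epsilon> again comes from the contraction.\<close>

lemma \<eta>k_derivative:
  assumes x: "norm x \<le> 1"
  shows "frechet_derivative (\<eta>k k) (at x) (axis i 1) \<bullet> axis l 1 - frechet_derivative (\<eta>k k) (at x) (axis l 1) \<bullet> axis i 1
    = (1 - \<epsilon> k) * mol (\<epsilon> k) (\<omega> i l) x"
proof -
  let ?ker = "mol_kernel (\<epsilon> k) x"
  have "(1 - \<epsilon> k) * norm x \<le> (1 - \<epsilon> k) * 1" using \<epsilon>1 x by (intro mult_left_mono) auto
  then have tf: "test_function (cball 0 1) ?ker"
    using \<epsilon>(2)[of k] \<epsilon>1[of k] by (intro test_function_mol_kernel(1)) auto
  note tk = test_function_test_kernel(1)[OF tf]
  have int: "integrable lborel (\<lambda>y. frechet_derivative ?ker (at y) v *\<^sub>R \<eta> y)" for v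
  proof -
    obtain K where "\<And>z. norm (frechet_derivative ?ker (at z) v) \<le> K"
      using test_kernel_bounded[OF test_kernel_derivative[OF tk]] by metis
    then show ?thesis
      using integrable_bounded_scaleR[OF integrable_data(2), of "\<lambda>y. frechet_derivative ?ker (at y) v" K]
        test_kernel_measurable[OF test_kernel_derivative[OF tk]] by auto
  qed
  have c: "(LINT y|lborel. frechet_derivative ?ker (at y) v *\<^sub>R \<eta> y) $ m = (LINT y|lborel. frechet_derivative ?ker (at y) v * \<eta> y $ m)"
    and ic: "integrable lborel (\<lambda>y. frechet_derivative ?ker (at y) v * \<eta> y $ m)" for v m
    using integral_bounded_linear[OF bounded_linear_vec_nth[of m] int[of v]]
      integrable_bounded_linear[OF bounded_linear_vec_nth[of m] int[of v]] by simp_all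
  have D: "frechet_derivative (\<eta>k k) (at x) v $ m = - (1 - \<epsilon> k) * (LINT y|lborel. frechet_derivative ?ker (at y) v * \<eta> y $ m)" for v m
    by (simp add: frechet_derivative_at[OF mol_has_derivative[OF integrable_data(2) \<epsilon>(2)], symmetric] c)
  have "(LINT y|lborel. frechet_derivative ?ker (at y) (axis i 1) * \<eta> y $ l) - (LINT y|lborel. frechet_derivative ?ker (at y) (axis l 1) * \<eta> y $ i)
    = - mol (\<epsilon> k) (\<omega> i l) x"
    using d\<eta>[OF tf, of i l] by (simp add: Bochner_Integration.integral_diff[OF ic ic] mol_eq_mol_kernel \<epsilon>)
  then have "- (1 - \<epsilon> k) * ((LINT y|lborel. frechet_derivative ?ker (at y) (axis i 1) * \<eta> y $ l) - (LINT y|lborel. frechet_derivative ?ker (at y) (axis l 1) * \<eta> y $ i))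
    = (1 - \<epsilon> k) * mol (\<epsilon> k) (\<omega> i l) x" by (simp only: mult_minus_left mult_minus_right minus_minus)
  then show ?thesis by (simp only: inner_axis D right_diff_distrib) simp
qed

lemma norm_uk_le: "norm (uk k x) \<le> 1"
  by (rule norm_mol_le) (use u_le in auto)

text \<open>The relation |u|^2 = 1 is differentiated through the mollified maps, for which the
  product rule is classical: the derivative of \<phi> |u_k|^2 integrates to 0. In the limit the
  derivative of \<phi> is multiplied by 1 and integrates to 0 on its own, so the other term does
  too.\<close>

lemma tangent: "AE x in uball. \<forall>j. u x \<bullet> D j x = 0"
proof -
  have "AE x in uball. u x \<bullet> D j x = 0" for j
  proof (rule AE_uball_open, rule fundamental_lemma[where f="\<lambda>x. u x \<bullet> D j x"])
    show "Lp_ball 1 (\<lambda>x. u x \<bullet> D j x)"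
    proof (rule Lp_ball_bounded_by[where G="\<lambda>x. norm (D j x)"])
      show "norm (u x \<bullet> D j x) ^ 1 \<le> norm (D j x)" for x
        using Cauchy_Schwarz_ineq2[of "u x" "D j x"] mult_right_mono[OF u_le norm_ge_zero, of x "D j x"] by simp
      show "(\<lambda>x. u x \<bullet> D j x) \<in> borel_measurable borel" by measurable
    qed (use integrable_data zero_outside in auto)
    fix \<phi> :: "real^3 \<Rightarrow> real" assume \<phi>: "test_function (cball 0 1) \<phi>"
    note tk = test_function_test_kernel[OF \<phi>]
    obtain M where M: "M > 0" "\<And>x. norm (\<phi> x) \<le> M" using test_kernel_bounded[OF tk(1)] by metis
    obtain L where L: "L > 0" "\<And>x v. norm (frechet_derivative \<phi> (at x) v) \<le> L * norm v"
      using test_kernel_derivative_bounded[OF tk(1)] by metis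
    let ?e = "axis j 1 :: real^3"
    let ?D\<phi> = "\<lambda>x. frechet_derivative \<phi> (at x) ?e" and ?Duk = "\<lambda>k x. frechet_derivative (uk k) (at x) ?e"
    have [measurable]: "\<phi> \<in> borel_measurable borel" "?D\<phi> \<in> borel_measurable borel" "?Duk k \<in> borel_measurable borel" for k
      using test_kernel_measurable[OF tk(1)] test_kernel_measurable[OF test_kernel_derivative[OF tk(1)]]
        test_kernel_measurable[OF test_kernel_derivative[OF kernels(1)]] by auto
    let ?f = "\<lambda>k x. \<phi> x * (2 * (uk k x \<bullet> ?Duk k x)) + ?D\<phi> x * (uk k x \<bullet> uk k x)"
    have \<phi>0: "\<phi> x = 0" "?D\<phi> x = 0" if "norm x > 1" for x
      using tk(2)[of x] test_kernel_derivative[OF tk(1), of ?e] that by (auto simp: test_kernel_def)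
    have zero: "(LINT x|uball. ?f k x) = 0" for k
    proof -
      have F: "test_kernel 1 (\<lambda>x. \<phi> x * (uk k x \<bullet> uk k x))"
        using tk(1) kernels(1)[of k]
        by (auto simp: test_kernel_def intro!: Ck_on_bounded_bilinear[OF bounded_bilinear_mult]
            Ck_on_bounded_bilinear[OF bounded_bilinear_inner])
      have "((\<lambda>x. \<phi> x * (uk k x \<bullet> uk k x)) has_derivative (\<lambda>h. \<phi> x * (uk k x \<bullet> frechet_derivative (uk k) (at x) h
          + frechet_derivative (uk k) (at x) h \<bullet> uk k x) + frechet_derivative \<phi> (at x) h * (uk k x \<bullet> uk k x))) (at x)" for x
        by (rule has_derivative_mult[OF test_kernel_has_derivative[OF tk(1)]
              has_derivative_inner[OF test_kernel_has_derivative[OF kernels(1)] test_kernel_has_derivative[OF kernels(1)]]])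
      from frechet_derivative_at[OF this, THEN fun_cong, symmetric]
      have "frechet_derivative (\<lambda>x. \<phi> x * (uk k x \<bullet> uk k x)) (at x) ?e = ?f k x" for x
        by (simp add: inner_commute)
      then have "(LINT x|lborel. ?f k x) = 0"
        using integral_test_kernel_derivative[OF F, of ?e] by simp
      then show ?thesis by (subst integral_lborel_eq_uball(1)[symmetric]) (auto simp: \<phi>0)
    qed
    have "(\<lambda>k. LINT x|uball. ?f k x) \<longlonglongrightarrow> (LINT x|uball. \<phi> x * (2 * (u x \<bullet> D j x)) + ?D\<phi> x)"
    \<comment> \<open>\<open>M\<close> and \<open>L\<close> bound \<phi> and its derivative; the
      bound sqrt \<Phi> of the derivatives of u is estimated by 1 + \<Phi>.\<close>
    proof (rule integral_dominated_convergence[where w="\<lambda>x. M * (2 * (1 + \<Phi> x)) + L"])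
      have "integrable uball (\<lambda>x::real^3. c)" for c :: real using finite_measure.integrable_const[OF finite_measure_uball] .
      then show "integrable uball (\<lambda>x. M * (2 * (1 + \<Phi> x)) + L)"
        using \<Phi> by (intro Bochner_Integration.integrable_add integrable_mult_right)
      show "AE x in uball. (\<lambda>k. ?f k x) \<longlonglongrightarrow> \<phi> x * (2 * (u x \<bullet> D j x)) + ?D\<phi> x"
        using AE_good
      proof eventually_elim
        case (elim x)
        have "(\<lambda>k. (1 - \<epsilon> k) *\<^sub>R mol (\<epsilon> k) (D j) x) \<longlonglongrightarrow> (1 - 0) *\<^sub>R D j x"
          using elim by (intro tendsto_intros \<epsilon>(1)) (auto simp: good_def)
        moreover have "norm x \<le> 1" using elim by (simp add: good_def)
        ultimately have "(\<lambda>k. ?Duk k x) \<longlonglongrightarrow> D j x" by (simp add: uk_derivative)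
        then have "(\<lambda>k. ?f k x) \<longlonglongrightarrow> \<phi> x * (2 * (u x \<bullet> D j x)) + ?D\<phi> x * (u x \<bullet> u x)"
          using elim by (intro tendsto_intros) (auto simp: good_def)
        then show ?case using elim by (simp add: good_def norm_eq_1)
      qed
      show "AE x in uball. norm (?f k x) \<le> M * (2 * (1 + \<Phi> x)) + L" for k
        using AE_good
      proof eventually_elim
        case (elim x)
        have x: "norm x \<le> 1" and \<Phi>0: "\<Phi> x \<ge> 0" and b: "norm (mol (\<epsilon> k) (D j) x) \<le> sqrt (\<Phi> x)"
          using elim by (auto simp: good_def)
        have sq: "sqrt (\<Phi> x) \<le> 1 + \<Phi> x"
          by (rule real_le_lsqrt[OF _ _]) (use \<Phi>0 in \<open>auto simp: power2_eq_square algebra_simps\<close>)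
        have "norm (?Duk k x) \<le> 1 * sqrt (\<Phi> x)"
          unfolding uk_derivative[OF x] norm_scaleR using b \<epsilon>(2)[of k] \<epsilon>1[of k] by (intro mult_mono) auto
        then have d: "norm (?Duk k x) \<le> 1 + \<Phi> x" using sq by simp
        have "\<bar>uk k x \<bullet> ?Duk k x\<bar> \<le> 1 * (1 + \<Phi> x)"
          using d \<Phi>0 by (intro order_trans[OF Cauchy_Schwarz_ineq2] mult_mono norm_uk_le) auto
        then have 1: "\<bar>\<phi> x * (2 * (uk k x \<bullet> ?Duk k x))\<bar> \<le> M * (2 * (1 + \<Phi> x))"
          unfolding abs_mult[of "\<phi> x"] using M(1) M(2)[of x] \<Phi>0 by (intro mult_mono) auto
        have "\<bar>uk k x \<bullet> uk k x\<bar> \<le> 1 * 1"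
          by (intro order_trans[OF Cauchy_Schwarz_ineq2] mult_mono norm_uk_le) auto
        then have 2: "\<bar>?D\<phi> x * (uk k x \<bullet> uk k x)\<bar> \<le> L * 1"
          unfolding abs_mult using L(1) L(2)[of x ?e] by (intro mult_mono) auto
        show ?case using 1 2 by simp
      qed
    qed measurable
    then have "(LINT x|uball. \<phi> x * (2 * (u x \<bullet> D j x)) + ?D\<phi> x) = 0" unfolding zero by (simp add: LIMSEQ_const_iff)
    then have "(LINT x|lborel. \<phi> x * (2 * (u x \<bullet> D j x)) + ?D\<phi> x) = 0"
      by (subst integral_lborel_eq_uball(1)) (auto simp: \<phi>0)
    moreover have "(LINT x|lborel. ?D\<phi> x) = 0" by (rule integral_test_kernel_derivative[OF tk(1)]) simp
    moreover have "integrable lborel ?D\<phi>"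
      by (rule integrable_compact_support[OF test_kernel_continuous[OF test_kernel_derivative[OF tk(1)]] \<phi>0(2)])
    moreover have iD: "integrable lborel (\<lambda>x. \<phi> x * (2 * (u x \<bullet> D j x)))"
    proof (rule Bochner_Integration.integrable_bound[where f="\<lambda>x. M * (2 * norm (D j x))"])
      show "integrable lborel (\<lambda>x. M * (2 * norm (D j x)))" using integrable_data by auto
      show "AE x in lborel. norm (\<phi> x * (2 * (u x \<bullet> D j x))) \<le> norm (M * (2 * norm (D j x)))"
      proof (rule AE_I2)
        fix x
        have "\<bar>u x \<bullet> D j x\<bar> \<le> 1 * norm (D j x)"
          by (intro order_trans[OF Cauchy_Schwarz_ineq2] mult_right_mono u_le) auto
        then have "\<bar>\<phi> x * (2 * (u x \<bullet> D j x))\<bar> \<le> M * (2 * norm (D j x))"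
          unfolding abs_mult[of "\<phi> x"] using M(1) M(2)[of x] by (intro mult_mono) auto
        then show "norm (\<phi> x * (2 * (u x \<bullet> D j x))) \<le> norm (M * (2 * norm (D j x)))" using M(1) by simp
      qed
    qed measurable
    ultimately have "(LINT x|lborel. \<phi> x * (2 * (u x \<bullet> D j x))) = 0" by simp
    then have "(LINT x|lborel. 2 * (\<phi> x * (u x \<bullet> D j x))) = 0" by (simp only: mult.left_commute)
    then show "(LINT y|lborel. \<phi> y *\<^sub>R (u y \<bullet> D j y)) = 0" by simp
  qed simp
  then show ?thesis by (simp add: AE_all_countable)
qed

end

section \<open>Almost flatness of the mollified connections\<close>

context sphere_seq
begin

abbreviation "Ak k \<equiv> sphere_connection (uk k) (\<eta>k k)"
abbreviation "DAk k \<equiv> \<lambda>y w v. frechet_derivative (\<lambda>y. Ak k y v) (at y) w"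

definition Sk :: "nat \<Rightarrow> real^3 \<Rightarrow> real" where
  "Sk k y = (\<Sum>j\<in>UNIV. norm (Ak k y (axis j 1) - a j y))
      + (\<Sum>i\<in>UNIV. \<Sum>j\<in>UNIV. norm (curvature (Ak k) (DAk k) y (axis i 1) (axis j 1)))
      + (\<Sum>j\<in>UNIV. norm (frechet_derivative (uk k) (at y) (axis j 1) - 2 *\<^sub>R cross3 (Ak k y (axis j 1)) (uk k y)))"

lemma Ak_eq: "norm y \<le> 1 \<Longrightarrow> Ak k y (axis j 1) =
    (1/2) *\<^sub>R (cross3 (uk k y) ((1 - \<epsilon> k) *\<^sub>R mol (\<epsilon> k) (D j) y) - \<eta>k k y $ j *\<^sub>R uk k y)"
  by (simp add: sphere_connection_def uk_derivative inner_axis)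

lemma curvature_Ak: "norm y \<le> 1 \<Longrightarrow> curvature (Ak k) (DAk k) y (axis i 1) (axis j 1) =
    curv_poly (uk k y) ((1 - \<epsilon> k) *\<^sub>R mol (\<epsilon> k) (D i) y) ((1 - \<epsilon> k) *\<^sub>R mol (\<epsilon> k) (D j) y)
      (\<eta>k k y $ i) (\<eta>k k y $ j) ((1 - \<epsilon> k) * mol (\<epsilon> k) (\<omega> i j) y)"
  unfolding sphere_connection_curvature[OF kernels]
  by (simp only: uk_derivative \<eta>k_derivative) (simp add: inner_axis)

lemma a_measurable[measurable]: "a j \<in> borel_measurable borel"
proof -
  have "(\<lambda>v::real^3. v $ j) \<in> borel_measurable borel"
    by (intro borel_measurable_continuous_onI continuous_intros)
  from measurable_compose[OF measurable_data(2) this]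
  have [measurable]: "(\<lambda>x. \<eta> x $ j) \<in> borel_measurable borel" .
  note measurable_data[measurable]
  show ?thesis unfolding a_def[abs_def] by measurable
qed

lemma Sk_measurable: "Sk k \<in> borel_measurable borel"
proof -
  note K = kernels[of k]
  have [measurable]: "uk k \<in> borel_measurable borel" "\<eta>k k \<in> borel_measurable borel"
    "(\<lambda>y. frechet_derivative (uk k) (at y) v) \<in> borel_measurable borel"
    "(\<lambda>y. frechet_derivative (\<eta>k k) (at y) v) \<in> borel_measurable borel" for v
    using test_kernel_measurable[OF K(1)] test_kernel_measurable[OF K(2)]
      test_kernel_measurable[OF test_kernel_derivative[OF K(1)]] test_kernel_measurable[OF test_kernel_derivative[OF K(2)]]
    by auto
  have [measurable]: "(\<lambda>y. Ak k y v) \<in> borel_measurable borel" for v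
    unfolding sphere_connection_def[abs_def] by measurable
  have "(\<lambda>y. curvature (Ak k) (DAk k) y v w) \<in> borel_measurable borel" for v w
    unfolding sphere_connection_curvature[OF K] curv_poly_def by measurable
  then show ?thesis unfolding Sk_def[abs_def] by measurable
qed

text \<open>The three kinds of error are continuous expressions in converging quantities. Their
  limits are a - a, the curvature polynomial at tangent data with the right d\<eta>, and D - 2 a x
  u, all equal to 0.\<close>

lemma good_limits:
  assumes x: "good x" and t: "\<forall>j. u x \<bullet> D j x = 0"
  shows "(\<lambda>k. Sk k x) \<longlonglongrightarrow> 0"
proof -
  have x1: "norm x \<le> 1" and ux: "norm (u x) = 1" using x by (auto simp: good_def)
  have uu: "u x \<bullet> u x = 1" using ux by (simp add: norm_eq_1)
  have ul: "(\<lambda>k. uk k x) \<longlonglongrightarrow> u x" and \<eta>l: "(\<lambda>k. \<eta>k k x) \<longlonglongrightarrow> \<eta> x" using x by (auto simp: good_def)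
  have Dl: "(\<lambda>k. (1 - \<epsilon> k) *\<^sub>R mol (\<epsilon> k) (D j) x) \<longlonglongrightarrow> D j x" for j
  proof -
    have "(\<lambda>k. (1 - \<epsilon> k) *\<^sub>R mol (\<epsilon> k) (D j) x) \<longlonglongrightarrow> (1 - 0) *\<^sub>R D j x"
      using x by (intro tendsto_intros \<epsilon>(1)) (auto simp: good_def)
    then show ?thesis by simp
  qed
  have \<omega>l: "(\<lambda>k. (1 - \<epsilon> k) * mol (\<epsilon> k) (\<omega> i j) x) \<longlonglongrightarrow> \<omega> i j x" for i j
  proof -
    have "(\<lambda>k. (1 - \<epsilon> k) * mol (\<epsilon> k) (\<omega> i j) x) \<longlonglongrightarrow> (1 - 0) * \<omega> i j x"
      using x by (intro tendsto_intros \<epsilon>(1)) (auto simp: good_def)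
    then show ?thesis by simp
  qed
  have Al: "(\<lambda>k. Ak k x (axis j 1)) \<longlonglongrightarrow> a j x" for j
    unfolding Ak_eq[OF x1] a_def by (intro tendsto_intros ul \<eta>l Dl)
  have 1: "(\<lambda>k. norm (Ak k x (axis j 1) - a j x)) \<longlonglongrightarrow> 0" for j
    using tendsto_norm[OF tendsto_diff[OF Al[of j] tendsto_const[of "a j x"]]] by (simp only: diff_self norm_zero)
  have 2: "(\<lambda>k. norm (curvature (Ak k) (DAk k) x (axis i 1) (axis j 1))) \<longlonglongrightarrow> 0" for i j
  proof -
    have "(\<lambda>k. curvature (Ak k) (DAk k) x (axis i 1) (axis j 1)) \<longlonglongrightarrow> curv_poly (u x) (D i x) (D j x) (\<eta> x $ i) (\<eta> x $ j) (\<omega> i j x)"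
      unfolding curvature_Ak[OF x1] curv_poly_def by (intro tendsto_intros ul \<eta>l Dl \<omega>l)
    also have "curv_poly (u x) (D i x) (D j x) (\<eta> x $ i) (\<eta> x $ j) (\<omega> i j x) = 0"
      unfolding \<omega>_def using ux t by (intro curv_poly_zero) auto
    finally show ?thesis by (rule tendsto_norm_zero)
  qed
  have 3: "(\<lambda>k. norm (frechet_derivative (uk k) (at x) (axis j 1) - 2 *\<^sub>R cross3 (Ak k x (axis j 1)) (uk k x))) \<longlonglongrightarrow> 0" for j
  proof -
    have "(\<lambda>k. frechet_derivative (uk k) (at x) (axis j 1) - 2 *\<^sub>R cross3 (Ak k x (axis j 1)) (uk k x)) \<longlonglongrightarrow>
      D j x - 2 *\<^sub>R cross3 (a j x) (u x)"
      unfolding uk_derivative[OF x1] by (intro tendsto_intros ul Dl Al)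
    also have "2 *\<^sub>R cross3 (a j x) (u x) = D j x"
      unfolding a_def using ux t by (intro cross_recovers_tangent) auto
    finally show ?thesis by (simp add: tendsto_norm_zero)
  qed
  have "(\<lambda>k. Sk k x) \<longlonglongrightarrow> (\<Sum>j\<in>(UNIV::3 set). 0) + (\<Sum>i\<in>(UNIV::3 set). \<Sum>j\<in>(UNIV::3 set). 0) + (\<Sum>j\<in>(UNIV::3 set). 0)"
    unfolding Sk_def by (intro tendsto_add tendsto_sum 1 2 3)
  then show ?thesis by simp
qed

lemma good_bound:
  assumes x: "good x"
  shows "Sk k x \<le> 60 * (1 + \<Phi> x)"
proof -
  define m where "m = sqrt (\<Phi> x)"
  have x1: "norm x \<le> 1" and \<Phi>0: "\<Phi> x \<ge> 0" and ux: "norm (u x) \<le> 1" using x by (auto simp: good_def)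
  have m0: "m \<ge> 0" and m2: "m\<^sup>2 = \<Phi> x" using \<Phi>0 by (auto simp: m_def)
  have \<epsilon>a: "\<bar>1 - \<epsilon> k\<bar> \<le> 1" using \<epsilon>(2)[of k] \<epsilon>1[of k] by simp
  have Dk: "norm ((1 - \<epsilon> k) *\<^sub>R mol (\<epsilon> k) (D j) x) \<le> m" for j
  proof -
    have "norm ((1 - \<epsilon> k) *\<^sub>R mol (\<epsilon> k) (D j) x) \<le> 1 * m"
      unfolding norm_scaleR using x \<epsilon>a by (intro mult_mono) (auto simp: good_def m_def)
    then show ?thesis by simp
  qed
  have \<eta>k: "\<bar>\<eta>k k x $ j\<bar> \<le> m" for j
    using component_le_norm_cart[of "\<eta>k k x" j] x by (auto simp: good_def m_def intro: order_trans)
  have \<eta>x: "\<bar>\<eta> x $ j\<bar> \<le> m" for j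
    using component_le_norm_cart[of "\<eta> x" j] x by (auto simp: good_def m_def intro: order_trans)
  have \<omega>k: "\<bar>(1 - \<epsilon> k) * mol (\<epsilon> k) (\<omega> i j) x\<bar> \<le> m\<^sup>2" for i j
  proof -
    have "\<bar>1 - \<epsilon> k\<bar> * \<bar>mol (\<epsilon> k) (\<omega> i j) x\<bar> \<le> 1 * \<Phi> x"
      using x \<epsilon>a by (intro mult_mono) (auto simp: good_def)
    then show ?thesis by (simp add: abs_mult m2)
  qed
  have gen: "norm ((1/2) *\<^sub>R (cross3 v d - s *\<^sub>R v)) \<le> m" if "norm v \<le> 1" "norm d \<le> m" "\<bar>s\<bar> \<le> m" for v d :: "real^3" and s
  proof -
    have "norm (cross3 v d) \<le> 1 * m" by (intro order_trans[OF norm_cross3_le] mult_mono) (use that in auto)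
    moreover have "norm (s *\<^sub>R v) \<le> m * 1" unfolding norm_scaleR using that m0 by (intro mult_mono) auto
    ultimately show ?thesis using norm_triangle_ineq4[of "cross3 v d" "s *\<^sub>R v"] by simp
  qed
  have A: "norm (Ak k x (axis j 1)) \<le> m" for j
    unfolding Ak_eq[OF x1] by (rule gen[OF norm_uk_le Dk \<eta>k])
  have aj: "norm (a j x) \<le> m" for j
    unfolding a_def by (rule gen[OF ux _ \<eta>x]) (use x in \<open>auto simp: good_def m_def\<close>)
  have 1: "norm (Ak k x (axis j 1) - a j x) \<le> 2 * m" for j
    using norm_triangle_ineq4[of "Ak k x (axis j 1)" "a j x"] A[of j] aj[of j] by linarith
  have 2: "norm (curvature (Ak k) (DAk k) x (axis i 1) (axis j 1)) \<le> 5 * m\<^sup>2" for i j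
    unfolding curvature_Ak[OF x1] by (rule curv_poly_bound[OF norm_uk_le Dk Dk \<eta>k \<eta>k \<omega>k])
  have 3: "norm (frechet_derivative (uk k) (at x) (axis j 1) - 2 *\<^sub>R cross3 (Ak k x (axis j 1)) (uk k x)) \<le> 3 * m" for j
  proof -
    have "norm (cross3 (Ak k x (axis j 1)) (uk k x)) \<le> m * 1"
      by (intro order_trans[OF norm_cross3_le] mult_mono A norm_uk_le) (use m0 in auto)
    then show ?thesis
      using norm_triangle_ineq4[of "frechet_derivative (uk k) (at x) (axis j 1)" "2 *\<^sub>R cross3 (Ak k x (axis j 1)) (uk k x)"] Dk[of j]
      unfolding uk_derivative[OF x1] by simp
  qed
  have "Sk k x \<le> (\<Sum>j\<in>(UNIV::3 set). 2 * m) + (\<Sum>i\<in>(UNIV::3 set). \<Sum>j\<in>(UNIV::3 set). 5 * m\<^sup>2) + (\<Sum>j\<in>(UNIV::3 set). 3 * m)"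
    unfolding Sk_def by (intro add_mono sum_mono 1 2 3)
  \<comment> \<open>The sums give 3 * 2 m + 9 * 5 m^2 + 3 * 3 m; the linear part is then absorbed by
    2 m <= 1 + m^2.\<close>
  also have "\<dots> = 15 * m + 45 * m\<^sup>2" by simp
  also have "\<dots> \<le> 60 * (1 + \<Phi> x)"
  proof -
    have "2 * 1 * m \<le> 1\<^sup>2 + m\<^sup>2" by (rule sum_squares_bound)
    then show ?thesis using m2 zero_le_power2[of m] by simp
  qed
  finally show ?thesis .
qed

lemma a_integrable: "integrable uball (a j)"
proof (rule Bochner_Integration.integrable_bound[where f="\<lambda>x. norm (D j x) + norm (\<eta> x)"])
  show "integrable uball (\<lambda>x. norm (D j x) + norm (\<eta> x))"
    using integrable_data by (intro integrable_uball) auto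
  show "AE x in uball. norm (a j x) \<le> norm (norm (D j x) + norm (\<eta> x))"
  proof (rule AE_I2)
    fix x
    have "norm (cross3 (u x) (D j x)) \<le> 1 * norm (D j x)"
      by (intro order_trans[OF norm_cross3_le] mult_mono u_le) auto
    moreover have "norm (\<eta> x $ j *\<^sub>R u x) \<le> norm (\<eta> x) * 1"
      unfolding norm_scaleR by (intro mult_mono u_le) (auto simp: component_le_norm_cart)
    moreover have "norm (a j x) = (1/2) * norm (cross3 (u x) (D j x) - \<eta> x $ j *\<^sub>R u x)" by (simp add: a_def)
    ultimately have "norm (a j x) \<le> norm (D j x) + norm (\<eta> x)"
      using norm_triangle_ineq4[of "cross3 (u x) (D j x)" "\<eta> x $ j *\<^sub>R u x"]
        norm_ge_zero[of "D j x"] norm_ge_zero[of "\<eta> x"] by linarith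
    then show "norm (a j x) \<le> norm (norm (D j x) + norm (\<eta> x))" by simp
  qed
qed measurable

text \<open>The integrated errors tend to 0 by dominated convergence; a fast subsequence gives them
  the geometric decay that the sequence of gauges needs.\<close>

lemma lift:
  obtains g c where "norm c = 1" "g \<in> borel_measurable borel" "\<And>x. norm x > 1 \<Longrightarrow> g x = 0"
    "AE x in uball. norm (g x) = 1 \<and> u x = Hopf c (g x)"
    "\<And>j. weak_dir (axis j 1) g (\<lambda>x. im (a j x) \<odot> g x)"
proof -
  note [measurable] = Sk_measurable
  have "(\<lambda>k. \<integral>\<^sup>+x. ennreal (Sk k x) \<partial>uball) \<longlonglongrightarrow> (\<integral>\<^sup>+x. 0 \<partial>(uball :: (real^3) measure))"
  proof (rule nn_integral_dominated_convergence[where w="\<lambda>x. ennreal (norm (60 * (1 + \<Phi> x)))"])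
    show "AE x in uball. ennreal (Sk k x) \<le> ennreal (norm (60 * (1 + \<Phi> x)))" for k
      using AE_good by eventually_elim (use good_bound in \<open>fastforce intro!: ennreal_leI intro: order_trans\<close>)
    have "integrable uball (\<lambda>x::real^3. 1::real)" using finite_measure.integrable_const[OF finite_measure_uball] .
    then have "integrable uball (\<lambda>x. 60 * (1 + \<Phi> x))"
      using \<Phi> by (intro Bochner_Integration.integrable_add integrable_mult_right)
    then show "(\<integral>\<^sup>+x. ennreal (norm (60 * (1 + \<Phi> x))) \<partial>uball) < \<infinity>" by (simp only: integrable_iff_bounded)
    show "AE x in uball. (\<lambda>k. ennreal (Sk k x)) \<longlonglongrightarrow> 0"
      using AE_good tangent
    proof eventually_elim
      case (elim x)
      from tendsto_ennrealI[OF good_limits[OF elim]] show ?case by simp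
    qed
    show "(\<lambda>x. ennreal (norm (60 * (1 + \<Phi> x)))) \<in> borel_measurable uball"
      using borel_measurable_integrable[OF \<Phi>] by measurable
  qed auto
  moreover define I where "I = (\<lambda>k. \<integral>\<^sup>+x. ennreal (Sk k x) \<partial>uball)"
  ultimately have I0: "I \<longlonglongrightarrow> 0" by simp
  obtain r where r: "strict_mono r" "\<And>k. I (r k) \<le> ennreal ((1/2) ^ k)"
  proof (rule fast_subsequence[OF I0])
    fix r assume "strict_mono r" "\<And>k. I (r k) \<le> ennreal ((1/2) ^ k)"
    then show thesis by (rule that)
  qed
  \<comment> \<open>A bound for each k separately. It may grow with k, as it serves only the
    continuity and the difference quotients of individual gauges.\<close>
  define K where "K k = (SOME K. connection (Ak k) (DAk k) K)" for k
  have K: "connection (Ak k) (DAk k) (K k)" for k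
    unfolding K_def by (rule someI_ex[OF sphere_connection[OF kernels]])
  have GS: "gauge_sequence (\<lambda>k. Ak (r k)) (\<lambda>k. DAk (r k)) (\<lambda>k. K (r k)) (\<lambda>k. uk (r k))
    (\<lambda>k y. frechet_derivative (uk (r k)) (at y)) a u"
    unfolding gauge_sequence_def Sk_def[symmetric]
  proof (intro conjI allI)
    show "connection (Ak (r k)) (DAk (r k)) (K (r k))" for k by (rule K)
    show "(uk (r k) has_derivative frechet_derivative (uk (r k)) (at y)) (at y)" for k y
      by (rule test_kernel_has_derivative[OF kernels(1)])
    show "continuous_on UNIV (\<lambda>y. frechet_derivative (uk (r k)) (at y) w)" for k w
      by (rule test_kernel_continuous[OF test_kernel_derivative[OF kernels(1)]])
    show "AE x in uball. norm (u x) = 1" by (rule u_sphere)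
    show "AE x in uball. (\<lambda>k. uk (r k) x) \<longlonglongrightarrow> u x"
      using AE_good
    proof eventually_elim
      case (elim x)
      then have "(\<lambda>k. uk k x) \<longlonglongrightarrow> u x" by (simp add: good_def)
      from LIMSEQ_subseq_LIMSEQ[OF this r(1)] show ?case by (simp add: o_def)
    qed
    show "a j \<in> borel_measurable borel" "integrable uball (a j)" for j
      by (rule a_measurable, rule a_integrable)
    show "(\<integral>\<^sup>+y. ennreal (Sk (r k) y) \<partial>uball) \<le> ennreal ((1/2) ^ k)" for k
      using r(2) by (simp add: I_def)
  qed
  interpret G: gauge_sequence "\<lambda>k. Ak (r k)" "\<lambda>k. DAk (r k)" "\<lambda>k. K (r k)" "\<lambda>k. uk (r k)"
    "\<lambda>k y. frechet_derivative (uk (r k)) (at y)" a u "\<lambda>k. Sk (r k)"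
    by (rule GS, rule eq_reflection, simp add: Sk_def)
  show ?thesis
  proof (rule G.lift_exists)
    fix g c
    assume "norm c = 1" "g \<in> borel_measurable borel" "\<And>x. norm x > 1 \<Longrightarrow> g x = 0"
      "AE x in uball. norm (g x) = 1 \<and> u x = Hopf c (g x)"
      "\<And>j. weak_dir (axis j 1) g (\<lambda>x. im (a j x) \<odot> g x)"
    then show thesis by (rule that)
  qed
qed

end

context sphere_data
begin

lemma lift_and_tangent:
  obtains g c where "norm c = 1" "g \<in> borel_measurable borel" "\<And>x. norm x > 1 \<Longrightarrow> g x = 0"
    "AE x in uball. norm (g x) = 1 \<and> u x = Hopf c (g x)"
    "\<And>j. weak_dir (axis j 1) g (\<lambda>x. im ((1/2) *\<^sub>R (cross3 (u x) (D j x) - \<eta> x $ j *\<^sub>R u x)) \<odot> g x)"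
    "AE x in uball. \<forall>j. u x \<bullet> D j x = 0"
proof -
  obtain \<epsilon> \<Phi> where *: "\<epsilon> \<longlonglongrightarrow> 0" "\<And>k. 0 < \<epsilon> k" "\<And>k. \<epsilon> k \<le> 1/2" "integrable uball \<Phi>"
    "AE x in uball. (\<lambda>k. mol (\<epsilon> k) pack x) \<longlonglongrightarrow> pack x \<and> (\<forall>k. (norm (mol (\<epsilon> k) pack x))\<^sup>2 \<le> \<Phi> x)
      \<and> (\<lambda>k. mol (\<epsilon> k) \<Omega> x) \<longlonglongrightarrow> \<Omega> x \<and> (\<forall>k. norm (mol (\<epsilon> k) \<Omega> x) \<le> \<Phi> x) \<and> (norm (pack x))\<^sup>2 \<le> \<Phi> x"
  proof (rule mol_sequence[OF pack_Lp \<Omega>_Lp])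
    fix \<epsilon> \<Phi>
    assume "\<epsilon> \<longlonglongrightarrow> 0" "\<And>k. 0 < \<epsilon> k" "\<And>k. \<epsilon> k \<le> 1/2" "integrable uball \<Phi>"
    "AE x in uball. (\<lambda>k. mol (\<epsilon> k) pack x) \<longlonglongrightarrow> pack x \<and> (\<forall>k. (norm (mol (\<epsilon> k) pack x))\<^sup>2 \<le> \<Phi> x)
      \<and> (\<lambda>k. mol (\<epsilon> k) \<Omega> x) \<longlonglongrightarrow> \<Omega> x \<and> (\<forall>k. norm (mol (\<epsilon> k) \<Omega> x) \<le> \<Phi> x) \<and> (norm (pack x))\<^sup>2 \<le> \<Phi> x"
    then show thesis by (rule that)
  qed
  interpret S: sphere_seq u \<eta> D \<omega> \<epsilon> \<Phi>
    by unfold_locales (use * in \<open>auto simp: \<omega>_def\<close>)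
  show ?thesis
  proof (rule S.lift)
    fix g c
    assume "norm c = 1" "g \<in> borel_measurable borel" "\<And>x. norm x > 1 \<Longrightarrow> g x = 0"
      "AE x in uball. norm (g x) = 1 \<and> u x = Hopf c (g x)"
      "\<And>j. weak_dir (axis j 1) g (\<lambda>x. im (S.a j x) \<odot> g x)"
    then show thesis using S.tangent unfolding S.a_def by (rule that)
  qed
qed

end

section \<open>Smooth approximation of sphere-valued maps\<close>

lemma sgn_has_derivative:
  fixes v :: "'a::real_normed_vector \<Rightarrow> 'b::euclidean_space"
  assumes v: "(v has_derivative v') (at x)" and nz: "v x \<noteq> 0"
  shows "((\<lambda>x. v x /\<^sub>R norm (v x)) has_derivative
    (\<lambda>h. v' h /\<^sub>R norm (v x) - ((v x \<bullet> v' h) / norm (v x) ^ 3) *\<^sub>R v x)) (at x)"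
proof -
  have n: "((\<lambda>x. norm (v x)) has_derivative (\<lambda>h. v' h \<bullet> sgn (v x))) (at x)"
    using has_derivative_compose[OF v has_derivative_norm[OF nz]] .
  have i: "((\<lambda>x. inverse (norm (v x))) has_derivative
      (\<lambda>h. - (inverse (norm (v x)) * (v' h \<bullet> sgn (v x)) * inverse (norm (v x))))) (at x)"
    by (rule Deriv.has_derivative_inverse[OF _ n]) (use nz in simp)
  show ?thesis
    by (rule has_derivative_eq_rhs[OF has_derivative_scaleR[OF i v]])
       (use nz in \<open>simp add: fun_eq_iff sgn_div_norm power3_eq_cube divide_inverse inner_commute algebra_simps\<close>)
qed

text \<open>Each of the two terms is at most |h| / |y|. The energy density of a radial projection is
  thus of inverse square order in the distance from its centre.\<close>

lemma sgn_derivative_le: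
  fixes y h :: "'b::euclidean_space"
  assumes "y \<noteq> 0"
  shows "norm (h /\<^sub>R norm y - ((y \<bullet> h) / norm y ^ 3) *\<^sub>R y) \<le> 2 * norm h / norm y"
proof -
  have n: "norm y > 0" using assms by simp
  have "norm (((y \<bullet> h) / norm y ^ 3) *\<^sub>R y) = \<bar>y \<bullet> h\<bar> / norm y ^ 2"
    using n by (simp add: power3_eq_cube power2_eq_square abs_mult)
  also have "\<dots> \<le> (norm y * norm h) / norm y ^ 2"
    by (intro divide_right_mono Cauchy_Schwarz_ineq2) auto
  also have "\<dots> = norm h / norm y" using n by (simp add: power2_eq_square)
  finally have "norm (((y \<bullet> h) / norm y ^ 3) *\<^sub>R y) \<le> norm h / norm y" .
  then show ?thesis
    using norm_triangle_ineq4[of "h /\<^sub>R norm y" "((y \<bullet> h) / norm y ^ 3) *\<^sub>R y"] by (simp add: divide_inverse_commute)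
qed

text \<open>An average over the centre of projection; the image of the ball is avoided because it has
  measure zero in the larger space.\<close>

lemma good_projection_centre:
  fixes v :: "'a::euclidean_space \<Rightarrow> 'b::euclidean_space" and w :: "'a \<Rightarrow> ennreal"
  assumes dim: "DIM('a) < DIM('b)"
    and v: "v differentiable_on cball 0 1" "v \<in> borel_measurable borel" and w: "w \<in> borel_measurable uball" "(\<integral>\<^sup>+x. w x \<partial>uball) < \<infinity>"
    and r: "0 < r" "r \<le> 1" and \<tau>: "0 < \<tau>"
    and C: "\<And>y::'b. (\<integral>\<^sup>+a. ennreal (1 / (norm (y - a))\<^sup>2) * indicator (cball 0 1) a \<partial>lborel) \<le> ennreal C"
  obtains a where "norm a < r" "a \<notin> v ` cball 0 1"
    "(\<integral>\<^sup>+x. w x * ennreal (1 / (norm (v x - a))\<^sup>2) \<partial>uball) * emeasure lborel (ball (0::'b) r)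
      \<le> ennreal C * (\<integral>\<^sup>+x. w x \<partial>uball) + ennreal \<tau>"
proof (rule ccontr)
  \<comment> \<open>If every centre off the image failed, integrating the reversed inequality over
    the ball of radius \<open>r\<close> would give C W + \<tau> <= C W, by Fubini and the bound
    \<open>C\<close> for the inverse square. The positive \<tau> makes this absurd even if W =
    0.\<close>
  assume "\<not> thesis"
  let ?W = "\<integral>\<^sup>+x. w x \<partial>uball" and ?V = "emeasure lborel (ball (0::'b) r)"
  let ?I = "\<lambda>a. \<integral>\<^sup>+x. w x * ennreal (1 / (norm (v x - a))\<^sup>2) \<partial>uball"
  note [measurable] = v(2) w(1)
  have V: "?V \<noteq> 0" "?V < \<infinity>"
  proof -
    show "?V \<noteq> 0"
      using content_ball_pos[OF r(1), of "0::'b"] by (auto simp: measure_def)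
    have "?V \<le> emeasure lborel (cball (0::'b) r)" by (intro emeasure_mono) auto
    then show "?V < \<infinity>" using emeasure_lborel_cball_finite[of "0::'b" r] by (rule le_less_trans)
  qed
  have neg: "negligible (v ` cball 0 1)"
    by (rule negligible_differentiable_image_lowdim[OF dim v(1)])
  then have "AE a in lebesgue. a \<notin> v ` cball 0 1" by (intro AE_not_in) (simp add: negligible_iff_null_sets)
  then have AE: "AE a in lborel. a \<notin> v ` cball 0 1" by (simp add: AE_completion_iff)
  interpret U: finite_measure "uball :: 'a measure" by (rule finite_measure_uball)
  interpret P: pair_sigma_finite "uball :: 'a measure" "lborel :: 'b measure" ..
  have [measurable]: "(\<lambda>x. x) \<in> borel_measurable (uball::'a measure)" by (rule measurable_restrict_space1) simp
  have [measurable]: "v \<in> borel_measurable uball" by (rule measurable_uball[OF v(2)])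
  have [measurable]: "ball (0::'b) r \<in> sets borel" "cball (0::'b) 1 \<in> sets borel" by auto
  have m: "?I \<in> borel_measurable borel"
    by (rule U.borel_measurable_nn_integral) measurable
  have "ennreal C * ?W + ennreal \<tau> = (\<integral>\<^sup>+a. ((ennreal C * ?W + ennreal \<tau>) / ?V) * indicator (ball (0::'b) r) a \<partial>lborel)"
    using V by (subst nn_integral_cmult_indicator) (auto simp: ennreal_divide_times)
  also have "\<dots> \<le> (\<integral>\<^sup>+a. ?I a * indicator (ball 0 r) a \<partial>lborel)"
  proof (rule nn_integral_mono_AE)
    show "AE a in lborel. ((ennreal C * ?W + ennreal \<tau>) / ?V) * indicator (ball (0::'b) r) a \<le> ?I a * indicator (ball 0 r) a"
      using AE
    proof eventually_elim
      case (elim a)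
      show ?case
      proof (cases "norm a < r")
        case True
        then have "\<not> ?I a * ?V \<le> ennreal C * ?W + ennreal \<tau>" using \<open>\<not> thesis\<close> that elim by blast
        then have "ennreal C * ?W + ennreal \<tau> \<le> ?I a * ?V" by simp
        then have "(ennreal C * ?W + ennreal \<tau>) / ?V \<le> ?I a * ?V / ?V" by (rule divide_right_mono_ennreal)
        also have "?I a * ?V / ?V = ?I a" using V by (intro mult_divide_eq_ennreal) auto
        finally show ?thesis using True by simp
      qed simp
    qed
  qed
  also have "\<dots> = (\<integral>\<^sup>+a. (\<integral>\<^sup>+x. w x * ennreal (1 / (norm (v x - a))\<^sup>2) * indicator (ball 0 r) a \<partial>uball) \<partial>lborel)"
    by (intro nn_integral_cong nn_integral_multc[symmetric]) measurable
  also have "\<dots> = (\<integral>\<^sup>+x. (\<integral>\<^sup>+a. w x * ennreal (1 / (norm (v x - a))\<^sup>2) * indicator (ball 0 r) a \<partial>lborel) \<partial>uball)"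
    by (rule P.Fubini') measurable
  also have "\<dots> \<le> (\<integral>\<^sup>+x. w x * ennreal C \<partial>uball)"
  proof (rule nn_integral_mono)
    fix x
    have "(\<integral>\<^sup>+a. w x * ennreal (1 / (norm (v x - a))\<^sup>2) * indicator (ball 0 r) a \<partial>lborel)
      \<le> (\<integral>\<^sup>+a. w x * (ennreal (1 / (norm (v x - a))\<^sup>2) * indicator (cball 0 1) a) \<partial>lborel)"
      using r by (intro nn_integral_mono) (auto simp: indicator_def)
    also have "\<dots> = w x * (\<integral>\<^sup>+a. ennreal (1 / (norm (v x - a))\<^sup>2) * indicator (cball 0 1) a \<partial>lborel)"
      by (rule nn_integral_cmult) measurable
    also have "\<dots> \<le> w x * ennreal C" by (intro mult_left_mono C) auto
    finally show "(\<integral>\<^sup>+a. w x * ennreal (1 / (norm (v x - a))\<^sup>2) * indicator (ball 0 r) a \<partial>lborel) \<le> w x * ennreal C" .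
  qed
  also have "\<dots> = ennreal C * ?W" by (subst nn_integral_multc[OF w(1)]) (rule mult.commute)
  finally have "ennreal C * ?W + ennreal \<tau> \<le> ennreal C * ?W + 0" by simp
  then have "ennreal \<tau> \<le> 0"
    using w(2) by (subst (asm) ennreal_add_left_cancel_le) (auto simp: ennreal_mult_eq_top_iff)
  then show False using \<tau> by simp
qed

definition sgn_deriv :: "'b::euclidean_space \<Rightarrow> 'b \<Rightarrow> 'b" where
  "sgn_deriv y h = h /\<^sub>R norm y - ((y \<bullet> h) / norm y ^ 3) *\<^sub>R y"

text \<open>The delicate set is where the mollified map v has |v| <= 3/4; almost every point leaves
  it eventually. There the projection may cost energy of order \<Phi> / |v - a|^2, which the choice
  of the centre a makes small. Elsewhere |v - a| >= 1/2 and dominated convergence applies.\<close>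

lemma smooth_sphere_approximation:
  fixes g :: "real^3 \<Rightarrow> 'b::euclidean_space" and Dg :: "3 \<Rightarrow> real^3 \<Rightarrow> 'b"
  assumes dim: "3 < DIM('b)"
    and g: "Lp_ball 2 g" "AE x in uball. norm (g x) = 1"
    and Dg: "\<And>j. Lp_ball 2 (Dg j)" "\<And>j. weak_dir (axis j 1) g (Dg j)" "AE x in uball. \<forall>j. g x \<bullet> Dg j x = 0"
  obtains G where "\<And>n. \<exists>U. open U \<and> cball 0 1 \<subseteq> U \<and> (\<forall>m. Ck_on m U (G n)) \<and> (\<forall>x\<in>U. norm (G n x) = 1)"
    "AE x in uball. (\<lambda>n. G n x) \<longlonglongrightarrow> g x"
    "\<And>j. (\<lambda>n. \<integral>\<^sup>+x. ennreal (norm (frechet_derivative (G n) (at x) (axis j 1) - Dg j x) ^ 2) \<partial>uball) \<longlonglongrightarrow> 0"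
proof -
  have [measurable]: "g \<in> borel_measurable borel" "Dg j \<in> borel_measurable borel" for j
    using g Dg by (auto simp: Lp_ball_def)
  have ig: "integrable lborel g" by (rule Lp_ball_integrable[OF g(1)]) simp
  define pk where "pk x = (g x, \<chi> j. Dg j x)" for x
  have pkL: "Lp_ball 2 pk"
  proof (rule Lp_ball_bounded_by[where G="\<lambda>x. (norm (g x))\<^sup>2 + (\<Sum>j\<in>UNIV. (norm (Dg j x))\<^sup>2)"])
    show "pk \<in> borel_measurable borel"
      unfolding pk_def[abs_def] by (intro borel_measurable_Pair vec_lambda_measurable) measurable
    show "pk x = 0" if "norm x > 1" for x
      using g(1) Dg(1) that by (simp add: pk_def Lp_ball_def zero_prod_def vec_eq_iff)
    show "(norm (pk x))\<^sup>2 \<le> (norm (g x))\<^sup>2 + (\<Sum>j\<in>UNIV. (norm (Dg j x))\<^sup>2)" for x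
      by (simp only: pk_def norm_Pair_sq norm_vec_sq[of "\<chi> j. Dg j x"] vec_lambda_beta order_refl)
    show "integrable lborel (\<lambda>x. (norm (g x))\<^sup>2 + (\<Sum>j\<in>UNIV. (norm (Dg j x))\<^sup>2))"
      using g(1) Dg(1) by (intro Bochner_Integration.integrable_add Bochner_Integration.integrable_sum) (auto simp: Lp_ball_def)
  qed
  have z: "Lp_ball 1 (\<lambda>x::real^3. 0::real)" by (simp add: Lp_ball_def)
  obtain \<epsilon> \<Phi> where \<epsilon>: "\<epsilon> \<longlonglongrightarrow> 0" "\<And>k. 0 < \<epsilon> k" "\<And>k. \<epsilon> k \<le> 1/2" and \<Phi>: "integrable uball \<Phi>"
    and AE_pk: "AE x in uball. (\<lambda>k. mol (\<epsilon> k) pk x) \<longlonglongrightarrow> pk x \<and> (\<forall>k. (norm (mol (\<epsilon> k) pk x))\<^sup>2 \<le> \<Phi> x)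
      \<and> (\<lambda>k. mol (\<epsilon> k) (\<lambda>x. 0::real) x) \<longlonglongrightarrow> 0 \<and> (\<forall>k. norm (mol (\<epsilon> k) (\<lambda>x. 0::real) x) \<le> \<Phi> x) \<and> (norm (pk x))\<^sup>2 \<le> \<Phi> x"
  proof (rule mol_sequence[OF pkL z])
    fix \<epsilon> \<Phi>
    assume "\<epsilon> \<longlonglongrightarrow> 0" "\<And>k. 0 < \<epsilon> k" "\<And>k. \<epsilon> k \<le> 1/2" "integrable uball \<Phi>"
     "AE x in uball. (\<lambda>k. mol (\<epsilon> k) pk x) \<longlonglongrightarrow> pk x \<and> (\<forall>k. (norm (mol (\<epsilon> k) pk x))\<^sup>2 \<le> \<Phi> x)
      \<and> (\<lambda>k. mol (\<epsilon> k) (\<lambda>x. 0::real) x) \<longlonglongrightarrow> 0 \<and> (\<forall>k. norm (mol (\<epsilon> k) (\<lambda>x. 0::real) x) \<le> \<Phi> x) \<and> (norm (pk x))\<^sup>2 \<le> \<Phi> x"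
    then show thesis by (rule that)
  qed
  have [measurable]: "\<Phi> \<in> borel_measurable uball" using \<Phi> by auto
  define v where "v k = mol (\<epsilon> k) g" for k
  define h where "h k j x = frechet_derivative (v k) (at x) (axis j 1)" for k j x
  have \<epsilon>1: "\<epsilon> k \<le> 1" for k using \<epsilon>(3)[of k] by simp
  have g0: "g x = 0" if "norm x > 1" for x using g(1) that by (simp add: Lp_ball_def)
  have tk: "test_kernel 3 (v k)" for k
    unfolding v_def by (rule test_kernel_mol[OF ig g0 \<epsilon>(2,3)])
  have [measurable]: "v k \<in> borel_measurable borel" "h k j \<in> borel_measurable borel" for k j
    unfolding h_def[abs_def] using test_kernel_measurable[OF tk] test_kernel_measurable[OF test_kernel_derivative[OF tk]] by auto
  have heq: "h k j x = (1 - \<epsilon> k) *\<^sub>R mol (\<epsilon> k) (Dg j) x" if "norm x \<le> 1" for k j x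
    unfolding h_def v_def by (rule mol_weak_dir[OF ig _ Dg(2) \<epsilon>(2) \<epsilon>1 that]) measurable
  define good where "good x \<longleftrightarrow> norm x \<le> 1 \<and> (\<lambda>k. v k x) \<longlonglongrightarrow> g x \<and> (\<forall>j. (\<lambda>k. h k j x) \<longlonglongrightarrow> Dg j x)
    \<and> (\<forall>k j. (norm (h k j x))\<^sup>2 \<le> \<Phi> x) \<and> (\<forall>j. (norm (Dg j x))\<^sup>2 \<le> \<Phi> x) \<and> norm (g x) = 1 \<and> (\<forall>j. g x \<bullet> Dg j x = 0)" for x
  have AE_good: "AE x in uball. good x"
  proof -
    have ipk: "integrable lborel pk" by (rule Lp_ball_integrable[OF pkL]) simp
    have comps: "v k x = fst (mol (\<epsilon> k) pk x)" "mol (\<epsilon> k) (Dg j) x = snd (mol (\<epsilon> k) pk x) $ j" for k j x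
    proof -
      have "mol (\<epsilon> k) (\<lambda>x. fst (pk x)) x = fst (mol (\<epsilon> k) pk x)"
        by (rule mol_bounded_linear[OF bounded_linear_fst ipk \<epsilon>(2)])
      then show "v k x = fst (mol (\<epsilon> k) pk x)" by (simp add: pk_def v_def)
      have "mol (\<epsilon> k) (\<lambda>x. snd (pk x) $ j) x = snd (mol (\<epsilon> k) pk x) $ j"
        by (rule mol_bounded_linear[OF bounded_linear_compose[OF bounded_linear_vec_nth bounded_linear_snd] ipk \<epsilon>(2)])
      then show "mol (\<epsilon> k) (Dg j) x = snd (mol (\<epsilon> k) pk x) $ j" by (simp add: pk_def)
    qed
    have nc: "norm (snd w $ j) \<le> norm w" for w :: "'b \<times> ('b^3)" and j
    proof -
      have "norm (snd w) \<le> norm w" by (cases w) (simp add: norm_snd_le)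
      with Finite_Cartesian_Product.norm_nth_le[of "snd w" j] show ?thesis by linarith
    qed
    have "AE x in uball. norm (x::real^3) \<le> 1" by (rule AE_I2) simp
    with AE_pk g(2) Dg(3) show ?thesis
    proof eventually_elim
      case (elim x)
      then have l: "(\<lambda>k. mol (\<epsilon> k) pk x) \<longlonglongrightarrow> pk x" and b: "\<And>k. (norm (mol (\<epsilon> k) pk x))\<^sup>2 \<le> \<Phi> x" and p: "(norm (pk x))\<^sup>2 \<le> \<Phi> x"
        by blast+
      have Dj: "Dg j x = snd (pk x) $ j" for j by (simp add: pk_def)
      show ?case unfolding good_def
      proof (intro conjI allI)
        show "norm x \<le> 1" "norm (g x) = 1" "g x \<bullet> Dg j x = 0" for j using elim by auto
        show "(\<lambda>k. v k x) \<longlonglongrightarrow> g x" using tendsto_fst[OF l] by (simp add: comps pk_def)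
        fix j
        have ml: "(\<lambda>k. mol (\<epsilon> k) (Dg j) x) \<longlonglongrightarrow> Dg j x"
          unfolding comps Dj by (intro tendsto_vec_nth tendsto_snd l)
        have "(\<lambda>k. (1 - \<epsilon> k) *\<^sub>R mol (\<epsilon> k) (Dg j) x) \<longlonglongrightarrow> (1 - 0) *\<^sub>R Dg j x"
          by (intro tendsto_intros ml \<epsilon>(1))
        then show "(\<lambda>k. h k j x) \<longlonglongrightarrow> Dg j x" using elim by (simp add: heq)
        show "(norm (Dg j x))\<^sup>2 \<le> \<Phi> x"
          unfolding Dj by (rule order_trans[OF power_mono[OF nc] p]) simp
        fix k
        have "norm (h k j x) \<le> 1 * norm (mol (\<epsilon> k) pk x)"
          unfolding heq[OF \<open>norm x \<le> 1\<close>] norm_scaleR comps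
          by (intro mult_mono nc) (use \<epsilon>(2)[of k] \<epsilon>1[of k] in auto)
        then have "(norm (h k j x))\<^sup>2 \<le> (norm (mol (\<epsilon> k) pk x))\<^sup>2" by (intro power_mono) auto
        then show "(norm (h k j x))\<^sup>2 \<le> \<Phi> x" using b[of k] by linarith
      qed
    qed
  qed
  have \<Phi>0: "\<Phi> x \<ge> 0" if "good x" for x
    using that zero_le_power2[of "norm (Dg 1 x)"] unfolding good_def by (meson order_trans)
  have evbig: "\<forall>\<^sub>F k in sequentially. norm (v k x) > 3/4" if "good x" for x
  proof -
    have "(\<lambda>k. norm (v k x)) \<longlonglongrightarrow> norm (g x)" using that by (intro tendsto_norm) (simp add: good_def)
    moreover have "3/4 < norm (g x)" using that by (simp add: good_def)
    ultimately show ?thesis by (rule order_tendstoD(1))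
  qed
  \<comment> \<open>The majorant of the squared derivatives, restricted to the delicate set of index
    k; its integral tends to 0.\<close>
  define W where "W k x = ennreal (\<Phi> x) * indicator {x. norm (v k x) \<le> 3/4} x" for k x
  have Wset: "{x. norm (v k x) \<le> 3/4} \<in> sets borel" for k by measurable
  have [measurable]: "W k \<in> borel_measurable uball" for k
  proof -
    have "(\<lambda>x. indicator {x. norm (v k x) \<le> 3/4} x :: ennreal) \<in> borel_measurable uball"
      by (rule measurable_uball) (rule borel_measurable_indicator[OF Wset])
    then show ?thesis unfolding W_def[abs_def] by measurable
  qed
  have Wle: "W k x \<le> ennreal (\<Phi> x)" for k x by (auto simp: W_def indicator_def)
  have \<Phi>fin: "(\<integral>\<^sup>+x. ennreal (norm (c * \<Phi> x)) \<partial>uball) < \<infinity>" for c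
    using integrable_mult_right[OF \<Phi>, of c] by (simp only: integrable_iff_bounded)
  have Wfin: "(\<integral>\<^sup>+x. W k x \<partial>uball) < \<infinity>" for k
  proof -
    have "(\<integral>\<^sup>+x. W k x \<partial>uball) \<le> (\<integral>\<^sup>+x. ennreal (norm (1 * \<Phi> x)) \<partial>uball)"
      by (intro nn_integral_mono order_trans[OF Wle] ennreal_leI) auto
    then show ?thesis using \<Phi>fin[of 1] by (rule le_less_trans)
  qed
  have Wev: "\<forall>\<^sub>F k in sequentially. W k x = 0" if "good x" for x
    using evbig[OF that] by eventually_elim (simp add: W_def)
  have "(\<lambda>k. \<integral>\<^sup>+x. W k x \<partial>uball) \<longlonglongrightarrow> (\<integral>\<^sup>+x. 0 \<partial>(uball :: (real^3) measure))"
  proof (rule nn_integral_dominated_convergence[where w="\<lambda>x. ennreal (norm (1 * \<Phi> x))"])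
    show "AE x in uball. W k x \<le> ennreal (norm (1 * \<Phi> x))" for k
      by (intro AE_I2 order_trans[OF Wle] ennreal_leI) auto
    show "AE x in uball. (\<lambda>k. W k x) \<longlonglongrightarrow> 0"
      using AE_good by eventually_elim (rule tendsto_eventually[OF Wev])
  qed (use \<Phi>fin[of 1] in auto)
  then have W0: "(\<lambda>k. \<integral>\<^sup>+x. W k x \<partial>uball) \<longlonglongrightarrow> 0" by simp
  obtain C where C: "C \<ge> 0" "\<And>y::'b. (\<integral>\<^sup>+a. ennreal (1 / (norm (y - a))\<^sup>2) * indicator (cball 0 1) a \<partial>lborel) \<le> ennreal C"
  proof (rule singular_integral_bounded[where 'a='b])
    show "3 \<le> DIM('b)" using dim by simp
    fix C :: real assume "C \<ge> 0" "\<And>y::'b. (\<integral>\<^sup>+a. ennreal (1 / (norm (y - a))\<^sup>2) * indicator (cball 0 1) a \<partial>lborel) \<le> ennreal C"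
    then show thesis by (rule that)
  qed
  define J where "J k a = (\<integral>\<^sup>+x. W k x * ennreal (1 / (norm (v k x - a))\<^sup>2) \<partial>uball)" for k a
  \<comment> \<open>Radius 1/(n+4): the centres tend to 0 and have norm at most 1/4, so that |v| >
    3/4 leaves a distance of at least 1/2. The index k is chosen after the radius, large enough for
    the integral of \<open>W k\<close> to be small against the volume of the shrinking ball of
    centres.\<close>
  have "\<exists>k a. k \<ge> n \<and> norm a < 1 / real (n + 4) \<and> a \<notin> v k ` cball 0 1 \<and> J k a \<le> ennreal (1 / real (Suc n))" for n
  proof -
    define r where "r = 1 / real (n + 4)"
    have r: "0 < r" "r \<le> 1" by (auto simp: r_def)
    define V where "V = measure lborel (ball (0::'b) r)"
    have V: "V > 0" unfolding V_def using content_ball_pos[OF r(1)] by simp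
    have "emeasure lborel (ball (0::'b) r) \<le> emeasure lborel (cball (0::'b) r)" by (intro emeasure_mono) auto
    then have "emeasure lborel (ball (0::'b) r) < \<infinity>" using emeasure_lborel_cball_finite[of "0::'b" r] by (rule le_less_trans)
    then have eV: "emeasure lborel (ball (0::'b) r) = ennreal V" by (simp add: V_def emeasure_eq_ennreal_measure)
    \<comment> \<open>\<tau> and \<open>\<tau>'\<close> are arranged so that C
      \<open>\<tau>'\<close> + \<tau> <= 2 \<tau> = V/(n+1). Dividing by the volume V bounds the
      energy by 1/(n+1).\<close>
    define \<tau> where "\<tau> = V / (2 * real (Suc n))"
    have \<tau>: "\<tau> > 0" using V by (simp add: \<tau>_def)
    define \<tau>' where "\<tau>' = \<tau> / (C + 1)"
    have \<tau>': "\<tau>' > 0" "C * \<tau>' \<le> \<tau>" using \<tau> C(1) by (auto simp: \<tau>'_def divide_simps)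
    have "\<forall>\<^sub>F k in sequentially. (\<integral>\<^sup>+x. W k x \<partial>uball) < ennreal \<tau>'"
      using order_tendstoD(2)[OF W0, of "ennreal \<tau>'"] \<tau>' by simp
    then obtain N where N: "\<And>k. k \<ge> N \<Longrightarrow> (\<integral>\<^sup>+x. W k x \<partial>uball) < ennreal \<tau>'" by (auto simp: eventually_sequentially)
    define k where "k = max n N"
    have Ik: "(\<integral>\<^sup>+x. W k x \<partial>uball) \<le> ennreal \<tau>'" using N[of k] by (simp add: k_def less_imp_le)
    have diff: "v k differentiable_on cball 0 1"
      using test_kernel_has_derivative[OF tk] unfolding differentiable_on_def differentiable_def
      by (blast intro: has_derivative_at_withinI)
    have vm: "v k \<in> borel_measurable borel" and Wm: "W k \<in> borel_measurable uball" by measurable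
    have dim': "DIM(real^3) < DIM('b)" using dim by simp
    obtain a where a: "norm a < r" "a \<notin> v k ` cball 0 1"
      "J k a * ennreal V \<le> ennreal C * (\<integral>\<^sup>+x. W k x \<partial>uball) + ennreal \<tau>"
    proof (rule good_projection_centre[OF dim' diff vm Wm Wfin r \<tau> C(2)])
      fix a assume "norm a < r" "a \<notin> v k ` cball 0 1"
        "(\<integral>\<^sup>+x. W k x * ennreal (1 / (norm (v k x - a))\<^sup>2) \<partial>uball) * emeasure lborel (ball (0::'b) r)
          \<le> ennreal C * (\<integral>\<^sup>+x. W k x \<partial>uball) + ennreal \<tau>"
      then show thesis unfolding eV J_def[symmetric] by (rule that)
    qed
    note a(3)
    also have "ennreal C * (\<integral>\<^sup>+x. W k x \<partial>uball) + ennreal \<tau> \<le> ennreal C * ennreal \<tau>' + ennreal \<tau>"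
      by (intro add_right_mono mult_left_mono Ik) auto
    also have "\<dots> = ennreal (C * \<tau>' + \<tau>)" using C(1) \<tau> \<tau>' by (simp add: ennreal_mult ennreal_plus)
    also have "\<dots> \<le> ennreal (2 * \<tau>)" using \<tau>' by (intro ennreal_leI) simp
    also have "2 * \<tau> = V / real (Suc n)" by (simp add: \<tau>_def del: of_nat_Suc)
    finally have le: "J k a * ennreal V \<le> ennreal (V / real (Suc n))" .
    have "J k a \<le> ennreal (1 / real (Suc n))"
    proof (cases "J k a")
      case (real i)
      then have "ennreal (i * V) \<le> ennreal (V / real (Suc n))" using le V by (simp add: ennreal_mult)
      then have "i * V \<le> V / real (Suc n)" using V by (subst (asm) ennreal_le_iff) auto
      then have "i \<le> 1 / real (Suc n)" using V by (simp add: field_simps del: of_nat_Suc)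
      then show ?thesis using real by (simp add: ennreal_leI del: of_nat_Suc)
    next
      case top
      then have "top \<le> ennreal (V / real (Suc n))" using le V by (simp add: ennreal_top_mult)
      then show ?thesis using ennreal_less_top leD by blast
    qed
    then show ?thesis using a by (intro exI[of _ k] exI[of _ a]) (simp add: k_def r_def)
  qed
  then obtain \<kappa> \<alpha> where \<kappa>: "\<And>n. \<kappa> n \<ge> n" and \<alpha>: "\<And>n. norm (\<alpha> n) < 1 / real (n + 4)"
    "\<And>n. \<alpha> n \<notin> v (\<kappa> n) ` cball 0 1" and J: "\<And>n. J (\<kappa> n) (\<alpha> n) \<le> ennreal (1 / real (Suc n))"
    by metis
  have \<kappa>lim: "filterlim \<kappa> at_top sequentially"
    by (rule filterlim_at_top_mono[OF filterlim_ident]) (simp add: \<kappa>)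
  have \<alpha>lim: "\<alpha> \<longlonglongrightarrow> 0"
  proof (rule tendsto_norm_zero_cancel, rule tendsto_sandwich[OF _ _ tendsto_const])
    show "\<forall>\<^sub>F n in sequentially. norm (\<alpha> n) \<le> 1 / real (n + 4)"
      using \<alpha>(1) by (intro always_eventually allI less_imp_le)
    show "(\<lambda>n. 1 / real (n + 4)) \<longlonglongrightarrow> 0"
      using LIMSEQ_ignore_initial_segment[OF lim_1_over_n[where 'a=real], of 4] by simp
  qed auto
  define G where "G n x = (v (\<kappa> n) x - \<alpha> n) /\<^sub>R norm (v (\<kappa> n) x - \<alpha> n)" for n x
  define DG where "DG n j x = sgn_deriv (v (\<kappa> n) x - \<alpha> n) (h (\<kappa> n) j x)" for n j x
  have nz: "v (\<kappa> n) x - \<alpha> n \<noteq> 0" if "norm x \<le> 1" for n x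
    using \<alpha>(2)[of n] that by (metis eq_iff_diff_eq_0 imageI mem_cball_0)
  have DG: "frechet_derivative (G n) (at x) (axis j 1) = DG n j x" if "norm x \<le> 1" for n j x
  proof -
    have "((\<lambda>x. v (\<kappa> n) x - \<alpha> n) has_derivative frechet_derivative (v (\<kappa> n)) (at x)) (at x)"
      using has_derivative_diff[OF test_kernel_has_derivative[OF tk] has_derivative_const] by simp
    from frechet_derivative_at[OF sgn_has_derivative[OF this nz[OF that]], THEN fun_cong, symmetric]
    show ?thesis by (simp add: G_def[abs_def] DG_def sgn_deriv_def h_def)
  qed
  have [measurable]: "DG n j \<in> borel_measurable borel" for n j
    unfolding DG_def[abs_def] sgn_deriv_def by measurable
  have Gl: "(\<lambda>n. v (\<kappa> n) x - \<alpha> n) \<longlonglongrightarrow> g x" and hl: "(\<lambda>n. h (\<kappa> n) j x) \<longlonglongrightarrow> Dg j x" if "good x" for x j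
  proof -
    have "(\<lambda>n. v (\<kappa> n) x) \<longlonglongrightarrow> g x"
      by (rule filterlim_compose[OF _ \<kappa>lim, of "\<lambda>k. v k x"]) (use that in \<open>simp add: good_def\<close>)
    from tendsto_diff[OF this \<alpha>lim] show "(\<lambda>n. v (\<kappa> n) x - \<alpha> n) \<longlonglongrightarrow> g x" by simp
    show "(\<lambda>n. h (\<kappa> n) j x) \<longlonglongrightarrow> Dg j x"
      by (rule filterlim_compose[OF _ \<kappa>lim, of "\<lambda>k. h k j x"]) (use that in \<open>simp add: good_def\<close>)
  qed
  show ?thesis
  proof (rule that[of G])
    fix n
    let ?U = "{x. v (\<kappa> n) x \<noteq> \<alpha> n}"
    have cv: "continuous_on UNIV (v (\<kappa> n))" by (rule test_kernel_continuous[OF tk])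
    have U: "open ?U" by (rule open_Collect_neq[OF cv continuous_on_const])
    moreover have "cball 0 1 \<subseteq> ?U" using nz by auto
    moreover have "Ck_on m ?U (G n)" for m
    proof -
      have "Ck_on m UNIV (v (\<kappa> n))" using tk[of "\<kappa> n"] unfolding test_kernel_def by blast
      from Ck_on_add[OF open_UNIV this Ck_on_const[OF open_UNIV]]
      have "Ck_on m UNIV (\<lambda>x. v (\<kappa> n) x + (- \<alpha> n))" .
      from Ck_on_subset[OF this subset_UNIV] have "Ck_on m ?U (\<lambda>x. v (\<kappa> n) x - \<alpha> n)" by simp
      then show ?thesis unfolding G_def[abs_def] by (rule Ck_on_normalize[OF U]) auto
    qed
    moreover have "norm (G n x) = 1" if "x \<in> ?U" for x using that by (simp add: G_def)
    ultimately show "\<exists>U. open U \<and> cball 0 1 \<subseteq> U \<and> (\<forall>m. Ck_on m U (G n)) \<and> (\<forall>x\<in>U. norm (G n x) = 1)" by blast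
  next
    show "AE x in uball. (\<lambda>n. G n x) \<longlonglongrightarrow> g x"
      using AE_good
    proof eventually_elim
      case (elim x)
      have "(\<lambda>n. G n x) \<longlonglongrightarrow> g x /\<^sub>R norm (g x)"
        unfolding G_def using elim by (intro tendsto_intros Gl) (auto simp: good_def)
      then show ?case using elim by (simp add: good_def)
    qed
  next
    fix j
    \<comment> \<open>The squared error off the delicate set; on that set the error is charged to
      \<open>W\<close> and to the singular term \<open>?P\<close>.\<close>
    define q where "q n x = (if norm (v (\<kappa> n) x) \<le> 3/4 then 0 else norm (DG n j x - Dg j x) ^ 2)" for n x
    have [measurable]: "q n \<in> borel_measurable borel" for n unfolding q_def[abs_def] by measurable
    let ?P = "\<lambda>n x. W (\<kappa> n) x * ennreal (1 / (norm (v (\<kappa> n) x - \<alpha> n))\<^sup>2)"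
    have DGle: "norm (DG n j x) ^ 2 \<le> 4 * \<Phi> x * (1 / (norm (v (\<kappa> n) x - \<alpha> n))\<^sup>2)" if "good x" for n x
    proof -
      have "norm (DG n j x) ^ 2 \<le> (2 * norm (h (\<kappa> n) j x) / norm (v (\<kappa> n) x - \<alpha> n)) ^ 2"
        unfolding DG_def sgn_deriv_def using nz that by (intro power_mono sgn_derivative_le) (auto simp: good_def)
      also have "\<dots> = 4 * (norm (h (\<kappa> n) j x))\<^sup>2 * (1 / (norm (v (\<kappa> n) x - \<alpha> n))\<^sup>2)"
        by (simp add: power_divide power_mult_distrib)
      also have "\<dots> \<le> 4 * \<Phi> x * (1 / (norm (v (\<kappa> n) x - \<alpha> n))\<^sup>2)"
        using that by (intro mult_right_mono) (auto simp: good_def)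
      finally show ?thesis .
    qed
    have D2: "norm (DG n j x - Dg j x) ^ 2 \<le> 4 * (norm (DG n j x) ^ 2 + \<Phi> x)" if "good x" for n x
    proof -
      have "norm (DG n j x - Dg j x) ^ 2 \<le> 2 ^ 2 * (norm (DG n j x) ^ 2 + norm (Dg j x) ^ 2)" by (rule norm_power_diff_le)
      also have "\<dots> \<le> 4 * (norm (DG n j x) ^ 2 + \<Phi> x)" using that by (simp add: good_def)
      finally show ?thesis .
    qed
    \<comment> \<open>The squared error is at most 4 (|DG|^2 + \<Phi>), and |DG|^2 is at most 4
      \<Phi> / |v - \<alpha>|^2; hence the coefficients 16 and 4.\<close>
    have pw: "ennreal (norm (DG n j x - Dg j x) ^ 2) \<le> 16 * ?P n x + (4 * W (\<kappa> n) x + ennreal (q n x))" if "good x" for n x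
    proof (cases "norm (v (\<kappa> n) x) \<le> 3/4")
      case True
      let ?i = "1 / (norm (v (\<kappa> n) x - \<alpha> n))\<^sup>2"
      have "norm (DG n j x - Dg j x) ^ 2 \<le> 16 * (\<Phi> x * ?i) + 4 * \<Phi> x"
      proof -
        have "X \<le> 16 * t + 4 * f" if "X \<le> 4 * (Y + f)" "Y \<le> 4 * t" for X Y t f :: real
          using that by (simp add: distrib_left)
        from this[OF D2[OF that, of n] DGle[OF that, of n, unfolded mult.assoc[of 4 "\<Phi> x" ?i]]] show ?thesis .
      qed
      then have "ennreal (norm (DG n j x - Dg j x) ^ 2) \<le> ennreal (16 * (\<Phi> x * ?i) + 4 * \<Phi> x)" by (rule ennreal_leI)
      also have "\<dots> = 16 * (ennreal (\<Phi> x) * ennreal ?i) + 4 * ennreal (\<Phi> x)"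
      proof -
        have "ennreal (16 * (a * b) + 4 * c) = 16 * (ennreal a * ennreal b) + 4 * ennreal c"
          if "0 \<le> a" "0 \<le> b" "0 \<le> c" for a b c
          using that by (simp add: ennreal_plus ennreal_mult)
        from this[OF \<Phi>0[OF that] _ \<Phi>0[OF that], of ?i] show ?thesis by simp
      qed
      finally show ?thesis using True by (simp add: W_def q_def)
    next
      case False
      then show ?thesis by (simp add: W_def q_def)
    qed
    have L0: "(\<lambda>n. \<integral>\<^sup>+x. 4 * W (\<kappa> n) x + ennreal (q n x) \<partial>uball) \<longlonglongrightarrow> (\<integral>\<^sup>+x. 0 \<partial>(uball :: (real^3) measure))"
    \<comment> \<open>72 = 4 + 68: off the delicate set 1 / |v - \<alpha>|^2 <= 4, so |DG|^2 <= 16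
      \<Phi> and \<open>q\<close> is at most 4 (16 + 1) \<Phi>.\<close>
    proof (rule nn_integral_dominated_convergence[where w="\<lambda>x. ennreal (norm (72 * \<Phi> x))"])
      show "AE x in uball. 4 * W (\<kappa> n) x + ennreal (q n x) \<le> ennreal (norm (72 * \<Phi> x))" for n
        using AE_good
      proof eventually_elim
        case (elim x)
        have qle: "q n x \<le> 68 * \<Phi> x"
        proof (cases "norm (v (\<kappa> n) x) \<le> 3/4")
          case False
          have "1 / real (n + 4) \<le> 1 / 4" by (intro divide_left_mono) auto
          then have "norm (\<alpha> n) \<le> 1/4" using \<alpha>(1)[of n] by linarith
          then have "norm (v (\<kappa> n) x - \<alpha> n) \<ge> 1/2"
            using False norm_triangle_ineq2[of "v (\<kappa> n) x" "\<alpha> n"] by linarith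
          then have "(norm (v (\<kappa> n) x - \<alpha> n))\<^sup>2 \<ge> (1/2)\<^sup>2" by (intro power_mono) auto
          then have "1 / (norm (v (\<kappa> n) x - \<alpha> n))\<^sup>2 \<le> 4" by (simp add: divide_simps power2_eq_square)
          then have "4 * \<Phi> x * (1 / (norm (v (\<kappa> n) x - \<alpha> n))\<^sup>2) \<le> 4 * \<Phi> x * 4"
            using \<Phi>0[OF elim] by (intro mult_left_mono) auto
          then have "norm (DG n j x) ^ 2 \<le> 16 * \<Phi> x" using DGle[OF elim, of n] by linarith
          then show ?thesis using D2[OF elim, of n] False by (simp add: q_def)
        qed (use \<Phi>0[OF elim] in \<open>simp add: q_def\<close>)
        have "4 * W (\<kappa> n) x + ennreal (q n x) \<le> 4 * ennreal (\<Phi> x) + ennreal (68 * \<Phi> x)"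
          by (intro add_mono mult_left_mono Wle ennreal_leI qle) auto
        also have "\<dots> = ennreal (4 * \<Phi> x + 68 * \<Phi> x)"
          using \<Phi>0[OF elim] by (subst ennreal_plus) (auto simp: ennreal_mult)
        also have "\<dots> \<le> ennreal (norm (72 * \<Phi> x))" by (intro ennreal_leI) simp
        finally show ?case .
      qed
      show "AE x in uball. (\<lambda>n. 4 * W (\<kappa> n) x + ennreal (q n x)) \<longlonglongrightarrow> 0"
        using AE_good
      proof eventually_elim
        case (elim x)
        have ng: "norm (g x) = 1" using elim by (simp add: good_def)
        have "(\<lambda>n. DG n j x) \<longlonglongrightarrow> sgn_deriv (g x) (Dg j x)"
          unfolding DG_def sgn_deriv_def by (intro tendsto_intros Gl[OF elim] hl[OF elim]) (use ng in auto)
        \<comment> \<open>In the limit the projection changes nothing, because \<open>Dg\<close> is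
          tangent to the sphere at the unit vector g.\<close>
        also have "sgn_deriv (g x) (Dg j x) = Dg j x" using elim by (simp add: sgn_deriv_def good_def)
        finally have "(\<lambda>n. norm (DG n j x - Dg j x) ^ 2) \<longlonglongrightarrow> norm (Dg j x - Dg j x) ^ 2" by (intro tendsto_intros)
        then have n0: "(\<lambda>n. norm (DG n j x - Dg j x) ^ 2) \<longlonglongrightarrow> 0" by simp
        have ev: "\<forall>\<^sub>F n in sequentially. norm (v (\<kappa> n) x) > 3/4"
          by (rule eventually_compose_filterlim[OF evbig[OF elim] \<kappa>lim])
        have "\<forall>\<^sub>F n in sequentially. ennreal (norm (DG n j x - Dg j x) ^ 2) = 4 * W (\<kappa> n) x + ennreal (q n x)"
          using ev by eventually_elim (simp add: W_def q_def)
        from Lim_transform_eventually[OF tendsto_ennrealI[OF n0] this] show ?case by simp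
      qed
    qed (use \<Phi>fin[of 72] in auto)
    have up: "(\<lambda>n. ennreal (16 / real (Suc n)) + (\<integral>\<^sup>+x. 4 * W (\<kappa> n) x + ennreal (q n x) \<partial>uball)) \<longlonglongrightarrow> 0"
    proof -
      have "(\<lambda>n. 16 * inverse (real (Suc n))) \<longlonglongrightarrow> 16 * 0" by (intro tendsto_intros LIMSEQ_inverse_real_of_nat)
      then have "(\<lambda>n. ennreal (16 / real (Suc n))) \<longlonglongrightarrow> ennreal 0"
        by (intro tendsto_ennrealI) (simp add: divide_inverse del: of_nat_Suc)
      from tendsto_add[OF this L0] show ?thesis by simp
    qed
    show "(\<lambda>n. \<integral>\<^sup>+x. ennreal (norm (frechet_derivative (G n) (at x) (axis j 1) - Dg j x) ^ 2) \<partial>uball) \<longlonglongrightarrow> 0"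
    proof (rule tendsto_sandwich[OF _ _ tendsto_const up])
      show "\<forall>\<^sub>F n in sequentially. (\<integral>\<^sup>+x. ennreal (norm (frechet_derivative (G n) (at x) (axis j 1) - Dg j x) ^ 2) \<partial>uball)
        \<le> ennreal (16 / real (Suc n)) + (\<integral>\<^sup>+x. 4 * W (\<kappa> n) x + ennreal (q n x) \<partial>uball)"
      proof (intro always_eventually allI)
        fix n
        have [measurable]: "?P n \<in> borel_measurable uball" by measurable
        have "(\<integral>\<^sup>+x. ennreal (norm (frechet_derivative (G n) (at x) (axis j 1) - Dg j x) ^ 2) \<partial>uball)
          = (\<integral>\<^sup>+x. ennreal (norm (DG n j x - Dg j x) ^ 2) \<partial>uball)"
          by (intro nn_integral_cong) (simp add: DG)
        also have "\<dots> \<le> (\<integral>\<^sup>+x. 16 * ?P n x + (4 * W (\<kappa> n) x + ennreal (q n x)) \<partial>uball)"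
          by (rule nn_integral_mono_AE) (use AE_good pw in \<open>auto elim: eventually_mono\<close>)
        also have "\<dots> = 16 * J (\<kappa> n) (\<alpha> n) + (\<integral>\<^sup>+x. 4 * W (\<kappa> n) x + ennreal (q n x) \<partial>uball)"
          unfolding J_def by (subst nn_integral_add) (auto simp: nn_integral_cmult)
        also have "16 * J (\<kappa> n) (\<alpha> n) \<le> 16 * ennreal (1 / real (Suc n))" by (intro mult_left_mono J) auto
        also have "16 * ennreal (1 / real (Suc n)) = ennreal (16 / real (Suc n))"
          by (subst ennreal_numeral[symmetric], subst ennreal_mult[symmetric]) auto
        finally show "(\<integral>\<^sup>+x. ennreal (norm (frechet_derivative (G n) (at x) (axis j 1) - Dg j x) ^ 2) \<partial>uball)
          \<le> ennreal (16 / real (Suc n)) + (\<integral>\<^sup>+x. 4 * W (\<kappa> n) x + ennreal (q n x) \<partial>uball)"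
          by (simp add: add_right_mono)
      qed
    qed auto
  qed
qed

section \<open>Weak and classical derivatives on the ball\<close>

abbreviation lball :: "'a::euclidean_space measure" where
  "lball \<equiv> lebesgue_on (cball 0 1)"

lemma AE_lball_iff_uball: "(AE x in lball. P x) \<longleftrightarrow> (AE x in (uball :: 'a::euclidean_space measure). P x)"
  by (subst (1 2) AE_restrict_space_iff) (auto simp: AE_completion_iff)

lemma lball_of_uball:
  fixes g :: "'a::euclidean_space \<Rightarrow> 'b::euclidean_space"
  assumes g: "g \<in> borel_measurable uball"
  shows "g \<in> borel_measurable lball" "(LINT x|lball. g x) = (LINT x|uball. g x)"
    "integrable lball g \<longleftrightarrow> integrable uball g"
proof -
  have m: "(\<lambda>x. indicator (cball 0 1) x *\<^sub>R g x) \<in> borel_measurable lborel"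
    using g by (subst (asm) borel_measurable_restrict_space_iff) auto
  then have "(\<lambda>x. indicator (cball 0 1) x *\<^sub>R g x) \<in> borel_measurable lebesgue" by (rule measurable_completion)
  then show "g \<in> borel_measurable lball" by (subst borel_measurable_restrict_space_iff) auto
  show "(LINT x|lball. g x) = (LINT x|uball. g x)" "integrable lball g \<longleftrightarrow> integrable uball g"
    using integral_completion[OF m] integrable_completion[OF m]
    by (simp_all add: integral_restrict_space integrable_restrict_space)
qed

text \<open>Transfers measurability and integrals between functions measurable for Lebesgue sets, as
  in the spaces of the statement, and the Borel representatives of the proof.\<close>

lemma lball_AE_eq:
  fixes f g :: "'a::euclidean_space \<Rightarrow> 'b::euclidean_space"
  assumes g: "g \<in> borel_measurable uball" and eq: "AE x in uball. f x = g x"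
  shows "f \<in> borel_measurable lball" "(LINT x|lball. f x) = (LINT x|uball. g x)"
    "integrable lball f \<longleftrightarrow> integrable uball g"
proof -
  have ae: "AE x in lball. f x = g x" using eq by (simp add: AE_lball_iff_uball)
  note G = lball_of_uball[OF g]
  have ae': "AE x in lebesgue. indicator (cball 0 1) x *\<^sub>R g x = indicator (cball 0 1) x *\<^sub>R f x"
    using ae by (subst (asm) AE_restrict_space_iff) (auto elim!: eventually_mono simp: indicator_def)
  have "(\<lambda>x. indicator (cball 0 1) x *\<^sub>R g x) \<in> borel_measurable lebesgue"
    using G(1) by (subst (asm) borel_measurable_restrict_space_iff) auto
  from borel_measurable_AE[OF this ae']
  have "(\<lambda>x. indicator (cball 0 1) x *\<^sub>R f x) \<in> borel_measurable lebesgue" .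
  then show f: "f \<in> borel_measurable lball" by (subst borel_measurable_restrict_space_iff) auto
  show "(LINT x|lball. f x) = (LINT x|uball. g x)"
    using integral_cong_AE[OF f G(1) ae] G(2) by simp
  show "integrable lball f \<longleftrightarrow> integrable uball g"
    using integrable_cong_AE[OF f G(1) ae] G(3) by simp
qed

lemma borel_representative:
  fixes f :: "'a::euclidean_space \<Rightarrow> 'b::euclidean_space"
  assumes "f \<in> borel_measurable lebesgue"
  obtains g where "g \<in> borel_measurable borel" "AE x in lborel. f x = g x"
proof -
  have "\<exists>h\<in>borel_measurable lborel. AE x in lborel. f x \<bullet> b = h x" if "b \<in> Basis" for b
    by (rule completion_ex_borel_measurable_real)
       (use assms borel_measurable_euclidean_space that in blast)
  then obtain h where h: "\<And>b. b \<in> Basis \<Longrightarrow> h b \<in> borel_measurable lborel" "\<And>b. b \<in> Basis \<Longrightarrow> AE x in lborel. f x \<bullet> b = h b x"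
    by metis
  show ?thesis
  proof (rule that[of "\<lambda>x. \<Sum>b\<in>Basis. h b x *\<^sub>R b"])
    show "(\<lambda>x. \<Sum>b\<in>Basis. h b x *\<^sub>R b) \<in> borel_measurable borel"
      using h(1) by (intro borel_measurable_sum borel_measurable_scaleR) auto
    have "AE x in lborel. \<forall>b\<in>Basis. f x \<bullet> b = h b x"
      by (subst AE_finite_all) (use h(2) in auto)
    then show "AE x in lborel. f x = (\<Sum>b\<in>Basis. h b x *\<^sub>R b)"
    proof eventually_elim
      case (elim x)
      then show ?case using euclidean_representation[of "f x"] by (simp cong: sum.cong)
    qed
  qed
qed

lemma L2_on_representative:
  fixes f :: "'a::euclidean_space \<Rightarrow> 'b::euclidean_space"
  assumes f: "L2_on (cball 0 1) f"
  obtains g where "Lp_ball 2 g" "AE x in uball. f x = g x"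
proof -
  have m: "f \<in> borel_measurable lball" and i: "integrable lball (\<lambda>x. (norm (f x))\<^sup>2)" using f by (auto simp: L2_on_def)
  have "(\<lambda>x. indicator (cball 0 1) x *\<^sub>R f x) \<in> borel_measurable lebesgue"
    using m by (subst (asm) borel_measurable_restrict_space_iff) auto
  then obtain g where g: "g \<in> borel_measurable borel" "AE x in lborel. indicator (cball 0 1) x *\<^sub>R f x = g x"
    by (rule borel_representative)
  define h where "h x = indicator (cball 0 1) x *\<^sub>R g x" for x
  have [measurable]: "h \<in> borel_measurable borel"
    unfolding h_def[abs_def] using g(1) by (intro borel_measurable_scaleR borel_measurable_indicator) auto
  have h0: "h x = 0" if "norm x > 1" for x using that by (simp add: h_def)
  have eq: "AE x in uball. f x = h x"
    unfolding AE_uball_iff using g(2) by eventually_elim (auto simp: h_def)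
  have "AE x in uball. (norm (f x))\<^sup>2 = (norm (h x))\<^sup>2" using eq by eventually_elim simp
  from lball_AE_eq(3)[OF _ this] have "integrable uball (\<lambda>x. (norm (h x))\<^sup>2)" using i by simp
  then have "integrable lborel (\<lambda>x. (norm (h x))\<^sup>2)"
    by (subst integral_lborel_eq_uball(2)) (auto simp: h0)
  then have "Lp_ball 2 h" using h0 by (auto simp: Lp_ball_def)
  then show ?thesis using eq by (rule that)
qed

lemma partial_UNIV: "partial UNIV j f x = frechet_derivative f (at x) (axis j 1)"
  by (simp add: partial_def)

text \<open>Weak derivatives are only locally integrable in the open ball. Their difference is
  therefore cut off to the balls of radius \<open>R n\<close>, which exhaust the open ball, and the
  fundamental lemma is applied on each; the sphere has measure 0.\<close>

lemma has_weak_partial_unique: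
  fixes f :: "real^3 \<Rightarrow> 'b::euclidean_space"
  assumes "has_weak_partial B3 j f h1" "has_weak_partial B3 j f h2"
  shows "AE x in uball. h1 x = h2 x"
proof -
  define R where "R n = 1 - 1 / (real n + 2)" for n
  have "AE x in lborel. norm x < R n \<longrightarrow> h1 x = h2 x" for n
  proof -
    let ?r = "R n" and ?K = "cball (0::real^3) (R n)"
    have r: "?r \<le> 1" "?r < 1" by (auto simp: R_def)
    have K: "compact ?K" "?K \<subseteq> interior B3" using r by auto
    have i: "integrable lebesgue (\<lambda>x. indicator ?K x *\<^sub>R h1 x)" "integrable lebesgue (\<lambda>x. indicator ?K x *\<^sub>R h2 x)"
      using assms K by (auto simp: has_weak_partial_def locally_integrable_on_def set_integrable_def)
    define d where "d x = indicator ?K x *\<^sub>R (h1 x - h2 x)" for x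
    have id: "integrable lebesgue d"
      using Bochner_Integration.integrable_diff[OF i] by (simp add: d_def[abs_def] scaleR_diff_right)
    from borel_measurable_integrable[OF id]
    obtain g where g: "g \<in> borel_measurable borel" "AE x in lborel. d x = g x"
      by (rule borel_representative)
    define g' where "g' x = indicator ?K x *\<^sub>R g x" for x
    have [measurable]: "g' \<in> borel_measurable borel"
      unfolding g'_def[abs_def] using g(1) by (intro borel_measurable_scaleR borel_measurable_indicator) auto
    have eq: "AE x in lborel. d x = g' x" using g(2) by eventually_elim (auto simp: g'_def d_def indicator_def)
    have eqL: "AE x in lebesgue. d x = g' x" using eq by (simp add: AE_completion_iff)
    have g'm: "g' \<in> borel_measurable lebesgue" by (rule measurable_completion) simp
    have "integrable lebesgue g'" using integrable_cong_AE[OF _ g'm eqL] id by auto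
    then have ig: "integrable lborel g'" by (subst (asm) integrable_completion) auto
    have "AE x in lborel. norm x < ?r \<longrightarrow> g' x = 0"
    proof (rule fundamental_lemma[OF _ r(1)])
      have "g' x = 0" if "norm x > 1" for x using that r by (simp add: g'_def)
      then show "Lp_ball 1 g'" using integrable_norm[OF ig] by (simp add: Lp_ball_def)
      fix \<phi> :: "real^3 \<Rightarrow> real" assume \<phi>: "test_function ?K \<phi>"
      have "interior ?K \<subseteq> interior B3" using r by (intro interior_mono) auto
      then have \<phi>B: "test_function B3 \<phi>" using \<phi> by (auto simp: test_function_def)
      have \<phi>0: "\<phi> x = 0" if "x \<notin> ?K" for x
      proof (rule ccontr)
        assume "\<phi> x \<noteq> 0"
        then have "x \<in> closure {x. \<phi> x \<noteq> 0}" by (intro closure_subset[THEN subsetD]) simp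
        moreover have "closure {x. \<phi> x \<noteq> 0} \<subseteq> interior ?K" using \<phi> unfolding test_function_def by blast
        ultimately show False using that interior_subset by blast
      qed
      note tk = test_function_test_kernel(1)[OF \<phi>B]
      obtain M where M: "\<And>x. norm (\<phi> x) \<le> M" using test_kernel_bounded[OF tk] by metis
      have \<phi>m: "\<phi> \<in> borel_measurable lebesgue" by (rule measurable_completion) (simp add: test_kernel_measurable[OF tk])
      have e: "indicator B3 x *\<^sub>R (\<phi> x *\<^sub>R h x) = \<phi> x *\<^sub>R (indicator ?K x *\<^sub>R h x)" for h :: "real^3 \<Rightarrow> 'b" and x
        using \<phi>0[of x] r by (auto simp: indicator_def)
      have ih: "integrable lebesgue (\<lambda>x. \<phi> x *\<^sub>R (indicator ?K x *\<^sub>R h1 x))" "integrable lebesgue (\<lambda>x. \<phi> x *\<^sub>R (indicator ?K x *\<^sub>R h2 x))"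
        using integrable_bounded_scaleR[OF i(1) \<phi>m] integrable_bounded_scaleR[OF i(2) \<phi>m] M by auto
      have "(LINT x|lball. \<phi> x *\<^sub>R h1 x) = (LINT x|lball. \<phi> x *\<^sub>R h2 x)"
      proof -
        have "(LINT x|lball. partial UNIV j \<phi> x *\<^sub>R f x) = - (LINT x|lball. \<phi> x *\<^sub>R h1 x)"
          using assms(1) \<phi>B unfolding has_weak_partial_def by blast
        moreover have "(LINT x|lball. partial UNIV j \<phi> x *\<^sub>R f x) = - (LINT x|lball. \<phi> x *\<^sub>R h2 x)"
          using assms(2) \<phi>B unfolding has_weak_partial_def by blast
        ultimately show ?thesis by simp
      qed
      then have "(LINT x|lebesgue. \<phi> x *\<^sub>R (indicator ?K x *\<^sub>R h1 x)) = (LINT x|lebesgue. \<phi> x *\<^sub>R (indicator ?K x *\<^sub>R h2 x))"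
        unfolding e[symmetric] by (subst (asm) (1 2) integral_restrict_space) simp_all
      then have "(LINT x|lebesgue. \<phi> x *\<^sub>R d x) = 0"
        using Bochner_Integration.integral_diff[OF ih] by (simp add: d_def scaleR_diff_right)
      moreover have "(LINT x|lebesgue. \<phi> x *\<^sub>R d x) = (LINT x|lebesgue. \<phi> x *\<^sub>R g' x)"
        by (rule integral_cong_AE) (use \<phi>m g'm id eqL in \<open>auto elim!: eventually_mono\<close>)
      moreover have "(LINT x|lebesgue. \<phi> x *\<^sub>R g' x) = (LINT x|lborel. \<phi> x *\<^sub>R g' x)"
        by (rule integral_completion) (use test_kernel_measurable[OF tk] in auto)
      ultimately show "(LINT x|lborel. \<phi> x *\<^sub>R g' x) = 0" by simp
    qed
    then show ?thesis
      using eq by eventually_elim (auto simp: d_def indicator_def)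
  qed
  then have "AE x in lborel. \<forall>n. norm x < R n \<longrightarrow> h1 x = h2 x" by (subst AE_all_countable) blast
  then show ?thesis
  proof (intro AE_uball_open, eventually_elim)
    case (elim x)
    show ?case
    proof
      assume "norm x < 1"
      then obtain n where "inverse (real (Suc n)) < 1 - norm x" using reals_Archimedean[of "1 - norm x"] by auto
      moreover have "1 / (real n + 2) \<le> inverse (real (Suc n))" by (simp add: divide_simps)
      ultimately have "norm x < R n" by (simp add: R_def)
      then show "h1 x = h2 x" using elim by blast
    qed
  qed
qed

lemma has_weak_partial_weak_dir:
  fixes f h :: "real^3 \<Rightarrow> 'b::euclidean_space"
  assumes w: "has_weak_partial B3 j f h" and f': "f' \<in> borel_measurable borel" "AE x in uball. f x = f' x"
    and h': "h' \<in> borel_measurable borel" "AE x in uball. h x = h' x"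
  shows "weak_dir (axis j 1) f' h'"
  unfolding weak_dir_def
proof (intro allI impI)
  fix \<phi> :: "real^3 \<Rightarrow> real" assume \<phi>: "test_function (cball 0 1) \<phi>"
  note tk = test_function_test_kernel[OF \<phi>]
  let ?D = "\<lambda>x. frechet_derivative \<phi> (at x) (axis j 1)"
  have [measurable]: "\<phi> \<in> borel_measurable borel" "?D \<in> borel_measurable borel" "f' \<in> borel_measurable borel" "h' \<in> borel_measurable borel"
    using test_kernel_measurable[OF tk(1)] test_kernel_measurable[OF test_kernel_derivative[OF tk(1)]] f' h' by auto
  have 0: "\<phi> x = 0" "?D x = 0" if "norm x > 1" for x
    using tk(2)[of x] test_kernel_derivative[OF tk(1), of "axis j 1"] that by (auto simp: test_kernel_def)
  have "(LINT x|lball. ?D x *\<^sub>R f x) = (LINT x|uball. ?D x *\<^sub>R f' x)"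
    by (rule lball_AE_eq(2)) (use f'(2) in \<open>auto elim!: eventually_mono\<close>)
  moreover have "(LINT x|lball. \<phi> x *\<^sub>R h x) = (LINT x|uball. \<phi> x *\<^sub>R h' x)"
    by (rule lball_AE_eq(2)) (use h'(2) in \<open>auto elim!: eventually_mono\<close>)
  moreover have "(LINT x|lball. ?D x *\<^sub>R f x) = - (LINT x|lball. \<phi> x *\<^sub>R h x)"
    using w \<phi> unfolding has_weak_partial_def partial_UNIV by blast
  ultimately have "(LINT x|uball. ?D x *\<^sub>R f' x) = - (LINT x|uball. \<phi> x *\<^sub>R h' x)" by simp
  then show "(LINT x|lborel. ?D x *\<^sub>R f' x) = - (LINT x|lborel. \<phi> x *\<^sub>R h' x)"
    by (subst (1 2) integral_lborel_eq_uball(1)) (auto simp: 0)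
qed

text \<open>Testing with \<phi> dx^m isolates one component: m = 3, 2, 1 give the index pairs (1,2),
  (1,3), (2,3), with the signs of the wedge product. The other pairs follow because both sides are
  antisymmetric.\<close>

lemma distributional_d_scalar:
  assumes d: "distributional_d \<eta> \<beta>"
    and \<eta>': "\<eta>' \<in> borel_measurable borel" "AE x in uball. \<eta> x = \<eta>' x"
    and \<beta>': "\<And>i l. \<beta>' i l \<in> borel_measurable borel" "AE x in uball. \<forall>i l. \<beta> x $ i $ l = \<beta>' i l x"
    and skew: "\<And>i l x. \<beta>' l i x = - \<beta>' i l x"
    and \<phi>: "test_function B3 \<phi>"
  shows "(LINT y|lborel. frechet_derivative \<phi> (at y) (axis i 1) * \<eta>' y $ l - frechet_derivative \<phi> (at y) (axis l 1) * \<eta>' y $ i)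
        = - (LINT y|lborel. \<phi> y * \<beta>' i l y)"
proof -
  note tk = test_function_test_kernel[OF \<phi>]
  let ?D = "\<lambda>i x. frechet_derivative \<phi> (at x) (axis i 1)"
  have [measurable]: "\<phi> \<in> borel_measurable borel" "?D i \<in> borel_measurable borel" "\<beta>' i l \<in> borel_measurable borel" for i l
    using test_kernel_measurable[OF tk(1)] test_kernel_measurable[OF test_kernel_derivative[OF tk(1)]] \<beta>' by auto
  have [measurable]: "(\<lambda>x. \<eta>' x $ i) \<in> borel_measurable borel" for i
  proof -
    have "(\<lambda>v::real^3. v $ i) \<in> borel_measurable borel" by (intro borel_measurable_continuous_onI continuous_intros)
    from measurable_compose[OF \<eta>'(1) this] show ?thesis .
  qed
  have 0: "\<phi> x = 0" "?D i x = 0" if "norm x > 1" for x i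
    using tk(2)[of x] test_kernel_derivative[OF tk(1), of "axis i 1"] that by (auto simp: test_kernel_def)
  define X where "X i l = (LINT y|uball. ?D i y * \<eta>' y $ l - ?D l y * \<eta>' y $ i)" for i l
  define Y where "Y i l = (LINT y|uball. \<phi> y * \<beta>' i l y)" for i l
  have Xs: "X l i = - X i l" for i l
    unfolding X_def by (subst integral_minus[symmetric]) (intro Bochner_Integration.integral_cong refl, simp)
  have Ys: "Y l i = - Y i l" for i l
    unfolding Y_def by (subst integral_minus[symmetric]) (intro Bochner_Integration.integral_cong refl, simp add: skew[of l i])
  have test: "(LINT x|lball. wedge12 \<eta> (ext_deriv UNIV (\<lambda>y. \<phi> y *\<^sub>R axis m 1)) x) = (LINT x|lball. wedge21 \<beta> (\<lambda>y. \<phi> y *\<^sub>R axis m 1) x)" for m :: 3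
  proof -
    have "{x. \<phi> x *\<^sub>R (axis m 1 :: real^3) \<noteq> 0} = {x. \<phi> x \<noteq> 0}" by (auto simp: axis_eq_0_iff)
    moreover have "Ck_on k UNIV (\<lambda>y. \<phi> y *\<^sub>R (axis m 1 :: real^3))" for k
      using tk(1) by (intro Ck_on_bounded_linear[OF bounded_linear_scaleR_left open_UNIV]) (auto simp: test_kernel_def)
    ultimately have "test_function B3 (\<lambda>y. \<phi> y *\<^sub>R (axis m 1 :: real^3))"
      using \<phi> by (auto simp: test_function_def smooth_on_UNIV_iff)
    then show ?thesis using d by (auto simp: distributional_d_def)
  qed
  have p: "partial UNIV j (\<lambda>y. \<phi> y *\<^sub>R (axis m 1 :: real^3)) x = ?D j x *\<^sub>R axis m 1" for j m x
    unfolding partial_UNIV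
    using frechet_derivative_at[OF bounded_linear.has_derivative[OF bounded_linear_scaleR_left[of "axis m 1 :: real^3"]
      test_kernel_has_derivative[OF tk(1), of x]], THEN fun_cong, of "axis j 1"]
    by simp
  have ax: "(axis m 1 :: real^3) $ k = (if k = m then 1 else 0)" for m k by (simp add: axis_def)
  note ext = ext_deriv_def p wedge12_def wedge21_def ax
  have "X 1 2 = - Y 1 2"
  proof -
    have "(LINT x|lball. wedge12 \<eta> (ext_deriv UNIV (\<lambda>y. \<phi> y *\<^sub>R axis 3 1)) x) = - X 1 2"
      unfolding X_def integral_minus[symmetric] by (rule lball_AE_eq(2)) (use \<eta>'(2) in \<open>auto elim!: eventually_mono simp: ext\<close>)
    moreover have "(LINT x|lball. wedge21 \<beta> (\<lambda>y. \<phi> y *\<^sub>R axis 3 1) x) = (LINT y|uball. \<phi> y * \<beta>' 1 2 y)"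
      by (rule lball_AE_eq(2)) (use \<beta>'(2) in \<open>auto elim!: eventually_mono simp: ext\<close>)
    ultimately show ?thesis using test[of 3] by (simp add: X_def Y_def)
  qed
  moreover have "X 1 3 = - Y 1 3"
  proof -
    have "(LINT x|lball. wedge12 \<eta> (ext_deriv UNIV (\<lambda>y. \<phi> y *\<^sub>R axis 2 1)) x) = (LINT y|uball. (?D 1 y * \<eta>' y $ 3 - ?D 3 y * \<eta>' y $ 1))"
      by (rule lball_AE_eq(2)) (use \<eta>'(2) in \<open>auto elim!: eventually_mono simp: ext\<close>)
    moreover have "(LINT x|lball. wedge21 \<beta> (\<lambda>y. \<phi> y *\<^sub>R axis 2 1) x) = - Y 1 3"
      unfolding Y_def integral_minus[symmetric] by (rule lball_AE_eq(2)) (use \<beta>'(2) in \<open>auto elim!: eventually_mono simp: ext\<close>)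
    ultimately show ?thesis using test[of 2] by (simp add: X_def Y_def)
  qed
  moreover have "X 2 3 = - Y 2 3"
  proof -
    have "(LINT x|lball. wedge12 \<eta> (ext_deriv UNIV (\<lambda>y. \<phi> y *\<^sub>R axis 1 1)) x) = - X 2 3"
      unfolding X_def integral_minus[symmetric] by (rule lball_AE_eq(2)) (use \<eta>'(2) in \<open>auto elim!: eventually_mono simp: ext\<close>)
    moreover have "(LINT x|lball. wedge21 \<beta> (\<lambda>y. \<phi> y *\<^sub>R axis 1 1) x) = (LINT y|uball. \<phi> y * \<beta>' 2 3 y)"
      by (rule lball_AE_eq(2)) (use \<beta>'(2) in \<open>auto elim!: eventually_mono simp: ext\<close>)
    ultimately show ?thesis using test[of 1] by (simp add: X_def Y_def)
  qed
  moreover have "X i i = - Y i i" for i using Xs[of i i] Ys[of i i] by simp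
  ultimately have "X i l = - Y i l"
    using Xs[of 2 1] Xs[of 3 1] Xs[of 3 2] Ys[of 2 1] Ys[of 3 1] Ys[of 3 2]
    using exhaust_3[of i] exhaust_3[of l] by auto
  then show ?thesis
    unfolding X_def Y_def by (subst (1 2) integral_lborel_eq_uball(1)) (auto simp: 0)
qed

lemma Ck_on_Un: "open U \<Longrightarrow> open V \<Longrightarrow> Ck_on k U f \<Longrightarrow> Ck_on k V f \<Longrightarrow> Ck_on k (U \<union> V) f"
  by (induction k arbitrary: f) (auto intro: continuous_on_open_Un)

lemma integrable_uball_continuous:
  fixes f :: "'a::euclidean_space \<Rightarrow> 'b::euclidean_space"
  assumes "continuous_on (cball 0 1) f"
  shows "integrable uball f" "f \<in> borel_measurable uball"
proof -
  show "integrable uball f"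
    using borel_integrable_compact[OF compact_cball assms] by (simp add: integrable_restrict_space)
  then show "f \<in> borel_measurable uball" by (rule borel_measurable_integrable)
qed

text \<open>\<phi> f is smooth on all of space: on \<open>U\<close> as a product, and off the
  support of \<phi> because it is 0 there, two open sets that cover everything. Its derivative
  integrates to 0, which is integration by parts.\<close>

lemma classical_weak_partial:
  fixes f :: "real^3 \<Rightarrow> 'b::euclidean_space"
  assumes U: "open U" "B3 \<subseteq> U" and f: "\<And>m. Ck_on m U f"
  shows "has_weak_partial B3 j f (\<lambda>x. frechet_derivative f (at x) (axis j 1))"
proof -
  let ?f' = "\<lambda>x. frechet_derivative f (at x) (axis j 1)"
  have cf: "continuous_on U f" "continuous_on U ?f'"
    using Ck_on_imp_continuous_on f[of 0] f[of "Suc 0"] by auto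
  have loc: "locally_integrable_on h (interior B3)" if "continuous_on U h" for h :: "real^3 \<Rightarrow> 'b"
    unfolding locally_integrable_on_def set_integrable_def
  proof (intro allI impI)
    fix K assume K: "compact K \<and> K \<subseteq> interior B3"
    then have "K \<subseteq> U" using U interior_subset by blast
    then have "integrable lborel (\<lambda>x. indicator K x *\<^sub>R h x)"
      using K continuous_on_subset[OF that] by (intro borel_integrable_compact) auto
    then show "integrable lebesgue (\<lambda>x. indicator K x *\<^sub>R h x)"
      by (subst integrable_completion) auto
  qed
  have "(LINT x|lball. partial UNIV j \<phi> x *\<^sub>R f x) = - (LINT x|lball. \<phi> x *\<^sub>R ?f' x)" if \<phi>: "test_function B3 \<phi>" for \<phi> :: "real^3 \<Rightarrow> real"
  proof -
    note tk = test_function_test_kernel[OF \<phi>]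
    let ?D = "\<lambda>x. frechet_derivative \<phi> (at x) (axis j 1)"
    let ?V = "- closure {x. \<phi> x \<noteq> 0}"
    define F where "F x = \<phi> x *\<^sub>R f x" for x
    have "closure {x. \<phi> x \<noteq> 0} \<subseteq> U" using \<phi> U interior_subset unfolding test_function_def by blast
    then have UV: "U \<union> ?V = UNIV" by auto
    have tF: "test_kernel 1 F"
      unfolding test_kernel_def
    proof (intro conjI allI impI)
      fix m
      have "Ck_on m U \<phi>" using tk(1) Ck_on_subset[of m UNIV \<phi> U] by (simp add: test_kernel_def)
      then have "Ck_on m U F" unfolding F_def by (intro Ck_on_bounded_bilinear[OF bounded_bilinear_scaleR] U f)
      moreover have "Ck_on m ?V F"
      proof (rule Ck_on_cong[OF _ _ Ck_on_const[of _ _ 0]])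
        show "0 = F x" if "x \<in> ?V" for x
          using that closure_subset[of "{x. \<phi> x \<noteq> 0}"] by (auto simp: F_def)
      qed auto
      ultimately have "Ck_on m (U \<union> ?V) F" by (intro Ck_on_Un U) auto
      then show "Ck_on m UNIV F" by (simp add: UV)
    qed (use tk(2) in \<open>auto simp: F_def\<close>)
    have z: "(LINT x|lborel. frechet_derivative F (at x) (axis j 1)) = 0"
      by (rule integral_test_kernel_derivative[OF tF]) simp
    have tD: "test_kernel 1 ?D" by (rule test_kernel_derivative[OF tk(1)])
    have c: "continuous_on B3 (\<lambda>x. ?D x *\<^sub>R f x)" "continuous_on B3 (\<lambda>x. \<phi> x *\<^sub>R ?f' x)"
      by (intro continuous_on_scaleR test_kernel_continuous[OF tD] test_kernel_continuous[OF tk(1)]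
        continuous_on_subset[OF cf(1) U(2)] continuous_on_subset[OF cf(2) U(2)])+
    have der: "frechet_derivative F (at x) (axis j 1) = \<phi> x *\<^sub>R ?f' x + ?D x *\<^sub>R f x" if "x \<in> B3" for x
    proof -
      have "(f has_derivative frechet_derivative f (at x)) (at x)"
        using Ck_on_has_derivative[OF f] that U by blast
      from bounded_bilinear.FDERIV[OF bounded_bilinear_scaleR test_kernel_has_derivative[OF tk(1)] this]
      show ?thesis unfolding F_def using frechet_derivative_at by (metis (mono_tags, lifting))
    qed
    have "0 = (LINT x|uball. frechet_derivative F (at x) (axis j 1))"
      using z test_kernel_derivative[OF tF, of "axis j 1"]
      by (subst (asm) integral_lborel_eq_uball(1)) (auto simp: test_kernel_def)
    also have "\<dots> = (LINT x|uball. \<phi> x *\<^sub>R ?f' x + ?D x *\<^sub>R f x)"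
      by (rule Bochner_Integration.integral_cong) (use der in \<open>auto simp: space_uball\<close>)
    also have "\<dots> = (LINT x|uball. \<phi> x *\<^sub>R ?f' x) + (LINT x|uball. ?D x *\<^sub>R f x)"
      by (intro Bochner_Integration.integral_add integrable_uball_continuous c)
    finally show ?thesis
      using lball_of_uball(2)[OF integrable_uball_continuous(2)[OF c(1)]] lball_of_uball(2)[OF integrable_uball_continuous(2)[OF c(2)]]
      by (simp add: partial_UNIV add_eq_0_iff2)
  qed
  then show ?thesis unfolding has_weak_partial_def using loc cf by auto
qed

text \<open>Square integrability makes the integrals against bounded kernels exist, so that they can
  be split.\<close>

lemma has_weak_partial_diff:
  fixes f g :: "real^3 \<Rightarrow> 'b::euclidean_space"
  assumes f: "has_weak_partial B3 j f f'" "L2_on B3 f" "L2_on B3 f'"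
    and g: "has_weak_partial B3 j g g'" "L2_on B3 g" "L2_on B3 g'"
  shows "has_weak_partial B3 j (\<lambda>x. f x - g x) (\<lambda>x. f' x - g' x)"
proof -
  have loc: "locally_integrable_on (\<lambda>x. f x - g x) (interior B3)"
    if "locally_integrable_on f (interior B3)" "locally_integrable_on g (interior B3)" for f g :: "real^3 \<Rightarrow> 'b"
    using that unfolding locally_integrable_on_def by (auto intro: set_integral_diff(1))
  have i: "integrable lball (\<lambda>x. \<phi> x *\<^sub>R h x)" if h: "L2_on B3 h" and tk: "test_kernel 1 \<phi>" for \<phi> :: "real^3 \<Rightarrow> real" and h :: "real^3 \<Rightarrow> 'b"
  proof -
    obtain h' where h': "Lp_ball 2 h'" "AE x in uball. h x = h' x" by (rule L2_on_representative[OF h])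
    obtain M where M: "\<And>x. norm (\<phi> x) \<le> M" using test_kernel_bounded[OF tk] by metis
    have [measurable]: "h' \<in> borel_measurable borel" "\<phi> \<in> borel_measurable borel" using h'(1) test_kernel_measurable[OF tk] by (auto simp: Lp_ball_def)
    have "integrable uball (\<lambda>x. \<phi> x *\<^sub>R h' x)"
      using integrable_bounded_scaleR[OF Lp_ball_integrable[OF h'(1)], of \<phi> M] M by (intro integrable_uball) auto
    moreover have "AE x in uball. \<phi> x *\<^sub>R h x = \<phi> x *\<^sub>R h' x" using h'(2) by eventually_elim simp
    ultimately show ?thesis by (subst lball_AE_eq(3)) auto
  qed
  have "(LINT x|lball. partial UNIV j \<phi> x *\<^sub>R (f x - g x)) = - (LINT x|lball. \<phi> x *\<^sub>R (f' x - g' x))"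
    if \<phi>: "test_function B3 \<phi>" for \<phi> :: "real^3 \<Rightarrow> real"
  proof -
    note tk = test_function_test_kernel(1)[OF \<phi>]
    have tD: "test_kernel 1 (partial UNIV j \<phi>)" using test_kernel_derivative[OF tk] by (simp add: partial_UNIV[abs_def])
    have "(LINT x|lball. partial UNIV j \<phi> x *\<^sub>R f x) = - (LINT x|lball. \<phi> x *\<^sub>R f' x)"
      using f(1) \<phi> unfolding has_weak_partial_def by blast
    moreover have "(LINT x|lball. partial UNIV j \<phi> x *\<^sub>R g x) = - (LINT x|lball. \<phi> x *\<^sub>R g' x)"
      using g(1) \<phi> unfolding has_weak_partial_def by blast
    ultimately show ?thesis
      using Bochner_Integration.integral_diff[OF i[OF f(2) tD] i[OF g(2) tD]]
        Bochner_Integration.integral_diff[OF i[OF f(3) tk] i[OF g(3) tk]]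
      by (simp add: scaleR_diff_right)
  qed
  then show ?thesis using f(1) g(1) loc unfolding has_weak_partial_def by blast
qed

lemma L2_norm_lball_AE_eq:
  fixes f g :: "'a::euclidean_space \<Rightarrow> 'b::euclidean_space"
  assumes "g \<in> borel_measurable uball" "AE x in uball. f x = g x"
  shows "L2_norm_on (cball 0 1) f = sqrt (LINT x|uball. (norm (g x))\<^sup>2)"
proof -
  have "AE x in uball. (norm (f x))\<^sup>2 = (norm (g x))\<^sup>2" using assms(2) by eventually_elim simp
  from lball_AE_eq(2)[OF _ this] show ?thesis using assms(1) by (simp add: L2_norm_on_def)
qed

lemma L2_dominated_convergence:
  fixes fs :: "nat \<Rightarrow> 'a \<Rightarrow> 'b::euclidean_space"
  assumes [measurable]: "\<And>k. fs k \<in> borel_measurable M" "f \<in> borel_measurable M"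
    and lim: "AE x in M. (\<lambda>k. fs k x) \<longlonglongrightarrow> f x"
    and dom: "AE x in M. \<forall>k. (norm (fs k x))\<^sup>2 \<le> \<Psi> x" "integrable M \<Psi>"
  shows "integrable M (\<lambda>x. (norm (fs k x))\<^sup>2)" "(\<lambda>k. sqrt (LINT x|M. (norm (fs k x - f x))\<^sup>2)) \<longlonglongrightarrow> 0"
proof -
  show "integrable M (\<lambda>x. (norm (fs k x))\<^sup>2)"
    by (rule Bochner_Integration.integrable_bound[OF dom(2)]) (use dom(1) in \<open>auto elim!: eventually_mono intro: order_trans\<close>)
  have "(\<lambda>k. LINT x|M. (norm (fs k x - f x))\<^sup>2) \<longlonglongrightarrow> (LINT x|M. 0)"
  \<comment> \<open>8 = 2^2 (1 + 1): the limit inherits the bound \<Psi>, and the square of a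
    difference costs a factor 2^2.\<close>
  proof (rule integral_dominated_convergence[where w="\<lambda>x. 8 * \<Psi> x"])
    show "integrable M (\<lambda>x. 8 * \<Psi> x)" using dom(2) by simp
    show "AE x in M. (\<lambda>k. (norm (fs k x - f x))\<^sup>2) \<longlonglongrightarrow> 0"
      using lim
    proof eventually_elim
      case (elim x)
      have "(\<lambda>k. (norm (fs k x - f x))\<^sup>2) \<longlonglongrightarrow> (norm (f x - f x))\<^sup>2" by (intro tendsto_intros elim)
      then show ?case by simp
    qed
    show "AE x in M. norm ((norm (fs k x - f x))\<^sup>2) \<le> 8 * \<Psi> x" for k
      using lim dom(1)
    proof eventually_elim
      case (elim x)
      have "(\<lambda>k. (norm (fs k x))\<^sup>2) \<longlonglongrightarrow> (norm (f x))\<^sup>2" by (intro tendsto_intros elim)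
      then have "(norm (f x))\<^sup>2 \<le> \<Psi> x" by (rule LIMSEQ_le_const2) (use elim in auto)
      with elim(2)[rule_format, of k] norm_power_diff_le[of "fs k x" "f x" 2]
      show ?case by (simp add: distrib_left)
    qed
  qed measurable
  then show "(\<lambda>k. sqrt (LINT x|M. (norm (fs k x - f x))\<^sup>2)) \<longlonglongrightarrow> 0"
    using tendsto_real_sqrt by fastforce
qed

section \<open>Smooth pairs from smooth lifts\<close>

lemma Hopf_has_derivative:
  assumes "(G has_derivative G') (at x)"
  shows "((\<lambda>x. Hopf c (G x)) has_derivative (\<lambda>v. DHopf c (G x) (G' v))) (at x)"
proof -
  have 1: "((\<lambda>x. qcnj (G x)) has_derivative (\<lambda>v. qcnj (G' v))) (at x)"
    by (rule bounded_linear.has_derivative[OF bounded_linear_qcnj assms])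
  have 2: "((\<lambda>x. G x \<odot> im c) has_derivative (\<lambda>v. G' v \<odot> im c)) (at x)"
    by (rule bounded_linear.has_derivative[OF bounded_bilinear.bounded_linear_left[OF bounded_bilinear_qmul] assms])
  from has_derivative_snd[OF qmul.FDERIV[OF 2 1]]
  show ?thesis unfolding Hopf_def DHopf_def by (simp add: add.commute)
qed

lemma Ck_on_qmul: "open U \<Longrightarrow> Ck_on k U f \<Longrightarrow> Ck_on k U g \<Longrightarrow> Ck_on k U (\<lambda>x. f x \<odot> g x)"
  by (rule Ck_on_bounded_bilinear[OF bounded_bilinear_qmul])

lemma Ck_on_Hopf: "open U \<Longrightarrow> Ck_on k U G \<Longrightarrow> Ck_on k U (\<lambda>x. Hopf c (G x))"
  unfolding Hopf_def
  by (intro Ck_on_bounded_linear[OF bounded_linear_snd] Ck_on_bounded_linear[OF bounded_linear_qcnj] Ck_on_qmul Ck_on_const)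

text \<open>The pullback by \<open>G\<close> of -2 times the 1-form on the three-sphere dual to the
  fibre direction q c of the Hopf map. The factor matches the lift, for which <A g, g c> = A . u = -
  \<eta> / 2.\<close>

definition hopf_form :: "real^3 \<Rightarrow> (real^3 \<Rightarrow> quat) \<Rightarrow> form1" where
  "hopf_form c G x = (\<chi> j. - 2 * (frechet_derivative G (at x) (axis j 1) \<bullet> (G x \<odot> im c)))"

lemma vec_lambda_sum_axis: "(\<chi> j. (f j :: real)) = (\<Sum>j\<in>UNIV. f j *\<^sub>R axis j 1)"
  by (simp add: vec_eq_iff axis_def if_distrib cong: if_cong)

lemma Ck_on_inner: "open U \<Longrightarrow> Ck_on k U f \<Longrightarrow> Ck_on k U g \<Longrightarrow> Ck_on k U (\<lambda>x. f x \<bullet> g x)"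
  by (rule Ck_on_bounded_bilinear[OF bounded_bilinear_inner])

lemma Ck_on_hopf_form:
  assumes U: "open U" and G: "\<And>m. Ck_on m U G"
  shows "Ck_on k U (hopf_form c G)"
proof -
  have "Ck_on k U (\<lambda>x. frechet_derivative G (at x) v)" for v using G[of "Suc k"] by simp
  then have "Ck_on k U (\<lambda>x. - 2 * (frechet_derivative G (at x) (axis j 1) \<bullet> (G x \<odot> im c)))" for j
    by (intro Ck_on_bounded_linear[OF bounded_linear_mult_right U] Ck_on_inner Ck_on_qmul Ck_on_const U G)
  then show ?thesis
    unfolding hopf_form_def[abs_def] vec_lambda_sum_axis
    by (intro Ck_on_sum Ck_on_bounded_linear[OF bounded_linear_scaleR_left U] U)
qed

lemma qmul_im_skew: "p \<bullet> (q \<odot> im c) = - (q \<bullet> (p \<odot> im c))"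
  by (simp add: quat_simps inner_prod_def algebra_simps)

lemma sphere_valued_derivative:
  fixes G :: "'a::real_normed_vector \<Rightarrow> 'b::real_inner"
  assumes U: "open U" "x \<in> U" and G: "\<And>y. y \<in> U \<Longrightarrow> norm (G y) = 1"
    and D: "(G has_derivative G') (at x)"
  shows "G' v \<bullet> G x = 0"
proof -
  have "((\<lambda>y. G y \<bullet> G y) has_derivative (\<lambda>v. G x \<bullet> G' v + G' v \<bullet> G x)) (at x)"
    by (rule has_derivative_inner[OF D D])
  moreover have "((\<lambda>y. G y \<bullet> G y) has_derivative (\<lambda>v. 0)) (at x)"
    by (rule has_derivative_transform_within_open[OF has_derivative_const[of 1] U]) (use G in \<open>simp add: norm_eq_1\<close>)
  ultimately have "(\<lambda>v. G x \<bullet> G' v + G' v \<bullet> G x) = (\<lambda>v. 0)" by (rule has_derivative_unique)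
  from fun_cong[OF this, of v] show ?thesis by (simp add: inner_commute)
qed

text \<open>Second derivatives of \<open>G\<close> cancel by symmetry. The two first-order terms
  agree because right multiplication by \<open>im c\<close> is skew, and their sum is the quantity
  in \<open>Hopf_volume_identity\<close>. The tangency needed there comes from |G| = 1 on a
  neighbourhood.\<close>

lemma ext_deriv_hopf_form:
  assumes U: "open U" "B3 \<subseteq> U" and G: "\<And>m. Ck_on m U G" "\<And>y. y \<in> U \<Longrightarrow> norm (G y) = 1"
    and c: "norm c = 1" and x: "x \<in> B3"
  shows "ext_deriv B3 (hopf_form c G) x = smooth_pullback_vol (\<lambda>x. Hopf c (G x)) x"
proof -
  have xU: "x \<in> U" using U x by auto
  let ?P = "\<lambda>j y. frechet_derivative G (at y) (axis j 1)"
  let ?Q = "\<lambda>l i. frechet_derivative (?P l) (at x) (axis i 1)"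
  have DG: "(G has_derivative frechet_derivative G (at x)) (at x)" using Ck_on_has_derivative[OF G(1) xU] .
  have DP: "(?P j has_derivative frechet_derivative (?P j) (at x)) (at x)" for j
    by (rule Ck_on_has_derivative[of 0 U, OF _ xU]) (use G(1)[of "Suc (Suc 0)"] in simp)
  have sym: "?Q l i = ?Q i l" for i l
    by (rule symmetric_derivative[OF U(1) xU G(1)])
  have tan: "?P j x \<bullet> G x = 0" for j by (rule sphere_valued_derivative[OF U(1) xU G(2) DG])
  have "((\<lambda>y. \<Sum>j\<in>UNIV. (- 2 * (?P j y \<bullet> (G y \<odot> im c))) *\<^sub>R (axis j 1 :: real^3)) has_derivative
     (\<lambda>v. \<Sum>j\<in>UNIV. (- 2 * (?P j x \<bullet> (frechet_derivative G (at x) v \<odot> im c) + frechet_derivative (?P j) (at x) v \<bullet> (G x \<odot> im c))) *\<^sub>R axis j 1)) (at x)"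
    by (intro has_derivative_sum bounded_linear.has_derivative[OF bounded_linear_scaleR_left]
      bounded_linear.has_derivative[OF bounded_linear_mult_right] has_derivative_inner DP
      bounded_linear.has_derivative[OF bounded_bilinear.bounded_linear_left[OF bounded_bilinear_qmul]] DG)
  then have "frechet_derivative (hopf_form c G) (at x within B3) =
     (\<lambda>v. \<Sum>j\<in>UNIV. (- 2 * (?P j x \<bullet> (frechet_derivative G (at x) v \<odot> im c) + frechet_derivative (?P j) (at x) v \<bullet> (G x \<odot> im c))) *\<^sub>R axis j 1)"
    unfolding vec_lambda_sum_axis[symmetric] hopf_form_def[symmetric]
    by (rule frechet_derivative_within_cball) (use x in simp)
  then have 1: "partial B3 i (hopf_form c G) x $ l = - 2 * (?P l x \<bullet> (?P i x \<odot> im c) + ?Q l i \<bullet> (G x \<odot> im c))" for i l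
    unfolding partial_def vec_lambda_sum_axis[symmetric] by simp
  have "frechet_derivative (\<lambda>x. Hopf c (G x)) (at x within B3) = (\<lambda>v. DHopf c (G x) (frechet_derivative G (at x) v))"
    by (rule frechet_derivative_within_cball[OF Hopf_has_derivative[OF DG]]) (use x in simp)
  then have 2: "partial B3 i (\<lambda>x. Hopf c (G x)) x = DHopf c (G x) (?P i x)" for i by (simp add: partial_def)
  have "ext_deriv B3 (hopf_form c G) x $ i $ l = smooth_pullback_vol (\<lambda>x. Hopf c (G x)) x $ i $ l" for i l
  proof -
    have "ext_deriv B3 (hopf_form c G) x $ i $ l = - 2 * (?P l x \<bullet> (?P i x \<odot> im c)) + 2 * (?P i x \<bullet> (?P l x \<odot> im c))"
      by (simp add: ext_deriv_def 1 sym[of l i] algebra_simps)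
    also have "\<dots> = 4 * (?P i x \<bullet> (?P l x \<odot> im c))" by (simp add: qmul_im_skew[of "?P l x"])
    also have "\<dots> = Hopf c (G x) \<bullet> cross3 (DHopf c (G x) (?P i x)) (DHopf c (G x) (?P l x))"
      by (rule Hopf_volume_identity[symmetric]) (use G(2)[OF xU] c tan in auto)
    finally show ?thesis by (simp add: smooth_pullback_vol_def pullback_vol_def 2)
  qed
  then show ?thesis by (simp add: vec_eq_iff)
qed

lemma weak_partial_works:
  "has_weak_partial S j f g \<Longrightarrow> has_weak_partial S j f (weak_partial S j f)"
  unfolding weak_partial_def by (rule someI[where P="has_weak_partial S j f"])

lemma L2_on_uball:
  fixes f :: "'a::euclidean_space \<Rightarrow> 'b::euclidean_space"
  assumes "f \<in> borel_measurable uball" "integrable uball (\<lambda>x. (norm (f x))\<^sup>2)"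
  shows "L2_on (cball 0 1) f"
  using assms lball_of_uball(1)[OF assms(1)] lball_of_uball(3)[of "\<lambda>x. (norm (f x))\<^sup>2"] by (simp add: L2_on_def)

text \<open>Produces Borel representatives that carry all hypotheses. \<open>weak_partial\<close> is
  a choice, identified almost everywhere with the representative by uniqueness of weak
  derivatives.\<close>

lemma sphere_data_of_W12_S2:
  assumes u: "W12_S2 u" and \<eta>: "L2_on B3 \<eta>" and d: "distributional_d \<eta> (weak_pullback_vol u)"
  obtains u' \<eta>' D h where "sphere_data u' \<eta>' D" "AE x in uball. u x = u' x" "AE x in uball. \<eta> x = \<eta>' x"
    "\<And>j. has_weak_partial B3 j u (h j)" "\<And>j. L2_on B3 (h j)" "\<And>j. AE x in uball. h j x = D j x"
proof -
  have L2u: "L2_on B3 u" and ex: "\<forall>j. \<exists>g. L2_on B3 g \<and> has_weak_partial B3 j u g" and sph: "AE x in uball. norm (u x) = 1"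
    using u by (auto simp: W12_S2_def W12_on_def AE_lball_iff_uball)
  obtain u1 where u1: "Lp_ball 2 u1" "AE x in uball. u x = u1 x" by (rule L2_on_representative[OF L2u])
  obtain \<eta>' where \<eta>': "Lp_ball 2 \<eta>'" "AE x in uball. \<eta> x = \<eta>' x" by (rule L2_on_representative[OF \<eta>])
  obtain h where h: "\<And>j. L2_on B3 (h j)" "\<And>j. has_weak_partial B3 j u (h j)" using ex by metis
  have "\<exists>D. Lp_ball 2 D \<and> (AE x in uball. h j x = D x)" for j
    by (rule L2_on_representative[OF h(1)[of j]]) blast
  then obtain D where D: "\<And>j. Lp_ball 2 (D j)" "\<And>j. AE x in uball. h j x = D j x" by metis
  have [measurable]: "u1 \<in> borel_measurable borel" "\<eta>' \<in> borel_measurable borel" "D j \<in> borel_measurable borel" for j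
    using u1 \<eta>' D by (auto simp: Lp_ball_def)
  \<comment> \<open>Alters \<open>u1\<close> within the ball only on a null set and makes |u'| <= 1
    hold everywhere.\<close>
  define u' where "u' x = (if norm (u1 x) \<le> 1 then u1 x else 0)" for x
  have m[measurable]: "u' \<in> borel_measurable borel" unfolding u'_def[abs_def] by measurable
  have uu': "AE x in uball. u x = u' x" using u1(2) sph by eventually_elim (auto simp: u'_def)
  have u': "Lp_ball 2 u'"
    by (rule Lp_ball_bounded_by[where G="\<lambda>x. norm (u1 x) ^ 2"])
       (use u1(1) in \<open>auto simp: u'_def Lp_ball_def\<close>)
  have wp: "AE x in uball. \<forall>j. weak_partial B3 j u x = D j x"
  proof -
    have "AE x in uball. weak_partial B3 j u x = D j x" for j
      using has_weak_partial_unique[OF weak_partial_works[OF h(2)] h(2), of j] D(2)[of j] by eventually_elim simp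
    then show ?thesis by (subst AE_all_countable) blast
  qed
  have pb: "AE x in uball. \<forall>i l. weak_pullback_vol u x $ i $ l = u' x \<bullet> cross3 (D i x) (D l x)"
    using wp uu' by eventually_elim (simp add: weak_pullback_vol_def pullback_vol_def)
  have mm: "(\<lambda>x. u' x \<bullet> cross3 (D i x) (D l x)) \<in> borel_measurable borel" for i l by measurable
  have skew: "u' x \<bullet> cross3 (D l x) (D i x) = - (u' x \<bullet> cross3 (D i x) (D l x))" for i l x
    by (subst cross_skew) simp
  have "sphere_data u' \<eta>' D"
    unfolding sphere_data_def
  proof (intro conjI allI impI)
    show "norm (u' x) \<le> 1" for x by (simp add: u'_def)
    show "AE x in uball. norm (u' x) = 1" using sph uu' by eventually_elim simp
    show "weak_dir (axis j 1) u' (D j)" for j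
      by (rule has_weak_partial_weak_dir[OF h(2) _ uu' _ D(2)]) auto
    fix \<phi> :: "real^3 \<Rightarrow> real" and i l assume \<phi>: "test_function B3 \<phi>"
    show "(LINT y|lborel. frechet_derivative \<phi> (at y) (axis i 1) * \<eta>' y $ l - frechet_derivative \<phi> (at y) (axis l 1) * \<eta>' y $ i)
        = - (LINT y|lborel. \<phi> y * (u' y \<bullet> cross3 (D i y) (D l y)))"
      by (rule distributional_d_scalar[OF d _ \<eta>'(2) mm pb skew \<phi>]) simp
  qed (use u' \<eta>' D in auto)
  then show ?thesis using uu' \<eta>'(2) h(2) h(1) D(2) by (rule that)
qed

lemma norm_DHopf_le: "norm c = 1 \<Longrightarrow> norm q = 1 \<Longrightarrow> norm (DHopf c q p) \<le> 2 * norm p"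
proof -
  assume c: "norm c = 1" and q: "norm q = 1"
  have "norm (DHopf c q p) = norm (p \<odot> im c \<odot> qcnj q + q \<odot> im c \<odot> qcnj p)"
    by (simp flip: im_DHopf)
  also have "\<dots> \<le> norm (p \<odot> im c \<odot> qcnj q) + norm (q \<odot> im c \<odot> qcnj p)" by (rule norm_triangle_ineq)
  finally show ?thesis by (simp add: norm_qmul c q)
qed

lemma tendsto_Hopf: "(f \<longlongrightarrow> a) F \<Longrightarrow> ((\<lambda>x. Hopf c (f x)) \<longlongrightarrow> Hopf c a) F"
  unfolding Hopf_def by (intro tendsto_intros)

lemma tendsto_DHopf: "(f \<longlongrightarrow> a) F \<Longrightarrow> (g \<longlongrightarrow> b) F \<Longrightarrow> ((\<lambda>x. DHopf c (f x) (g x)) \<longlongrightarrow> DHopf c a b) F"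
  unfolding DHopf_def by (intro tendsto_intros)

text \<open>Upgrades L^2 convergence of the derivatives to pointwise convergence with a majorant.
  The three partial derivatives are treated as one vector so that one subsequence serves them
  all.\<close>

lemma smooth_sphere_approximation_dominated:
  fixes g :: "real^3 \<Rightarrow> 'b::euclidean_space" and Dg :: "3 \<Rightarrow> real^3 \<Rightarrow> 'b"
  assumes dim: "3 < DIM('b)"
    and g: "Lp_ball 2 g" "AE x in uball. norm (g x) = 1"
    and Dg: "\<And>j. Lp_ball 2 (Dg j)" "\<And>j. weak_dir (axis j 1) g (Dg j)" "AE x in uball. \<forall>j. g x \<bullet> Dg j x = 0"
  obtains G U \<Phi> where "\<And>k. open (U k)" "\<And>k. cball 0 1 \<subseteq> U k" "\<And>k m. Ck_on m (U k) (G k)"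
    "\<And>k x. x \<in> U k \<Longrightarrow> norm (G k x) = 1" "AE x in uball. (\<lambda>k. G k x) \<longlonglongrightarrow> g x"
    "integrable uball \<Phi>"
    "AE x in uball. \<forall>j. (\<lambda>k. frechet_derivative (G k) (at x) (axis j 1)) \<longlonglongrightarrow> Dg j x"
    "AE x in uball. \<forall>k. (\<Sum>j\<in>UNIV. (norm (frechet_derivative (G k) (at x) (axis j 1)))\<^sup>2) \<le> \<Phi> x"
proof (rule smooth_sphere_approximation[OF assms])
  fix G :: "nat \<Rightarrow> real^3 \<Rightarrow> 'b"
  assume G: "\<And>n. \<exists>U. open U \<and> cball 0 1 \<subseteq> U \<and> (\<forall>m. Ck_on m U (G n)) \<and> (\<forall>x\<in>U. norm (G n x) = 1)"
    and lim: "AE x in uball. (\<lambda>n. G n x) \<longlonglongrightarrow> g x"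
    and Dlim: "\<And>j. (\<lambda>n. \<integral>\<^sup>+x. ennreal (norm (frechet_derivative (G n) (at x) (axis j 1) - Dg j x) ^ 2) \<partial>uball) \<longlonglongrightarrow> 0"
  obtain U where U: "\<And>n. open (U n)" "\<And>n. cball 0 1 \<subseteq> U n" "\<And>n m. Ck_on m (U n) (G n)" "\<And>n x. x \<in> U n \<Longrightarrow> norm (G n x) = 1"
    using G by metis
  let ?P = "\<lambda>n j x. frechet_derivative (G n) (at x) (axis j 1)"
  have [measurable]: "?P n j \<in> borel_measurable uball" for n j
  proof (rule integrable_uball_continuous(2))
    have "continuous_on (U n) (?P n j)" using U(3)[of "Suc 0"] by simp
    then show "continuous_on (cball 0 1) (?P n j)" by (rule continuous_on_subset[OF _ U(2)])
  qed
  have [measurable]: "Dg j \<in> borel_measurable borel" for j using Dg(1) by (simp add: Lp_ball_def)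
  define V where "V n x = (\<chi> j. ?P n j x)" for n x
  define W where "W x = (\<chi> j. Dg j x)" for x
  have Vm: "V n \<in> borel_measurable uball" for n unfolding V_def[abs_def] by (rule vec_lambda_measurable) measurable
  have Wm: "W \<in> borel_measurable uball" unfolding W_def[abs_def] by (rule vec_lambda_measurable) measurable
  have Wi: "integrable uball (\<lambda>x. norm (W x) ^ 2)"
    unfolding norm_vec_sq W_def using Dg(1)
    by (auto intro!: integrable_uball Bochner_Integration.integrable_sum simp: Lp_ball_def)
  have "(\<integral>\<^sup>+x. ennreal (norm (V n x - W x) ^ 2) \<partial>uball) = (\<Sum>j\<in>UNIV. \<integral>\<^sup>+x. ennreal (norm (?P n j x - Dg j x) ^ 2) \<partial>uball)" for n
    unfolding norm_vec_sq V_def W_def by (subst nn_integral_sum[symmetric]) (auto simp: sum_ennreal)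
  moreover have "(\<lambda>n. \<Sum>j\<in>UNIV. \<integral>\<^sup>+x. ennreal (norm (?P n j x - Dg j x) ^ 2) \<partial>uball) \<longlonglongrightarrow> (\<Sum>j\<in>(UNIV::3 set). 0)"
    by (intro tendsto_sum Dlim)
  ultimately have VW: "(\<lambda>n. \<integral>\<^sup>+x. ennreal (norm (V n x - W x) ^ 2) \<partial>uball) \<longlonglongrightarrow> 0" by simp
  show thesis
  proof (rule dominated_subsequence[OF Vm Wm Wi _ VW])
    fix r \<Phi>
    assume r: "strict_mono (r :: nat \<Rightarrow> nat)" and \<Phi>: "integrable uball \<Phi>" and
      1: "AE x in uball. (\<lambda>k. V (r k) x) \<longlonglongrightarrow> W x" and 2: "AE x in uball. \<forall>k. norm (V (r k) x) ^ 2 \<le> \<Phi> x"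
    show thesis
    proof (rule that[of "\<lambda>k. U (r k)" "\<lambda>k. G (r k)" \<Phi>])
      show "AE x in uball. (\<lambda>k. G (r k) x) \<longlonglongrightarrow> g x"
        using lim by eventually_elim (use LIMSEQ_subseq_LIMSEQ[OF _ r] in \<open>auto simp: comp_def\<close>)
      show "AE x in uball. \<forall>j. (\<lambda>k. ?P (r k) j x) \<longlonglongrightarrow> Dg j x"
        using 1
      proof eventually_elim
        case (elim x)
        show ?case using tendsto_vec_nth[OF elim] by (simp add: V_def W_def)
      qed
      show "AE x in uball. \<forall>k. (\<Sum>j\<in>UNIV. (norm (?P (r k) j x))\<^sup>2) \<le> \<Phi> x"
        using 2 by (simp add: norm_vec_sq V_def)
    qed (use U \<Phi> in auto)
  qed simp
qed

lemma smooth_onI: "open U \<Longrightarrow> S \<subseteq> U \<Longrightarrow> (\<And>k. Ck_on k U f) \<Longrightarrow> smooth_on S f"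
  unfolding smooth_on_def by blast

theorem theorem1p2:
  fixes u :: "real^3 \<Rightarrow> real^3" and \<eta> :: form1
  assumes "W12_S2 u"
    and "L2_on B3 \<eta>"
    and "distributional_d \<eta> (weak_pullback_vol u)"
  shows "\<exists>(us :: nat \<Rightarrow> real^3 \<Rightarrow> real^3) (\<eta>s :: nat \<Rightarrow> form1).
      (\<forall>k. smooth_on B3 (us k) \<and> us k ` B3 \<subseteq> S2) \<and>
      (\<forall>k. smooth_on B3 (\<eta>s k)) \<and>
      (\<forall>k. \<forall>x\<in>B3. ext_deriv B3 (\<eta>s k) x = smooth_pullback_vol (us k) x) \<and>
      W12_converges B3 us u \<and> L2_converges B3 \<eta>s \<eta>"
proof (rule sphere_data_of_W12_S2[OF assms])
  fix u' \<eta>' D h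
  assume S: "sphere_data u' \<eta>' D" and uu': "AE x in uball. u x = u' x" and \<eta>\<eta>': "AE x in uball. \<eta> x = \<eta>' x"
    and h: "\<And>j. has_weak_partial B3 j u (h j)" "\<And>j. L2_on B3 (h j)" "\<And>j. AE x in uball. h j x = D j x"
  have dat: "Lp_ball 2 u'" "Lp_ball 2 \<eta>'" "\<And>j. Lp_ball 2 (D j)" and u'1: "\<And>x. norm (u' x) \<le> 1" and u'S: "AE x in uball. norm (u' x) = 1"
    using S by (auto simp: sphere_data_def)
  have [measurable]: "u' \<in> borel_measurable borel" "\<eta>' \<in> borel_measurable borel" "D j \<in> borel_measurable borel" for j
    using dat by (auto simp: Lp_ball_def)
  define a where "a j x = (1/2) *\<^sub>R (cross3 (u' x) (D j x) - \<eta>' x $ j *\<^sub>R u' x)" for j x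
  show ?thesis
  proof (rule sphere_data.lift_and_tangent[OF S])
    fix g c
    assume c: "norm c = 1" and [measurable]: "g \<in> borel_measurable borel" and g0: "\<And>x. norm x > 1 \<Longrightarrow> g x = 0"
      and g: "AE x in uball. norm (g x) = 1 \<and> u' x = Hopf c (g x)"
      and wg: "\<And>j. weak_dir (axis j 1) g (\<lambda>x. im ((1/2) *\<^sub>R (cross3 (u' x) (D j x) - \<eta>' x $ j *\<^sub>R u' x)) \<odot> g x)"
      and tan: "AE x in uball. \<forall>j. u' x \<bullet> D j x = 0"
    \<comment> \<open>The weak derivative of the lift; left multiplication by an imaginary
      quaternion makes it tangent to the three-sphere.\<close>
    define Dg where "Dg j x = im (a j x) \<odot> g x" for j x
    have [measurable]: "(\<lambda>x. \<eta>' x $ j) \<in> borel_measurable borel" for j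
      by (rule measurable_compose[OF _ borel_measurable_continuous_onI[OF continuous_on_component[OF continuous_on_id]]]) simp
    have [measurable]: "a j \<in> borel_measurable borel" for j unfolding a_def[abs_def] by measurable
    have Dgm[measurable]: "Dg j \<in> borel_measurable borel" for j
      unfolding Dg_def[abs_def]
      by (rule borel_measurable_continuous_Pair[where H="\<lambda>a q. im a \<odot> q"]) (auto intro!: continuous_intros)
    have gL: "Lp_ball 2 g"
    proof -
      have "integrable uball (\<lambda>x. norm (g x) ^ 2)"
        by (rule finite_measure.integrable_const_bound[OF finite_measure_uball, of _ 1])
           (use g in \<open>auto elim!: eventually_mono\<close>)
      then show ?thesis using g0 by (subst (asm) integral_lborel_eq_uball(2)[symmetric]) (auto simp: Lp_ball_def)
    qed
    have DgL: "Lp_ball 2 (Dg j)" for j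
    proof -
      have "integrable lborel (\<lambda>x. norm (D j x) ^ 2 + norm (\<eta>' x) ^ 2)"
        using dat by (intro Bochner_Integration.integrable_add) (auto simp: Lp_ball_def)
      then have i: "integrable uball (\<lambda>x. norm (D j x) ^ 2 + norm (\<eta>' x) ^ 2)" by (rule integrable_uball)
      have "integrable uball (\<lambda>x. norm (Dg j x) ^ 2)"
      proof (rule Bochner_Integration.integrable_bound[OF i])
        show "AE x in uball. norm (norm (Dg j x) ^ 2) \<le> norm (norm (D j x) ^ 2 + norm (\<eta>' x) ^ 2)"
          using g
        proof eventually_elim
          case (elim x)
          have "norm (cross3 (u' x) (D j x)) \<le> norm (D j x)"
            using norm_cross3_le[of "u' x" "D j x"] mult_right_mono[OF u'1[of x], of "norm (D j x)"] by simp
          moreover have "norm (\<eta>' x $ j *\<^sub>R u' x) \<le> norm (\<eta>' x)"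
            using mult_mono[OF component_le_norm_cart[of "\<eta>' x" j] u'1[of x]] by simp
          ultimately have "norm (cross3 (u' x) (D j x) - \<eta>' x $ j *\<^sub>R u' x) \<le> norm (D j x) + norm (\<eta>' x)"
            using norm_triangle_ineq4[of "cross3 (u' x) (D j x)" "\<eta>' x $ j *\<^sub>R u' x"] by linarith
          then have "norm (Dg j x) \<le> (norm (D j x) + norm (\<eta>' x)) / 2"
            using elim by (simp add: Dg_def a_def norm_qmul)
          then have "norm (Dg j x) ^ 2 \<le> ((norm (D j x) + norm (\<eta>' x)) / 2) ^ 2" by (rule power_mono) simp
          also have "\<dots> \<le> norm (D j x) ^ 2 + norm (\<eta>' x) ^ 2"
            using norm_power_add_le[of "norm (D j x)" "norm (\<eta>' x)" 2] by (simp add: power_divide)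
          finally show ?case by simp
        qed
      qed simp
      then show ?thesis using g0 by (subst (asm) integral_lborel_eq_uball(2)[symmetric]) (auto simp: Lp_ball_def Dg_def qmul.zero_right)
    qed
    have dim: "3 < DIM(quat)" by simp
    have tg: "AE x in uball. \<forall>j. g x \<bullet> Dg j x = 0" unfolding Dg_def inner_commute[of "g _"] inner_im_qmul by simp
    have wg': "weak_dir (axis j 1) g (Dg j)" for j using wg by (simp add: Dg_def[abs_def] a_def)
    have g1: "AE x in uball. norm (g x) = 1" using g by eventually_elim simp
    show ?thesis
    proof (rule smooth_sphere_approximation_dominated[OF dim gL g1 DgL wg' tg])
      fix G U \<Phi>
      assume U: "\<And>k. open (U k)" "\<And>k. cball 0 1 \<subseteq> U k" and G: "\<And>k m. Ck_on m (U k) (G k)" "\<And>k x. x \<in> U k \<Longrightarrow> norm (G k x) = 1"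
        and Gl: "AE x in uball. (\<lambda>k. G k x) \<longlonglongrightarrow> g x" and \<Phi>: "integrable uball \<Phi>"
        and Dl: "AE x in uball. \<forall>j. (\<lambda>k. frechet_derivative (G k) (at x) (axis j 1)) \<longlonglongrightarrow> Dg j x"
        and dom: "AE x in uball. \<forall>k. (\<Sum>j\<in>UNIV. (norm (frechet_derivative (G k) (at x) (axis j 1)))\<^sup>2) \<le> \<Phi> x"
      let ?P = "\<lambda>k j x. frechet_derivative (G k) (at x) (axis j 1)"
      \<comment> \<open>Built from a smooth lift, the pairs satisfy the equation exactly; what has
        to be proved is their convergence.\<close>
      define us where "us k x = Hopf c (G k x)" for k x
      define \<eta>s where "\<eta>s k = hopf_form c (G k)" for k
      define DU where "DU k j x = frechet_derivative (us k) (at x) (axis j 1)" for k j x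
      have Ck: "Ck_on m (U k) (us k)" "Ck_on m (U k) (\<eta>s k)" for k m
        unfolding us_def \<eta>s_def by (intro Ck_on_Hopf Ck_on_hopf_form U G)+
      have inU: "AE x in uball. \<forall>k. x \<in> U k" using U(2) by (auto simp: AE_uball_iff subset_iff)
      have DU: "DU k j x = DHopf c (G k x) (?P k j x)" if "x \<in> U k" for k j x
        using frechet_derivative_at[OF Hopf_has_derivative[where c=c, OF Ck_on_has_derivative[OF G(1) that]]]
        by (simp add: DU_def us_def[abs_def] fun_eq_iff)
      have us1: "norm (us k x) = 1" if "x \<in> U k" for k x using G(2)[OF that] c by (simp add: us_def norm_Hopf)
      have m[measurable]: "us k \<in> borel_measurable uball" "\<eta>s k \<in> borel_measurable uball" "DU k j \<in> borel_measurable uball" for k j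
      proof -
        have "Ck_on 0 (U k) (DU k j)" using Ck(1)[of "Suc 0"] by (simp add: DU_def[abs_def])
        with Ck[of 0] have "continuous_on (U k) (us k)" "continuous_on (U k) (\<eta>s k)" "continuous_on (U k) (DU k j)" by auto
        then show "us k \<in> borel_measurable uball" "\<eta>s k \<in> borel_measurable uball" "DU k j \<in> borel_measurable uball"
          by (auto intro!: integrable_uball_continuous(2) continuous_on_subset[OF _ U(2)])
      qed
      have P_le: "AE x in uball. \<forall>k j. (norm (?P k j x))\<^sup>2 \<le> \<Phi> x"
        using dom
      proof (eventually_elim, intro allI)
        fix x k j
        assume "\<forall>k. (\<Sum>j\<in>UNIV. (norm (?P k j x))\<^sup>2) \<le> \<Phi> x"
        moreover have "(norm (?P k j x))\<^sup>2 \<le> (\<Sum>j\<in>UNIV. (norm (?P k j x))\<^sup>2)" by (rule member_le_sum) auto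
        ultimately show "(norm (?P k j x))\<^sup>2 \<le> \<Phi> x" by (meson order_trans)
      qed
      have "AE x in uball. (\<lambda>k. us k x) \<longlonglongrightarrow> u' x"
        using g Gl by eventually_elim (auto simp: us_def intro: tendsto_Hopf)
      moreover have "AE x in uball. \<forall>k. (norm (us k x))\<^sup>2 \<le> 1" using inU by eventually_elim (simp add: us1)
      moreover have "integrable uball (\<lambda>x. 1::real)" using finite_measure.integrable_const[OF finite_measure_uball] .
      ultimately have us: "\<And>k. integrable uball (\<lambda>x. (norm (us k x))\<^sup>2)" "(\<lambda>k. sqrt (LINT x|uball. (norm (us k x - u' x))\<^sup>2)) \<longlonglongrightarrow> 0"
        by (intro L2_dominated_convergence[where fs=us and f=u' and M=uball] m; simp)+
      have \<Phi>4: "integrable uball (\<lambda>x. 4 * \<Phi> x)" using \<Phi> by simp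
      have "AE x in uball. (\<lambda>k. DU k j x) \<longlonglongrightarrow> D j x" for j
        using g Gl Dl inU tan
      proof eventually_elim
        case (elim x)
        have "(\<lambda>k. DHopf c (G k x) (?P k j x)) \<longlonglongrightarrow> DHopf c (g x) (Dg j x)" using elim by (intro tendsto_DHopf) auto
        \<comment> \<open>The differential of the Hopf map takes A g to 2 A x u, and this is du by
          the choice of the connection.\<close>
        also have "DHopf c (g x) (Dg j x) = 2 *\<^sub>R cross3 (a j x) (u' x)" using elim by (simp add: Dg_def DHopf_im_qmul)
        also have "\<dots> = D j x"
          unfolding a_def using elim c by (intro cross_recovers_tangent) (auto simp: norm_Hopf)
        finally show ?case using elim by (simp add: DU)
      qed
      moreover have "AE x in uball. \<forall>k. (norm (DU k j x))\<^sup>2 \<le> 4 * \<Phi> x" for j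
        using P_le inU
      proof (eventually_elim, intro allI)
        fix x k
        assume P: "\<forall>k j. (norm (?P k j x))\<^sup>2 \<le> \<Phi> x" and x: "\<forall>k. x \<in> U k"
        have "norm (DU k j x) \<le> 2 * norm (?P k j x)" using x norm_DHopf_le[OF c G(2)] by (simp add: DU)
        then have "(norm (DU k j x))\<^sup>2 \<le> (2 * norm (?P k j x))\<^sup>2" by (rule power_mono) simp
        also have "\<dots> \<le> 4 * \<Phi> x" using P by (simp add: power_mult_distrib)
        finally show "(norm (DU k j x))\<^sup>2 \<le> 4 * \<Phi> x" .
      qed
      ultimately have DUs: "\<And>k. integrable uball (\<lambda>x. (norm (DU k j x))\<^sup>2)" "(\<lambda>k. sqrt (LINT x|uball. (norm (DU k j x - D j x))\<^sup>2)) \<longlonglongrightarrow> 0" for j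
        by (intro L2_dominated_convergence[where fs="\<lambda>k. DU k j" and f="D j" and M=uball, OF _ _ _ _ \<Phi>4] m; simp)+
      have "AE x in uball. (\<lambda>k. \<eta>s k x) \<longlonglongrightarrow> \<eta>' x"
        using g Gl Dl tan
      proof eventually_elim
        case (elim x)
        have u1: "u' x \<bullet> u' x = 1" using elim c by (simp add: norm_Hopf flip: norm_eq_1)
        show ?case
        proof (rule vec_tendstoI)
          fix j
          have "(\<lambda>k. \<eta>s k x $ j) \<longlonglongrightarrow> - 2 * (Dg j x \<bullet> (g x \<odot> im c))"
            unfolding \<eta>s_def hopf_form_def vec_lambda_beta using elim by (intro tendsto_intros) auto
          also have "Dg j x \<bullet> (g x \<odot> im c) = a j x \<bullet> u' x" using elim by (simp add: Dg_def inner_im_qmul_Hopf)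
          \<comment> \<open>u x du is orthogonal to u, so the component of the connection along u is
            - \<eta> / 2; the factor -2 in \<open>hopf_form\<close> then returns \<eta>.\<close>
          also have "a j x \<bullet> u' x = - (1/2) * \<eta>' x $ j" by (simp add: a_def inner_diff_left dot_cross_self u1)
          finally show "(\<lambda>k. \<eta>s k x $ j) \<longlonglongrightarrow> \<eta>' x $ j" by simp
        qed
      qed
      moreover have "AE x in uball. \<forall>k. (norm (\<eta>s k x))\<^sup>2 \<le> 4 * \<Phi> x"
        using dom inU
      proof (eventually_elim, intro allI)
        fix x k
        assume d: "\<forall>k. (\<Sum>j\<in>UNIV. (norm (?P k j x))\<^sup>2) \<le> \<Phi> x" and x: "\<forall>k. x \<in> U k"
        have "(norm (\<eta>s k x $ j))\<^sup>2 \<le> 4 * (norm (?P k j x))\<^sup>2" for j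
        proof -
          have "\<bar>?P k j x \<bullet> (G k x \<odot> im c)\<bar> \<le> norm (?P k j x)"
            using Cauchy_Schwarz_ineq2[of "?P k j x" "G k x \<odot> im c"] G(2) x c by (simp add: norm_qmul)
          then have "norm (\<eta>s k x $ j) \<le> 2 * norm (?P k j x)" by (simp add: \<eta>s_def hopf_form_def)
          then have "(norm (\<eta>s k x $ j))\<^sup>2 \<le> (2 * norm (?P k j x))\<^sup>2" by (rule power_mono) simp
          then show ?thesis by (simp add: power_mult_distrib)
        qed
        then have "(norm (\<eta>s k x))\<^sup>2 \<le> (\<Sum>j\<in>UNIV. 4 * (norm (?P k j x))\<^sup>2)" unfolding norm_vec_sq by (intro sum_mono)
        also have "\<dots> \<le> 4 * \<Phi> x" using d by (simp flip: sum_distrib_left)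
        finally show "(norm (\<eta>s k x))\<^sup>2 \<le> 4 * \<Phi> x" .
      qed
      ultimately have \<eta>s: "\<And>k. integrable uball (\<lambda>x. (norm (\<eta>s k x))\<^sup>2)" "(\<lambda>k. sqrt (LINT x|uball. (norm (\<eta>s k x - \<eta>' x))\<^sup>2)) \<longlonglongrightarrow> 0"
        by (intro L2_dominated_convergence[where fs=\<eta>s and f=\<eta>' and M=uball, OF _ _ _ _ \<Phi>4] m; simp)+
      have wk: "has_weak_partial B3 j (us k) (DU k j)" for j k
        unfolding DU_def by (rule classical_weak_partial[OF U Ck(1)])
      have L2: "L2_on B3 (us k)" "L2_on B3 (DU k j)" "L2_on B3 (\<eta>s k)" for k j
        by (intro L2_on_uball m us(1) DUs(1) \<eta>s(1))+
      have W12u: "W12_on B3 u" using assms(1) by (simp add: W12_S2_def)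
      then have L2u: "L2_on B3 u" by (simp add: W12_on_def)
      have n\<eta>: "L2_norm_on B3 (\<lambda>x. \<eta>s k x - \<eta> x) = sqrt (LINT x|uball. (norm (\<eta>s k x - \<eta>' x))\<^sup>2)" for k
        by (rule L2_norm_lball_AE_eq) (use \<eta>\<eta>' in \<open>auto elim!: eventually_mono\<close>)
      have nu: "L2_norm_on B3 (\<lambda>x. us k x - u x) = sqrt (LINT x|uball. (norm (us k x - u' x))\<^sup>2)" for k
        by (rule L2_norm_lball_AE_eq) (use uu' in \<open>auto elim!: eventually_mono\<close>)
      \<comment> \<open>The norm refers to a chosen weak derivative of the difference; uniqueness
        identifies it with the difference of the known derivatives.\<close>
      have nD: "L2_norm_on B3 (weak_partial B3 j (\<lambda>x. us k x - u x)) = sqrt (LINT x|uball. (norm (DU k j x - D j x))\<^sup>2)" for k j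
      proof (rule L2_norm_lball_AE_eq)
        have w: "has_weak_partial B3 j (\<lambda>x. us k x - u x) (\<lambda>x. DU k j x - h j x)"
          by (rule has_weak_partial_diff[OF wk L2(1,2) h(1) L2u h(2)])
        show "AE x in uball. weak_partial B3 j (\<lambda>x. us k x - u x) x = DU k j x - D j x"
          using has_weak_partial_unique[OF weak_partial_works[OF w] w] h(3)[of j] by eventually_elim simp
      qed measurable
      have "(\<lambda>k. W12_norm_on B3 (\<lambda>x. us k x - u x)) \<longlonglongrightarrow> sqrt (0\<^sup>2 + (\<Sum>j\<in>(UNIV::3 set). 0\<^sup>2))"
        unfolding W12_norm_on_def nu nD
        by (intro tendsto_real_sqrt tendsto_add tendsto_sum tendsto_power us(2) DUs(2))
      moreover have "W12_on B3 (us k)" for k unfolding W12_on_def using L2(1,2) wk by blast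
      ultimately have "W12_converges B3 us u" unfolding W12_converges_def using W12u by simp
      moreover have "L2_converges B3 \<eta>s \<eta>"
        unfolding L2_converges_def n\<eta> using L2 \<eta>s(2) assms(2) by simp
      moreover have "smooth_on B3 (us k)" "smooth_on B3 (\<eta>s k)" "us k ` B3 \<subseteq> S2" for k
        using us1 subsetD[OF U(2)] by (auto intro!: smooth_onI[OF U Ck(1)] smooth_onI[OF U Ck(2)])
      moreover have "ext_deriv B3 (\<eta>s k) x = smooth_pullback_vol (us k) x" if "x \<in> B3" for k x
        unfolding us_def[abs_def] \<eta>s_def by (rule ext_deriv_hopf_form[OF U G c that])
      ultimately show ?thesis by blast
    qed
  qed
qed

end
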